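(* Let $(R,\mathfrak{m})$ be a local ring with dimension $t$ and depth $r \geq 1$, possessing a (normalized) dualizing complex $D^{\bullet}$. Let $N$ be a finitely generated $R$-module with $\operatorname{pd}_R N < \infty$. For a positive integer $i \leq r$, assume any of the following conditions: (a) $\operatorname{Ext}_R^{j}(N, D^{\bullet}) = 0$ for $j = t-r+i, \ldots, t$; (b) $\operatorname{Ext}_R^{j}(N, N\otimes_R^{\mathrm{L}} D^{\bullet}) = 0$ for $j = t-r+i, \ldots, t$. Then $\operatorname{pd}_R N < i$.
   Context: All rings are Noetherian, commutative, with $1 \neq 0$. A dualizing complex $D^{\bullet}$ of $R$ is regarded as a bounded complex of injective $R$-modules with finitely generated cohomology, normalized so that $\mathrm{R}\Gamma_{\mathfrak{m}}(D^{\bullet}) \cong E[-t]$, where $t=\dim R$ and $E=E(R/\mathfrak{m})$ is the injective hull of the residue field; i.e. local duality reads $H^i_{\mathfrak{m}}(X) \cong \operatorname{Hom}_R(\operatorname{Ext}^{t-i}_R(X,D^{\bullet}),E)$ for complexes $X$ with finitely generated cohomology. For a complex $Y$, $\operatorname{Ext}^j_R(N,Y) = H^j(\operatorname{RHom}_R(N,Y))$. *)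

theory Defs
  imports
    "HOL-Algebra.Module"
    "HOL-Algebra.Ideal_Product"
    "HOL-Algebra.Ring_Divisibility"
    "HOL-Library.Extended_Nat"
    "HOL-Library.Extended_Real"
begin

text \<open>
  The record \<open>module\<close> extends \<open>ring\<close>, so every module carries a multiplication and a unit
  without meaning; they are left \<open>undefined\<close> (or inherited) throughout.
\<close>

section \<open>Local rings\<close>

text \<open>\<open>1 \<noteq> 0\<close> follows from the existence of a (proper) maximal ideal.\<close>

locale noetherian_local_ring = cring R + noetherian_ring R for R (structure) +
  assumes unique_maximal: "\<exists>!I. maximalideal I R"

definition max_ideal :: "('r, 'k) ring_scheme \<Rightarrow> 'r set"
  where "max_ideal R = (THE I. maximalideal I R)"

definition krull_dim :: "('r, 'k) ring_scheme \<Rightarrow> enat"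
  where "krull_dim R =
    Sup {enat n | n. \<exists>p :: nat \<Rightarrow> 'r set.
           (\<forall>k\<le>n. primeideal (p k) R) \<and> (\<forall>k<n. p k \<subset> p (Suc k))}"

definition regular_sequence :: "('r, 'k) ring_scheme \<Rightarrow> 'r list \<Rightarrow> bool"
  where "regular_sequence R xs \<longleftrightarrow>
    set xs \<subseteq> carrier R \<and>
    (\<forall>k<length xs. \<forall>a\<in>carrier R.
       xs ! k \<otimes>\<^bsub>R\<^esub> a \<in> Idl\<^bsub>R\<^esub> (set (take k xs)) \<longrightarrow> a \<in> Idl\<^bsub>R\<^esub> (set (take k xs))) \<and>
    Idl\<^bsub>R\<^esub> (set xs) \<noteq> carrier R"

definition depth :: "('r, 'k) ring_scheme \<Rightarrow> enat"
  where "depth R =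
    Sup {enat (length xs) | xs. regular_sequence R xs \<and> set xs \<subseteq> max_ideal R}"


section \<open>Modules\<close>

definition ring_mod :: "('r, 'k) ring_scheme \<Rightarrow> ('r, 'r) module"
  where "ring_mod R =
    \<lparr>carrier = carrier R, monoid.mult = monoid.mult R, one = one R, zero = zero R, add = add R,
     smult = monoid.mult R\<rparr>"

definition is_zero_mod :: "('r, 'm) module \<Rightarrow> bool"
  where "is_zero_mod M \<longleftrightarrow> carrier M = {\<zero>\<^bsub>M\<^esub>}"

definition sub_mod :: "('r, 'm) module \<Rightarrow> 'm set \<Rightarrow> ('r, 'm) module"
  where "sub_mod M K = M\<lparr>carrier := K\<rparr>"

definition quot_mod :: "('r, 'm) module \<Rightarrow> 'm set \<Rightarrow> ('r, 'm set) module"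
  where "quot_mod M K =
    \<lparr>carrier = a_rcosets\<^bsub>M\<^esub> K, monoid.mult = (\<lambda>_ _. undefined), one = undefined, zero = K,
     add = set_add M, smult = (\<lambda>r C. K <+>\<^bsub>M\<^esub> ((\<lambda>x. r \<odot>\<^bsub>M\<^esub> x) ` C))\<rparr>"

definition mod_hom ::
    "('r, 'k) ring_scheme \<Rightarrow> ('r, 'm) module \<Rightarrow> ('r, 'n) module \<Rightarrow> ('m \<Rightarrow> 'n) set"
  where "mod_hom R M N =
    {f. f \<in> carrier M \<rightarrow> carrier N \<and>
        (\<forall>x\<in>carrier M. \<forall>y\<in>carrier M. f (x \<oplus>\<^bsub>M\<^esub> y) = f x \<oplus>\<^bsub>N\<^esub> f y) \<and>
        (\<forall>r\<in>carrier R. \<forall>x\<in>carrier M. f (r \<odot>\<^bsub>M\<^esub> x) = r \<odot>\<^bsub>N\<^esub> f x)}"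

definition fin_gen_mod :: "('r, 'k) ring_scheme \<Rightarrow> ('r, 'm) module \<Rightarrow> bool"
  where "fin_gen_mod R M \<longleftrightarrow>
    (\<exists>A. finite A \<and> A \<subseteq> carrier M \<and>
       (\<forall>x\<in>carrier M. \<exists>c\<in>A \<rightarrow> carrier R. x = (\<Oplus>\<^bsub>M\<^esub>a\<in>A. c a \<odot>\<^bsub>M\<^esub> a)))"

text \<open>
  Types cannot be quantified in a formula, so the modules tested against in the next two
  definitions live in fixed types. Nothing is lost. For projectivity, the free module on the
  elements of \<open>P\<close> (finitely supported functions \<open>'p \<Rightarrow> 'r\<close>) is among the modules \<open>A\<close>, so that
  \<open>P\<close> is a direct summand of it. For injectivity, all ideals \<open>A\<close> of \<open>B = R\<close> are included, and
  Baer's criterion gives the extension property for modules over any other type.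
\<close>

definition projective_mod :: "('r, 'k) ring_scheme \<Rightarrow> ('r, 'p) module \<Rightarrow> bool"
  where "projective_mod R P \<longleftrightarrow>
    module R P \<and>
    (\<forall>(A :: ('r, 'p \<Rightarrow> 'r) module) (B :: ('r, 'p) module) g f.
       module R A \<and> module R B \<and> g \<in> mod_hom R A B \<and> g ` carrier A = carrier B \<and>
       f \<in> mod_hom R P B \<longrightarrow>
       (\<exists>h\<in>mod_hom R P A. \<forall>x\<in>carrier P. g (h x) = f x))"

definition injective_mod :: "('r, 'k) ring_scheme \<Rightarrow> ('r, 'e) module \<Rightarrow> bool"
  where "injective_mod R E \<longleftrightarrow>
    module R E \<and>
    (\<forall>(A :: ('r, 'r) module) (B :: ('r, 'r) module) g f.
       module R A \<and> module R B \<and> g \<in> mod_hom R A B \<and> inj_on g (carrier A) \<and>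
       f \<in> mod_hom R A E \<longrightarrow>
       (\<exists>h\<in>mod_hom R B E. \<forall>x\<in>carrier A. h (g x) = f x))"

definition injective_hull ::
    "('r, 'k) ring_scheme \<Rightarrow> ('r, 'm) module \<Rightarrow> ('r, 'e) module \<Rightarrow> bool"
  where "injective_hull R M E \<longleftrightarrow>
    injective_mod R E \<and>
    (\<exists>\<iota>\<in>mod_hom R M E. inj_on \<iota> (carrier M) \<and>
       (\<forall>K. submodule K R E \<and> K \<noteq> {\<zero>\<^bsub>E\<^esub>} \<longrightarrow> K \<inter> \<iota> ` carrier M \<noteq> {\<zero>\<^bsub>E\<^esub>}))"

definition torsion_part :: "'r set \<Rightarrow> ('r, 'k) ring_scheme \<Rightarrow> ('r, 'm) module \<Rightarrow> 'm set"
  where "torsion_part I R M =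
    {x \<in> carrier M. \<exists>k::nat. \<forall>a \<in> I [^]\<^bsub>ideals_set R\<^esub> k. a \<odot>\<^bsub>M\<^esub> x = \<zero>\<^bsub>M\<^esub>}"


section \<open>Tensor products of modules\<close>

definition free_mod :: "('r, 'k) ring_scheme \<Rightarrow> 's set \<Rightarrow> ('r, 's \<Rightarrow> 'r) module"
  where "free_mod R S =
    \<lparr>carrier = {\<phi>. (\<forall>s\<in>S. \<phi> s \<in> carrier R) \<and> (\<forall>s. s \<notin> S \<longrightarrow> \<phi> s = \<zero>\<^bsub>R\<^esub>) \<and>
                   finite {s. \<phi> s \<noteq> \<zero>\<^bsub>R\<^esub>}},
     monoid.mult = (\<lambda>_ _. undefined), one = undefined, zero = (\<lambda>_. \<zero>\<^bsub>R\<^esub>),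
     add = (\<lambda>\<phi> \<psi> s. \<phi> s \<oplus>\<^bsub>R\<^esub> \<psi> s), smult = (\<lambda>r \<phi> s. r \<otimes>\<^bsub>R\<^esub> \<phi> s)\<rparr>"

definition free_gen :: "('r, 'k) ring_scheme \<Rightarrow> 's \<Rightarrow> 's \<Rightarrow> 'r"
  where "free_gen R s = (\<lambda>s'. if s' = s then \<one>\<^bsub>R\<^esub> else \<zero>\<^bsub>R\<^esub>)"

abbreviation pair_mod ::
    "('r, 'k) ring_scheme \<Rightarrow> ('r, 'm) module \<Rightarrow> ('r, 'n) module \<Rightarrow> ('r, 'm \<times> 'n \<Rightarrow> 'r) module"
  where "pair_mod R M N \<equiv> free_mod R (carrier M \<times> carrier N)"

definition bilinear_gens ::
    "('r, 'k) ring_scheme \<Rightarrow> ('r, 'm) module \<Rightarrow> ('r, 'n) module \<Rightarrow> ('m \<times> 'n \<Rightarrow> 'r) set"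
  where "bilinear_gens R M N =
    (let F = pair_mod R M N; e = (\<lambda>x y. free_gen R (x, y)) in
      {e (x \<oplus>\<^bsub>M\<^esub> x') y \<ominus>\<^bsub>F\<^esub> (e x y \<oplus>\<^bsub>F\<^esub> e x' y) | x x' y.
         x \<in> carrier M \<and> x' \<in> carrier M \<and> y \<in> carrier N} \<union>
      {e x (y \<oplus>\<^bsub>N\<^esub> y') \<ominus>\<^bsub>F\<^esub> (e x y \<oplus>\<^bsub>F\<^esub> e x y') | x y y'.
         x \<in> carrier M \<and> y \<in> carrier N \<and> y' \<in> carrier N} \<union>
      {e (r \<odot>\<^bsub>M\<^esub> x) y \<ominus>\<^bsub>F\<^esub> r \<odot>\<^bsub>F\<^esub> e x y | r x y.
         r \<in> carrier R \<and> x \<in> carrier M \<and> y \<in> carrier N} \<union>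
      {e x (r \<odot>\<^bsub>N\<^esub> y) \<ominus>\<^bsub>F\<^esub> r \<odot>\<^bsub>F\<^esub> e x y | r x y.
         r \<in> carrier R \<and> x \<in> carrier M \<and> y \<in> carrier N})"

definition bilinear_rels ::
    "('r, 'k) ring_scheme \<Rightarrow> ('r, 'm) module \<Rightarrow> ('r, 'n) module \<Rightarrow> ('m \<times> 'n \<Rightarrow> 'r) set"
  where "bilinear_rels R M N =
    (\<lambda>K. submodule K R (pair_mod R M N)) hull bilinear_gens R M N"

definition tensor_mod ::
    "('r, 'k) ring_scheme \<Rightarrow> ('r, 'm) module \<Rightarrow> ('r, 'n) module \<Rightarrow>
     ('r, ('m \<times> 'n \<Rightarrow> 'r) set) module"
  where "tensor_mod R M N = quot_mod (pair_mod R M N) (bilinear_rels R M N)"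

text \<open>
  The map \<open>f \<otimes> g\<close> from \<open>M \<otimes> N\<close> to \<open>M' \<otimes> N'\<close>; its values do not depend on \<open>M\<close> and \<open>N\<close>, which
  enter only through the coset \<open>C\<close>.
\<close>

definition tensor_map ::
    "('r, 'k) ring_scheme \<Rightarrow> ('r, 'm') module \<Rightarrow> ('r, 'n') module \<Rightarrow>
     ('m \<Rightarrow> 'm') \<Rightarrow> ('n \<Rightarrow> 'n') \<Rightarrow> ('m \<times> 'n \<Rightarrow> 'r) set \<Rightarrow> ('m' \<times> 'n' \<Rightarrow> 'r) set"
  where "tensor_map R M' N' f g C =
    (let F' = pair_mod R M' N' in
      bilinear_rels R M' N' <+>\<^bsub>F'\<^esub>
      (\<lambda>\<phi>. \<Oplus>\<^bsub>F'\<^esub>s\<in>{s. \<phi> s \<noteq> \<zero>\<^bsub>R\<^esub>}. \<phi> s \<odot>\<^bsub>F'\<^esub> free_gen R (f (fst s), g (snd s))) ` C)"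


section \<open>Complexes\<close>

text \<open>Cohomological grading: \<open>diff X n\<close> maps \<open>obj X n\<close> to \<open>obj X (n + 1)\<close>.\<close>

record ('r, 'm) cochain =
  obj :: "int \<Rightarrow> ('r, 'm) module"
  diff :: "int \<Rightarrow> 'm \<Rightarrow> 'm"

definition is_complex :: "('r, 'k) ring_scheme \<Rightarrow> ('r, 'm) cochain \<Rightarrow> bool"
  where "is_complex R X \<longleftrightarrow>
    (\<forall>n. module R (obj X n) \<and> diff X n \<in> mod_hom R (obj X n) (obj X (n + 1)) \<and>
       (\<forall>x\<in>carrier (obj X n). diff X (n + 1) (diff X n x) = \<zero>\<^bsub>obj X (n + 2)\<^esub>))"

definition bounded_cpx :: "('r, 'm) cochain \<Rightarrow> bool"
  where "bounded_cpx X \<longleftrightarrow> (\<exists>a b. \<forall>n. n < a \<or> b < n \<longrightarrow> is_zero_mod (obj X n))"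

definition cocycles :: "('r, 'm) cochain \<Rightarrow> int \<Rightarrow> 'm set"
  where "cocycles X n = {x \<in> carrier (obj X n). diff X n x = \<zero>\<^bsub>obj X (n + 1)\<^esub>}"

definition coboundaries :: "('r, 'm) cochain \<Rightarrow> int \<Rightarrow> 'm set"
  where "coboundaries X n = diff X (n - 1) ` carrier (obj X (n - 1))"

definition cohomology :: "('r, 'm) cochain \<Rightarrow> int \<Rightarrow> ('r, 'm set) module"
  where "cohomology X n = quot_mod (sub_mod (obj X n) (cocycles X n)) (coboundaries X n)"

definition chain_map ::
    "('r, 'k) ring_scheme \<Rightarrow> ('r, 'm) cochain \<Rightarrow> ('r, 'n) cochain \<Rightarrow> (int \<Rightarrow> 'm \<Rightarrow> 'n) \<Rightarrow> bool"
  where "chain_map R X Y f \<longleftrightarrow>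
    (\<forall>n. f n \<in> mod_hom R (obj X n) (obj Y n) \<and>
       (\<forall>x\<in>carrier (obj X n). f (n + 1) (diff X n x) = diff Y n (f n x)))"

definition cohomology_map ::
    "('r, 'n) cochain \<Rightarrow> (int \<Rightarrow> 'm \<Rightarrow> 'n) \<Rightarrow> int \<Rightarrow> 'm set \<Rightarrow> 'n set"
  where "cohomology_map Y f n C = coboundaries Y n <+>\<^bsub>obj Y n\<^esub> f n ` C"

definition quasi_iso ::
    "('r, 'k) ring_scheme \<Rightarrow> ('r, 'm) cochain \<Rightarrow> ('r, 'n) cochain \<Rightarrow> (int \<Rightarrow> 'm \<Rightarrow> 'n) \<Rightarrow> bool"
  where "quasi_iso R X Y f \<longleftrightarrow>
    chain_map R X Y f \<and>
    (\<forall>n. bij_betw (cohomology_map Y f n) (carrier (cohomology X n)) (carrier (cohomology Y n)))"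

text \<open>
  Isomorphism in the derived category, by a roof of quasi-isomorphisms. The apex \<open>Z\<close> is taken
  in the element type of \<open>X\<close>. When the cohomology of \<open>X\<close> sits in a single degree \<open>t\<close> and \<open>Y\<close>
  is a module placed in degree \<open>t\<close> (the only use below), this is no restriction: the canonical
  truncation of \<open>X\<close> in degrees \<open>\<le> t\<close> is a subcomplex of \<open>X\<close> that serves as \<open>Z\<close>.
\<close>

definition derived_iso ::
    "('r, 'k) ring_scheme \<Rightarrow> ('r, 'm) cochain \<Rightarrow> ('r, 'n) cochain \<Rightarrow> bool"
  where "derived_iso R X Y \<longleftrightarrow>
    (\<exists>(Z :: ('r, 'm) cochain) f g. is_complex R Z \<and> quasi_iso R Z X f \<and> quasi_iso R Z Y g)"

text \<open>The complex with \<open>M\<close> in degree \<open>n\<close> and \<open>0\<close> elsewhere, that is \<open>M[-n]\<close>.\<close>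

definition stalk :: "('r, 'm) module \<Rightarrow> int \<Rightarrow> ('r, 'm) cochain"
  where "stalk M n =
    \<lparr>obj = (\<lambda>i. if i = n then M else sub_mod M {\<zero>\<^bsub>M\<^esub>}), diff = (\<lambda>_ _. \<zero>\<^bsub>M\<^esub>)\<rparr>"

text \<open>
  \<open>Hom(X,Y)\<close> in degree \<open>n\<close> is the product over \<open>i\<close> of \<open>Hom(X^i, Y^(i+n))\<close>, with differential
  \<open>f \<mapsto> d f - (-1)^n f d\<close>. Homomorphisms are taken extensional, so that equality of elements is
  equality of maps on the carrier.
\<close>

definition hom_cpx ::
    "('r, 'k) ring_scheme \<Rightarrow> ('r, 'm) cochain \<Rightarrow> ('r, 'n) cochain \<Rightarrow>
     ('r, int \<Rightarrow> 'm \<Rightarrow> 'n) cochain"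
  where "hom_cpx R X Y =
    \<lparr>obj = (\<lambda>n.
       \<lparr>carrier = {f. \<forall>i. f i \<in> mod_hom R (obj X i) (obj Y (i + n)) \<inter>
                                extensional (carrier (obj X i))},
        monoid.mult = (\<lambda>_ _. undefined), one = undefined,
        zero = (\<lambda>i. \<lambda>x\<in>carrier (obj X i). \<zero>\<^bsub>obj Y (i + n)\<^esub>),
        add = (\<lambda>f g i. \<lambda>x\<in>carrier (obj X i). f i x \<oplus>\<^bsub>obj Y (i + n)\<^esub> g i x),
        smult = (\<lambda>r f i. \<lambda>x\<in>carrier (obj X i). r \<odot>\<^bsub>obj Y (i + n)\<^esub> f i x)\<rparr>),
     diff = (\<lambda>n f i. \<lambda>x\<in>carrier (obj X i).
       if even n
       then diff Y (i + n) (f i x) \<ominus>\<^bsub>obj Y (i + (n + 1))\<^esub> f (i + 1) (diff X i x)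
       else diff Y (i + n) (f i x) \<oplus>\<^bsub>obj Y (i + (n + 1))\<^esub> f (i + 1) (diff X i x))\<rparr>"

text \<open>
  \<open>X \<otimes> Y\<close> in degree \<open>n\<close> is the direct sum over \<open>i\<close> of \<open>X^i \<otimes> Y^(n-i)\<close>, with differential
  \<open>x \<otimes> y \<mapsto> dx \<otimes> y + (-1)^i x \<otimes> dy\<close>.
\<close>

definition tensor_cpx ::
    "('r, 'k) ring_scheme \<Rightarrow> ('r, 'm) cochain \<Rightarrow> ('r, 'n) cochain \<Rightarrow>
     ('r, int \<Rightarrow> ('m \<times> 'n \<Rightarrow> 'r) set) cochain"
  where "tensor_cpx R X Y =
    (let T = (\<lambda>n i. tensor_mod R (obj X i) (obj Y (n - i))) in
     \<lparr>obj = (\<lambda>n.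
       \<lparr>carrier = {z. (\<forall>i. z i \<in> carrier (T n i)) \<and> finite {i. z i \<noteq> \<zero>\<^bsub>T n i\<^esub>}},
        monoid.mult = (\<lambda>_ _. undefined), one = undefined,
        zero = (\<lambda>i. \<zero>\<^bsub>T n i\<^esub>),
        add = (\<lambda>z w i. z i \<oplus>\<^bsub>T n i\<^esub> w i),
        smult = (\<lambda>r z i. r \<odot>\<^bsub>T n i\<^esub> z i)\<rparr>),
     diff = (\<lambda>n z i.
       let a = tensor_map R (obj X i) (obj Y (n + 1 - i)) (diff X (i - 1)) (\<lambda>y. y) (z (i - 1));
           b = tensor_map R (obj X i) (obj Y (n + 1 - i)) (\<lambda>x. x) (diff Y (n - i)) (z i)
       in if even i then a \<oplus>\<^bsub>T (n + 1) i\<^esub> b else a \<ominus>\<^bsub>T (n + 1) i\<^esub> b)\<rparr>)"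


section \<open>Derived functors\<close>

definition proj_resolution ::
    "('r, 'k) ring_scheme \<Rightarrow> ('r, 'n) module \<Rightarrow> ('r, 'p) cochain \<Rightarrow> bool"
  where "proj_resolution R N P \<longleftrightarrow>
    is_complex R P \<and> (\<forall>n. projective_mod R (obj P n)) \<and> (\<forall>n>0. is_zero_mod (obj P n)) \<and>
    (\<exists>f. quasi_iso R P (stalk N 0) f)"

text \<open>
  An element type large enough for projective resolutions of any module \<open>N\<close> over \<open>'n\<close>: it
  contains free modules of rank \<open>max(\<aleph>0, |'n|, |'r|)\<close>, and submodules of these again have at
  most that many elements, so that \<open>N\<close> has a free resolution in it, and syzygies in such a
  resolution stay in it. Hence the choice in \<open>proj_res\<close> succeeds and \<open>proj_dim\<close> does not depend
  on the restriction to this type.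
\<close>

type_synonym ('r, 'n) res_elem = "nat \<times> 'n \<times> 'r \<Rightarrow> 'r"

definition proj_res ::
    "('r, 'k) ring_scheme \<Rightarrow> ('r, 'n) module \<Rightarrow> ('r, ('r, 'n) res_elem) cochain"
  where "proj_res R N = (SOME P. proj_resolution R N P)"

text \<open>
  The infimum runs over all integers, so that the zero module has projective dimension \<open>-\<infinity>\<close>;
  it is \<open>\<infinity>\<close> if there is no finite projective resolution.
\<close>

definition proj_dim :: "('r, 'k) ring_scheme \<Rightarrow> ('r, 'n) module \<Rightarrow> ereal"
  where "proj_dim R N =
    Inf {ereal (real_of_int n) | n. \<exists>P :: ('r, ('r, 'n) res_elem) cochain.
           proj_resolution R N P \<and> (\<forall>k>n. is_zero_mod (obj P (- k)))}"

definition RHom ::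
    "('r, 'k) ring_scheme \<Rightarrow> ('r, 'n) module \<Rightarrow> ('r, 'm) cochain \<Rightarrow>
     ('r, int \<Rightarrow> ('r, 'n) res_elem \<Rightarrow> 'm) cochain"
  where "RHom R N Y = hom_cpx R (proj_res R N) Y"

definition Ext ::
    "('r, 'k) ring_scheme \<Rightarrow> int \<Rightarrow> ('r, 'n) module \<Rightarrow> ('r, 'm) cochain \<Rightarrow>
     ('r, (int \<Rightarrow> ('r, 'n) res_elem \<Rightarrow> 'm) set) module"
  where "Ext R j N Y = cohomology (RHom R N Y) j"

definition Ltensor ::
    "('r, 'k) ring_scheme \<Rightarrow> ('r, 'n) module \<Rightarrow> ('r, 'm) cochain \<Rightarrow>
     ('r, int \<Rightarrow> (('r, 'n) res_elem \<times> 'm \<Rightarrow> 'r) set) cochain"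
  where "Ltensor R N Y = tensor_cpx R (proj_res R N) Y"


section \<open>Dualizing complexes\<close>

definition homothety :: "('r, 'm) cochain \<Rightarrow> 'r \<Rightarrow> int \<Rightarrow> 'm \<Rightarrow> 'm"
  where "homothety X r = (\<lambda>i. \<lambda>x\<in>carrier (obj X i). r \<odot>\<^bsub>obj X i\<^esub> x)"

text \<open>
  As \<open>D\<close> is a bounded complex of injectives, \<open>RHom(D,D)\<close> is \<open>Hom(D,D)\<close>.
\<close>

definition dualizing_complex :: "('r, 'k) ring_scheme \<Rightarrow> ('r, 'd) cochain \<Rightarrow> bool"
  where "dualizing_complex R D \<longleftrightarrow>
    is_complex R D \<and> bounded_cpx D \<and> (\<forall>n. injective_mod R (obj D n)) \<and>
    (\<forall>n. fin_gen_mod R (cohomology D n)) \<and>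
    quasi_iso R (stalk (ring_mod R) 0) (hom_cpx R D D)
      (\<lambda>n. if n = 0 then homothety D else (\<lambda>_. \<zero>\<^bsub>obj (hom_cpx R D D) n\<^esub>))"

definition torsion_cpx :: "'r set \<Rightarrow> ('r, 'k) ring_scheme \<Rightarrow> ('r, 'm) cochain \<Rightarrow> ('r, 'm) cochain"
  where "torsion_cpx I R X =
    \<lparr>obj = (\<lambda>n. sub_mod (obj X n) (torsion_part I R (obj X n))), diff = diff X\<rparr>"

text \<open>
  Again because \<open>D\<close> is a bounded complex of injectives, its derived \<open>m\<close>-torsion is obtained by
  applying \<open>torsion_cpx\<close> to \<open>D\<close> itself. A hull \<open>E\<close> of the residue field isomorphic to the
  cohomology of that complex in degree \<open>t\<close> can always be found in the element type of \<open>D\<close>.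
\<close>

definition normalized_dualizing_complex :: "('r, 'k) ring_scheme \<Rightarrow> ('r, 'd) cochain \<Rightarrow> bool"
  where "normalized_dualizing_complex R D \<longleftrightarrow>
    dualizing_complex R D \<and>
    (\<exists>(E :: ('r, 'd) module) t. krull_dim R = enat t \<and>
       injective_hull R (quot_mod (ring_mod R) (max_ideal R)) E \<and>
       derived_iso R (torsion_cpx (max_ideal R) R D) (stalk E (int t)))"

end

theory Submission
  imports Defs
begin

text \<open>
  Let \<open>s = t - r\<close>. It is the top degree of the cohomology of \<open>D\<close>: by local duality for \<open>R/I\<close>, here proved
  with the complexes \<open>Hom(R/I, D)\<close>, killing a maximal regular sequence raises the top degree by \<open>r\<close>, up to \<open>t\<close>.
  Let \<open>F\<close> be the minimal free resolution of \<open>N\<close>, of length \<open>p\<close>; then \<open>p \<le> r\<close>. If \<open>p \<ge> i\<close>, then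
  \<open>s + p\<close> is one of the degrees where \<open>Ext\<close> vanishes. But the corner of the complex \<open>Hom(F, Y)\<close> at \<open>F\<^sub>p\<close> and
  the top degree \<open>s\<close> of \<open>H(Y)\<close> gives \<open>Ext\<^bsup>s + p\<^esup>(N, Y) \<otimes> k = Hom(F\<^sub>p, H\<^sup>s(Y)) \<otimes> k\<close> with \<open>k = R/m\<close>, because the
  differential of \<open>F\<close> is zero modulo \<open>m\<close>; this is nonzero for \<open>Y = D\<close> by Nakayama's lemma, and for \<open>Y = F \<otimes> D\<close>
  because \<open>H\<^sup>s(F \<otimes> D) \<otimes> k = F\<^sub>0 \<otimes> H\<^sup>s(D) \<otimes> k\<close>. Nonvanishing is expressed by a submodule \<open>X\<close> of
  \<open>Y\<^sup>s\<close> that contains \<open>mZ\<^sup>s + B\<^sup>s\<close> but not \<open>Z\<^sup>s\<close>.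
\<close>

section \<open>Noetherian local rings\<close>

text \<open>Injectivity of the terms of \<open>D\<close> is used through one elementwise property,
  \<open>cyc_inj\<close>, which survives quotients, extensions and passage to torsion. It makes the
  cocycles and coboundaries of the torsion subcomplex cyclically injective, and so the normalization
  turns into a statement about \<open>Hom(R/m, D)\<close>: its cohomology is nonzero in degree
  \<open>t\<close> and zero elsewhere. The vanishing above \<open>t\<close> spreads from
  \<open>m\<close> to all ideals by Noetherian induction. The nonvanishing in degree
  \<open>t\<close> passes to \<open>Hom(R/(xs), D)\<close>, with \<open>xs\<close> a maximal regular
  sequence, through a copy of \<open>R/m\<close> in \<open>R/(xs)\<close>, that is, a socle element.
  The same socle element gives \<open>p \<le> r\<close>, the inequality in the Auslander-Buchsbaum
  formula. \<open>Ext\<close> is computed from an arbitrary chosen resolution, while the corner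
  argument wants the minimal one. The comparison maps from \<open>F\<close> to the chosen resolution
  and back compose to the identity modulo \<open>m\<close>, so the coefficients that occur on the
  way are units; this suffices to pass a class through the chosen resolution.\<close>

definition colon :: "('r, 'k) ring_scheme \<Rightarrow> 'r set \<Rightarrow> 'r \<Rightarrow> 'r set"
  where "colon R I x = {c \<in> carrier R. c \<otimes>\<^bsub>R\<^esub> x \<in> I}"

text \<open>The ideal \<open>I + xR\<close>. Together with \<open>(I : x)\<close> it sits in the
  exact sequence \<open>0 \<rightarrow> R/(I : x) \<rightarrow> R/I \<rightarrow> R/(I + xR)
  \<rightarrow> 0\<close>, along which the inductions over ideals proceed.\<close>

definition adjoin :: "('r, 'k) ring_scheme \<Rightarrow> 'r set \<Rightarrow> 'r \<Rightarrow> 'r set"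
  where "adjoin R I x = {i \<oplus>\<^bsub>R\<^esub> c \<otimes>\<^bsub>R\<^esub> x | i c. i \<in> I \<and> c \<in> carrier R}"

context cring
begin

lemma ideal_intro:
  assumes "I \<subseteq> carrier R" "\<zero> \<in> I" "\<And>a b. a \<in> I \<Longrightarrow> b \<in> I \<Longrightarrow> a \<oplus> b \<in> I"
    and "\<And>a c. a \<in> I \<Longrightarrow> c \<in> carrier R \<Longrightarrow> c \<otimes> a \<in> I"
  shows "ideal I R"
proof (rule idealI)
  have minus: "\<ominus> a \<in> I" if "a \<in> I" for a
  proof -
    have "\<ominus> a = (\<ominus> \<one>) \<otimes> a" using that assms(1) by (simp add: l_minus subset_iff)
    then show ?thesis using assms(4)[OF that, of "\<ominus> \<one>"] by simp
  qed
  show "subgroup I (add_monoid R)"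
    by (rule add.subgroupI) (use assms minus in \<open>auto simp: a_inv_def\<close>)
  show "\<And>a x. a \<in> I \<Longrightarrow> x \<in> carrier R \<Longrightarrow> a \<otimes> x \<in> I"
    using assms(1,4) m_comm by (metis subsetD)
qed (use assms(4) ring_axioms in auto)

lemma idealD:
  assumes "ideal I R"
  shows "I \<subseteq> carrier R" "\<zero> \<in> I" "\<And>a b. a \<in> I \<Longrightarrow> b \<in> I \<Longrightarrow> a \<oplus> b \<in> I"
    "\<And>a c. a \<in> I \<Longrightarrow> c \<in> carrier R \<Longrightarrow> c \<otimes> a \<in> I"
    "\<And>a c. a \<in> I \<Longrightarrow> c \<in> carrier R \<Longrightarrow> a \<otimes> c \<in> I"
    "\<And>a. a \<in> I \<Longrightarrow> \<ominus> a \<in> I" "\<And>a b. a \<in> I \<Longrightarrow> b \<in> I \<Longrightarrow> a \<ominus> b \<in> I"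
proof -
  interpret ideal I R by fact
  show "I \<subseteq> carrier R" "\<zero> \<in> I" "\<And>a b. a \<in> I \<Longrightarrow> b \<in> I \<Longrightarrow> a \<oplus> b \<in> I"
    "\<And>a c. a \<in> I \<Longrightarrow> c \<in> carrier R \<Longrightarrow> c \<otimes> a \<in> I"
    "\<And>a c. a \<in> I \<Longrightarrow> c \<in> carrier R \<Longrightarrow> a \<otimes> c \<in> I"
    "\<And>a. a \<in> I \<Longrightarrow> \<ominus> a \<in> I" "\<And>a b. a \<in> I \<Longrightarrow> b \<in> I \<Longrightarrow> a \<ominus> b \<in> I"
    by (auto simp: I_l_closed I_r_closed minus_eq)
qed

lemma ideal_colon:
  assumes "ideal I R" "x \<in> carrier R"
  shows "ideal (colon R I x) R" "I \<subseteq> colon R I x"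
  using idealD[OF assms(1)] assms(2)
  by (auto intro!: ideal_intro simp: colon_def l_distr m_assoc)

lemma ideal_adjoin:
  assumes "ideal I R" "x \<in> carrier R"
  shows "ideal (adjoin R I x) R" "I \<subseteq> adjoin R I x" "x \<in> adjoin R I x"
proof -
  note I = idealD[OF assms(1)]
  show "ideal (adjoin R I x) R"
  proof (rule ideal_intro)
    show "\<zero> \<in> adjoin R I x" unfolding adjoin_def using I(2) assms(2) by (force intro: exI[of _ \<zero>])
    show "a \<oplus> b \<in> adjoin R I x" if ab: "a \<in> adjoin R I x" "b \<in> adjoin R I x" for a b
    proof -
      obtain i c j d where *: "i \<in> I" "c \<in> carrier R" "a = i \<oplus> c \<otimes> x" "j \<in> I" "d \<in> carrier R" "b = j \<oplus> d \<otimes> x"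
        using ab unfolding adjoin_def by blast
      then have "i \<in> carrier R" "j \<in> carrier R" using I(1) by auto
      then have "a \<oplus> b = (i \<oplus> j) \<oplus> (c \<oplus> d) \<otimes> x" using * assms(2) by algebra
      then show ?thesis unfolding adjoin_def using * I(3) by blast
    qed
    show "e \<otimes> a \<in> adjoin R I x" if ab: "a \<in> adjoin R I x" "e \<in> carrier R" for a e
    proof -
      obtain i c where *: "i \<in> I" "c \<in> carrier R" "a = i \<oplus> c \<otimes> x"
        using ab unfolding adjoin_def by blast
      then have "i \<in> carrier R" using I(1) by auto
      then have "e \<otimes> a = e \<otimes> i \<oplus> (e \<otimes> c) \<otimes> x" using * assms(2) ab by algebra
      then show ?thesis unfolding adjoin_def using * I(4) ab by blast
    qed
  qed (use I(1) assms(2) in \<open>auto simp: adjoin_def\<close>)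
  show "I \<subseteq> adjoin R I x"
  proof
    fix i assume i: "i \<in> I"
    then have "i = i \<oplus> \<zero> \<otimes> x" using I(1) assms(2) by (simp add: subset_iff)
    then show "i \<in> adjoin R I x" unfolding adjoin_def using i by blast
  qed
  have "x = \<zero> \<oplus> \<one> \<otimes> x" using assms(2) by simp
  then show "x \<in> adjoin R I x" unfolding adjoin_def using I(2) by blast
qed

lemma adjoin_minimal:
  assumes "ideal J R" "I \<subseteq> J" "x \<in> J"
  shows "adjoin R I x \<subseteq> J"
  using idealD[OF assms(1)] assms(2,3) by (auto simp: adjoin_def)

text \<open>Choose an element outside \<open>P\<close> from each \<open>J y\<close> and multiply:
  primality keeps the product outside \<open>P\<close>, and the ideal property puts it into every
  \<open>J y\<close>.\<close>

lemma prime_contains_factor: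
  assumes P: "primeideal P R" and "finite F" and "\<And>y. y \<in> F \<Longrightarrow> ideal (J y) R \<and> \<not> J y \<subseteq> P"
  shows "\<exists>c\<in>carrier R. c \<notin> P \<and> (\<forall>y\<in>F. c \<in> J y)"
  using assms(2,3)
proof (induction F)
  case empty
  show ?case using primeideal.I_notcarr[OF P] idealD(1)[OF primeideal.axioms(1)[OF P]] by auto
next
  case (insert y F)
  then obtain c where c: "c \<in> carrier R" "c \<notin> P" "\<forall>y\<in>F. c \<in> J y" by blast
  obtain d where d: "d \<in> J y" "d \<notin> P" using insert.prems by blast
  have "d \<in> carrier R" using idealD(1)[of "J y"] insert.prems d(1) by blast
  then have "c \<otimes> d \<notin> P" using primeideal.I_prime[OF P] c d by blast
  moreover have "c \<otimes> d \<in> J z" if "z \<in> insert y F" for z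
    using that insert.prems idealD(4,5)[of "J z"] c d \<open>d \<in> carrier R\<close> by (cases "z = y") auto
  ultimately show ?case using c(1) \<open>d \<in> carrier R\<close> by blast
qed

end

context noetherian_ring
begin

text \<open>A nonempty chain of ideals in a Noetherian ring contains its own union, so Zorn's lemma
  applies to an arbitrary nonempty family of ideals.\<close>

lemma maximal_ideal_exists:
  assumes "\<C> \<noteq> {}" "\<And>I. I \<in> \<C> \<Longrightarrow> ideal I R"
  shows "\<exists>I\<in>\<C>. \<forall>J\<in>\<C>. I \<subseteq> J \<longrightarrow> J = I"
proof (rule subset_Zorn)
  fix C assume C: "subset.chain \<C> C"
  show "\<exists>U\<in>\<C>. \<forall>X\<in>C. X \<subseteq> U"
  proof (cases "C = {}")
    case True
    then show ?thesis using assms(1) by auto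
  next
    case False
    have "subset.chain {I. ideal I R} C"
      using C assms(2) unfolding subset.chain_def by blast
    then have "\<Union>C \<in> C" using ideal_chain_is_trivial False by blast
    moreover have "C \<subseteq> \<C>" using C by (simp add: subset.chain_def)
    ultimately show ?thesis by (intro bexI[of _ "\<Union>C"]) auto
  qed
qed

end

text \<open>The ideal grows from \<open>{\<zero>}\<close> by finitely many generators, one at a
  time; a single new element \<open>x\<close> is what the exact sequence for \<open>I + xR\<close>
  can handle.\<close>

lemma (in cring) ideal_fg_induct [consumes 2, case_names zero adjoin]:
  assumes "noetherian_ring R" "ideal I R" "P {\<zero>}"
    and step: "\<And>I x. ideal I R \<Longrightarrow> x \<in> carrier R \<Longrightarrow> P I \<Longrightarrow> P (adjoin R I x)"
  shows "P I"
proof -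
  interpret noetherian_ring R by fact
  obtain A where A: "A \<subseteq> carrier R" "finite A" "I = Idl A" using finetely_gen[OF assms(2)] by blast
  have "P (Idl A)" using A(2,1)
  proof (induction A)
    case empty
    have "Idl {} = {\<zero>}"
      using genideal_minimal[OF zeroideal, of "{}"] idealD(2)[OF genideal_ideal[of "{}"]] by auto
    then show ?case using assms(3) by simp
  next
    case (insert x A)
    have id: "ideal (Idl A) R" using insert.prems by (auto intro: genideal_ideal)
    have "Idl (insert x A) = adjoin R (Idl A) x"
    proof
      show "Idl (insert x A) \<subseteq> adjoin R (Idl A) x"
        using ideal_adjoin[OF id, of x] genideal_self[of A] insert.prems
        by (intro genideal_minimal) auto
      show "adjoin R (Idl A) x \<subseteq> Idl (insert x A)"
        using insert.prems genideal_ideal[of "insert x A"] genideal_self[of "insert x A"]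
        by (intro adjoin_minimal genideal_minimal) auto
    qed
    then show ?case using step[OF id] insert by auto
  qed
  then show ?thesis using A(3) by simp
qed

context noetherian_local_ring
begin

lemma noeth: "noetherian_ring R" ..

lemma maximalideal_max_ideal: "maximalideal (max_ideal R) R"
  unfolding max_ideal_def by (rule theI'[OF unique_maximal])

lemma ideal_max_ideal: "ideal (max_ideal R) R"
  using maximalideal_max_ideal by (rule maximalideal.axioms)

lemma one_notin_max_ideal: "\<one> \<notin> max_ideal R"
  using ideal.one_imp_carrier[OF ideal_max_ideal] maximalideal.I_notcarr[OF maximalideal_max_ideal] by auto

lemma one_not_zero: "\<one> \<noteq> \<zero>"
  using one_notin_max_ideal idealD(2)[OF ideal_max_ideal] by auto

lemma proper_ideal_subset_max_ideal:
  assumes "ideal I R" "I \<noteq> carrier R"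
  shows "I \<subseteq> max_ideal R"
proof -
  let ?C = "{J. ideal J R \<and> J \<noteq> carrier R \<and> I \<subseteq> J}"
  obtain J where J: "J \<in> ?C" "\<forall>K\<in>?C. J \<subseteq> K \<longrightarrow> K = J"
    using maximal_ideal_exists[of ?C] assms by blast
  have "maximalideal J R"
  proof (rule maximalidealI)
    show "ideal J R" "carrier R \<noteq> J" using J(1) by auto
    fix K assume K: "ideal K R" "J \<subseteq> K" "K \<subseteq> carrier R"
    show "K = J \<or> K = carrier R" using J K by blast
  qed
  then have "J = max_ideal R" using unique_maximal maximalideal_max_ideal by blast
  then show ?thesis using J(1) by blast
qed

lemma unit_outside_max_ideal:
  assumes "x \<in> carrier R" "x \<notin> max_ideal R"
  shows "\<exists>y\<in>carrier R. y \<otimes> x = \<one>"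
proof -
  have "PIdl x = carrier R"
    using proper_ideal_subset_max_ideal[OF cgenideal_ideal[OF assms(1)]] cgenideal_self[OF assms(1)] assms(2)
    by blast
  then have "\<one> \<in> PIdl x" by simp
  then show ?thesis unfolding cgenideal_def by auto
qed

lemma unit_one_minus:
  assumes "x \<in> max_ideal R"
  shows "\<exists>y\<in>carrier R. y \<otimes> (\<one> \<ominus> x) = \<one>"
proof (rule unit_outside_max_ideal)
  have x: "x \<in> carrier R" using assms idealD(1)[OF ideal_max_ideal] by blast
  then show "\<one> \<ominus> x \<in> carrier R" by simp
  have "(\<one> \<ominus> x) \<oplus> x = \<one>" using x by algebra
  then show "\<one> \<ominus> x \<notin> max_ideal R"
    using assms idealD(3)[OF ideal_max_ideal] one_notin_max_ideal by metis
qed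

text \<open>
  The maximal elements among the ideals \<open>(I : y)\<close> with \<open>y \<notin> I\<close> are prime, every zero divisor
  modulo \<open>I\<close> lies in one of them, and there are finitely many; prime avoidance concludes.
\<close>

lemma socle_exists:
  assumes I: "ideal I R"
    and zd: "\<And>x. x \<in> max_ideal R \<Longrightarrow> \<exists>a\<in>carrier R. a \<notin> I \<and> x \<otimes> a \<in> I"
  shows "\<exists>y\<in>carrier R. y \<notin> I \<and> (\<forall>x\<in>max_ideal R. x \<otimes> y \<in> I)"
proof (rule ccontr)
  assume contra: "\<not> ?thesis"
  note m = idealD[OF ideal_max_ideal]
  \<comment> \<open>\<open>Y\<close> collects the \<open>y\<close> outside \<open>I\<close> for
    which \<open>(I : y)\<close> is maximal among the ideals of this form.\<close>
  define Y where "Y = {y \<in> carrier R. y \<notin> I \<and> (\<forall>z\<in>carrier R. z \<notin> I \<and> colon R I y \<subseteq> colon R I z \<longrightarrow> colon R I z = colon R I y)}"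
  have Yc: "y \<in> carrier R" "y \<notin> I" if "y \<in> Y" for y using that by (auto simp: Y_def)
  have Ymax: "colon R I z = colon R I y" if "y \<in> Y" "z \<in> carrier R" "z \<notin> I" "colon R I y \<subseteq> colon R I z" for y z
    using that by (auto simp: Y_def)
  have toY: "\<exists>z\<in>Y. colon R I y \<subseteq> colon R I z" if y: "y \<in> carrier R" "y \<notin> I" for y
  proof -
    let ?C = "{colon R I z | z. z \<in> carrier R \<and> z \<notin> I \<and> colon R I y \<subseteq> colon R I z}"
    have "?C \<noteq> {}" using y by blast
    then obtain J where J: "J \<in> ?C" "\<forall>K\<in>?C. J \<subseteq> K \<longrightarrow> K = J"
      using maximal_ideal_exists[of ?C] ideal_colon(1)[OF I] by blast
    then obtain z where z: "J = colon R I z" "z \<in> carrier R" "z \<notin> I" "colon R I y \<subseteq> colon R I z" by blast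
    have "colon R I w = colon R I z" if w: "w \<in> carrier R" "w \<notin> I" "colon R I z \<subseteq> colon R I w" for w
      using J(2) z w by blast
    then have "z \<in> Y" using z by (simp add: Y_def)
    then show ?thesis using z by blast
  qed
  have prime: "primeideal (colon R I y) R" if y: "y \<in> Y" for y
  proof (rule primeidealI)
    show "ideal (colon R I y) R" using ideal_colon[OF I] Yc[OF y] by blast
    show "cring R" ..
    show "carrier R \<noteq> colon R I y"
    proof
      assume "carrier R = colon R I y"
      then have "\<one> \<in> colon R I y" using one_closed by blast
      then show False using Yc[OF y] by (simp add: colon_def)
    qed
    fix a b assume ab: "a \<in> carrier R" "b \<in> carrier R" "a \<otimes> b \<in> colon R I y"
    show "a \<in> colon R I y \<or> b \<in> colon R I y"
    proof (rule disjCI)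
      assume "b \<notin> colon R I y"
      then have by_: "b \<otimes> y \<notin> I" using ab by (simp add: colon_def)
      \<comment> \<open>Maximality turns this inclusion into an equality, and \<open>a\<close> lies
        in the right-hand side.\<close>
      have "colon R I y \<subseteq> colon R I (b \<otimes> y)"
      proof
        fix c assume c: "c \<in> colon R I y"
        then have "c \<otimes> (b \<otimes> y) = b \<otimes> (c \<otimes> y)"
          using ab(2) Yc[OF y] by (intro m_lcomm) (auto simp: colon_def)
        then show "c \<in> colon R I (b \<otimes> y)"
          using c idealD(4)[OF I _ ab(2)] by (simp add: colon_def)
      qed
      then have "colon R I (b \<otimes> y) = colon R I y" using Ymax[OF y _ by_] ab Yc[OF y] by simp
      moreover have "a \<in> colon R I (b \<otimes> y)" using ab Yc[OF y] by (simp add: colon_def m_assoc)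
      ultimately show "a \<in> colon R I y" by simp
    qed
  qed
  have not_m: "\<not> max_ideal R \<subseteq> colon R I y" if "y \<in> Y" for y
    using contra Yc[OF that] by (auto simp: colon_def)
  have UI: "I \<union> F \<subseteq> carrier R" if "F \<subseteq> Y" for F using that idealD(1)[OF I] Yc by auto
  \<comment> \<open>A finite \<open>F\<close> for which \<open>I + (F)\<close> is maximal: adding a
    further \<open>y \<in> Y\<close> changes nothing, so all of \<open>Y\<close> lies in
    \<open>I + (F)\<close>.\<close>
  obtain F where F: "finite F" "F \<subseteq> Y"
    "\<And>G. finite G \<Longrightarrow> G \<subseteq> Y \<Longrightarrow> Idl (I \<union> F) \<subseteq> Idl (I \<union> G) \<Longrightarrow> Idl (I \<union> G) = Idl (I \<union> F)"
  proof -
    let ?C = "{Idl (I \<union> F) | F. finite F \<and> F \<subseteq> Y}"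
    have "Idl (I \<union> {}) \<in> ?C" by blast
    then have "?C \<noteq> {}" by blast
    moreover have "ideal K R" if "K \<in> ?C" for K using that genideal_ideal UI by blast
    ultimately obtain J where J: "J \<in> ?C" "\<forall>K\<in>?C. J \<subseteq> K \<longrightarrow> K = J"
      using maximal_ideal_exists[of ?C] by blast
    then obtain F where F: "J = Idl (I \<union> F)" "finite F" "F \<subseteq> Y" by blast
    show ?thesis
    proof (rule that[OF F(2,3)])
      fix G assume G: "finite G" "G \<subseteq> Y" "Idl (I \<union> F) \<subseteq> Idl (I \<union> G)"
      then have "Idl (I \<union> G) \<in> ?C" by blast
      then show "Idl (I \<union> G) = Idl (I \<union> F)" using J(2) G(3) F(1) by blast
    qed
  qed
  have YF: "y \<in> Idl (I \<union> F)" if y: "y \<in> Y" for y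
  proof -
    have sub: "I \<union> insert y F \<subseteq> carrier R" using UI[of "insert y F"] F(2) y by blast
    have "Idl (I \<union> F) \<subseteq> Idl (I \<union> insert y F)"
      using genideal_self[OF sub] by (intro genideal_minimal genideal_ideal sub) auto
    then have "Idl (I \<union> insert y F) = Idl (I \<union> F)" using F(1,2) y by (intro F(3)) auto
    then show ?thesis using genideal_self[OF sub] by auto
  qed
  \<comment> \<open>Prime avoidance, one prime at a time: if \<open>x\<close> falls into the new
    prime, it is corrected by \<open>c \<otimes> d\<close> with \<open>c\<close> in all the other
    primes, \<open>d\<close> in the maximal ideal, and neither of them in the new prime.\<close>
  have "\<exists>x\<in>max_ideal R. \<forall>y\<in>F. x \<notin> colon R I y"
    using F(1,2)
  proof (induction F)
    case empty
    then show ?case using m(2) by auto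
  next
    case (insert y F)
    then obtain x where x: "x \<in> max_ideal R" "\<forall>y\<in>F. x \<notin> colon R I y" by blast
    have y: "y \<in> Y" using insert.prems by blast
    show ?case
    proof (cases "x \<in> colon R I y")
      case False
      then show ?thesis using x by blast
    next
      case True
      have "\<not> colon R I z \<subseteq> colon R I y" if z: "z \<in> F" for z
        using Ymax[of z y] Yc[OF y] x z True insert.prems by blast
      then obtain c where c: "c \<in> carrier R" "c \<notin> colon R I y" "\<forall>z\<in>F. c \<in> colon R I z"
        using prime_contains_factor[OF prime[OF y] insert(1), of "colon R I"] ideal_colon(1)[OF I] Yc insert.prems
        by blast
      obtain d where d: "d \<in> max_ideal R" "d \<notin> colon R I y" using not_m[OF y] by blast
      have dc: "d \<in> carrier R" and xc: "x \<in> carrier R" using d x m(1) by auto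
      have cd: "c \<otimes> d \<notin> colon R I y" using primeideal.I_prime[OF prime[OF y]] c d dc by blast
      have "x \<oplus> c \<otimes> d \<in> max_ideal R" using x d m c by auto
      moreover have "x \<oplus> c \<otimes> d \<notin> colon R I y"
      proof
        assume "x \<oplus> c \<otimes> d \<in> colon R I y"
        then have "(x \<oplus> c \<otimes> d) \<ominus> x \<in> colon R I y"
          using idealD(7)[OF ideal_colon(1)[OF I]] True Yc[OF y] by blast
        moreover have "(x \<oplus> c \<otimes> d) \<ominus> x = c \<otimes> d" using xc dc c(1) by algebra
        ultimately show False using cd by simp
      qed
      moreover have "x \<oplus> c \<otimes> d \<notin> colon R I z" if z: "z \<in> F" for z
      proof
        assume *: "x \<oplus> c \<otimes> d \<in> colon R I z"
        have zc: "z \<in> carrier R" using insert.prems z Yc by blast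
        note J = idealD[OF ideal_colon(1)[OF I zc]]
        have "(x \<oplus> c \<otimes> d) \<ominus> c \<otimes> d \<in> colon R I z" using * J(5,7) c(3) z dc by blast
        moreover have "(x \<oplus> c \<otimes> d) \<ominus> c \<otimes> d = x" using xc dc c(1) by algebra
        ultimately show False using x(2) z by simp
      qed
      ultimately show ?thesis by blast
    qed
  qed
  then obtain x where x: "x \<in> max_ideal R" "\<forall>y\<in>F. x \<notin> colon R I y" by blast
  obtain a where a: "a \<in> carrier R" "a \<notin> I" "x \<otimes> a \<in> I" using zd[OF x(1)] by blast
  have xa: "x \<in> colon R I a" using a x m(1) by (auto simp: colon_def)
  obtain y where y: "y \<in> Y" "colon R I a \<subseteq> colon R I y" using toY a by blast
  \<comment> \<open>The finitely many primes from \<open>F\<close> suffice: otherwise some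
    \<open>c\<close> outside \<open>(I : y)\<close> would kill \<open>F\<close> modulo
    \<open>I\<close>, hence all of \<open>I + (F)\<close>, hence \<open>y\<close>.\<close>
  have "\<exists>z\<in>F. colon R I z \<subseteq> colon R I y"
  proof (rule ccontr)
    assume "\<not> ?thesis"
    then obtain c where c: "c \<in> carrier R" "c \<notin> colon R I y" "\<forall>z\<in>F. c \<in> colon R I z"
      using prime_contains_factor[OF prime[OF y(1)] F(1), of "colon R I"] ideal_colon(1)[OF I] Yc F(2) by blast
    have "I \<subseteq> colon R I c" using ideal_colon(2)[OF I c(1)] .
    moreover have "F \<subseteq> colon R I c"
    proof
      fix z assume z: "z \<in> F"
      then have "z \<in> carrier R" using F(2) Yc by blast
      then show "z \<in> colon R I c" using c(1,3) z m_comm[of z c] by (simp add: colon_def)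
    qed
    ultimately have "I \<union> F \<subseteq> colon R I c" by blast
    then have "Idl (I \<union> F) \<subseteq> colon R I c" by (intro genideal_minimal ideal_colon I c)
    then have "y \<in> colon R I c" using YF[OF y(1)] by blast
    then show False using c(1,2) Yc[OF y(1)] m_comm[of y c] by (simp add: colon_def)
  qed
  then obtain z where z: "z \<in> F" "colon R I z \<subseteq> colon R I y" by blast
  then have "colon R I y = colon R I z" using Ymax[of z y] F(2) Yc[OF y(1)] by blast
  then show False using x(2) z xa y(2) by blast
qed

end

section \<open>Modules\<close>

lemma (in module) a_inv_zero: "\<ominus>\<^bsub>M\<^esub> \<zero>\<^bsub>M\<^esub> = \<zero>\<^bsub>M\<^esub>"
  using M.r_neg1[of "\<zero>\<^bsub>M\<^esub>" "\<zero>\<^bsub>M\<^esub>"] M.r_neg[of "\<zero>\<^bsub>M\<^esub>"] by simp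

text \<open>With these rules \<open>algebra\<close> treats equations between module elements.
  Scalars are distributed over sums of vectors, but sums and products of scalars are not split;
  those are expanded by hand where they occur.\<close>

lemmas (in module) module_simprules
  [algebra add: "module" "zero M" "add M" "a_inv M" "a_minus M" "smult M"] =
  M.a_closed M.zero_closed M.a_inv_closed M.minus_closed M.minus_eq M.l_zero M.r_zero M.a_assoc M.l_neg M.r_neg
  M.a_comm M.a_lcomm M.r_neg1 M.r_neg2 M.minus_add M.minus_minus a_inv_zero
  smult_closed smult_r_distr smult_r_minus smult_r_null

context module
begin

lemma smult_minus_one: "x \<in> carrier M \<Longrightarrow> (\<ominus> \<one>) \<odot>\<^bsub>M\<^esub> x = \<ominus>\<^bsub>M\<^esub> x"
  by (simp add: smult_l_minus)

lemma minus_self: "x \<in> carrier M \<Longrightarrow> x \<ominus>\<^bsub>M\<^esub> x = \<zero>\<^bsub>M\<^esub>"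
  by algebra

lemma eq_of_minus_zero: "x \<in> carrier M \<Longrightarrow> y \<in> carrier M \<Longrightarrow> x \<ominus>\<^bsub>M\<^esub> y = \<zero>\<^bsub>M\<^esub> \<Longrightarrow> x = y"
proof -
  assume *: "x \<in> carrier M" "y \<in> carrier M" "x \<ominus>\<^bsub>M\<^esub> y = \<zero>\<^bsub>M\<^esub>"
  have "x = (x \<ominus>\<^bsub>M\<^esub> y) \<oplus>\<^bsub>M\<^esub> y" using *(1,2) by algebra
  then show "x = y" using * by simp
qed

lemma minus_add_cancel: "x \<in> carrier M \<Longrightarrow> y \<in> carrier M \<Longrightarrow> (x \<ominus>\<^bsub>M\<^esub> y) \<oplus>\<^bsub>M\<^esub> y = x"
  by algebra

lemma smult_minus_distr:
  "c \<in> carrier R \<Longrightarrow> x \<in> carrier M \<Longrightarrow> y \<in> carrier M \<Longrightarrow> c \<odot>\<^bsub>M\<^esub> (x \<ominus>\<^bsub>M\<^esub> y) = c \<odot>\<^bsub>M\<^esub> x \<ominus>\<^bsub>M\<^esub> c \<odot>\<^bsub>M\<^esub> y"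
  by algebra

lemma smult_comm:
  "c \<in> carrier R \<Longrightarrow> d \<in> carrier R \<Longrightarrow> x \<in> carrier M \<Longrightarrow> c \<odot>\<^bsub>M\<^esub> (d \<odot>\<^bsub>M\<^esub> x) = d \<odot>\<^bsub>M\<^esub> (c \<odot>\<^bsub>M\<^esub> x)"
  by (metis R.m_comm smult_assoc1)

lemma submod_intro:
  assumes "H \<subseteq> carrier M" "\<zero>\<^bsub>M\<^esub> \<in> H" "\<And>a b. a \<in> H \<Longrightarrow> b \<in> H \<Longrightarrow> a \<oplus>\<^bsub>M\<^esub> b \<in> H"
    and "\<And>c a. c \<in> carrier R \<Longrightarrow> a \<in> H \<Longrightarrow> c \<odot>\<^bsub>M\<^esub> a \<in> H"
  shows "submodule H R M"
proof (rule submoduleI)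
  fix a assume a: "a \<in> H"
  then show "\<ominus>\<^bsub>M\<^esub> a \<in> H" using assms(1) assms(4)[of "\<ominus> \<one>" a] smult_minus_one[of a] by auto
qed (use assms in auto)

lemma submodD:
  assumes "submodule H R M"
  shows "H \<subseteq> carrier M" "\<zero>\<^bsub>M\<^esub> \<in> H" "\<And>a b. a \<in> H \<Longrightarrow> b \<in> H \<Longrightarrow> a \<oplus>\<^bsub>M\<^esub> b \<in> H"
    "\<And>c a. c \<in> carrier R \<Longrightarrow> a \<in> H \<Longrightarrow> c \<odot>\<^bsub>M\<^esub> a \<in> H"
    "\<And>a. a \<in> H \<Longrightarrow> \<ominus>\<^bsub>M\<^esub> a \<in> H"
    "\<And>a b. a \<in> H \<Longrightarrow> b \<in> H \<Longrightarrow> a \<ominus>\<^bsub>M\<^esub> b \<in> H"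
proof -
  note E = submoduleE[OF assms]
  show "H \<subseteq> carrier M" "\<And>a b. a \<in> H \<Longrightarrow> b \<in> H \<Longrightarrow> a \<oplus>\<^bsub>M\<^esub> b \<in> H"
    "\<And>c a. c \<in> carrier R \<Longrightarrow> a \<in> H \<Longrightarrow> c \<odot>\<^bsub>M\<^esub> a \<in> H" "\<And>a. a \<in> H \<Longrightarrow> \<ominus>\<^bsub>M\<^esub> a \<in> H"
    "\<And>a b. a \<in> H \<Longrightarrow> b \<in> H \<Longrightarrow> a \<ominus>\<^bsub>M\<^esub> b \<in> H"
    using E by (auto simp: M.minus_eq)
  obtain x where "x \<in> H" using E(2) by auto
  then have "x \<oplus>\<^bsub>M\<^esub> \<ominus>\<^bsub>M\<^esub> x \<in> H" "x \<in> carrier M" using E by auto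
  then show "\<zero>\<^bsub>M\<^esub> \<in> H" by (simp add: M.r_neg)
qed

lemma submod_zero: "submodule {\<zero>\<^bsub>M\<^esub>} R M"
  by (rule submod_intro) auto

lemma submod_coset:
  assumes "submodule H R M" "x \<ominus>\<^bsub>M\<^esub> y \<in> H" "y \<in> H" "x \<in> carrier M"
  shows "x \<in> H"
  using submodD(1,3)[OF assms(1)] assms(2-4) minus_add_cancel[of x y] by (metis subsetD)

end

lemma module_sub_mod: "module R M \<Longrightarrow> submodule H R M \<Longrightarrow> module R (sub_mod M H)"
  unfolding sub_mod_def by (rule submodule.submodule_is_module)

lemma sub_mod_simps [simp]:
  "carrier (sub_mod M K) = K" "zero (sub_mod M K) = zero M" "add (sub_mod M K) = add M"
  "smult (sub_mod M K) = smult M"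
  by (simp_all add: sub_mod_def)

lemma mod_homD:
  assumes "f \<in> mod_hom R M N"
  shows "\<And>x. x \<in> carrier M \<Longrightarrow> f x \<in> carrier N"
    "\<And>x y. x \<in> carrier M \<Longrightarrow> y \<in> carrier M \<Longrightarrow> f (x \<oplus>\<^bsub>M\<^esub> y) = f x \<oplus>\<^bsub>N\<^esub> f y"
    "\<And>r x. r \<in> carrier R \<Longrightarrow> x \<in> carrier M \<Longrightarrow> f (r \<odot>\<^bsub>M\<^esub> x) = r \<odot>\<^bsub>N\<^esub> f x"
  using assms by (auto simp: mod_hom_def)

lemma mod_homI:
  assumes "\<And>x. x \<in> carrier M \<Longrightarrow> f x \<in> carrier N"
    "\<And>x y. x \<in> carrier M \<Longrightarrow> y \<in> carrier M \<Longrightarrow> f (x \<oplus>\<^bsub>M\<^esub> y) = f x \<oplus>\<^bsub>N\<^esub> f y"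
    "\<And>r x. r \<in> carrier R \<Longrightarrow> x \<in> carrier M \<Longrightarrow> f (r \<odot>\<^bsub>M\<^esub> x) = r \<odot>\<^bsub>N\<^esub> f x"
  shows "f \<in> mod_hom R M N"
  using assms by (auto simp: mod_hom_def)

lemma mod_hom_more:
  assumes "module R M" "module R N" "f \<in> mod_hom R M N"
  shows "f \<zero>\<^bsub>M\<^esub> = \<zero>\<^bsub>N\<^esub>" "\<And>x. x \<in> carrier M \<Longrightarrow> f (\<ominus>\<^bsub>M\<^esub> x) = \<ominus>\<^bsub>N\<^esub> f x"
    "\<And>x y. x \<in> carrier M \<Longrightarrow> y \<in> carrier M \<Longrightarrow> f (x \<ominus>\<^bsub>M\<^esub> y) = f x \<ominus>\<^bsub>N\<^esub> f y"
proof -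
  interpret M: module R M by fact
  interpret N: module R N by fact
  note f = mod_homD[OF assms(3)]
  show "f \<zero>\<^bsub>M\<^esub> = \<zero>\<^bsub>N\<^esub>"
    using f(3)[of "\<zero>\<^bsub>R\<^esub>" "\<zero>\<^bsub>M\<^esub>"] f(1)[of "\<zero>\<^bsub>M\<^esub>"] by simp
  show n: "f (\<ominus>\<^bsub>M\<^esub> x) = \<ominus>\<^bsub>N\<^esub> f x" if "x \<in> carrier M" for x
    using f(3)[of "\<ominus>\<^bsub>R\<^esub> \<one>\<^bsub>R\<^esub>" x] that f(1)[of x] by (simp add: M.smult_minus_one N.smult_minus_one)
  show "f (x \<ominus>\<^bsub>M\<^esub> y) = f x \<ominus>\<^bsub>N\<^esub> f y" if "x \<in> carrier M" "y \<in> carrier M" for x y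
    using that by (simp add: f n M.minus_eq N.minus_eq)
qed

lemma mod_hom_compose:
  "f \<in> mod_hom R M N \<Longrightarrow> g \<in> mod_hom R N L \<Longrightarrow> (\<lambda>x. g (f x)) \<in> mod_hom R M L"
  by (auto simp: mod_hom_def Pi_iff)

lemma submod_image:
  assumes "module R M" "module R N" "f \<in> mod_hom R M N" "submodule H R M"
  shows "submodule (f ` H) R N"
proof -
  interpret M: module R M by fact
  interpret N: module R N by fact
  note f = mod_homD[OF assms(3)] mod_hom_more[OF assms(1-3)]
  note H = M.submodD[OF assms(4)]
  show ?thesis
  proof (rule N.submod_intro)
    show "f ` H \<subseteq> carrier N" using f(1) H(1) by auto
    show "\<zero>\<^bsub>N\<^esub> \<in> f ` H" using f(4) H(2) by (metis imageI)
    show "a \<oplus>\<^bsub>N\<^esub> b \<in> f ` H" if "a \<in> f ` H" "b \<in> f ` H" for a b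
      using that f(2) H(1,3) by (smt (verit) imageE imageI subsetD)
    show "c \<odot>\<^bsub>N\<^esub> a \<in> f ` H" if "c \<in> carrier R" "a \<in> f ` H" for a c
      using that f(3) H(1,4) by (smt (verit) imageE imageI subsetD)
  qed
qed

lemma submod_kernel:
  assumes "module R M" "module R N" "f \<in> mod_hom R M N"
  shows "submodule {x \<in> carrier M. f x = \<zero>\<^bsub>N\<^esub>} R M"
proof -
  interpret M: module R M by fact
  interpret N: module R N by fact
  note f = mod_homD[OF assms(3)] mod_hom_more[OF assms(1-3)]
  show ?thesis by (rule M.submod_intro) (auto simp: f)
qed

text \<open>This is \<open>B + C s_1 + ... + C s_n\<close>. With \<open>C = carrier R\<close> it
  expresses generation modulo \<open>B\<close>; with \<open>C = max_ideal R\<close> it is the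
  submodule \<open>mV + B\<close> of Nakayama's lemma.\<close>

primrec gspan :: "('r, 'm, 'e) module_scheme \<Rightarrow> 'r set \<Rightarrow> 'm set \<Rightarrow> 'm list \<Rightarrow> 'm set"
  where
    "gspan M C B [] = B"
  | "gspan M C B (s # S) = {c \<odot>\<^bsub>M\<^esub> s \<oplus>\<^bsub>M\<^esub> v | c v. c \<in> C \<and> v \<in> gspan M C B S}"

context module
begin

lemma submod_gspan:
  assumes "ideal C R" "submodule B R M" "set S \<subseteq> carrier M"
  shows "submodule (gspan M C B S) R M"
  using assms(3)
proof (induction S)
  case Nil
  then show ?case using assms by simp
next
  case (Cons s S)
  then have s: "s \<in> carrier M" by simp
  have IH: "submodule (gspan M C B S) R M" using Cons by simp
  note G = submodD[OF IH] and C = idealD[OF assms(1)]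
  show ?case
  proof (rule submod_intro)
    show "gspan M C B (s # S) \<subseteq> carrier M" using G(1) C(1) s by auto
    have "\<zero>\<^bsub>M\<^esub> = \<zero> \<odot>\<^bsub>M\<^esub> s \<oplus>\<^bsub>M\<^esub> \<zero>\<^bsub>M\<^esub>" using s by simp
    then show "\<zero>\<^bsub>M\<^esub> \<in> gspan M C B (s # S)" using C(2) G(2) by auto
    fix a assume "a \<in> gspan M C B (s # S)"
    then obtain c v where a: "a = c \<odot>\<^bsub>M\<^esub> s \<oplus>\<^bsub>M\<^esub> v" "c \<in> C" "v \<in> gspan M C B S" by auto
    have cv: "c \<in> carrier R" "v \<in> carrier M" using a G(1) C(1) by auto
    show "e \<odot>\<^bsub>M\<^esub> a \<in> gspan M C B (s # S)" if e: "e \<in> carrier R" for e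
    proof -
      have "e \<odot>\<^bsub>M\<^esub> a = (e \<otimes> c) \<odot>\<^bsub>M\<^esub> s \<oplus>\<^bsub>M\<^esub> e \<odot>\<^bsub>M\<^esub> v"
        using a cv e s by (simp add: smult_r_distr smult_assoc1)
      then show ?thesis using C(4)[OF a(2) e] G(4)[OF e a(3)] by auto
    qed
    fix b assume "b \<in> gspan M C B (s # S)"
    then obtain d w where b: "b = d \<odot>\<^bsub>M\<^esub> s \<oplus>\<^bsub>M\<^esub> w" "d \<in> C" "w \<in> gspan M C B S" by auto
    have dw: "d \<in> carrier R" "w \<in> carrier M" using b G(1) C(1) by auto
    have "a \<oplus>\<^bsub>M\<^esub> b = (c \<oplus> d) \<odot>\<^bsub>M\<^esub> s \<oplus>\<^bsub>M\<^esub> (v \<oplus>\<^bsub>M\<^esub> w)"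
      using a(1) b(1) cv dw s by (simp add: smult_l_distr M.a_ac)
    then show "a \<oplus>\<^bsub>M\<^esub> b \<in> gspan M C B (s # S)" using C(3)[OF a(2) b(2)] G(3)[OF a(3) b(3)] by auto
  qed
qed

lemma gspan_step:
  assumes "ideal C R" "submodule B R M" "set (s # S) \<subseteq> carrier M" "v \<in> gspan M C B S"
  shows "v \<in> gspan M C B (s # S)"
proof -
  have "v \<in> carrier M" using assms submodD(1)[OF submod_gspan[of C B S]] by auto
  then have "v = \<zero> \<odot>\<^bsub>M\<^esub> s \<oplus>\<^bsub>M\<^esub> v" using assms(3) by simp
  then show ?thesis using idealD(2)[OF assms(1)] assms(4) by auto
qed

lemma gspan_base:
  assumes "ideal C R" "submodule B R M" "set S \<subseteq> carrier M"
  shows "B \<subseteq> gspan M C B S"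
  using assms(3)
proof (induction S)
  case (Cons s S)
  then show ?case using gspan_step[OF assms(1,2) Cons.prems] by auto
qed simp

lemma gspan_gens:
  assumes "submodule B R M" "set S \<subseteq> carrier M"
  shows "set S \<subseteq> gspan M (carrier R) B S"
  using assms(2)
proof (induction S)
  case (Cons s S)
  have "s = \<one> \<odot>\<^bsub>M\<^esub> s \<oplus>\<^bsub>M\<^esub> \<zero>\<^bsub>M\<^esub>" using Cons.prems by simp
  moreover have "\<zero>\<^bsub>M\<^esub> \<in> gspan M (carrier R) B S"
    using submodD(2)[OF submod_gspan[OF oneideal assms(1)]] Cons.prems by simp
  ultimately have "s \<in> gspan M (carrier R) B (s # S)" using R.one_closed by auto
  then show ?case using Cons gspan_step[OF oneideal assms(1) Cons.prems] by auto
qed simp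

lemma gspan_minimal:
  assumes "submodule X R M" "B \<subseteq> X" "set S \<subseteq> X" "C \<subseteq> carrier R"
  shows "gspan M C B S \<subseteq> X"
  using assms(3)
proof (induction S)
  case (Cons s S)
  then have "gspan M C B S \<subseteq> X" "s \<in> X" by simp_all
  then have "c \<odot>\<^bsub>M\<^esub> s \<oplus>\<^bsub>M\<^esub> v \<in> X" if "c \<in> C" "v \<in> gspan M C B S" for c v
    using that submodD(3,4)[OF assms(1)] assms(4) by blast
  then show ?case by auto
qed (use assms in simp)

lemma gspan_smult:
  assumes "ideal C R" "submodule B R M" "set S \<subseteq> carrier M" "c \<in> C" "v \<in> gspan M (carrier R) B S"
  shows "c \<odot>\<^bsub>M\<^esub> v \<in> gspan M C B S"
  using assms(3,5)
proof (induction S arbitrary: v)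
  case Nil
  then show ?case using submodD(4)[OF assms(2)] idealD(1)[OF assms(1)] assms(4) by auto
next
  case (Cons s S)
  then obtain d w where v: "v = d \<odot>\<^bsub>M\<^esub> s \<oplus>\<^bsub>M\<^esub> w" "d \<in> carrier R" "w \<in> gspan M (carrier R) B S" by auto
  have "w \<in> carrier M" using v submodD(1)[OF submod_gspan[OF oneideal assms(2), of S]] Cons.prems by auto
  moreover have "c \<in> carrier R" using idealD(1)[OF assms(1)] assms(4) by auto
  ultimately have "c \<odot>\<^bsub>M\<^esub> v = (c \<otimes> d) \<odot>\<^bsub>M\<^esub> s \<oplus>\<^bsub>M\<^esub> c \<odot>\<^bsub>M\<^esub> w"
    using v(1,2) Cons.prems by (simp add: smult_r_distr smult_assoc1)
  then show ?case using Cons v idealD(5)[OF assms(1,4)] by auto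
qed

lemma finsum_in_submod:
  assumes "submodule X R M" "finite A" "\<And>a. a \<in> A \<Longrightarrow> f a \<in> X"
  shows "(\<Oplus>\<^bsub>M\<^esub>a\<in>A. f a) \<in> X"
  using assms(2,3)
proof (induction A)
  case empty
  show ?case using submodD(2)[OF assms(1)] by simp
next
  case (insert a A)
  then have "f \<in> A \<rightarrow> carrier M" "f a \<in> carrier M" using submodD(1)[OF assms(1)] by auto
  then show ?case using insert submodD(3)[OF assms(1)] by (simp add: M.finsum_insert)
qed

end

text \<open>From \<open>s = c s + v\<close> with \<open>c\<close> in the maximal ideal, the unit
  \<open>1 - c\<close> expresses \<open>s\<close> through the remaining generators; substituting
  this into their relations gives the hypothesis for the shorter list.\<close>

lemma (in noetherian_local_ring) nakayama:
  assumes "module R M" "submodule B R M" "set S \<subseteq> carrier M"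
    and "\<And>s. s \<in> set S \<Longrightarrow> s \<in> gspan M (max_ideal R) B S"
  shows "set S \<subseteq> B"
  using assms(3,4)
proof (induction S)
  case (Cons s S)
  interpret M: module R M by fact
  note m = idealD[OF ideal_max_ideal]
  have S: "set S \<subseteq> carrier M" and s: "s \<in> carrier M" using Cons.prems by auto
  note G = M.submodD[OF M.submod_gspan[OF ideal_max_ideal assms(2) S]]
  obtain c v where c: "s = c \<odot>\<^bsub>M\<^esub> s \<oplus>\<^bsub>M\<^esub> v" "c \<in> max_ideal R" "v \<in> gspan M (max_ideal R) B S"
    using Cons.prems(2)[of s] by auto
  obtain y where y: "y \<in> carrier R" "y \<otimes> (\<one> \<ominus> c) = \<one>" using unit_one_minus[OF c(2)] by blast
  have cc: "c \<in> carrier R" "v \<in> carrier M" using c m(1) G(1) by auto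
  have "(\<one> \<ominus> c) \<odot>\<^bsub>M\<^esub> s = s \<ominus>\<^bsub>M\<^esub> c \<odot>\<^bsub>M\<^esub> s"
    using cc s by (simp add: minus_eq M.M.minus_eq M.smult_l_distr M.smult_l_minus)
  also have "\<dots> = (c \<odot>\<^bsub>M\<^esub> s \<oplus>\<^bsub>M\<^esub> v) \<ominus>\<^bsub>M\<^esub> c \<odot>\<^bsub>M\<^esub> s" using c(1) by simp
  also have "\<dots> = v" using cc s by algebra
  finally have "v = (\<one> \<ominus> c) \<odot>\<^bsub>M\<^esub> s" ..
  then have "y \<odot>\<^bsub>M\<^esub> v = s" using y cc s by (simp flip: M.smult_assoc1)
  then have sG: "s \<in> gspan M (max_ideal R) B S" using G(4)[OF y(1) c(3)] by simp
  have "set S \<subseteq> B"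
  proof (rule Cons.IH[OF S])
    fix u assume "u \<in> set S"
    then obtain d w where "u = d \<odot>\<^bsub>M\<^esub> s \<oplus>\<^bsub>M\<^esub> w" "d \<in> max_ideal R" "w \<in> gspan M (max_ideal R) B S"
      using Cons.prems(2)[of u] by auto
    then show "u \<in> gspan M (max_ideal R) B S" using G(3,4) sG m(1) by auto
  qed
  moreover have "s \<in> B"
    using M.gspan_minimal[OF assms(2), of B S "max_ideal R"] calculation sG m(1) by auto
  ultimately show ?case by simp
qed simp

text \<open>The witness is the span of the generators with coefficients in the maximal ideal. If it
  contained \<open>V\<close>, it would contain the generators themselves, which is the situation of
  \<open>nakayama\<close>.\<close>

lemma (in noetherian_local_ring) nakayama_submodule:
  assumes "module R M" "submodule B R M" "set S \<subseteq> V" "submodule V R M" "V \<subseteq> gspan M (carrier R) B S" "\<not> V \<subseteq> B"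
  shows "\<exists>X. submodule X R M \<and> B \<subseteq> X \<and> (\<forall>a\<in>max_ideal R. \<forall>v\<in>V. a \<odot>\<^bsub>M\<^esub> v \<in> X) \<and> \<not> V \<subseteq> X"
proof (intro exI conjI ballI)
  interpret M: module R M by fact
  let ?X = "gspan M (max_ideal R) B S"
  have S: "set S \<subseteq> carrier M" using assms(3) M.submodD(1)[OF assms(4)] by auto
  show "submodule ?X R M" using M.submod_gspan[OF ideal_max_ideal assms(2) S] .
  show "B \<subseteq> ?X" using M.gspan_base[OF ideal_max_ideal assms(2) S] .
  show "a \<odot>\<^bsub>M\<^esub> v \<in> ?X" if "a \<in> max_ideal R" "v \<in> V" for a v
    using M.gspan_smult[OF ideal_max_ideal assms(2) S] that assms(5) by blast
  show "\<not> V \<subseteq> ?X"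
  proof
    assume "V \<subseteq> ?X"
    then have "set S \<subseteq> B" using assms(3) by (intro nakayama[OF assms(1,2) S]) auto
    then have "gspan M (carrier R) B S \<subseteq> B" using M.gspan_minimal[OF assms(2)] by blast
    then show False using assms(5,6) by blast
  qed
qed

text \<open>The coefficients at \<open>s\<close> of the elements of \<open>W\<close> form an ideal;
  elements of \<open>W\<close> that realize its generators reduce \<open>W\<close> to combinations
  of the shorter list. \<open>B\<close> may stick out of \<open>W\<close>, so the generators are
  taken from \<open>W\<close> and generation is claimed up to \<open>B\<close>.\<close>

lemma (in cring) submodule_noetherian:
  assumes "noetherian_ring R" "module R M" "submodule B R M" "set S \<subseteq> carrier M"
    and "submodule W R M" "W \<subseteq> gspan M (carrier R) B S"
  shows "\<exists>T. set T \<subseteq> W \<and> (\<forall>w\<in>W. \<exists>v\<in>gspan M (carrier R) {\<zero>\<^bsub>M\<^esub>} T. w \<ominus>\<^bsub>M\<^esub> v \<in> B)"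
  using assms(4-6)
proof (induction S arbitrary: W)
  case Nil
  interpret M: module R M by fact
  have "w \<ominus>\<^bsub>M\<^esub> \<zero>\<^bsub>M\<^esub> \<in> B" if "w \<in> W" for w
    using Nil that M.submodD(2,6)[OF assms(3)] by auto
  then show ?case by (intro exI[of _ "[]"]) auto
next
  case (Cons s S)
  interpret M: module R M by fact
  have s: "s \<in> carrier M" and S: "set S \<subseteq> carrier M" using Cons.prems by auto
  let ?G = "gspan M (carrier R) B S" and ?sp = "gspan M (carrier R) {\<zero>\<^bsub>M\<^esub>}"
  have smG: "submodule ?G R M" using M.submod_gspan[OF oneideal assms(3) S] .
  note G = M.submodD[OF smG] and W = M.submodD[OF Cons.prems(2)]
  define I where "I = {c \<in> carrier R. \<exists>v\<in>?G. c \<odot>\<^bsub>M\<^esub> s \<oplus>\<^bsub>M\<^esub> v \<in> W}"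
  have I: "ideal I R"
  proof (rule ideal_intro)
    have "\<zero> \<odot>\<^bsub>M\<^esub> s \<oplus>\<^bsub>M\<^esub> \<zero>\<^bsub>M\<^esub> \<in> W" using s W(2) by simp
    then show "\<zero> \<in> I" unfolding I_def using G(2) by blast
    fix a assume "a \<in> I"
    then obtain v where a: "a \<in> carrier R" "v \<in> ?G" "a \<odot>\<^bsub>M\<^esub> s \<oplus>\<^bsub>M\<^esub> v \<in> W" unfolding I_def by blast
    have v: "v \<in> carrier M" using a G(1) by auto
    show "c \<otimes> a \<in> I" if c: "c \<in> carrier R" for c
    proof -
      have "(c \<otimes> a) \<odot>\<^bsub>M\<^esub> s \<oplus>\<^bsub>M\<^esub> c \<odot>\<^bsub>M\<^esub> v = c \<odot>\<^bsub>M\<^esub> (a \<odot>\<^bsub>M\<^esub> s \<oplus>\<^bsub>M\<^esub> v)"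
        using a c v s by (simp add: M.smult_r_distr M.smult_assoc1)
      then have "(c \<otimes> a) \<odot>\<^bsub>M\<^esub> s \<oplus>\<^bsub>M\<^esub> c \<odot>\<^bsub>M\<^esub> v \<in> W" using W(4)[OF c a(3)] by simp
      then show ?thesis unfolding I_def using G(4)[OF c a(2)] a(1) c by blast
    qed
    fix b assume "b \<in> I"
    then obtain w where b: "b \<in> carrier R" "w \<in> ?G" "b \<odot>\<^bsub>M\<^esub> s \<oplus>\<^bsub>M\<^esub> w \<in> W" unfolding I_def by blast
    have w: "w \<in> carrier M" using b G(1) by auto
    have "(a \<oplus> b) \<odot>\<^bsub>M\<^esub> s \<oplus>\<^bsub>M\<^esub> (v \<oplus>\<^bsub>M\<^esub> w) = (a \<odot>\<^bsub>M\<^esub> s \<oplus>\<^bsub>M\<^esub> v) \<oplus>\<^bsub>M\<^esub> (b \<odot>\<^bsub>M\<^esub> s \<oplus>\<^bsub>M\<^esub> w)"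
      using a b v w s by (simp add: M.smult_l_distr M.M.a_ac)
    then have "(a \<oplus> b) \<odot>\<^bsub>M\<^esub> s \<oplus>\<^bsub>M\<^esub> (v \<oplus>\<^bsub>M\<^esub> w) \<in> W" using W(3)[OF a(3) b(3)] by simp
    then show "a \<oplus> b \<in> I" unfolding I_def using G(3)[OF a(2) b(2)] a(1) b(1) by blast
  qed (auto simp: I_def)
  have "\<exists>T. set T \<subseteq> W \<and> (\<forall>c\<in>J. \<exists>v\<in>?sp T. c \<odot>\<^bsub>M\<^esub> s \<ominus>\<^bsub>M\<^esub> v \<in> ?G)" if "ideal J R" "J \<subseteq> I" for J
    using assms(1) that
  proof (induction J rule: ideal_fg_induct)
    case zero
    have "\<zero> \<odot>\<^bsub>M\<^esub> s \<ominus>\<^bsub>M\<^esub> \<zero>\<^bsub>M\<^esub> = \<zero>\<^bsub>M\<^esub>" using s by (simp add: M.minus_self)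
    then show ?case using G(2) by (intro exI[of _ "[]"]) auto
  next
    case (adjoin J x)
    have "x \<in> I" "J \<subseteq> I" using adjoin ideal_adjoin[of J x] by auto
    then obtain T where T: "set T \<subseteq> W" "\<And>c. c \<in> J \<Longrightarrow> \<exists>v\<in>?sp T. c \<odot>\<^bsub>M\<^esub> s \<ominus>\<^bsub>M\<^esub> v \<in> ?G"
      using adjoin by blast
    obtain u where u: "u \<in> ?G" "x \<odot>\<^bsub>M\<^esub> s \<oplus>\<^bsub>M\<^esub> u \<in> W" "u \<in> carrier M"
      using \<open>x \<in> I\<close> G(1) unfolding I_def by blast
    \<comment> \<open>\<open>?t\<close> is an element of \<open>W\<close> with the new coefficient
      \<open>x\<close>; subtracting a multiple of it brings \<open>c \<odot> s\<close> into the span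
      of the shorter list.\<close>
    let ?t = "x \<odot>\<^bsub>M\<^esub> s \<oplus>\<^bsub>M\<^esub> u"
    have "\<exists>v\<in>?sp (?t # T). c \<odot>\<^bsub>M\<^esub> s \<ominus>\<^bsub>M\<^esub> v \<in> ?G" if c: "c \<in> adjoin R J x" for c
    proof -
      obtain j d where c: "c = j \<oplus> d \<otimes> x" "j \<in> J" "d \<in> carrier R" using c unfolding adjoin_def by blast
      obtain v where v: "v \<in> ?sp T" "j \<odot>\<^bsub>M\<^esub> s \<ominus>\<^bsub>M\<^esub> v \<in> ?G" using T(2) c by blast
      have jc: "j \<in> carrier R" using c idealD(1)[OF adjoin(1)] by auto
      have vc: "v \<in> carrier M"
        using v M.submodD(1)[OF M.submod_gspan[OF oneideal M.submod_zero]] T(1) W(1) by blast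
      have "c \<odot>\<^bsub>M\<^esub> s \<ominus>\<^bsub>M\<^esub> (d \<odot>\<^bsub>M\<^esub> ?t \<oplus>\<^bsub>M\<^esub> v)
          = (j \<odot>\<^bsub>M\<^esub> s \<oplus>\<^bsub>M\<^esub> d \<odot>\<^bsub>M\<^esub> (x \<odot>\<^bsub>M\<^esub> s)) \<ominus>\<^bsub>M\<^esub> (d \<odot>\<^bsub>M\<^esub> (x \<odot>\<^bsub>M\<^esub> s \<oplus>\<^bsub>M\<^esub> u) \<oplus>\<^bsub>M\<^esub> v)"
        using c jc adjoin(2) s by (simp add: M.smult_l_distr M.smult_assoc1)
      also have "\<dots> = (j \<odot>\<^bsub>M\<^esub> s \<ominus>\<^bsub>M\<^esub> v) \<ominus>\<^bsub>M\<^esub> d \<odot>\<^bsub>M\<^esub> u"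
        using c(3) jc vc adjoin(2) s u(3) by algebra
      also have "\<dots> \<in> ?G" using v u c G(4,6) by blast
      finally show ?thesis using v(1) c(3) by auto
    qed
    then show ?case using T(1) u(2) by (intro exI[of _ "?t # T"]) auto
  qed
  then obtain T where T: "set T \<subseteq> W" "\<And>c. c \<in> I \<Longrightarrow> \<exists>v\<in>?sp T. c \<odot>\<^bsub>M\<^esub> s \<ominus>\<^bsub>M\<^esub> v \<in> ?G" using I by blast
  have smW': "submodule (W \<inter> ?G) R M" by (rule M.submod_intro) (use W G in auto)
  obtain T' where T': "set T' \<subseteq> W \<inter> ?G" "\<And>w. w \<in> W \<inter> ?G \<Longrightarrow> \<exists>v\<in>?sp T'. w \<ominus>\<^bsub>M\<^esub> v \<in> B"
    using Cons.IH[OF S smW'] by blast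
  have TT: "set (T @ T') \<subseteq> W" using T T' by auto
  then have TTc: "set (T @ T') \<subseteq> carrier M" using W(1) by blast
  have smTT: "submodule (?sp (T @ T')) R M" by (rule M.submod_gspan[OF oneideal M.submod_zero TTc])
  note TTsp = M.submodD[OF smTT]
  have sub: "?sp T \<subseteq> ?sp (T @ T')" "?sp T' \<subseteq> ?sp (T @ T')"
    using M.gspan_gens[OF M.submod_zero TTc] TTsp(2) by (intro M.gspan_minimal[OF smTT]; simp)+
  have spW: "?sp T \<subseteq> W" using T W by (intro M.gspan_minimal[OF Cons.prems(2)]) auto
  have "\<exists>v\<in>?sp (T @ T'). w \<ominus>\<^bsub>M\<^esub> v \<in> B" if w: "w \<in> W" for w
  proof -
    obtain c u where c: "w = c \<odot>\<^bsub>M\<^esub> s \<oplus>\<^bsub>M\<^esub> u" "c \<in> carrier R" "u \<in> ?G" using w Cons.prems(3) by auto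
    then have "c \<in> I" unfolding I_def using w by blast
    then obtain v where v: "v \<in> ?sp T" "c \<odot>\<^bsub>M\<^esub> s \<ominus>\<^bsub>M\<^esub> v \<in> ?G" using T(2) by blast
    have vc: "v \<in> carrier M" "u \<in> carrier M" using v spW W(1) c(3) G(1) by auto
    have "w \<ominus>\<^bsub>M\<^esub> v = (c \<odot>\<^bsub>M\<^esub> s \<ominus>\<^bsub>M\<^esub> v) \<oplus>\<^bsub>M\<^esub> u" unfolding c(1) using c(2) vc s by algebra
    then have "w \<ominus>\<^bsub>M\<^esub> v \<in> W \<inter> ?G" using W(6)[OF w, of v] v(1) spW G(3)[OF v(2) c(3)] by (metis IntI subsetD)
    then obtain v' where v': "v' \<in> ?sp T'" "(w \<ominus>\<^bsub>M\<^esub> v) \<ominus>\<^bsub>M\<^esub> v' \<in> B" using T'(2) by blast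
    have "v' \<in> carrier M" "w \<in> carrier M" using v' sub TTsp(1) w W(1) by auto
    then have "w \<ominus>\<^bsub>M\<^esub> (v \<oplus>\<^bsub>M\<^esub> v') = (w \<ominus>\<^bsub>M\<^esub> v) \<ominus>\<^bsub>M\<^esub> v'" using vc by algebra
    moreover have "v \<oplus>\<^bsub>M\<^esub> v' \<in> ?sp (T @ T')" using v v' sub TTsp(3) by blast
    ultimately show ?thesis using v'(2) by (metis (no_types, lifting))
  qed
  then show ?case using TT by blast
qed

section \<open>Cyclic injectivity\<close>

text \<open>
  \<open>R/(I:x)\<close> embeds into \<open>R/I\<close> by multiplication with \<open>x\<close>, with cokernel \<open>R/(I+xR)\<close>; cyclic injectivity
  of the module \<open>V/B\<close> says that homomorphisms into it extend along these embeddings.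
\<close>

definition cyc_inj :: "('r, 'k) ring_scheme \<Rightarrow> ('r, 'm) module \<Rightarrow> 'm set \<Rightarrow> 'm set \<Rightarrow> bool"
  where "cyc_inj R M V B \<longleftrightarrow>
    (\<forall>I x y. ideal I R \<and> x \<in> carrier R \<and> y \<in> V \<and> (\<forall>c\<in>colon R I x. c \<odot>\<^bsub>M\<^esub> y \<in> B) \<longrightarrow>
      (\<exists>z\<in>V. (\<forall>a\<in>I. a \<odot>\<^bsub>M\<^esub> z \<in> B) \<and> x \<odot>\<^bsub>M\<^esub> z \<ominus>\<^bsub>M\<^esub> y \<in> B))"

lemma cyc_injD:
  assumes "cyc_inj R M V B" "ideal I R" "x \<in> carrier R" "y \<in> V" "\<And>c. c \<in> colon R I x \<Longrightarrow> c \<odot>\<^bsub>M\<^esub> y \<in> B"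
  obtains z where "z \<in> V" "\<And>a. a \<in> I \<Longrightarrow> a \<odot>\<^bsub>M\<^esub> z \<in> B" "x \<odot>\<^bsub>M\<^esub> z \<ominus>\<^bsub>M\<^esub> y \<in> B"
  using assms unfolding cyc_inj_def by blast

lemma cyc_injD0:
  assumes "module R M" "V \<subseteq> carrier M" "cyc_inj R M V {\<zero>\<^bsub>M\<^esub>}" "ideal I R" "x \<in> carrier R" "y \<in> V"
    "\<And>c. c \<in> colon R I x \<Longrightarrow> c \<odot>\<^bsub>M\<^esub> y = \<zero>\<^bsub>M\<^esub>"
  obtains z where "z \<in> V" "\<And>a. a \<in> I \<Longrightarrow> a \<odot>\<^bsub>M\<^esub> z = \<zero>\<^bsub>M\<^esub>" "x \<odot>\<^bsub>M\<^esub> z = y"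
proof -
  interpret M: module R M by fact
  obtain z where z: "z \<in> V" "\<And>a. a \<in> I \<Longrightarrow> a \<odot>\<^bsub>M\<^esub> z \<in> {\<zero>\<^bsub>M\<^esub>}" "x \<odot>\<^bsub>M\<^esub> z \<ominus>\<^bsub>M\<^esub> y \<in> {\<zero>\<^bsub>M\<^esub>}"
    using cyc_injD[OF assms(3-6)] assms(7) by blast
  have "x \<odot>\<^bsub>M\<^esub> z = y"
    using z M.eq_of_minus_zero[of "x \<odot>\<^bsub>M\<^esub> z" y] assms(2,5,6) by auto
  then show ?thesis using that z by blast
qed

lemma ring_mod_simps [simp]:
  "carrier (ring_mod R) = carrier R" "zero (ring_mod R) = zero R" "add (ring_mod R) = add R"
  "smult (ring_mod R) = monoid.mult R"
  by (simp_all add: ring_mod_def)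

lemma (in cring) module_ring_mod: "module R (ring_mod R)"
proof (rule moduleI)
  show "cring R" by (rule is_cring)
  show "abelian_group (ring_mod R)"
  proof (rule abelian_groupI, unfold ring_mod_simps)
    show "\<exists>y\<in>carrier R. y \<oplus> x = \<zero>" if "x \<in> carrier R" for x
      using l_neg[OF that] a_inv_closed[OF that] by blast
  qed (auto intro: a_assoc a_comm)
qed (auto intro: l_distr r_distr m_assoc)

context cring
begin

text \<open>The homomorphism \<open>i \<oplus> c \<otimes> x \<mapsto> c y\<close> on the ideal
  \<open>I + xR\<close> is well defined because \<open>(I : x)\<close> kills \<open>y\<close>. After
  extension to \<open>R\<close>, its value at \<open>\<one>\<close> is the required
  \<open>z\<close>.\<close>

lemma injective_imp_cyc_inj:
  assumes "injective_mod R E"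
  shows "cyc_inj R E (carrier E) {\<zero>\<^bsub>E\<^esub>}"
  unfolding cyc_inj_def
proof (intro allI impI, elim conjE)
  fix I x y
  assume I: "ideal I R" and x: "x \<in> carrier R" and y: "y \<in> carrier E"
    and ann: "\<forall>c\<in>colon R I x. c \<odot>\<^bsub>E\<^esub> y \<in> {\<zero>\<^bsub>E\<^esub>}"
  have E: "module R E" using assms by (simp add: injective_mod_def)
  interpret E: module R E by fact
  let ?A = "sub_mod (ring_mod R) (adjoin R I x)"
  note J = idealD[OF ideal_adjoin(1)[OF I x]] and I' = idealD[OF I]
  define f where "f u = (SOME v. \<exists>i c. i \<in> I \<and> c \<in> carrier R \<and> u = i \<oplus> c \<otimes> x \<and> v = c \<odot>\<^bsub>E\<^esub> y)" for u
  have f: "f (i \<oplus> c \<otimes> x) = c \<odot>\<^bsub>E\<^esub> y" if ic: "i \<in> I" "c \<in> carrier R" for i c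
  proof -
    have "\<exists>v i' c'. i' \<in> I \<and> c' \<in> carrier R \<and> i \<oplus> c \<otimes> x = i' \<oplus> c' \<otimes> x \<and> v = c' \<odot>\<^bsub>E\<^esub> y" using ic by blast
    from someI_ex[OF this, folded f_def] obtain i' c' where
      *: "i' \<in> I" "c' \<in> carrier R" "i \<oplus> c \<otimes> x = i' \<oplus> c' \<otimes> x" "f (i \<oplus> c \<otimes> x) = c' \<odot>\<^bsub>E\<^esub> y" by blast
    have ii: "i \<in> carrier R" "i' \<in> carrier R" using ic * I'(1) by auto
    have "(c \<ominus> c') \<otimes> x = (i \<oplus> c \<otimes> x) \<ominus> i \<ominus> c' \<otimes> x" using ii ic *(2) x by algebra
    also have "\<dots> = (i' \<oplus> c' \<otimes> x) \<ominus> i \<ominus> c' \<otimes> x" using * by simp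
    also have "\<dots> = i' \<ominus> i" using ii ic *(2) x by algebra
    finally have "c \<ominus> c' \<in> colon R I x" using ic * I'(7) by (simp add: colon_def)
    then have "(c \<ominus> c') \<odot>\<^bsub>E\<^esub> y = \<zero>\<^bsub>E\<^esub>" using ann by blast
    then have "c \<odot>\<^bsub>E\<^esub> y \<ominus>\<^bsub>E\<^esub> c' \<odot>\<^bsub>E\<^esub> y = \<zero>\<^bsub>E\<^esub>"
      using ic * y by (simp add: minus_eq E.M.minus_eq E.smult_l_distr E.smult_l_minus)
    then have "c \<odot>\<^bsub>E\<^esub> y = c' \<odot>\<^bsub>E\<^esub> y" using E.eq_of_minus_zero ic(2) *(2) y by blast
    then show ?thesis using *(4) by simp
  qed
  have "module R ?A"
  proof (rule module_sub_mod[OF module_ring_mod])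
    show "submodule (adjoin R I x) R (ring_mod R)"
      by (rule module.submod_intro[OF module_ring_mod]) (use J in auto)
  qed
  moreover have "(\<lambda>u. u) \<in> mod_hom R ?A (ring_mod R)" using J(1) by (auto simp: mod_hom_def)
  moreover have "f \<in> mod_hom R ?A E"
  proof (rule mod_homI)
    fix u assume "u \<in> carrier ?A"
    then obtain i c where u: "u = i \<oplus> c \<otimes> x" "i \<in> I" "c \<in> carrier R" unfolding adjoin_def by auto
    have ii: "i \<in> carrier R" using u I'(1) by auto
    show "f u \<in> carrier E" using u f y by simp
    {
      fix r assume r: "r \<in> carrier R"
      have "r \<otimes> u = r \<otimes> i \<oplus> (r \<otimes> c) \<otimes> x" using u ii r x by algebra
      then show "f (r \<odot>\<^bsub>?A\<^esub> u) = r \<odot>\<^bsub>E\<^esub> f u"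
        using f[OF I'(4)[OF u(2) r], of "r \<otimes> c"] u r f y by (simp add: E.smult_assoc1)
    next
      fix v assume "v \<in> carrier ?A"
      then obtain j d where v: "v = j \<oplus> d \<otimes> x" "j \<in> I" "d \<in> carrier R" unfolding adjoin_def by auto
      have jj: "j \<in> carrier R" using v I'(1) by auto
      have "u \<oplus> v = (i \<oplus> j) \<oplus> (c \<oplus> d) \<otimes> x" using u v ii jj x by algebra
      then show "f (u \<oplus>\<^bsub>?A\<^esub> v) = f u \<oplus>\<^bsub>E\<^esub> f v"
        using f[OF I'(3)[OF u(2) v(2)], of "c \<oplus> d"] u v f y by (simp add: E.smult_l_distr)
    }
  qed
  ultimately obtain h where h: "h \<in> mod_hom R (ring_mod R) E" "\<And>u. u \<in> adjoin R I x \<Longrightarrow> h u = f u"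
    using assms module_ring_mod unfolding injective_mod_def
    by (metis inj_on_id2 sub_mod_simps(1))
  note h' = mod_homD[OF h(1)]
  show "\<exists>z\<in>carrier E. (\<forall>a\<in>I. a \<odot>\<^bsub>E\<^esub> z \<in> {\<zero>\<^bsub>E\<^esub>}) \<and> x \<odot>\<^bsub>E\<^esub> z \<ominus>\<^bsub>E\<^esub> y \<in> {\<zero>\<^bsub>E\<^esub>}"
  proof (intro bexI conjI ballI)
    have one: "\<one> \<in> carrier (ring_mod R)" by simp
    show "h \<one> \<in> carrier E" using h'(1)[OF one] .
    have eq: "a \<odot>\<^bsub>E\<^esub> h \<one> = f a" if "a \<in> adjoin R I x" for a
      using h'(3)[OF _ one, of a] h(2)[OF that] that J(1) by (simp add: subset_iff)
    show "a \<odot>\<^bsub>E\<^esub> h \<one> \<in> {\<zero>\<^bsub>E\<^esub>}" if "a \<in> I" for a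
    proof -
      have "a = a \<oplus> \<zero> \<otimes> x" using that I'(1) x by auto
      then have "f a = \<zero> \<odot>\<^bsub>E\<^esub> y" using f[OF that, of \<zero>] by simp
      then show ?thesis using eq[of a] ideal_adjoin(2)[OF I x] that y by auto
    qed
    have "f x = \<one> \<odot>\<^bsub>E\<^esub> y" using f[OF I'(2), of \<one>] x by simp
    then show "x \<odot>\<^bsub>E\<^esub> h \<one> \<ominus>\<^bsub>E\<^esub> y \<in> {\<zero>\<^bsub>E\<^esub>}"
      using eq[of x] ideal_adjoin(3)[OF I x] y E.minus_self by simp
  qed
qed

text \<open>In effect \<open>Ext^1(R/J, Z) = 0\<close>, so an element of \<open>G/Z\<close> killed
  by \<open>J\<close> lifts to an element of \<open>G\<close> killed by \<open>J\<close>. For each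
  new generator \<open>x\<close> the defect \<open>x (u - w)\<close> lies in \<open>Z\<close> and is
  killed by \<open>(J : x)\<close>, so it is \<open>x v\<close> for some \<open>v \<in> Z\<close>
  killed by the old ideal.\<close>

lemma cyc_inj_lift:
  assumes "noetherian_ring R" "module R G" "submodule Z R G" "cyc_inj R G Z {\<zero>\<^bsub>G\<^esub>}"
    and "ideal J R" "u \<in> carrier G" "\<And>a. a \<in> J \<Longrightarrow> a \<odot>\<^bsub>G\<^esub> u \<in> Z"
  shows "\<exists>w\<in>Z. \<forall>a\<in>J. a \<odot>\<^bsub>G\<^esub> (u \<ominus>\<^bsub>G\<^esub> w) = \<zero>\<^bsub>G\<^esub>"
  using assms(1,5,7)
proof (induction J rule: ideal_fg_induct)
  case zero
  interpret G: module R G by fact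
  show ?case using G.submodD(2)[OF assms(3)] assms(6) by (intro bexI[of _ "\<zero>\<^bsub>G\<^esub>"]) auto
next
  case (adjoin J x)
  interpret G: module R G by fact
  note Z = G.submodD[OF assms(3)] and J = idealD[OF adjoin(1)]
  have xJ: "x \<in> adjoin R J x" "J \<subseteq> adjoin R J x" using ideal_adjoin adjoin by auto
  then obtain w where w: "w \<in> Z" "\<And>a. a \<in> J \<Longrightarrow> a \<odot>\<^bsub>G\<^esub> (u \<ominus>\<^bsub>G\<^esub> w) = \<zero>\<^bsub>G\<^esub>" using adjoin by blast
  have wc: "w \<in> carrier G" using w Z(1) by auto
  have x: "x \<in> carrier R" by fact
  have "x \<odot>\<^bsub>G\<^esub> (u \<ominus>\<^bsub>G\<^esub> w) \<in> Z"
    using adjoin(4)[OF xJ(1)] w(1) wc x Z(4,6) assms(6) by (simp add: G.smult_minus_distr)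
  moreover have "c \<odot>\<^bsub>G\<^esub> (x \<odot>\<^bsub>G\<^esub> (u \<ominus>\<^bsub>G\<^esub> w)) = \<zero>\<^bsub>G\<^esub>" if "c \<in> colon R J x" for c
    using w(2)[of "c \<otimes> x"] that x wc assms(6) by (simp add: colon_def G.smult_assoc1)
  ultimately obtain v where v: "v \<in> Z" "\<And>a. a \<in> J \<Longrightarrow> a \<odot>\<^bsub>G\<^esub> v = \<zero>\<^bsub>G\<^esub>" "x \<odot>\<^bsub>G\<^esub> v = x \<odot>\<^bsub>G\<^esub> (u \<ominus>\<^bsub>G\<^esub> w)"
    using cyc_injD0[OF assms(2) Z(1) assms(4) adjoin(1) x] by metis
  have vc: "v \<in> carrier G" using v Z(1) by auto
  have "a \<odot>\<^bsub>G\<^esub> (u \<ominus>\<^bsub>G\<^esub> (w \<oplus>\<^bsub>G\<^esub> v)) = \<zero>\<^bsub>G\<^esub>" if "a \<in> adjoin R J x" for a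
  proof -
    obtain j c where a: "a = j \<oplus> c \<otimes> x" "j \<in> J" "c \<in> carrier R" using \<open>a \<in> adjoin R J x\<close> unfolding adjoin_def by blast
    have jc: "j \<in> carrier R" using a J(1) by auto
    let ?d = "(u \<ominus>\<^bsub>G\<^esub> w) \<ominus>\<^bsub>G\<^esub> v"
    have dc: "?d \<in> carrier G" using wc vc assms(6) by simp
    have "u \<ominus>\<^bsub>G\<^esub> (w \<oplus>\<^bsub>G\<^esub> v) = ?d" using wc vc assms(6) by algebra
    moreover have "j \<odot>\<^bsub>G\<^esub> ?d = \<zero>\<^bsub>G\<^esub>"
      using w(2)[OF a(2)] v(2)[OF a(2)] jc wc vc assms(6) by (simp add: G.smult_minus_distr G.minus_self)
    moreover have "x \<odot>\<^bsub>G\<^esub> ?d = \<zero>\<^bsub>G\<^esub>"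
      using v(3) x wc vc assms(6) by (simp add: G.smult_minus_distr G.minus_self)
    ultimately show ?thesis using a(1,3) jc x dc by (simp add: G.smult_l_distr G.smult_assoc1)
  qed
  then show ?case using Z(3)[OF w(1) v(1)] by blast
qed

text \<open>\<open>cyc_inj_lift\<close> replaces \<open>y\<close> by a representative that
  \<open>(I : x)\<close> kills exactly; cyclic injectivity of \<open>V\<close> applies to
  it.\<close>

lemma cyc_inj_quotient:
  assumes "noetherian_ring R" "module R G" "submodule V R G" "submodule Z R G" "Z \<subseteq> V"
    and "cyc_inj R G V {\<zero>\<^bsub>G\<^esub>}" "cyc_inj R G Z {\<zero>\<^bsub>G\<^esub>}"
  shows "cyc_inj R G V Z"
  unfolding cyc_inj_def
proof (intro allI impI, elim conjE)
  fix I x y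
  assume I: "ideal I R" and x: "x \<in> carrier R" and y: "y \<in> V" and ann: "\<forall>c\<in>colon R I x. c \<odot>\<^bsub>G\<^esub> y \<in> Z"
  interpret G: module R G by fact
  note V = G.submodD[OF assms(3)] and Z = G.submodD[OF assms(4)]
  have yc: "y \<in> carrier G" using y V by auto
  obtain w where w: "w \<in> Z" "\<forall>a\<in>colon R I x. a \<odot>\<^bsub>G\<^esub> (y \<ominus>\<^bsub>G\<^esub> w) = \<zero>\<^bsub>G\<^esub>"
    using cyc_inj_lift[OF assms(1,2,4,7) ideal_colon(1)[OF I x] yc] ann by blast
  have wc: "w \<in> carrier G" using w Z by auto
  have "y \<ominus>\<^bsub>G\<^esub> w \<in> V" using y w V(6) assms(5) by blast
  then obtain z where z: "z \<in> V" "\<And>a. a \<in> I \<Longrightarrow> a \<odot>\<^bsub>G\<^esub> z = \<zero>\<^bsub>G\<^esub>" "x \<odot>\<^bsub>G\<^esub> z = y \<ominus>\<^bsub>G\<^esub> w"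
    using cyc_injD0[OF assms(2) V(1) assms(6) I x] w by metis
  have "x \<odot>\<^bsub>G\<^esub> z \<ominus>\<^bsub>G\<^esub> y = \<ominus>\<^bsub>G\<^esub> w" unfolding z(3) using yc wc by algebra
  then show "\<exists>z\<in>V. (\<forall>a\<in>I. a \<odot>\<^bsub>G\<^esub> z \<in> Z) \<and> x \<odot>\<^bsub>G\<^esub> z \<ominus>\<^bsub>G\<^esub> y \<in> Z"
    using z(1,2) Z(2,5) w(1) by (intro bexI[of _ z]) auto
qed

text \<open>A solution modulo \<open>B\<close> is corrected twice by elements of \<open>B\<close>:
  \<open>w\<close> makes it killed by \<open>I\<close>, and \<open>v\<close> removes the error
  \<open>?e\<close> that is left in the equation \<open>x z = y\<close>.\<close>

lemma cyc_inj_extension: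
  assumes "noetherian_ring R" "module R G" "submodule V R G" "submodule B R G" "B \<subseteq> V"
    and "cyc_inj R G B {\<zero>\<^bsub>G\<^esub>}" "cyc_inj R G V B"
  shows "cyc_inj R G V {\<zero>\<^bsub>G\<^esub>}"
  unfolding cyc_inj_def
proof (intro allI impI, elim conjE)
  fix I x y
  assume I: "ideal I R" and x: "x \<in> carrier R" and y: "y \<in> V" and ann: "\<forall>c\<in>colon R I x. c \<odot>\<^bsub>G\<^esub> y \<in> {\<zero>\<^bsub>G\<^esub>}"
  interpret G: module R G by fact
  note V = G.submodD[OF assms(3)] and B = G.submodD[OF assms(4)] and I' = idealD[OF I]
  have yc: "y \<in> carrier G" using y V by auto
  obtain z where z: "z \<in> V" "\<And>a. a \<in> I \<Longrightarrow> a \<odot>\<^bsub>G\<^esub> z \<in> B" "x \<odot>\<^bsub>G\<^esub> z \<ominus>\<^bsub>G\<^esub> y \<in> B"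
    using cyc_injD[OF assms(7) I x y] ann B(2) by (metis singletonD)
  have zc: "z \<in> carrier G" using z V by auto
  obtain w where w: "w \<in> B" "\<And>a. a \<in> I \<Longrightarrow> a \<odot>\<^bsub>G\<^esub> (z \<ominus>\<^bsub>G\<^esub> w) = \<zero>\<^bsub>G\<^esub>"
    using cyc_inj_lift[OF assms(1,2,4,6) I zc] z(2) by blast
  have wc: "w \<in> carrier G" using w B by auto
  let ?e = "y \<ominus>\<^bsub>G\<^esub> x \<odot>\<^bsub>G\<^esub> (z \<ominus>\<^bsub>G\<^esub> w)"
  have "?e = x \<odot>\<^bsub>G\<^esub> w \<ominus>\<^bsub>G\<^esub> (x \<odot>\<^bsub>G\<^esub> z \<ominus>\<^bsub>G\<^esub> y)" using x yc zc wc by algebra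
  then have eB: "?e \<in> B" using z(3) w(1) x B(4,6) by simp
  have "c \<odot>\<^bsub>G\<^esub> ?e = \<zero>\<^bsub>G\<^esub>" if c: "c \<in> colon R I x" for c
  proof -
    have "c \<in> carrier R" "c \<otimes> x \<in> I" using c by (auto simp: colon_def)
    then have "c \<odot>\<^bsub>G\<^esub> (x \<odot>\<^bsub>G\<^esub> (z \<ominus>\<^bsub>G\<^esub> w)) = \<zero>\<^bsub>G\<^esub>" using w(2)[of "c \<otimes> x"] x zc wc by (simp add: G.smult_assoc1)
    then show ?thesis using ann c \<open>c \<in> carrier R\<close> yc x zc wc by (simp add: G.smult_minus_distr G.minus_self)
  qed
  then obtain v where v: "v \<in> B" "\<And>a. a \<in> I \<Longrightarrow> a \<odot>\<^bsub>G\<^esub> v = \<zero>\<^bsub>G\<^esub>" "x \<odot>\<^bsub>G\<^esub> v = ?e"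
    using cyc_injD0[OF assms(2) B(1) assms(6) I x eB] by metis
  have vc: "v \<in> carrier G" using v B by auto
  show "\<exists>z\<in>V. (\<forall>a\<in>I. a \<odot>\<^bsub>G\<^esub> z \<in> {\<zero>\<^bsub>G\<^esub>}) \<and> x \<odot>\<^bsub>G\<^esub> z \<ominus>\<^bsub>G\<^esub> y \<in> {\<zero>\<^bsub>G\<^esub>}"
  proof (intro bexI[of _ "(z \<ominus>\<^bsub>G\<^esub> w) \<oplus>\<^bsub>G\<^esub> v"] conjI ballI)
    show "(z \<ominus>\<^bsub>G\<^esub> w) \<oplus>\<^bsub>G\<^esub> v \<in> V" using z(1) w(1) v(1) V(3,6) assms(5) by blast
    show "a \<odot>\<^bsub>G\<^esub> ((z \<ominus>\<^bsub>G\<^esub> w) \<oplus>\<^bsub>G\<^esub> v) \<in> {\<zero>\<^bsub>G\<^esub>}" if a: "a \<in> I" for a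
    proof -
      have "a \<in> carrier R" using a I'(1) by blast
      then show ?thesis using w(2)[OF a] v(2)[OF a] zc wc vc by (simp add: G.smult_r_distr)
    qed
    have "x \<odot>\<^bsub>G\<^esub> ((z \<ominus>\<^bsub>G\<^esub> w) \<oplus>\<^bsub>G\<^esub> v) = x \<odot>\<^bsub>G\<^esub> (z \<ominus>\<^bsub>G\<^esub> w) \<oplus>\<^bsub>G\<^esub> ?e"
      using v(3) x zc wc vc by (simp add: G.smult_r_distr)
    also have "\<dots> = y" using x zc wc yc by algebra
    finally show "x \<odot>\<^bsub>G\<^esub> ((z \<ominus>\<^bsub>G\<^esub> w) \<oplus>\<^bsub>G\<^esub> v) \<ominus>\<^bsub>G\<^esub> y \<in> {\<zero>\<^bsub>G\<^esub>}" using yc by (simp add: G.minus_self)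
  qed
qed

lemma cyc_inj_image:
  assumes "module R G" "module R H" "d \<in> mod_hom R G H" "submodule V R G"
    and "cyc_inj R G V {v \<in> V. d v = \<zero>\<^bsub>H\<^esub>}"
  shows "cyc_inj R H (d ` V) {\<zero>\<^bsub>H\<^esub>}"
  unfolding cyc_inj_def
proof (intro allI impI, elim conjE)
  fix I x y'
  assume I: "ideal I R" and x: "x \<in> carrier R" and "y' \<in> d ` V"
    and ann: "\<forall>c\<in>colon R I x. c \<odot>\<^bsub>H\<^esub> y' \<in> {\<zero>\<^bsub>H\<^esub>}"
  interpret G: module R G by fact
  interpret H: module R H by fact
  note d = mod_homD[OF assms(3)] mod_hom_more[OF assms(1-3)] and V = G.submodD[OF assms(4)]
  obtain y where y: "y \<in> V" "y' = d y" using \<open>y' \<in> d ` V\<close> by blast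
  have "c \<odot>\<^bsub>G\<^esub> y \<in> {v \<in> V. d v = \<zero>\<^bsub>H\<^esub>}" if c: "c \<in> colon R I x" for c
  proof -
    have "c \<in> carrier R" using c by (simp add: colon_def)
    then show ?thesis using ann c y V(1,4) d(3) by auto
  qed
  then obtain z where z: "z \<in> V" "\<And>a. a \<in> I \<Longrightarrow> a \<odot>\<^bsub>G\<^esub> z \<in> {v \<in> V. d v = \<zero>\<^bsub>H\<^esub>}"
    "x \<odot>\<^bsub>G\<^esub> z \<ominus>\<^bsub>G\<^esub> y \<in> {v \<in> V. d v = \<zero>\<^bsub>H\<^esub>}"
    using cyc_injD[OF assms(5) I x y(1)] by blast
  have zc: "z \<in> carrier G" "y \<in> carrier G" using z y V by auto
  show "\<exists>z\<in>d ` V. (\<forall>a\<in>I. a \<odot>\<^bsub>H\<^esub> z \<in> {\<zero>\<^bsub>H\<^esub>}) \<and> x \<odot>\<^bsub>H\<^esub> z \<ominus>\<^bsub>H\<^esub> y' \<in> {\<zero>\<^bsub>H\<^esub>}"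
  proof (intro bexI[of _ "d z"] conjI ballI)
    show "a \<odot>\<^bsub>H\<^esub> d z \<in> {\<zero>\<^bsub>H\<^esub>}" if a: "a \<in> I" for a
      using z(2)[OF a] d(3)[of a z] zc idealD(1)[OF I] a by auto
    show "x \<odot>\<^bsub>H\<^esub> d z \<ominus>\<^bsub>H\<^esub> y' \<in> {\<zero>\<^bsub>H\<^esub>}"
      using z(3) d(3,6) zc x y by simp
  qed (use z in auto)
qed

end

section \<open>Torsion\<close>

context noetherian_local_ring
begin

interpretation ideals: comm_monoid "ideals_set R"
  by (rule ideals_set_is_comm_monoid)

abbreviation mpow :: "nat \<Rightarrow> 'a set"
  where "mpow k \<equiv> max_ideal R [^]\<^bsub>ideals_set R\<^esub> k"

lemma mpow_Suc: "mpow (Suc k) = mpow k \<cdot> max_ideal R"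
  by (simp add: ideals_set_def)

lemma mpow_add: "mpow (k + l) = mpow k \<cdot> mpow l"
  using ideals.nat_pow_mult[of "max_ideal R" k l] ideal_max_ideal by (simp add: ideals_set_def)

lemma pow_in_mpow: "u \<in> max_ideal R \<Longrightarrow> u [^] k \<in> mpow k"
proof (induction k)
  case 0
  then show ?case by (simp add: ideals_set_def)
next
  case (Suc k)
  then show ?case unfolding mpow_Suc by (simp add: ideal_prod.prod)
qed

lemma ideal_prod_subset:
  assumes "ideal L R" "\<And>i j. i \<in> I \<Longrightarrow> j \<in> J \<Longrightarrow> i \<otimes> j \<in> L"
  shows "I \<cdot> J \<subseteq> L"
proof
  fix s assume "s \<in> I \<cdot> J"
  then show "s \<in> L" by induction (use assms idealD(3) in auto)
qed

text \<open>In a maximal counterexample \<open>L\<close>, the last power \<open>v\<close> of some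
  \<open>u\<close> outside \<open>L\<close> has its square in \<open>L\<close>. So the square of
  \<open>K = L + vR\<close> lies in \<open>L\<close>, and a power of the maximal ideal inside the
  larger ideal \<open>K\<close> yields one inside \<open>L\<close>.\<close>

lemma mpow_subset_if_nil:
  assumes "ideal L R" "\<And>u. u \<in> max_ideal R \<Longrightarrow> \<exists>k::nat. u [^] k \<in> L"
  shows "\<exists>k. mpow k \<subseteq> L"
proof (rule ccontr)
  assume contra: "\<not> ?thesis"
  note m = idealD[OF ideal_max_ideal]
  let ?C = "{L. ideal L R \<and> (\<forall>u\<in>max_ideal R. \<exists>k::nat. u [^] k \<in> L) \<and> (\<nexists>k. mpow k \<subseteq> L)}"
  have "L \<in> ?C" using assms contra by blast
  then obtain L where L: "L \<in> ?C" and Lmax: "\<forall>K\<in>?C. L \<subseteq> K \<longrightarrow> K = L"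
    using maximal_ideal_exists[of ?C] by blast
  then have Li: "ideal L R" and Lnil: "\<And>u. u \<in> max_ideal R \<Longrightarrow> \<exists>k::nat. u [^] k \<in> L"
    and Lno: "\<And>k. \<not> mpow k \<subseteq> L" by blast+
  note L' = idealD[OF Li]
  have "mpow 1 \<subseteq> max_ideal R"
    using m(4) by (simp add: mpow_Suc ideals_set_def ideal_prod_subset[OF ideal_max_ideal])
  then obtain u where u: "u \<in> max_ideal R" "u \<notin> L" using Lno[of 1] by blast
  have uc: "u \<in> carrier R" using u m(1) by auto
  define k where "k = (LEAST k. u [^] (k::nat) \<in> L)"
  have k: "u [^] k \<in> L" unfolding k_def using Lnil[OF u(1)] by (rule LeastI_ex)
  have "\<one> \<notin> L" using u(2) uc L'(4)[of \<one> u] by auto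
  \<comment> \<open>So \<open>k \<ge> 2\<close>, which makes \<open>2(k - 1) \<ge> k\<close>; this
    puts the square of \<open>?v\<close> into \<open>L\<close>.\<close>
  then have k0: "k \<noteq> 0" "k \<noteq> 1" using k u uc by (auto intro: ccontr)
  have v: "u [^] (k - 1) \<notin> L" using not_less_Least[of "k - 1" "\<lambda>k. u [^] k \<in> L"] k0 by (simp add: k_def)
  let ?v = "u [^] (k - 1)"
  have vc: "?v \<in> carrier R" using uc by simp
  have "?v \<otimes> ?v = u [^] (k + (k - 2))"
  proof -
    have "(k - 1) + (k - 1) = k + (k - 2)" using k0 by simp
    then show ?thesis using uc by (simp add: nat_pow_mult)
  qed
  also have "\<dots> = u [^] (k - 2) \<otimes> u [^] k" using uc by (simp add: nat_pow_mult add.commute)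
  finally have vv: "?v \<otimes> ?v \<in> L" using L'(4)[OF k] uc by simp
  let ?K = "adjoin R L ?v"
  have K: "ideal ?K R" "L \<subseteq> ?K" "?v \<in> ?K" using ideal_adjoin[OF Li vc] by auto
  then have "?K \<noteq> L" using v by auto
  then have "?K \<notin> ?C" using Lmax K(2) by blast
  then obtain n where n: "mpow n \<subseteq> ?K" using K(1,2) Lnil by blast
  have "i \<otimes> j \<in> L" if ij: "i \<in> ?K" "j \<in> ?K" for i j
  proof -
    obtain a c b d where *: "i = a \<oplus> c \<otimes> ?v" "a \<in> L" "c \<in> carrier R" "j = b \<oplus> d \<otimes> ?v" "b \<in> L" "d \<in> carrier R"
      using ij unfolding adjoin_def by blast
    have ab: "a \<in> carrier R" "b \<in> carrier R" using * L'(1) by auto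
    have "i \<otimes> j = (b \<oplus> d \<otimes> ?v) \<otimes> a \<oplus> (c \<otimes> ?v) \<otimes> b \<oplus> (c \<otimes> d) \<otimes> (?v \<otimes> ?v)"
      unfolding *(1,4) using ab *(3,6) vc by algebra
    then show ?thesis using *(2,3,5,6) ab vc vv L'(3,4) by simp
  qed
  then have "mpow (n + n) \<subseteq> L" unfolding mpow_add using n by (intro ideal_prod_subset[OF Li]) blast
  then show False using Lno by blast
qed

abbreviation tors :: "('a, 'm) module \<Rightarrow> 'm set"
  where "tors \<equiv> torsion_part (max_ideal R) R"

lemma ideal_annihilator:
  assumes "module R M" "x \<in> carrier M"
  shows "ideal {c \<in> carrier R. c \<odot>\<^bsub>M\<^esub> x = \<zero>\<^bsub>M\<^esub>} R"
proof -
  interpret M: module R M by fact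
  show ?thesis by (rule ideal_intro) (use assms(2) in \<open>auto simp: M.smult_l_distr M.smult_assoc1\<close>)
qed

text \<open>Only powers of single elements have to be controlled; the uniform exponent comes from
  \<open>mpow_subset_if_nil\<close>, applied to the annihilator of \<open>x\<close>.\<close>

lemma torsion_iff:
  assumes "module R M"
  shows "x \<in> tors M \<longleftrightarrow> x \<in> carrier M \<and> (\<forall>u\<in>max_ideal R. \<exists>k::nat. u [^] k \<odot>\<^bsub>M\<^esub> x = \<zero>\<^bsub>M\<^esub>)"
proof
  assume "x \<in> tors M"
  then show "x \<in> carrier M \<and> (\<forall>u\<in>max_ideal R. \<exists>k::nat. u [^] k \<odot>\<^bsub>M\<^esub> x = \<zero>\<^bsub>M\<^esub>)"
    using pow_in_mpow unfolding torsion_part_def by blast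
next
  assume *: "x \<in> carrier M \<and> (\<forall>u\<in>max_ideal R. \<exists>k::nat. u [^] k \<odot>\<^bsub>M\<^esub> x = \<zero>\<^bsub>M\<^esub>)"
  let ?L = "{c \<in> carrier R. c \<odot>\<^bsub>M\<^esub> x = \<zero>\<^bsub>M\<^esub>}"
  have "\<exists>k::nat. u [^] k \<in> ?L" if "u \<in> max_ideal R" for u
    using * that idealD(1)[OF ideal_max_ideal] by auto
  from mpow_subset_if_nil[OF ideal_annihilator[OF assms conjunct1[OF *]] this]
  obtain k where "mpow k \<subseteq> ?L" ..
  then show "x \<in> tors M" using * unfolding torsion_part_def by blast
qed

lemma submodule_torsion:
  assumes "module R M"
  shows "submodule (tors M) R M"
proof -
  interpret M: module R M by fact
  note m = idealD[OF ideal_max_ideal]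
  show ?thesis
  proof (rule M.submod_intro)
    show "tors M \<subseteq> carrier M" by (auto simp: torsion_part_def)
    show "\<zero>\<^bsub>M\<^esub> \<in> tors M" using m(1) by (auto simp: torsion_iff[OF assms] intro!: exI[of _ "0::nat"])
    fix a assume a: "a \<in> tors M"
    then have ac: "a \<in> carrier M" by (simp add: torsion_part_def)
    show "c \<odot>\<^bsub>M\<^esub> a \<in> tors M" if c: "c \<in> carrier R" for c
      unfolding torsion_iff[OF assms]
    proof (intro conjI ballI)
      fix u assume u: "u \<in> max_ideal R"
      then obtain k :: nat where "u [^] k \<odot>\<^bsub>M\<^esub> a = \<zero>\<^bsub>M\<^esub>" using a torsion_iff[OF assms] by blast
      moreover have "u \<in> carrier R" using u m(1) by blast
      ultimately show "\<exists>k::nat. u [^] k \<odot>\<^bsub>M\<^esub> (c \<odot>\<^bsub>M\<^esub> a) = \<zero>\<^bsub>M\<^esub>"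
        using c ac by (intro exI[of _ k]) (simp add: M.smult_comm[of _ c])
    qed (use ac c in simp)
    fix b assume b: "b \<in> tors M"
    then have bc: "b \<in> carrier M" by (simp add: torsion_part_def)
    show "a \<oplus>\<^bsub>M\<^esub> b \<in> tors M"
      unfolding torsion_iff[OF assms]
    proof (intro conjI ballI)
      fix u assume u: "u \<in> max_ideal R"
      then obtain k l :: nat where kl: "u [^] k \<odot>\<^bsub>M\<^esub> a = \<zero>\<^bsub>M\<^esub>" "u [^] l \<odot>\<^bsub>M\<^esub> b = \<zero>\<^bsub>M\<^esub>"
        using a b torsion_iff[OF assms] by blast
      have uc: "u \<in> carrier R" using u m(1) by blast
      have "u [^] (k + l) \<odot>\<^bsub>M\<^esub> a = u [^] l \<odot>\<^bsub>M\<^esub> (u [^] k \<odot>\<^bsub>M\<^esub> a)"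
        using uc ac by (simp add: M.smult_assoc1[symmetric] nat_pow_mult add.commute)
      moreover have "u [^] (k + l) \<odot>\<^bsub>M\<^esub> b = u [^] k \<odot>\<^bsub>M\<^esub> (u [^] l \<odot>\<^bsub>M\<^esub> b)"
        using uc bc by (simp add: M.smult_assoc1[symmetric] nat_pow_mult)
      ultimately show "\<exists>k::nat. u [^] k \<odot>\<^bsub>M\<^esub> (a \<oplus>\<^bsub>M\<^esub> b) = \<zero>\<^bsub>M\<^esub>"
        using kl uc ac bc by (intro exI[of _ "k + l"]) (simp add: M.smult_r_distr)
    qed (use ac bc in simp)
  qed
qed

text \<open>
  This replaces the Artin--Rees lemma. If \<open>Q\<close> annihilates \<open>y\<close>, an ideal \<open>L\<close> that is maximal
  with \<open>I + xQ \<subseteq> L\<close> and \<open>(L : x) \<subseteq> Q\<close> contains a power of every element of the maximal ideal, so that a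
  solution \<open>z\<close> of \<open>xz = y\<close> annihilated by \<open>L\<close> is torsion.
\<close>

lemma cyc_inj_torsion:
  assumes "module R M" "cyc_inj R M (carrier M) {\<zero>\<^bsub>M\<^esub>}"
  shows "cyc_inj R M (tors M) {\<zero>\<^bsub>M\<^esub>}"
  unfolding cyc_inj_def
proof (intro allI impI, elim conjE)
  fix I x y
  assume I: "ideal I R" and x: "x \<in> carrier R" and y: "y \<in> tors M" and ann: "\<forall>c\<in>colon R I x. c \<odot>\<^bsub>M\<^esub> y \<in> {\<zero>\<^bsub>M\<^esub>}"
  interpret M: module R M by fact
  note m = idealD[OF ideal_max_ideal] and I' = idealD[OF I]
  have yc: "y \<in> carrier M" using y by (simp add: torsion_part_def)
  define Q where "Q = {c \<in> carrier R. c \<odot>\<^bsub>M\<^esub> y = \<zero>\<^bsub>M\<^esub>}"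
  have Q: "ideal Q R" unfolding Q_def by (rule ideal_annihilator[OF assms(1) yc])
  note Q' = idealD[OF Q]
  have colQ: "colon R I x \<subseteq> Q" using ann by (auto simp: Q_def colon_def)
  let ?C = "{L. ideal L R \<and> I \<subseteq> L \<and> (\<forall>q\<in>Q. q \<otimes> x \<in> L) \<and> colon R L x \<subseteq> Q}"
  \<comment> \<open>\<open>I + xQ\<close> is the smallest candidate. It satisfies
    \<open>(L : x) \<subseteq> Q\<close>, because \<open>c x = i + q x\<close> puts
    \<open>c - q\<close> into \<open>(I : x)\<close>, which lies in \<open>Q\<close>.\<close>
  let ?L = "{i \<oplus> q \<otimes> x | i q. i \<in> I \<and> q \<in> Q}"
  have "ideal ?L R \<and> I \<subseteq> ?L \<and> (\<forall>q\<in>Q. q \<otimes> x \<in> ?L) \<and> colon R ?L x \<subseteq> Q"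
  proof (intro conjI ballI)
    show "ideal ?L R"
    proof (rule ideal_intro)
      show "?L \<subseteq> carrier R" using I'(1) Q'(1) x by auto
      have "\<zero> = \<zero> \<oplus> \<zero> \<otimes> x" using x by simp
      then show "\<zero> \<in> ?L" using I'(2) Q'(2) by blast
      fix a assume "a \<in> ?L"
      then obtain i q where a: "a = i \<oplus> q \<otimes> x" "i \<in> I" "q \<in> Q" by blast
      have iq: "i \<in> carrier R" "q \<in> carrier R" using a I'(1) Q'(1) by auto
      show "c \<otimes> a \<in> ?L" if c: "c \<in> carrier R" for c
      proof -
        have "c \<otimes> a = c \<otimes> i \<oplus> (c \<otimes> q) \<otimes> x" unfolding a(1) using c iq x by algebra
        then show ?thesis using I'(4)[OF a(2) c] Q'(4)[OF a(3) c] by blast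
      qed
      fix b assume "b \<in> ?L"
      then obtain j p where b: "b = j \<oplus> p \<otimes> x" "j \<in> I" "p \<in> Q" by blast
      have jp: "j \<in> carrier R" "p \<in> carrier R" using b I'(1) Q'(1) by auto
      have "a \<oplus> b = (i \<oplus> j) \<oplus> (q \<oplus> p) \<otimes> x" unfolding a(1) b(1) using iq jp x by algebra
      then show "a \<oplus> b \<in> ?L" using I'(3)[OF a(2) b(2)] Q'(3)[OF a(3) b(3)] by blast
    qed
    show "I \<subseteq> ?L"
    proof
      fix i assume i: "i \<in> I"
      then have "i = i \<oplus> \<zero> \<otimes> x" using I'(1) x by auto
      then show "i \<in> ?L" using i Q'(2) by blast
    qed
    show "q \<otimes> x \<in> ?L" if q: "q \<in> Q" for q
    proof -
      have "q \<otimes> x = \<zero> \<oplus> q \<otimes> x" using q Q'(1) x by auto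
      then show ?thesis using q I'(2) by blast
    qed
    show "colon R ?L x \<subseteq> Q"
    proof
      fix c assume "c \<in> colon R ?L x"
      then obtain i q where c: "c \<in> carrier R" "c \<otimes> x = i \<oplus> q \<otimes> x" "i \<in> I" "q \<in> Q" by (auto simp: colon_def)
      have iq: "i \<in> carrier R" "q \<in> carrier R" using c I'(1) Q'(1) by auto
      have "(c \<ominus> q) \<otimes> x = c \<otimes> x \<ominus> q \<otimes> x" using c(1) iq x by algebra
      also have "\<dots> = i" unfolding c(2) using iq x by algebra
      finally have "c \<ominus> q \<in> Q" using colQ c iq by (auto simp: colon_def)
      then have "(c \<ominus> q) \<oplus> q \<in> Q" using Q'(3) c(4) by blast
      moreover have "(c \<ominus> q) \<oplus> q = c" using c(1) iq by algebra
      ultimately show "c \<in> Q" by simp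
    qed
  qed
  then have "?L \<in> ?C" by (rule CollectI)
  then obtain L where L: "L \<in> ?C" and Lmax: "\<forall>K\<in>?C. L \<subseteq> K \<longrightarrow> K = L"
    using maximal_ideal_exists[of ?C] by blast
  then have Li: "ideal L R" and IL: "I \<subseteq> L" and QL: "\<And>q. q \<in> Q \<Longrightarrow> q \<otimes> x \<in> L" and LQ: "colon R L x \<subseteq> Q" by blast+
  note L' = idealD[OF Li]
  have nil: "\<exists>k::nat. u [^] k \<in> L" if u: "u \<in> max_ideal R" for u
  proof -
    have uc: "u \<in> carrier R" using u m(1) by blast
    obtain k :: nat where "u [^] k \<odot>\<^bsub>M\<^esub> y = \<zero>\<^bsub>M\<^esub>" using y u torsion_iff[OF assms(1)] by blast
    then have vQ: "u [^] k \<in> Q" using uc by (simp add: Q_def)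
    let ?v = "u [^] k"
    have vc: "?v \<in> carrier R" using uc by simp
    \<comment> \<open>The ideals \<open>(L : v^n)\<close> become stable, which gives
      \<open>stab\<close>: modulo \<open>L\<close>, multiplication by \<open>v\<close> can be
      cancelled on multiples of \<open>w = v^n\<close>.\<close>
    let ?J = "\<lambda>n::nat. colon R L (?v [^] n)"
    have "ideal (?J n) R" for n using ideal_colon(1)[OF Li] vc by simp
    then have "\<exists>J\<in>range ?J. \<forall>K\<in>range ?J. J \<subseteq> K \<longrightarrow> K = J"
      by (intro maximal_ideal_exists) auto
    then obtain J where J: "J \<in> range ?J" "\<forall>K\<in>range ?J. J \<subseteq> K \<longrightarrow> K = J" by (rule bexE)
    obtain n where "J = ?J n" using J(1) by (rule rangeE)
    then have n: "?J l = ?J n" if "?J n \<subseteq> ?J l" for l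
      using J(2)[rule_format, OF rangeI[of ?J l]] that by simp
    let ?w = "?v [^] n"
    have wc: "?w \<in> carrier R" using vc by simp
    have stab: "b \<otimes> ?w \<in> L" if b: "b \<in> carrier R" "b \<otimes> (?v \<otimes> ?w) \<in> L" for b
    proof -
      have eq: "?v [^] Suc n = ?v \<otimes> ?w" using vc m_comm by simp
      have "colon R L ?w \<subseteq> colon R L (?v [^] Suc n)"
      proof
        fix c assume c: "c \<in> colon R L ?w"
        then have "c \<otimes> (?v \<otimes> ?w) = ?v \<otimes> (c \<otimes> ?w)" using vc wc by (intro m_lcomm) (auto simp: colon_def)
        then show "c \<in> colon R L (?v [^] Suc n)" unfolding eq using c L'(4)[OF _ vc] by (simp add: colon_def)
      qed
      then have "colon R L (?v [^] Suc n) = colon R L ?w" by (rule n)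
      moreover have "b \<in> colon R L (?v [^] Suc n)" unfolding eq using b by (simp add: colon_def)
      ultimately show ?thesis by (simp add: colon_def)
    qed
    let ?K = "adjoin R L ?w"
    have K: "ideal ?K R" "L \<subseteq> ?K" "?w \<in> ?K" using ideal_adjoin[OF Li wc] by auto
    \<comment> \<open>If \<open>c x = a + b w\<close>, then \<open>v c x \<in> L\<close> since
      \<open>v c \<in> Q\<close>; so \<open>b v w \<in> L\<close>, hence \<open>b w \<in> L\<close>
      and \<open>c x \<in> L\<close>. Thus \<open>L + wR\<close> is again a candidate, and
      maximality gives \<open>w \<in> L\<close>.\<close>
    have "colon R ?K x \<subseteq> Q"
    proof
      fix c assume "c \<in> colon R ?K x"
      then obtain a b where c: "c \<in> carrier R" "c \<otimes> x = a \<oplus> b \<otimes> ?w" "a \<in> L" "b \<in> carrier R"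
        by (auto simp: colon_def adjoin_def)
      have ac: "a \<in> carrier R" using c L'(1) by auto
      have "b \<otimes> (?v \<otimes> ?w) = ?v \<otimes> (a \<oplus> b \<otimes> ?w) \<ominus> ?v \<otimes> a" using c(4) ac vc wc by algebra
      also have "\<dots> = (?v \<otimes> c) \<otimes> x \<ominus> ?v \<otimes> a" unfolding c(2)[symmetric] using c(1) vc x by (simp add: m_assoc)
      finally have "b \<otimes> (?v \<otimes> ?w) \<in> L" using QL[OF Q'(5)[OF vQ c(1)]] L'(4)[OF c(3) vc] L'(7) by simp
      then have "c \<otimes> x \<in> L" unfolding c(2) using stab[OF c(4)] L'(3)[OF c(3)] by blast
      then show "c \<in> Q" using LQ c(1) by (auto simp: colon_def)
    qed
    then have "?K \<in> ?C" using K IL QL by blast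
    then have "?w \<in> L" using Lmax K by blast
    then show ?thesis using uc nat_pow_pow[of u k n] by auto
  qed
  have "c \<odot>\<^bsub>M\<^esub> y = \<zero>\<^bsub>M\<^esub>" if "c \<in> colon R L x" for c using that LQ by (auto simp: Q_def)
  then obtain z where z: "z \<in> carrier M" "\<And>a. a \<in> L \<Longrightarrow> a \<odot>\<^bsub>M\<^esub> z = \<zero>\<^bsub>M\<^esub>" "x \<odot>\<^bsub>M\<^esub> z = y"
    using cyc_injD0[OF assms(1) _ assms(2) Li x yc] by blast
  have "z \<in> tors M" unfolding torsion_iff[OF assms(1)] using z(1,2) nil by blast
  then show "\<exists>z\<in>tors M. (\<forall>a\<in>I. a \<odot>\<^bsub>M\<^esub> z \<in> {\<zero>\<^bsub>M\<^esub>}) \<and> x \<odot>\<^bsub>M\<^esub> z \<ominus>\<^bsub>M\<^esub> y \<in> {\<zero>\<^bsub>M\<^esub>}"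
    using z IL yc by (intro bexI[of _ z]) (auto simp: M.minus_self)
qed

end

section \<open>Cohomology of complexes\<close>

lemma is_complexD:
  assumes "is_complex R X"
  shows "module R (obj X n)" "diff X n \<in> mod_hom R (obj X n) (obj X (n + 1))"
    "diff X (n - 1) \<in> mod_hom R (obj X (n - 1)) (obj X n)"
    "x \<in> carrier (obj X (n - 1)) \<Longrightarrow> diff X n (diff X (n - 1) x) = \<zero>\<^bsub>obj X (n + 1)\<^esub>"
proof -
  have *: "module R (obj X n)" "diff X n \<in> mod_hom R (obj X n) (obj X (n + 1))"
    "x \<in> carrier (obj X n) \<Longrightarrow> diff X (n + 1) (diff X n x) = \<zero>\<^bsub>obj X (n + 2)\<^esub>" for n x
    using assms by (auto simp: is_complex_def)
  show "module R (obj X n)" "diff X n \<in> mod_hom R (obj X n) (obj X (n + 1))" using * by auto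
  show "diff X (n - 1) \<in> mod_hom R (obj X (n - 1)) (obj X n)" using *(2)[of "n - 1"] by simp
  show "diff X n (diff X (n - 1) x) = \<zero>\<^bsub>obj X (n + 1)\<^esub>" if "x \<in> carrier (obj X (n - 1))"
    using *(3)[OF that] by (simp add: algebra_simps)
qed

lemma submodule_cocycles:
  assumes "is_complex R X"
  shows "submodule (cocycles X n) R (obj X n)"
  unfolding cocycles_def
  by (rule submod_kernel) (use is_complexD[OF assms] in auto)

lemma submodule_coboundaries:
  assumes "is_complex R X"
  shows "submodule (coboundaries X n) R (obj X n)"
  unfolding coboundaries_def
  by (rule submod_image[OF is_complexD(1)[OF assms] is_complexD(1)[OF assms] is_complexD(3)[OF assms]
        module.carrier_is_submodule[OF is_complexD(1)[OF assms]]])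

lemma coboundaries_subset_cocycles:
  assumes "is_complex R X"
  shows "coboundaries X n \<subseteq> cocycles X n"
  using is_complexD[OF assms] mod_homD(1)[OF is_complexD(3)[OF assms]]
  by (auto simp: coboundaries_def cocycles_def)

definition coset_of :: "('r, 'm) cochain \<Rightarrow> int \<Rightarrow> 'm \<Rightarrow> 'm set"
  where "coset_of X n z = (\<lambda>b. b \<oplus>\<^bsub>obj X n\<^esub> z) ` coboundaries X n"

lemma carrier_cohomology: "carrier (cohomology X n) = coset_of X n ` cocycles X n"
  by (auto simp: cohomology_def quot_mod_def A_RCOSETS_def RCOSETS_def r_coset_def coset_of_def sub_mod_def)

lemma coset_of_eq_iff:
  assumes "is_complex R X" "z \<in> cocycles X n" "z' \<in> cocycles X n"
  shows "coset_of X n z = coset_of X n z' \<longleftrightarrow> z \<ominus>\<^bsub>obj X n\<^esub> z' \<in> coboundaries X n"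
proof -
  interpret M: module R "obj X n" by (rule is_complexD[OF assms(1)])
  note B = M.submodD[OF submodule_coboundaries[OF assms(1)]]
  have zc: "z \<in> carrier (obj X n)" "z' \<in> carrier (obj X n)" using assms by (auto simp: cocycles_def)
  show ?thesis
  proof
    assume "coset_of X n z = coset_of X n z'"
    moreover have "z \<in> coset_of X n z" unfolding coset_of_def using B(2) zc by (force intro: rev_image_eqI)
    ultimately obtain b where b: "b \<in> coboundaries X n" "z = b \<oplus>\<^bsub>obj X n\<^esub> z'" unfolding coset_of_def by blast
    then have "b \<in> carrier (obj X n)" using B(1) by blast
    then have "z \<ominus>\<^bsub>obj X n\<^esub> z' = b" unfolding b(2) using zc(2) by algebra
    then show "z \<ominus>\<^bsub>obj X n\<^esub> z' \<in> coboundaries X n" using b by simp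
  next
    assume e: "z \<ominus>\<^bsub>obj X n\<^esub> z' \<in> coboundaries X n"
    have sub: "coset_of X n u \<subseteq> coset_of X n v"
      if "u \<in> carrier (obj X n)" "v \<in> carrier (obj X n)" "u \<ominus>\<^bsub>obj X n\<^esub> v \<in> coboundaries X n" for u v
    proof
      fix y assume "y \<in> coset_of X n u"
      then obtain b where b: "b \<in> coboundaries X n" "y = b \<oplus>\<^bsub>obj X n\<^esub> u" unfolding coset_of_def by blast
      then have "b \<in> carrier (obj X n)" using B(1) by blast
      then have "y = (b \<oplus>\<^bsub>obj X n\<^esub> (u \<ominus>\<^bsub>obj X n\<^esub> v)) \<oplus>\<^bsub>obj X n\<^esub> v" unfolding b(2) using that(1,2) by algebra
      then show "y \<in> coset_of X n v" unfolding coset_of_def using B(3)[OF b(1) that(3)] by blast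
    qed
    have "z' \<ominus>\<^bsub>obj X n\<^esub> z = \<ominus>\<^bsub>obj X n\<^esub> (z \<ominus>\<^bsub>obj X n\<^esub> z')" using zc by algebra
    then have "z' \<ominus>\<^bsub>obj X n\<^esub> z \<in> coboundaries X n" using B(5)[OF e] by simp
    then show "coset_of X n z = coset_of X n z'" using sub zc e by blast
  qed
qed

lemma chain_mapD:
  assumes "chain_map R X Y f"
  shows "f n \<in> mod_hom R (obj X n) (obj Y n)"
    "x \<in> carrier (obj X n) \<Longrightarrow> f (n + 1) (diff X n x) = diff Y n (f n x)"
    "x \<in> carrier (obj X (n - 1)) \<Longrightarrow> f n (diff X (n - 1) x) = diff Y (n - 1) (f (n - 1) x)"
proof -
  have *: "x \<in> carrier (obj X n) \<Longrightarrow> f (n + 1) (diff X n x) = diff Y n (f n x)" for n x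
    using assms by (auto simp: chain_map_def)
  show "f n \<in> mod_hom R (obj X n) (obj Y n)" using assms by (auto simp: chain_map_def)
  show "x \<in> carrier (obj X n) \<Longrightarrow> f (n + 1) (diff X n x) = diff Y n (f n x)" by (rule *)
  show "x \<in> carrier (obj X (n - 1)) \<Longrightarrow> f n (diff X (n - 1) x) = diff Y (n - 1) (f (n - 1) x)"
    using *[of x "n - 1"] by simp
qed

lemma chain_map_cocycle:
  assumes "is_complex R X" "is_complex R Y" "chain_map R X Y f" "z \<in> cocycles X n"
  shows "f n z \<in> cocycles Y n"
  using assms(4) chain_mapD(2)[OF assms(3), of z n, symmetric] mod_homD(1)[OF chain_mapD(1)[OF assms(3)], of z n]
    mod_hom_more(1)[OF is_complexD(1)[OF assms(1)] is_complexD(1)[OF assms(2)] chain_mapD(1)[OF assms(3), of "n + 1"]]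
  by (auto simp: cocycles_def)

lemma chain_map_coboundary:
  assumes "chain_map R X Y f" "z \<in> coboundaries X n"
  shows "f n z \<in> coboundaries Y n"
  using assms(2) chain_mapD(3)[OF assms(1)] mod_homD(1)[OF chain_mapD(1)[OF assms(1)]]
  by (auto simp: coboundaries_def)

lemma cohomology_map_coset_of:
  assumes "is_complex R X" "is_complex R Y" "chain_map R X Y f" "z \<in> cocycles X n"
  shows "cohomology_map Y f n (coset_of X n z) = coset_of Y n (f n z)"
proof -
  interpret X: module R "obj X n" by (rule is_complexD[OF assms(1)])
  interpret Y: module R "obj Y n" by (rule is_complexD[OF assms(2)])
  note BX = X.submodD[OF submodule_coboundaries[OF assms(1)]]
  note BY = Y.submodD[OF submodule_coboundaries[OF assms(2)]]
  note f = mod_homD[OF chain_mapD(1)[OF assms(3), of n]]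
  have zc: "z \<in> carrier (obj X n)" using assms by (auto simp: cocycles_def)
  have "cohomology_map Y f n (coset_of X n z)
      = {b \<oplus>\<^bsub>obj Y n\<^esub> f n (b' \<oplus>\<^bsub>obj X n\<^esub> z) | b b'. b \<in> coboundaries Y n \<and> b' \<in> coboundaries X n}"
    by (auto simp: cohomology_map_def coset_of_def set_add_def set_mult_def)
  also have "\<dots> = coset_of Y n (f n z)"
  proof (intro equalityI subsetI)
    fix y assume "y \<in> {b \<oplus>\<^bsub>obj Y n\<^esub> f n (b' \<oplus>\<^bsub>obj X n\<^esub> z) | b b'. b \<in> coboundaries Y n \<and> b' \<in> coboundaries X n}"
    then obtain b b' where b: "y = b \<oplus>\<^bsub>obj Y n\<^esub> f n (b' \<oplus>\<^bsub>obj X n\<^esub> z)" "b \<in> coboundaries Y n" "b' \<in> coboundaries X n" by blast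
    have "b' \<in> carrier (obj X n)" "b \<in> carrier (obj Y n)" using b BX(1) BY(1) by auto
    then have "y = (b \<oplus>\<^bsub>obj Y n\<^esub> f n b') \<oplus>\<^bsub>obj Y n\<^esub> f n z"
      unfolding b(1) using zc f(1,2) by (simp add: Y.M.a_assoc)
    moreover have "f n b' \<in> coboundaries Y n" by (rule chain_map_coboundary[OF assms(3) b(3)])
    ultimately show "y \<in> coset_of Y n (f n z)" unfolding coset_of_def using BY(3) b(2) by blast
  next
    fix y assume "y \<in> coset_of Y n (f n z)"
    then obtain b where b: "b \<in> coboundaries Y n" "y = b \<oplus>\<^bsub>obj Y n\<^esub> f n z" unfolding coset_of_def by blast
    then have "y = b \<oplus>\<^bsub>obj Y n\<^esub> f n (\<zero>\<^bsub>obj X n\<^esub> \<oplus>\<^bsub>obj X n\<^esub> z)" using zc by simp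
    then show "y \<in> {b \<oplus>\<^bsub>obj Y n\<^esub> f n (b' \<oplus>\<^bsub>obj X n\<^esub> z) | b b'. b \<in> coboundaries Y n \<and> b' \<in> coboundaries X n}"
      using b(1) BX(2) by blast
  qed
  finally show ?thesis .
qed

text \<open>The two halves of bijectivity on cohomology, stated for representatives, so that roofs
  and resolutions can be treated with elements.\<close>

lemma quasi_isoD:
  assumes "is_complex R X" "is_complex R Y" "quasi_iso R X Y f"
  shows "chain_map R X Y f"
    "z \<in> cocycles X n \<Longrightarrow> f n z \<in> coboundaries Y n \<Longrightarrow> z \<in> coboundaries X n"
    "y \<in> cocycles Y n \<Longrightarrow> \<exists>z\<in>cocycles X n. y \<ominus>\<^bsub>obj Y n\<^esub> f n z \<in> coboundaries Y n"
proof -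
  show f: "chain_map R X Y f" using assms(3) by (simp add: quasi_iso_def)
  have bij: "bij_betw (cohomology_map Y f n) (carrier (cohomology X n)) (carrier (cohomology Y n))"
    using assms(3) by (simp add: quasi_iso_def)
  interpret X: module R "obj X n" by (rule is_complexD[OF assms(1)])
  interpret Y: module R "obj Y n" by (rule is_complexD[OF assms(2)])
  note ZX = X.submodD[OF submodule_cocycles[OF assms(1), of n]]
  note minus0 = mod_hom_more[OF is_complexD(1)[OF assms(1)] is_complexD(1)[OF assms(2)] chain_mapD(1)[OF f, of n]]
  note map = cohomology_map_coset_of[OF assms(1,2) f]
  show "z \<in> coboundaries X n" if z: "z \<in> cocycles X n" "f n z \<in> coboundaries Y n"
  proof -
    have zc: "z \<in> carrier (obj X n)" "f n z \<in> carrier (obj Y n)"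
      using z ZX(1) mod_homD(1)[OF chain_mapD(1)[OF f]] by auto
    have "f n z \<ominus>\<^bsub>obj Y n\<^esub> f n \<zero>\<^bsub>obj X n\<^esub> = f n z" unfolding minus0(1) using zc by algebra
    then have "coset_of Y n (f n z) = coset_of Y n (f n \<zero>\<^bsub>obj X n\<^esub>)"
      using z(2) coset_of_eq_iff[OF assms(2) chain_map_cocycle[OF assms(1,2) f z(1)] chain_map_cocycle[OF assms(1,2) f ZX(2)]]
      by simp
    then have "coset_of X n z = coset_of X n \<zero>\<^bsub>obj X n\<^esub>"
      using bij z(1) ZX(2) map unfolding bij_betw_def carrier_cohomology by (metis imageI inj_onD)
    then have "z \<ominus>\<^bsub>obj X n\<^esub> \<zero>\<^bsub>obj X n\<^esub> \<in> coboundaries X n"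
      using coset_of_eq_iff[OF assms(1) z(1) ZX(2)] by simp
    moreover have "z \<ominus>\<^bsub>obj X n\<^esub> \<zero>\<^bsub>obj X n\<^esub> = z" using zc by algebra
    ultimately show ?thesis by simp
  qed
  show "\<exists>z\<in>cocycles X n. y \<ominus>\<^bsub>obj Y n\<^esub> f n z \<in> coboundaries Y n" if y: "y \<in> cocycles Y n"
  proof -
    have "coset_of Y n y \<in> cohomology_map Y f n ` coset_of X n ` cocycles X n"
      using bij y unfolding bij_betw_def carrier_cohomology by blast
    then obtain z where z: "z \<in> cocycles X n" "coset_of Y n y = coset_of Y n (f n z)" using map by auto
    then show ?thesis using coset_of_eq_iff[OF assms(2) y chain_map_cocycle[OF assms(1,2) f z(1)]] by blast
  qed
qed

lemma stalk_simps:
  "obj (stalk E t) n = (if n = t then E else sub_mod E {\<zero>\<^bsub>E\<^esub>})" "diff (stalk E t) n x = \<zero>\<^bsub>E\<^esub>"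
  by (simp_all add: stalk_def)

lemma is_complex_stalk:
  assumes "module R E"
  shows "is_complex R (stalk E t)"
proof -
  interpret E: module R E by fact
  have "module R (sub_mod E {\<zero>\<^bsub>E\<^esub>})" by (rule module_sub_mod[OF assms E.submod_zero])
  then show ?thesis using assms by (auto simp: is_complex_def stalk_simps mod_hom_def)
qed

lemma cocycles_stalk: "cocycles (stalk E t) n = carrier (obj (stalk E t) n)"
  by (auto simp: cocycles_def stalk_simps)

lemma coboundaries_stalk: "module R E \<Longrightarrow> coboundaries (stalk E t) n = {\<zero>\<^bsub>E\<^esub>}"
proof -
  assume "module R E"
  then interpret E: module R E .
  have "carrier (obj (stalk E t) (n - 1)) \<noteq> {}" by (auto simp: stalk_simps)
  then show ?thesis by (auto simp: coboundaries_def stalk_simps image_constant_conv)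
qed

text \<open>For a cocycle \<open>z\<close> of the apex, \<open>f z\<close> is a coboundary exactly
  when \<open>g z\<close> vanishes (\<open>kill\<close>). Hence statements about annihilators and
  divisibility in \<open>E\<close> carry over to the cocycles of \<open>X\<close> modulo
  coboundaries.\<close>

lemma (in cring) derived_iso_stalk:
  fixes X :: "('a, 'm) cochain" and E :: "('a, 'e) module"
  assumes X: "is_complex R X" and E: "module R E" and iso: "derived_iso R X (stalk E t)"
  shows "n \<noteq> t \<Longrightarrow> cocycles X n \<subseteq> coboundaries X n"
    "cyc_inj R E (carrier E) {\<zero>\<^bsub>E\<^esub>} \<Longrightarrow> cyc_inj R (obj X t) (cocycles X t) (coboundaries X t)"
    "e \<in> carrier E \<Longrightarrow> e \<noteq> \<zero>\<^bsub>E\<^esub> \<Longrightarrow> \<exists>z\<in>cocycles X t. z \<notin> coboundaries X t \<and>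
      (\<forall>c\<in>carrier R. c \<odot>\<^bsub>E\<^esub> e = \<zero>\<^bsub>E\<^esub> \<longrightarrow> c \<odot>\<^bsub>obj X t\<^esub> z \<in> coboundaries X t)"
proof -
  obtain Z :: "('a, 'm) cochain" and f g where Z: "is_complex R Z" and f: "quasi_iso R Z X f" and g: "quasi_iso R Z (stalk E t) g"
    using iso unfolding derived_iso_def by blast
  note S = is_complex_stalk[OF E, of t]
  note f' = quasi_isoD[OF Z X f] and g' = quasi_isoD[OF Z S g]
  note fh = mod_homD[OF chain_mapD(1)[OF f'(1), of t]] and gh0 = mod_homD[OF chain_mapD(1)[OF g'(1)]]
  interpret E: module R E by fact
  note B = module.submodD[OF is_complexD(1)[OF X] submodule_coboundaries[OF X]]
  note ZX = module.submodD[OF is_complexD(1)[OF X] submodule_cocycles[OF X]]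
  note ZZ = module.submodD[OF is_complexD(1)[OF Z] submodule_cocycles[OF Z]]
  have kill: "f n z \<in> coboundaries X n \<longleftrightarrow> g n z = \<zero>\<^bsub>E\<^esub>" if z: "z \<in> cocycles Z n" for n z
  proof
    assume "f n z \<in> coboundaries X n"
    then have "z \<in> coboundaries Z n" using f'(2) z by blast
    then show "g n z = \<zero>\<^bsub>E\<^esub>" using chain_map_coboundary[OF g'(1)] coboundaries_stalk[OF E] by blast
  next
    assume "g n z = \<zero>\<^bsub>E\<^esub>"
    then have "z \<in> coboundaries Z n" using g'(2)[OF z] coboundaries_stalk[OF E] by blast
    then show "f n z \<in> coboundaries X n" by (rule chain_map_coboundary[OF f'(1)])
  qed
  show "cocycles X n \<subseteq> coboundaries X n" if "n \<noteq> t"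
  proof
    interpret X: module R "obj X n" by (rule is_complexD[OF X])
    fix x assume x: "x \<in> cocycles X n"
    obtain z where z: "z \<in> cocycles Z n" "x \<ominus>\<^bsub>obj X n\<^esub> f n z \<in> coboundaries X n" using f'(3)[OF x] by blast
    have "g n z \<in> carrier (obj (stalk E t) n)" using gh0(1) z ZZ(1) by blast
    then have "f n z \<in> coboundaries X n" using kill[OF z(1)] that by (simp add: stalk_simps)
    then show "x \<in> coboundaries X n"
      using X.submod_coset[OF submodule_coboundaries[OF X] z(2)] x ZX(1) by blast
  qed
  have ob: "obj (stalk E t) t = E" by (simp add: stalk_simps)
  have gE: "\<exists>z\<in>cocycles Z t. g t z = e" if e: "e \<in> carrier E" for e
  proof -
    obtain z where z: "z \<in> cocycles Z t" "e \<ominus>\<^bsub>E\<^esub> g t z \<in> {\<zero>\<^bsub>E\<^esub>}"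
      using g'(3)[of e t] e unfolding cocycles_stalk coboundaries_stalk[OF E] ob by blast
    have "g t z \<in> carrier E" using gh0(1)[of z t] z ZZ(1) ob by auto
    then show ?thesis using z E.eq_of_minus_zero[OF e] by auto
  qed
  interpret X: module R "obj X t" by (rule is_complexD[OF X])
  interpret Z: module R "obj Z t" by (rule is_complexD[OF Z])
  note gh = mod_homD[OF chain_mapD(1)[OF g'(1), of t], unfolded ob]
  note gm = mod_hom_more[OF is_complexD(1)[OF Z] is_complexD(1)[OF S] chain_mapD(1)[OF g'(1), of t], unfolded ob]
    and fm = mod_hom_more[OF is_complexD(1)[OF Z] is_complexD(1)[OF X] chain_mapD(1)[OF f'(1), of t]]
  show "\<exists>z\<in>cocycles X t. z \<notin> coboundaries X t \<and>
      (\<forall>c\<in>carrier R. c \<odot>\<^bsub>E\<^esub> e = \<zero>\<^bsub>E\<^esub> \<longrightarrow> c \<odot>\<^bsub>obj X t\<^esub> z \<in> coboundaries X t)"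
    if e: "e \<in> carrier E" "e \<noteq> \<zero>\<^bsub>E\<^esub>"
  proof -
    obtain z where z: "z \<in> cocycles Z t" "g t z = e" using gE[OF e(1)] by blast
    have zc: "z \<in> carrier (obj Z t)" using z ZZ(1) by blast
    show ?thesis
    proof (intro bexI conjI ballI impI)
      show "f t z \<in> cocycles X t" by (rule chain_map_cocycle[OF Z X f'(1) z(1)])
      show "f t z \<notin> coboundaries X t" using kill[OF z(1)] z(2) e(2) by simp
      fix c assume c: "c \<in> carrier R" "c \<odot>\<^bsub>E\<^esub> e = \<zero>\<^bsub>E\<^esub>"
      have "f t (c \<odot>\<^bsub>obj Z t\<^esub> z) \<in> coboundaries X t"
        using kill[OF ZZ(4)[OF c(1) z(1)]] gh(3)[OF c(1) zc] c(2) z(2) by simp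
      then show "c \<odot>\<^bsub>obj X t\<^esub> f t z \<in> coboundaries X t" using fh(3)[OF c(1) zc] by simp
    qed
  qed
  show "cyc_inj R (obj X t) (cocycles X t) (coboundaries X t)" if cyc: "cyc_inj R E (carrier E) {\<zero>\<^bsub>E\<^esub>}"
    unfolding cyc_inj_def
  proof (intro allI impI, elim conjE)
    fix I x y
    assume I: "ideal I R" and x: "x \<in> carrier R" and y: "y \<in> cocycles X t"
      and ann: "\<forall>c\<in>colon R I x. c \<odot>\<^bsub>obj X t\<^esub> y \<in> coboundaries X t"
    have yc: "y \<in> carrier (obj X t)" using y ZX(1) by blast
    obtain u where u: "u \<in> cocycles Z t" "y \<ominus>\<^bsub>obj X t\<^esub> f t u \<in> coboundaries X t" using f'(3)[OF y] by blast
    have uc: "u \<in> carrier (obj Z t)" using u ZZ(1) by blast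
    have "c \<odot>\<^bsub>E\<^esub> g t u = \<zero>\<^bsub>E\<^esub>" if c: "c \<in> colon R I x" for c
    proof -
      have cc: "c \<in> carrier R" using c by (simp add: colon_def)
      have "c \<odot>\<^bsub>obj X t\<^esub> f t u = c \<odot>\<^bsub>obj X t\<^esub> y \<ominus>\<^bsub>obj X t\<^esub> c \<odot>\<^bsub>obj X t\<^esub> (y \<ominus>\<^bsub>obj X t\<^esub> f t u)"
        using cc yc fh(1)[OF uc] by algebra
      then have "c \<odot>\<^bsub>obj X t\<^esub> f t u \<in> coboundaries X t" using ann c B(4)[OF cc u(2)] B(6) by simp
      then have "f t (c \<odot>\<^bsub>obj Z t\<^esub> u) \<in> coboundaries X t" using fh(3)[OF cc uc] by simp
      then show ?thesis using kill[OF ZZ(4)[OF cc u(1)]] gh(3)[OF cc uc] by simp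
    qed
    then obtain e where e: "e \<in> carrier E" "\<And>a. a \<in> I \<Longrightarrow> a \<odot>\<^bsub>E\<^esub> e = \<zero>\<^bsub>E\<^esub>" "x \<odot>\<^bsub>E\<^esub> e = g t u"
      using cyc_injD0[OF E _ cyc I x gh(1)[OF uc]] by blast
    obtain z where z: "z \<in> cocycles Z t" "g t z = e" using gE[OF e(1)] by blast
    have zc: "z \<in> carrier (obj Z t)" using z ZZ(1) by blast
    show "\<exists>z\<in>cocycles X t. (\<forall>a\<in>I. a \<odot>\<^bsub>obj X t\<^esub> z \<in> coboundaries X t) \<and> x \<odot>\<^bsub>obj X t\<^esub> z \<ominus>\<^bsub>obj X t\<^esub> y \<in> coboundaries X t"
    proof (intro bexI conjI ballI)
      show "f t z \<in> cocycles X t" by (rule chain_map_cocycle[OF Z X f'(1) z(1)])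
      show "a \<odot>\<^bsub>obj X t\<^esub> f t z \<in> coboundaries X t" if a: "a \<in> I" for a
      proof -
        have ac: "a \<in> carrier R" using a idealD(1)[OF I] by blast
        have "f t (a \<odot>\<^bsub>obj Z t\<^esub> z) \<in> coboundaries X t"
          using kill[OF ZZ(4)[OF ac z(1)]] gh(3)[OF ac zc] e(2)[OF a] z(2) by simp
        then show ?thesis using fh(3)[OF ac zc] by simp
      qed
      have "x \<odot>\<^bsub>obj Z t\<^esub> z \<ominus>\<^bsub>obj Z t\<^esub> u \<in> cocycles Z t" using ZZ(4,6) x z(1) u(1) by blast
      moreover have "g t (x \<odot>\<^bsub>obj Z t\<^esub> z \<ominus>\<^bsub>obj Z t\<^esub> u) = \<zero>\<^bsub>E\<^esub>"
        using gm(3) gh(1,3) x zc uc z(2) e(3) by (simp add: E.minus_self)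
      ultimately have "f t (x \<odot>\<^bsub>obj Z t\<^esub> z \<ominus>\<^bsub>obj Z t\<^esub> u) \<in> coboundaries X t" using kill by blast
      then have 1: "x \<odot>\<^bsub>obj X t\<^esub> f t z \<ominus>\<^bsub>obj X t\<^esub> f t u \<in> coboundaries X t"
        using fm(3) fh(3) x zc uc by simp
      have "x \<odot>\<^bsub>obj X t\<^esub> f t z \<ominus>\<^bsub>obj X t\<^esub> y = (x \<odot>\<^bsub>obj X t\<^esub> f t z \<ominus>\<^bsub>obj X t\<^esub> f t u) \<ominus>\<^bsub>obj X t\<^esub> (y \<ominus>\<^bsub>obj X t\<^esub> f t u)"
        using x fh(1)[OF zc] fh(1)[OF uc] yc by algebra
      then show "x \<odot>\<^bsub>obj X t\<^esub> f t z \<ominus>\<^bsub>obj X t\<^esub> y \<in> coboundaries X t" using 1 u(2) B(6) by simp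
    qed
  qed
qed

section \<open>Regular sequences\<close>

lemma (in cring) regular_sequence_ideals:
  assumes reg: "regular_sequence R xs"
  defines "I \<equiv> \<lambda>k. Idl (set (take k xs))"
  shows "ideal (I k) R" "I 0 = {\<zero>}"
    "k < length xs \<Longrightarrow> xs ! k \<in> carrier R"
    "k < length xs \<Longrightarrow> colon R (I k) (xs ! k) = I k"
    "k < length xs \<Longrightarrow> I (Suc k) = adjoin R (I k) (xs ! k)"
proof -
  have xsc: "set xs \<subseteq> carrier R" using reg by (simp add: regular_sequence_def)
  have tc: "set (take k xs) \<subseteq> carrier R" for k using xsc set_take_subset by (rule order_trans[rotated])
  show Ik: "ideal (I k) R" for k unfolding I_def by (rule genideal_ideal[OF tc])
  show "I 0 = {\<zero>}"
    using genideal_minimal[OF zeroideal, of "{}"] idealD(2)[OF genideal_ideal[of "{}"]] by (auto simp: I_def)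
  assume k: "k < length xs"
  show x: "xs ! k \<in> carrier R" using k xsc nth_mem by blast
  have "a \<in> I k" if "a \<in> carrier R" "a \<otimes> xs ! k \<in> I k" for a
    using reg k that x m_comm[of a "xs ! k"] unfolding regular_sequence_def I_def by metis
  then show "colon R (I k) (xs ! k) = I k" using ideal_colon(2)[OF Ik x] by (auto simp: colon_def)
  have tk: "set (take (Suc k) xs) = insert (xs ! k) (set (take k xs))" using k by (simp add: take_Suc_conv_app_nth)
  show "I (Suc k) = adjoin R (I k) (xs ! k)"
  proof
    show "I (Suc k) \<subseteq> adjoin R (I k) (xs ! k)"
      using ideal_adjoin[OF Ik x, of k] genideal_self[OF tc, of k] tk unfolding I_def
      by (intro genideal_minimal) auto
    show "adjoin R (I k) (xs ! k) \<subseteq> I (Suc k)"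
    proof (rule adjoin_minimal[OF Ik])
      have "Idl (set (take k xs)) \<subseteq> I (Suc k)"
        by (rule genideal_minimal[OF Ik]) (use genideal_self[OF tc, of "Suc k"] tk in \<open>auto simp: I_def\<close>)
      then show "I k \<subseteq> I (Suc k)" by (simp add: I_def)
      show "xs ! k \<in> I (Suc k)" using genideal_self[OF tc, of "Suc k"] tk by (auto simp: I_def)
    qed
  qed
qed

section \<open>Annihilator subcomplexes\<close>

text \<open>Injectivity of the terms enters through \<open>cyc\<close>, boundedness through
  \<open>below\<close>; at \<open>lo\<close> the inductions over the degree start.\<close>

locale cyc_inj_complex = noetherian_local_ring R for R (structure) +
  fixes D :: "('a, 'd) cochain" and lo :: int
  assumes complex: "is_complex R D"
    and cyc: "\<And>n. cyc_inj R (obj D n) (carrier (obj D n)) {\<zero>\<^bsub>obj D n\<^esub>}"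
    and below: "\<And>n. n < lo \<Longrightarrow> carrier (obj D n) = {\<zero>\<^bsub>obj D n\<^esub>}"
begin

sublocale D: module R "obj D n" for n
  by (rule is_complexD[OF complex])

lemmas d_hom = mod_homD[OF is_complexD(2)[OF complex]]
  mod_hom_more[OF is_complexD(1)[OF complex] is_complexD(1)[OF complex] is_complexD(2)[OF complex]]

lemmas d_hom' = mod_homD[OF is_complexD(3)[OF complex]]
  mod_hom_more[OF is_complexD(1)[OF complex] is_complexD(1)[OF complex] is_complexD(3)[OF complex]]

lemmas dd = is_complexD(4)[OF complex]

text \<open>\<open>ann I\<close> is the complex \<open>Hom(R/I, D)\<close>.\<close>

definition ann :: "'a set \<Rightarrow> int \<Rightarrow> 'd set"
  where "ann I n = {x \<in> carrier (obj D n). \<forall>c\<in>I. c \<odot>\<^bsub>obj D n\<^esub> x = \<zero>\<^bsub>obj D n\<^esub>}"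

definition cyc_ann :: "'a set \<Rightarrow> int \<Rightarrow> 'd set"
  where "cyc_ann I n = {z \<in> ann I n. diff D n z = \<zero>\<^bsub>obj D (n + 1)\<^esub>}"

definition bnd_ann :: "'a set \<Rightarrow> int \<Rightarrow> 'd set"
  where "bnd_ann I n = diff D (n - 1) ` ann I (n - 1)"

definition exact_at :: "'a set \<Rightarrow> int \<Rightarrow> bool"
  where "exact_at I n \<longleftrightarrow> cyc_ann I n \<subseteq> bnd_ann I n"

lemma exact_atE:
  assumes "exact_at I n" "z \<in> ann I n" "diff D n z = \<zero>\<^bsub>obj D (n + 1)\<^esub>"
  obtains w where "w \<in> ann I (n - 1)" "diff D (n - 1) w = z"
  using assms by (auto simp: exact_at_def cyc_ann_def bnd_ann_def)

lemma exact_at_cycE: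
  assumes "exact_at I n" "z \<in> cyc_ann I n"
  obtains w where "w \<in> ann I (n - 1)" "diff D (n - 1) w = z"
  using assms by (auto simp: exact_at_def bnd_ann_def)

lemma ann_carrier: "x \<in> ann I n \<Longrightarrow> x \<in> carrier (obj D n)"
  by (simp add: ann_def)

lemma submodule_ann:
  assumes "ideal I R"
  shows "submodule (ann I n) R (obj D n)"
proof -
  have "I \<subseteq> carrier R" using assms by (rule idealD)
  then show ?thesis
    by (intro D.submod_intro) (auto simp: ann_def D.smult_r_distr subset_iff D.smult_comm)
qed

lemmas annD = D.submodD[OF submodule_ann]

lemma submodule_cyc_ann:
  assumes "ideal I R"
  shows "submodule (cyc_ann I n) R (obj D n)"
  by (rule D.submod_intro)
    (use annD[OF assms] in \<open>auto simp: cyc_ann_def d_hom ann_carrier\<close>)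

lemma submodule_bnd_ann:
  assumes "ideal I R"
  shows "submodule (bnd_ann I n) R (obj D n)"
  unfolding bnd_ann_def
  by (rule submod_image[OF is_complexD(1)[OF complex] is_complexD(1)[OF complex] is_complexD(3)[OF complex] submodule_ann[OF assms]])

lemmas cyc_annD = D.submodD[OF submodule_cyc_ann]
lemmas bnd_annD = D.submodD[OF submodule_bnd_ann]

lemma d_ann: "ideal I R \<Longrightarrow> w \<in> ann I (n - 1) \<Longrightarrow> diff D (n - 1) w \<in> ann I n"
proof -
  assume I: "ideal I R" and w: "w \<in> ann I (n - 1)"
  have "c \<odot>\<^bsub>obj D n\<^esub> diff D (n - 1) w = \<zero>\<^bsub>obj D n\<^esub>" if c: "c \<in> I" for c
    using d_hom'(3)[of c w n] d_hom'(4)[of n] w c idealD(1)[OF I] by (auto simp: ann_def)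
  then show ?thesis using d_hom'(1)[of w n] w by (simp add: ann_def)
qed

lemma ann_anti: "I \<subseteq> J \<Longrightarrow> ann J n \<subseteq> ann I n"
  by (auto simp: ann_def)

lemma ann_zero: "ann {\<zero>} n = carrier (obj D n)"
  by (auto simp: ann_def)

lemma ann_adjoin:
  assumes "ideal I R" "x \<in> carrier R" "z \<in> ann I n" "x \<odot>\<^bsub>obj D n\<^esub> z = \<zero>\<^bsub>obj D n\<^esub>"
  shows "z \<in> ann (adjoin R I x) n"
proof -
  have zc: "z \<in> carrier (obj D n)" using assms(3) by (rule ann_carrier)
  have "(i \<oplus> c \<otimes> x) \<odot>\<^bsub>obj D n\<^esub> z = \<zero>\<^bsub>obj D n\<^esub>" if "i \<in> I" "c \<in> carrier R" for i c
    using that assms zc idealD(1)[OF assms(1)]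
    by (auto simp: ann_def D.smult_l_distr D.smult_assoc1 subset_iff)
  then show ?thesis using zc by (auto simp: ann_def adjoin_def)
qed

lemma ann_mult:
  assumes "x \<in> carrier R" "z \<in> ann I n"
  shows "x \<odot>\<^bsub>obj D n\<^esub> z \<in> ann (colon R I x) n"
proof -
  have zc: "z \<in> carrier (obj D n)" using assms(2) by (rule ann_carrier)
  have "c \<odot>\<^bsub>obj D n\<^esub> (x \<odot>\<^bsub>obj D n\<^esub> z) = \<zero>\<^bsub>obj D n\<^esub>" if "c \<in> colon R I x" for c
    using that assms zc by (auto simp: ann_def colon_def simp flip: D.smult_assoc1)
  then show ?thesis using zc assms(1) by (simp add: ann_def)
qed

text \<open>By cyclic injectivity of the terms, multiplication by \<open>x\<close> maps
  \<open>ann I\<close> onto \<open>ann (I : x)\<close>; this is exactness on the right in the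
  sequence that follows.\<close>

lemma ann_div:
  assumes "ideal I R" "x \<in> carrier R" "y \<in> ann (colon R I x) n"
  obtains z where "z \<in> ann I n" "x \<odot>\<^bsub>obj D n\<^esub> z = y"
proof -
  have yc: "y \<in> carrier (obj D n)" using assms(3) by (rule ann_carrier)
  have "c \<odot>\<^bsub>obj D n\<^esub> y = \<zero>\<^bsub>obj D n\<^esub>" if "c \<in> colon R I x" for c
    using that assms(3) by (simp add: ann_def)
  then obtain z where "z \<in> carrier (obj D n)" "\<And>a. a \<in> I \<Longrightarrow> a \<odot>\<^bsub>obj D n\<^esub> z = \<zero>\<^bsub>obj D n\<^esub>" "x \<odot>\<^bsub>obj D n\<^esub> z = y"
    using cyc_injD0[OF is_complexD(1)[OF complex] subset_refl cyc assms(1,2) yc] by metis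
  then show ?thesis using that unfolding ann_def by blast
qed

text \<open>
  The next lemmas are the pieces of the long exact cohomology sequence of
  \<open>0 \<rightarrow> ann (I + xR) \<rightarrow> ann I \<rightarrow> ann (I : x) \<rightarrow> 0\<close>, whose second map is multiplication by \<open>x\<close>.
\<close>

lemma exact_middle:
  assumes I: "ideal I R" and x: "x \<in> carrier R"
    and J: "exact_at (colon R I x) n" and K: "exact_at (adjoin R I x) n"
  shows "exact_at I n"
  unfolding exact_at_def
proof
  fix z assume z: "z \<in> cyc_ann I n"
  then have zI: "z \<in> ann I n" and zc: "z \<in> carrier (obj D n)" and dz: "diff D n z = \<zero>\<^bsub>obj D (n + 1)\<^esub>"
    by (auto simp: cyc_ann_def ann_def)
  have "x \<odot>\<^bsub>obj D n\<^esub> z \<in> cyc_ann (colon R I x) n"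
    using ann_mult[OF x zI] d_hom(3)[OF x zc] dz x by (simp add: cyc_ann_def)
  then obtain w where w: "w \<in> ann (colon R I x) (n - 1)" "diff D (n - 1) w = x \<odot>\<^bsub>obj D n\<^esub> z"
    by (rule exact_at_cycE[OF J])
  obtain v where v: "v \<in> ann I (n - 1)" "x \<odot>\<^bsub>obj D (n - 1)\<^esub> v = w" using ann_div[OF I x w(1)] .
  have vc: "v \<in> carrier (obj D (n - 1))" using v(1) by (rule ann_carrier)
  let ?u = "z \<ominus>\<^bsub>obj D n\<^esub> diff D (n - 1) v"
  have uI: "?u \<in> ann I n" using annD(6)[OF I zI d_ann[OF I v(1)]] .
  have "x \<odot>\<^bsub>obj D n\<^esub> ?u = \<zero>\<^bsub>obj D n\<^esub>"
    using x zc vc d_hom'(1)[OF vc] d_hom'(3)[OF x vc] v(2) w(2) by (simp add: D.smult_minus_distr D.minus_self)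
  then have "?u \<in> ann (adjoin R I x) n" by (rule ann_adjoin[OF I x uI])
  moreover have "diff D n ?u = \<zero>\<^bsub>obj D (n + 1)\<^esub>"
    using d_hom(6)[OF zc d_hom'(1)[OF vc]] dz dd[OF vc] by (simp add: D.minus_self)
  ultimately obtain y where y: "y \<in> ann (adjoin R I x) (n - 1)" "diff D (n - 1) y = ?u"
    by (rule exact_atE[OF K])
  have yI: "y \<in> ann I (n - 1)" using y(1) ann_anti[OF ideal_adjoin(2)[OF I x]] by blast
  have yc: "y \<in> carrier (obj D (n - 1))" using yI by (rule ann_carrier)
  have "diff D (n - 1) (y \<oplus>\<^bsub>obj D (n - 1)\<^esub> v) = ?u \<oplus>\<^bsub>obj D n\<^esub> diff D (n - 1) v"
    using d_hom'(2)[OF yc vc] y(2) by simp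
  also have "\<dots> = z" using zc d_hom'(1)[OF vc] by (rule D.minus_add_cancel)
  finally show "z \<in> bnd_ann I n" unfolding bnd_ann_def using annD(3)[OF I yI v(1)] by (metis imageI)
qed

lemma exact_left:
  assumes I: "ideal I R" and x: "x \<in> carrier R"
    and J: "exact_at (colon R I x) (n - 1)" and K: "exact_at I n"
  shows "exact_at (adjoin R I x) n"
  unfolding exact_at_def
proof
  fix z assume z: "z \<in> cyc_ann (adjoin R I x) n"
  then have "z \<in> cyc_ann I n"
    using ann_anti[OF ideal_adjoin(2)[OF I x]] by (auto simp: cyc_ann_def)
  then obtain w where w: "w \<in> ann I (n - 1)" "diff D (n - 1) w = z"
    by (rule exact_at_cycE[OF K])
  have wc: "w \<in> carrier (obj D (n - 1))" using w(1) by (rule ann_carrier)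
  have "x \<odot>\<^bsub>obj D n\<^esub> z = \<zero>\<^bsub>obj D n\<^esub>"
    using z ideal_adjoin(3)[OF I x] by (auto simp: cyc_ann_def ann_def)
  then have "diff D (n - 1) (x \<odot>\<^bsub>obj D (n - 1)\<^esub> w) = \<zero>\<^bsub>obj D n\<^esub>" using d_hom'(3)[OF x wc] w(2) by simp
  then have "x \<odot>\<^bsub>obj D (n - 1)\<^esub> w \<in> cyc_ann (colon R I x) (n - 1)"
    using ann_mult[OF x w(1)] by (simp add: cyc_ann_def)
  then obtain v where v: "v \<in> ann (colon R I x) (n - 1 - 1)" "diff D (n - 1 - 1) v = x \<odot>\<^bsub>obj D (n - 1)\<^esub> w"
    by (rule exact_at_cycE[OF J])
  obtain u where u: "u \<in> ann I (n - 1 - 1)" "x \<odot>\<^bsub>obj D (n - 1 - 1)\<^esub> u = v" using ann_div[OF I x v(1)] .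
  have uc: "u \<in> carrier (obj D (n - 1 - 1))" using u(1) by (rule ann_carrier)
  \<comment> \<open>The preimage \<open>w\<close> of \<open>z\<close> is changed by a coboundary so
    that \<open>x\<close> kills it, which moves it into \<open>ann (I + xR)\<close>.\<close>
  let ?y = "w \<ominus>\<^bsub>obj D (n - 1)\<^esub> diff D (n - 1 - 1) u"
  have "?y \<in> ann I (n - 1)" using annD(6)[OF I w(1) d_ann[OF I u(1)]] .
  moreover have "x \<odot>\<^bsub>obj D (n - 1)\<^esub> ?y = \<zero>\<^bsub>obj D (n - 1)\<^esub>"
    using x wc uc d_hom'(1)[OF uc] d_hom'(3)[OF x uc] u(2) v(2) by (simp add: D.smult_minus_distr D.minus_self)
  ultimately have "?y \<in> ann (adjoin R I x) (n - 1)" by (rule ann_adjoin[OF I x])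
  moreover have "diff D (n - 1) ?y = z"
    using d_hom'(6)[OF wc d_hom'(1)[OF uc]] w(2) dd[OF uc] d_hom'(1)[OF wc]
    by (simp add: D.M.minus_eq D.a_inv_zero)
  ultimately show "z \<in> bnd_ann (adjoin R I x) n" unfolding bnd_ann_def by (metis imageI)
qed

lemma mult_onto_cocycles:
  assumes I: "ideal I R" and x: "x \<in> carrier R" and K: "exact_at (adjoin R I x) (n + 1)"
    and z: "z \<in> cyc_ann (colon R I x) n"
  obtains y where "y \<in> cyc_ann I n" "x \<odot>\<^bsub>obj D n\<^esub> y = z"
proof -
  have zJ: "z \<in> ann (colon R I x) n" and dz: "diff D n z = \<zero>\<^bsub>obj D (n + 1)\<^esub>" using z by (auto simp: cyc_ann_def)
  obtain u where u: "u \<in> ann I n" "x \<odot>\<^bsub>obj D n\<^esub> u = z" using ann_div[OF I x zJ] .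
  have uc: "u \<in> carrier (obj D n)" using u(1) by (rule ann_carrier)
  have "diff D n u \<in> ann I (n + 1)" using d_ann[OF I, of u "n + 1"] u(1) by simp
  moreover have "x \<odot>\<^bsub>obj D (n + 1)\<^esub> diff D n u = \<zero>\<^bsub>obj D (n + 1)\<^esub>"
    using d_hom(3)[OF x uc] u(2) dz by simp
  ultimately have "diff D n u \<in> ann (adjoin R I x) (n + 1)" by (rule ann_adjoin[OF I x])
  moreover have "diff D (n + 1) (diff D n u) = \<zero>\<^bsub>obj D (n + 1 + 1)\<^esub>" using dd[of u "n + 1"] uc by simp
  ultimately have "diff D n u \<in> bnd_ann (adjoin R I x) (n + 1)"
    using K unfolding exact_at_def cyc_ann_def by blast
  \<comment> \<open>The lift \<open>u\<close> of \<open>z\<close> need not be a cocycle, but its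
    differential lies in \<open>ann (I + xR)\<close> and is therefore also the differential of some
    \<open>v\<close> killed by \<open>x\<close>.\<close>
  then obtain v where v: "v \<in> ann (adjoin R I x) n" "diff D n v = diff D n u"
    unfolding bnd_ann_def by auto
  have vI: "v \<in> ann I n" using v(1) ann_anti[OF ideal_adjoin(2)[OF I x]] by blast
  have vc: "v \<in> carrier (obj D n)" using vI by (rule ann_carrier)
  have xv: "x \<odot>\<^bsub>obj D n\<^esub> v = \<zero>\<^bsub>obj D n\<^esub>" using v(1) ideal_adjoin(3)[OF I x] by (auto simp: ann_def)
  show ?thesis
  proof (rule that)
    show "u \<ominus>\<^bsub>obj D n\<^esub> v \<in> cyc_ann I n"
      using annD(6)[OF I u(1) vI] d_hom(6)[OF uc vc] v(2) d_hom(1)[OF uc] by (simp add: cyc_ann_def D.minus_self)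
    show "x \<odot>\<^bsub>obj D n\<^esub> (u \<ominus>\<^bsub>obj D n\<^esub> v) = z"
      using x uc vc xv u(2) by (simp add: D.smult_minus_distr) (use u(2) uc x in \<open>auto simp: D.M.minus_eq D.a_inv_zero\<close>)
  qed
qed

section \<open>Finite generation of the cohomology of \<open>Hom(R/I, D)\<close>\<close>

definition fg_at :: "'a set \<Rightarrow> int \<Rightarrow> bool"
  where "fg_at I n \<longleftrightarrow> (\<exists>S. set S \<subseteq> cyc_ann I n \<and> cyc_ann I n \<subseteq> gspan (obj D n) (carrier R) (bnd_ann I n) S)"

text \<open>In the long exact sequence \<open>H^n(ann (I + xR))\<close> lies between
  \<open>H^{n-1}(ann (I : x))\<close> and \<open>H^n(ann I)\<close>. The list \<open>W\<close>
  consists of the images of generators \<open>T\<close> under the connecting map; \<open>U\<close>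
  represents generators of the image in \<open>H^n(ann I)\<close>, which is finitely generated by
  \<open>submodule_noetherian\<close>.\<close>

lemma fg_left:
  assumes I: "ideal I R" and x: "x \<in> carrier R"
    and J: "fg_at (colon R I x) (n - 1)" and K: "fg_at I n"
  shows "fg_at (adjoin R I x) n"
proof -
  let ?K = "adjoin R I x" and ?J = "colon R I x"
  note Ki = ideal_adjoin(1)[OF I x] and Ji = ideal_colon(1)[OF I x]
  have sub: "ann ?K n \<subseteq> ann I n" for n by (rule ann_anti[OF ideal_adjoin(2)[OF I x]])
  obtain S where S: "set S \<subseteq> cyc_ann I n" "cyc_ann I n \<subseteq> gspan (obj D n) (carrier R) (bnd_ann I n) S"
    using K unfolding fg_at_def by blast
  obtain T where T: "set T \<subseteq> cyc_ann ?J (n - 1)"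
    "cyc_ann ?J (n - 1) \<subseteq> gspan (obj D (n - 1)) (carrier R) (bnd_ann ?J (n - 1)) T"
    using J unfolding fg_at_def by blast
  have Sc: "set S \<subseteq> carrier (obj D n)" using S(1) cyc_annD(1)[OF I] by blast
  have "cyc_ann ?K n \<subseteq> gspan (obj D n) (carrier R) (bnd_ann I n) S"
    using S(2) sub[of n] by (auto simp: cyc_ann_def)
  from submodule_noetherian[OF noeth is_complexD(1)[OF complex] submodule_bnd_ann[OF I] Sc submodule_cyc_ann[OF Ki] this]
  obtain U where U: "set U \<subseteq> cyc_ann ?K n"
    "\<And>z. z \<in> cyc_ann ?K n \<Longrightarrow> \<exists>v\<in>gspan (obj D n) (carrier R) {\<zero>\<^bsub>obj D n\<^esub>} U. z \<ominus>\<^bsub>obj D n\<^esub> v \<in> bnd_ann I n" by blast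
  have "\<exists>w\<in>ann I (n - 1). x \<odot>\<^bsub>obj D (n - 1)\<^esub> w = \<tau>" if "\<tau> \<in> set T" for \<tau>
    using ann_div[OF I x, of \<tau> "n - 1"] that T(1) unfolding cyc_ann_def by blast
  then obtain lift where lift: "\<And>\<tau>. \<tau> \<in> set T \<Longrightarrow> lift \<tau> \<in> ann I (n - 1) \<and> x \<odot>\<^bsub>obj D (n - 1)\<^esub> lift \<tau> = \<tau>" by metis
  define W where "W = map (\<lambda>\<tau>. diff D (n - 1) (lift \<tau>)) T"
  have WK: "set W \<subseteq> cyc_ann ?K n"
  proof
    fix y assume "y \<in> set W"
    then obtain \<tau> where \<tau>: "\<tau> \<in> set T" "y = diff D (n - 1) (lift \<tau>)" by (auto simp: W_def)
    have lc: "lift \<tau> \<in> carrier (obj D (n - 1))" using lift[OF \<tau>(1)] ann_carrier by blast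
    have "x \<odot>\<^bsub>obj D n\<^esub> y = diff D (n - 1) \<tau>" using d_hom'(3)[OF x lc] lift[OF \<tau>(1)] \<tau>(2) by simp
    also have "\<dots> = \<zero>\<^bsub>obj D n\<^esub>" using \<tau>(1) T(1) by (auto simp: cyc_ann_def)
    finally have "y \<in> ann ?K n" using ann_adjoin[OF I x] d_ann[OF I] lift[OF \<tau>(1)] \<tau>(2) by blast
    then show "y \<in> cyc_ann ?K n" using dd[OF lc] \<tau>(2) by (simp add: cyc_ann_def)
  qed
  have UW: "set (U @ W) \<subseteq> cyc_ann ?K n" using U(1) WK by simp
  then have UWc: "set (U @ W) \<subseteq> carrier (obj D n)" using cyc_annD(1)[OF Ki] by blast
  let ?G = "gspan (obj D n) (carrier R) (bnd_ann ?K n) (U @ W)"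
  have smG: "submodule ?G R (obj D n)" by (rule D.submod_gspan[OF oneideal submodule_bnd_ann[OF Ki] UWc])
  note G = D.submodD[OF smG]
  have gens: "set (U @ W) \<subseteq> ?G" by (rule D.gspan_gens[OF submodule_bnd_ann[OF Ki] UWc])
  have base: "bnd_ann ?K n \<subseteq> ?G" by (rule D.gspan_base[OF oneideal submodule_bnd_ann[OF Ki] UWc])
  \<comment> \<open>\<open>X\<close> consists of the elements that have a lift along
    \<open>x\<close> with differential in \<open>?G\<close>. It contains the coboundaries and
    \<open>T\<close>, so the connecting map sends every cocycle of \<open>ann (I : x)\<close> into
    \<open>?G\<close>.\<close>
  define X where "X = {u \<in> carrier (obj D (n - 1)). \<exists>w\<in>ann I (n - 1). x \<odot>\<^bsub>obj D (n - 1)\<^esub> w = u \<and> diff D (n - 1) w \<in> ?G}"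
  have X: "submodule X R (obj D (n - 1))"
  proof (rule D.submod_intro)
    show "\<zero>\<^bsub>obj D (n - 1)\<^esub> \<in> X"
      unfolding X_def using annD(2)[OF I, of "n - 1"] G(2) d_hom'(4)[of n] x
      by (intro CollectI conjI bexI[of _ "\<zero>\<^bsub>obj D (n - 1)\<^esub>"]) auto
    fix a assume "a \<in> X"
    then obtain w where a: "a \<in> carrier (obj D (n - 1))" "w \<in> ann I (n - 1)" "x \<odot>\<^bsub>obj D (n - 1)\<^esub> w = a" "diff D (n - 1) w \<in> ?G"
      unfolding X_def by blast
    have wc: "w \<in> carrier (obj D (n - 1))" using a(2) by (rule ann_carrier)
    show "c \<odot>\<^bsub>obj D (n - 1)\<^esub> a \<in> X" if c: "c \<in> carrier R" for c
    proof -
      have "x \<odot>\<^bsub>obj D (n - 1)\<^esub> (c \<odot>\<^bsub>obj D (n - 1)\<^esub> w) = c \<odot>\<^bsub>obj D (n - 1)\<^esub> a"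
        using D.smult_comm[OF x c wc] a(3) by simp
      moreover have "diff D (n - 1) (c \<odot>\<^bsub>obj D (n - 1)\<^esub> w) \<in> ?G" using d_hom'(3)[OF c wc] G(4)[OF c a(4)] by simp
      ultimately show ?thesis unfolding X_def using annD(4)[OF I c a(2)] a(1) c by blast
    qed
    fix b assume "b \<in> X"
    then obtain v where b: "b \<in> carrier (obj D (n - 1))" "v \<in> ann I (n - 1)" "x \<odot>\<^bsub>obj D (n - 1)\<^esub> v = b" "diff D (n - 1) v \<in> ?G"
      unfolding X_def by blast
    have vc: "v \<in> carrier (obj D (n - 1))" using b(2) by (rule ann_carrier)
    have "x \<odot>\<^bsub>obj D (n - 1)\<^esub> (w \<oplus>\<^bsub>obj D (n - 1)\<^esub> v) = a \<oplus>\<^bsub>obj D (n - 1)\<^esub> b"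
      using D.smult_r_distr[OF x wc vc] a(3) b(3) by simp
    moreover have "diff D (n - 1) (w \<oplus>\<^bsub>obj D (n - 1)\<^esub> v) \<in> ?G" using d_hom'(2)[OF wc vc] G(3)[OF a(4) b(4)] by simp
    ultimately show "a \<oplus>\<^bsub>obj D (n - 1)\<^esub> b \<in> X" unfolding X_def using annD(3)[OF I a(2) b(2)] a(1) b(1) by blast
  qed (auto simp: X_def)
  have "gspan (obj D (n - 1)) (carrier R) (bnd_ann ?J (n - 1)) T \<subseteq> X"
  proof (rule D.gspan_minimal[OF X])
    show "bnd_ann ?J (n - 1) \<subseteq> X"
    proof
      fix u assume "u \<in> bnd_ann ?J (n - 1)"
      then obtain v where v: "v \<in> ann ?J (n - 1 - 1)" "u = diff D (n - 1 - 1) v" unfolding bnd_ann_def by blast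
      obtain y where y: "y \<in> ann I (n - 1 - 1)" "x \<odot>\<^bsub>obj D (n - 1 - 1)\<^esub> y = v" using ann_div[OF I x v(1)] .
      have yc: "y \<in> carrier (obj D (n - 1 - 1))" using y(1) by (rule ann_carrier)
      have "x \<odot>\<^bsub>obj D (n - 1)\<^esub> diff D (n - 1 - 1) y = u" using d_hom'(3)[OF x yc] y(2) v(2) by simp
      moreover have "diff D (n - 1) (diff D (n - 1 - 1) y) \<in> ?G" using dd[OF yc] G(2) by simp
      moreover have "u \<in> carrier (obj D (n - 1))" using v d_hom'(1) ann_carrier by blast
      ultimately show "u \<in> X" unfolding X_def using d_ann[OF I y(1)] by blast
    qed
    show "set T \<subseteq> X"
    proof
      fix \<tau> assume \<tau>: "\<tau> \<in> set T"
      then have "diff D (n - 1) (lift \<tau>) \<in> ?G" using gens by (auto simp: W_def)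
      moreover have "\<tau> \<in> carrier (obj D (n - 1))" using \<tau> T(1) cyc_annD(1)[OF Ji] by blast
      ultimately show "\<tau> \<in> X" unfolding X_def using lift[OF \<tau>] by blast
    qed
  qed simp
  then have JX: "cyc_ann ?J (n - 1) \<subseteq> X" using T(2) by blast
  have "cyc_ann ?K n \<subseteq> ?G"
  proof
    fix z assume z: "z \<in> cyc_ann ?K n"
    obtain v where v: "v \<in> gspan (obj D n) (carrier R) {\<zero>\<^bsub>obj D n\<^esub>} U" "z \<ominus>\<^bsub>obj D n\<^esub> v \<in> bnd_ann I n" using U(2)[OF z] by blast
    have vG: "v \<in> ?G" and vK: "v \<in> cyc_ann ?K n"
      using v(1) D.gspan_minimal[OF smG, of "{\<zero>\<^bsub>obj D n\<^esub>}" U "carrier R"]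
        D.gspan_minimal[OF submodule_cyc_ann[OF Ki], of "{\<zero>\<^bsub>obj D n\<^esub>}" n U "carrier R"] gens G(2) U(1) cyc_annD(2)[OF Ki]
      by auto
    obtain w where w: "w \<in> ann I (n - 1)" "z \<ominus>\<^bsub>obj D n\<^esub> v = diff D (n - 1) w" using v(2) unfolding bnd_ann_def by blast
    have wc: "w \<in> carrier (obj D (n - 1))" using w(1) by (rule ann_carrier)
    have "diff D (n - 1) w \<in> cyc_ann ?K n" using cyc_annD(6)[OF Ki z vK] w(2) by simp
    then have "x \<odot>\<^bsub>obj D n\<^esub> diff D (n - 1) w = \<zero>\<^bsub>obj D n\<^esub>"
      using ideal_adjoin(3)[OF I x] by (auto simp: cyc_ann_def ann_def)
    then have "diff D (n - 1) (x \<odot>\<^bsub>obj D (n - 1)\<^esub> w) = \<zero>\<^bsub>obj D n\<^esub>" using d_hom'(3)[OF x wc] by simp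
    then have "x \<odot>\<^bsub>obj D (n - 1)\<^esub> w \<in> cyc_ann ?J (n - 1)" using ann_mult[OF x w(1)] by (simp add: cyc_ann_def)
    then have "x \<odot>\<^bsub>obj D (n - 1)\<^esub> w \<in> X" using JX by blast
    then obtain y where y: "y \<in> ann I (n - 1)" "x \<odot>\<^bsub>obj D (n - 1)\<^esub> y = x \<odot>\<^bsub>obj D (n - 1)\<^esub> w" "diff D (n - 1) y \<in> ?G"
      unfolding X_def by blast
    have yc: "y \<in> carrier (obj D (n - 1))" using y(1) by (rule ann_carrier)
    \<comment> \<open>Two lifts of the same element differ by an element of
      \<open>ann (I + xR)\<close>, whose differential is a coboundary there.\<close>
    have "x \<odot>\<^bsub>obj D (n - 1)\<^esub> (w \<ominus>\<^bsub>obj D (n - 1)\<^esub> y) = \<zero>\<^bsub>obj D (n - 1)\<^esub>"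
      using y(2) x wc yc by (simp add: D.smult_minus_distr D.minus_self)
    then have "w \<ominus>\<^bsub>obj D (n - 1)\<^esub> y \<in> ann ?K (n - 1)" by (rule ann_adjoin[OF I x annD(6)[OF I w(1) y(1)]])
    then have "diff D (n - 1) (w \<ominus>\<^bsub>obj D (n - 1)\<^esub> y) \<in> ?G" using base unfolding bnd_ann_def by blast
    then have "diff D (n - 1) w \<ominus>\<^bsub>obj D n\<^esub> diff D (n - 1) y \<in> ?G" using d_hom'(6)[OF wc yc] by simp
    then have "diff D (n - 1) w \<in> ?G" using D.submod_coset[OF smG _ y(3)] d_hom'(1)[OF wc] by blast
    then have "z \<ominus>\<^bsub>obj D n\<^esub> v \<in> ?G" using w(2) by simp
    then show "z \<in> ?G" using D.submod_coset[OF smG _ vG] z cyc_annD(1)[OF Ki] by blast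
  qed
  then show ?thesis unfolding fg_at_def using UW by blast
qed

text \<open>\<open>fg_left\<close> asks for \<open>(I : x)\<close> one degree lower, an ideal that
  is not under control. Therefore the outer induction runs over the degree for all ideals at once,
  and the inner one over the generators of \<open>I\<close>.\<close>

lemma fg_all:
  assumes "\<And>n. fg_at {\<zero>} n" "ideal I R"
  shows "fg_at I n"
proof -
  have "fg_at I (lo - 1 + int k)" if "ideal I R" for k I
    using that
  proof (induction k arbitrary: I)
    case 0
    have "carrier (obj D (lo - 1)) = {\<zero>\<^bsub>obj D (lo - 1)\<^esub>}" using below by simp
    then have "cyc_ann I (lo - 1) \<subseteq> bnd_ann I (lo - 1)"
      using cyc_annD(1)[OF 0, of "lo - 1"] bnd_annD(2)[OF 0, of "lo - 1"] by auto
    then show ?case unfolding fg_at_def by (intro exI[of _ "[]"]) auto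
  next
    case (Suc k)
    show ?case using noeth Suc.prems
    proof (induction I rule: ideal_fg_induct)
      case zero
      then show ?case using assms(1) .
    next
      case (adjoin I x)
      have "lo - 1 + int (Suc k) - 1 = lo - 1 + int k" by simp
      then show ?case using fg_left[OF adjoin(1,2) _ adjoin(3)] Suc.IH[OF ideal_colon(1)[OF adjoin(1,2)]] by metis
    qed
  qed
  from this[OF assms(2), of "nat (n - (lo - 1))"] show ?thesis
  proof (cases "n \<ge> lo - 1")
    case False
    then have "carrier (obj D n) = {\<zero>\<^bsub>obj D n\<^esub>}" using below by simp
    then have "cyc_ann I n \<subseteq> bnd_ann I n"
      using cyc_annD(1)[OF assms(2), of n] bnd_annD(2)[OF assms(2), of n] by auto
    then show ?thesis unfolding fg_at_def by (intro exI[of _ "[]"]) auto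
  qed auto
qed

text \<open>Divisibility of the cocycles by \<open>x \<in> m\<close> says \<open>H = mH\<close> for
  the finitely generated cohomology \<open>H\<close>, so \<open>H = 0\<close>.\<close>

lemma nakayama_at:
  assumes I: "ideal I R" and "fg_at I n" and x: "x \<in> max_ideal R"
    and div: "\<And>z. z \<in> cyc_ann I n \<Longrightarrow> \<exists>y\<in>cyc_ann I n. x \<odot>\<^bsub>obj D n\<^esub> y = z"
  shows "exact_at I n"
proof (rule ccontr)
  assume "\<not> exact_at I n"
  then have "\<not> cyc_ann I n \<subseteq> bnd_ann I n" by (simp add: exact_at_def)
  moreover obtain S where "set S \<subseteq> cyc_ann I n" "cyc_ann I n \<subseteq> gspan (obj D n) (carrier R) (bnd_ann I n) S"
    using assms(2) unfolding fg_at_def by blast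
  ultimately obtain X where "\<forall>a\<in>max_ideal R. \<forall>v\<in>cyc_ann I n. a \<odot>\<^bsub>obj D n\<^esub> v \<in> X" "\<not> cyc_ann I n \<subseteq> X"
    using nakayama_submodule[OF is_complexD(1)[OF complex] submodule_bnd_ann[OF I] _ submodule_cyc_ann[OF I]] by metis
  then show False using div x by (metis subsetI)
qed

text \<open>Take \<open>I\<close> maximal among the ideals that fail, and \<open>x\<close> in the
  maximal ideal but outside \<open>I\<close>. If \<open>(I : x)\<close> is larger than
  \<open>I\<close>, both outer terms of the exact sequence vanish. Otherwise \<open>x\<close> is
  regular modulo \<open>I\<close>, multiplication by \<open>x\<close> is onto in degree
  \<open>n\<close>, and \<open>nakayama_at\<close> applies.\<close>

lemma exact_above:
  assumes fg: "\<And>I n. ideal I R \<Longrightarrow> fg_at I n"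
    and top: "\<And>n. n > t \<Longrightarrow> exact_at (max_ideal R) n"
    and "ideal I R" "n > t"
  shows "exact_at I n"
proof (rule ccontr)
  assume "\<not> exact_at I n"
  \<comment> \<open>Failure in some degree above \<open>t\<close>, not in a fixed one, so that the
    larger ideals are known in degree \<open>n + 1\<close> as well.\<close>
  let ?C = "{I. ideal I R \<and> (\<exists>n>t. \<not> exact_at I n)}"
  have "I \<in> ?C" using assms \<open>\<not> exact_at I n\<close> by blast
  then obtain I where I: "I \<in> ?C" and max: "\<forall>K\<in>?C. I \<subseteq> K \<longrightarrow> K = I"
    using maximal_ideal_exists[of ?C] by blast
  then obtain n where Ii: "ideal I R" and n: "n > t" "\<not> exact_at I n" by blast
  have above: "exact_at K m" if "ideal K R" "I \<subseteq> K" "K \<noteq> I" "m > t" for K m using max that by blast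
  note m = idealD[OF ideal_max_ideal]
  have "\<one> \<notin> I"
  proof
    assume "\<one> \<in> I"
    then have "cyc_ann I n \<subseteq> {\<zero>\<^bsub>obj D n\<^esub>}" by (auto simp: cyc_ann_def ann_def)
    then show False using n(2) bnd_annD(2)[OF Ii] by (auto simp: exact_at_def)
  qed
  then have "I \<noteq> carrier R" using one_closed by blast
  then have Im: "I \<subseteq> max_ideal R" by (rule proper_ideal_subset_max_ideal[OF Ii])
  have "I \<noteq> max_ideal R" using top n by blast
  then obtain x where x: "x \<in> max_ideal R" "x \<notin> I" using Im by blast
  have xc: "x \<in> carrier R" using x m(1) by blast
  have K: "exact_at (adjoin R I x) m" if "m > t" for m
    using above[OF _ _ _ that] ideal_adjoin[OF Ii xc] x(2) by blast
  show False
  proof (cases "colon R I x = I")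
    case False
    have "exact_at (colon R I x) n" using above[OF ideal_colon[OF Ii xc] False n(1)] .
    then show False using exact_middle[OF Ii xc _ K[OF n(1)]] n(2) by blast
  next
    case True
    have "exact_at (adjoin R I x) (n + 1)" using K n(1) by simp
    then have "\<exists>y\<in>cyc_ann I n. x \<odot>\<^bsub>obj D n\<^esub> y = z" if "z \<in> cyc_ann I n" for z
      using mult_onto_cocycles[OF Ii xc, of n z] that True by metis
    then show False using nakayama_at[OF Ii fg[OF Ii] x(1)] n(2) by blast
  qed
qed

text \<open>
  Killing a regular element raises the top degree of the cohomology by one; a maximal regular
  sequence therefore leads from the top degree \<open>s\<close> of \<open>D\<close> to \<open>s + r\<close>, which has to be \<open>t\<close>.
\<close>

lemma top_degree:
  assumes fg: "\<And>I n. ideal I R \<Longrightarrow> fg_at I n"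
    and above: "\<And>I n. ideal I R \<Longrightarrow> n > t \<Longrightarrow> exact_at I n"
    and nonzero: "\<not> exact_at (max_ideal R) t"
    and reg: "regular_sequence R xs" "set xs \<subseteq> max_ideal R"
    and socle: "y \<in> carrier R" "y \<notin> Idl (set xs)" "\<And>x. x \<in> max_ideal R \<Longrightarrow> x \<otimes> y \<in> Idl (set xs)"
  shows "\<not> exact_at {\<zero>} (t - int (length xs)) \<and> (\<forall>n>t - int (length xs). exact_at {\<zero>} n)"
proof -
  note m = idealD[OF ideal_max_ideal]
  let ?I = "\<lambda>k. Idl (set (take k xs))"
  note Ik = regular_sequence_ideals(1)[OF reg(1)] and I0 = regular_sequence_ideals(2)[OF reg(1)]
  have step: "colon R (?I k) (xs ! k) = ?I k" "?I (Suc k) = adjoin R (?I k) (xs ! k)"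
    "xs ! k \<in> carrier R" "xs ! k \<in> max_ideal R" if k: "k < length xs" for k
    using regular_sequence_ideals(3-5)[OF reg(1) k] reg(2) nth_mem[OF k] by auto
  have up: "\<not> exact_at (?I (Suc k)) (q + 1) \<and> (\<forall>n>q + 1. exact_at (?I (Suc k)) n)"
    if k: "k < length xs" and q: "\<not> exact_at (?I k) q" "\<forall>n>q. exact_at (?I k) n" for k q
  proof (intro conjI allI impI notI)
    note s = step[OF k]
    show False if "exact_at (?I (Suc k)) (q + 1)"
    proof -
      have "\<exists>y\<in>cyc_ann (?I k) q. (xs ! k) \<odot>\<^bsub>obj D q\<^esub> y = z" if "z \<in> cyc_ann (?I k) q" for z
        using mult_onto_cocycles[OF Ik s(3), of k q z] that s(1,2) \<open>exact_at (?I (Suc k)) (q + 1)\<close> by metis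
      then show False using nakayama_at[OF Ik fg[OF Ik] s(4)] q(1) by blast
    qed
    show "exact_at (?I (Suc k)) n" if "n > q + 1" for n
      using exact_left[OF Ik s(3), of k n] q(2) that s(1,2) by simp
  qed
  have down: "exact_at (?I (Suc k)) n" if k: "k < length xs" and "\<forall>n. exact_at (?I k) n" for k n
    using exact_left[OF Ik step(3)[OF k], of k n] that(2) step(1,2)[OF k] by simp
  \<comment> \<open>The socle element gives \<open>(J : y) = m\<close>. Since \<open>J + yR\<close>
    has no cohomology in degree \<open>t + 1\<close>, the cocycles of \<open>ann m\<close> in degree
    \<open>t\<close> are \<open>y\<close> times cocycles of \<open>ann J\<close>, so exactness for
    \<open>J\<close> would give exactness for \<open>m\<close>.\<close>
  have top: "\<not> exact_at (?I (length xs)) t"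
  proof
    let ?J = "?I (length xs)"
    assume ex: "exact_at ?J t"
    have colon: "colon R ?J y = max_ideal R"
    proof
      have "\<one> \<notin> colon R ?J y" using socle(1,2) by (simp add: colon_def)
      then show "colon R ?J y \<subseteq> max_ideal R"
        using one_closed by (intro proper_ideal_subset_max_ideal ideal_colon Ik socle) blast
      show "max_ideal R \<subseteq> colon R ?J y" using socle(3) m(1) by (auto simp: colon_def)
    qed
    have "exact_at (adjoin R ?J y) (t + 1)" by (rule above[OF ideal_adjoin(1)[OF Ik socle(1)]]) simp
    have "exact_at (max_ideal R) t"
      unfolding exact_at_def
    proof
      fix z assume "z \<in> cyc_ann (max_ideal R) t"
      then obtain u where u: "u \<in> cyc_ann ?J t" "y \<odot>\<^bsub>obj D t\<^esub> u = z"
        using mult_onto_cocycles[OF Ik socle(1) \<open>exact_at (adjoin R ?J y) (t + 1)\<close>] colon by metis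
      then obtain w where w: "w \<in> ann ?J (t - 1)" "u = diff D (t - 1) w"
        using ex unfolding exact_at_def bnd_ann_def by blast
      have "y \<odot>\<^bsub>obj D (t - 1)\<^esub> w \<in> ann (max_ideal R) (t - 1)" using ann_mult[OF socle(1) w(1)] colon by simp
      moreover have "diff D (t - 1) (y \<odot>\<^bsub>obj D (t - 1)\<^esub> w) = z"
        using d_hom'(3)[OF socle(1) ann_carrier[OF w(1)]] w(2) u(2) by simp
      ultimately show "z \<in> bnd_ann (max_ideal R) t" unfolding bnd_ann_def by (metis imageI)
    qed
    then show False using nonzero by blast
  qed
  \<comment> \<open>If \<open>D\<close> were exact in all degrees, \<open>down\<close> would carry
    this along the whole sequence, against \<open>top\<close>.\<close>
  have "\<exists>n. \<not> exact_at (?I 0) n"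
  proof (rule ccontr)
    assume "\<not> ?thesis"
    then have "k \<le> length xs \<Longrightarrow> \<forall>n. exact_at (?I k) n" for k
      by (induction k) (use down in auto)
    then show False using top by blast
  qed
  then obtain n0 where n0: "\<not> exact_at (?I 0) n0" by blast
  have bound: "n \<le> t" if "\<not> exact_at (?I 0) n" for n using above[OF Ik[of 0], of n] that by force
  obtain q where q: "\<not> exact_at (?I 0) q" "\<forall>n>q. exact_at (?I 0) n"
  proof -
    \<comment> \<open>The degrees without exactness are at most \<open>t\<close>, so the greatest
      one is found as the least distance from \<open>t\<close>.\<close>
    let ?P = "\<lambda>k::nat. \<not> exact_at (?I 0) (t - int k)"
    have "?P (nat (t - n0))" using n0 bound[OF n0] by simp
    then have "?P (LEAST k. ?P k)" by (rule LeastI)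
    moreover have "exact_at (?I 0) n" if "n > t - int (LEAST k. ?P k)" for n
    proof (rule ccontr)
      assume c: "\<not> exact_at (?I 0) n"
      then have "?P (nat (t - n))" using bound[OF c] by simp
      then have "(LEAST k. ?P k) \<le> nat (t - n)" by (rule Least_le)
      then show False using that bound[OF c] by linarith
    qed
    ultimately show ?thesis using that by blast
  qed
  have "k \<le> length xs \<Longrightarrow> \<not> exact_at (?I k) (q + int k) \<and> (\<forall>n>q + int k. exact_at (?I k) n)" for k
  proof (induction k)
    case 0
    then show ?case using q by simp
  next
    case (Suc k)
    then show ?case using up[of k "q + int k"] by (simp add: algebra_simps)
  qed
  from this[of "length xs"] have fin: "\<not> exact_at (?I (length xs)) (q + int (length xs))" "\<forall>n>q + int (length xs). exact_at (?I (length xs)) n"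
    by auto
  \<comment> \<open>Both numbers are the top degree for the last ideal of the sequence.\<close>
  have "q + int (length xs) \<le> t" using above[OF Ik] fin(1) by (meson not_le)
  moreover have "t \<le> q + int (length xs)" using top fin(2) by (meson not_le)
  ultimately have "q = t - int (length xs)" by simp
  then show ?thesis using q I0 by simp
qed

end

section \<open>Quotient modules\<close>

context module
begin

lemma abelian_subgroup_submodule: "submodule K R M \<Longrightarrow> abelian_subgroup K M"
  by (intro abelian_subgroupI3 additive_subgroupI M.abelian_group_axioms submodule.axioms(1))

lemma coset_eq_iff:
  assumes K: "submodule K R M" and xy: "x \<in> carrier M" "y \<in> carrier M"
  shows "K +>\<^bsub>M\<^esub> x = K +>\<^bsub>M\<^esub> y \<longleftrightarrow> x \<ominus>\<^bsub>M\<^esub> y \<in> K"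
proof -
  interpret K: abelian_subgroup K M by (rule abelian_subgroup_submodule[OF K])
  note K' = submodD[OF K]
  have mem: "u \<in> K +>\<^bsub>M\<^esub> v \<longleftrightarrow> u \<ominus>\<^bsub>M\<^esub> v \<in> K" if uv: "u \<in> carrier M" "v \<in> carrier M" for u v
  proof
    assume "u \<in> K +>\<^bsub>M\<^esub> v"
    then obtain k where k: "k \<in> K" "u = k \<oplus>\<^bsub>M\<^esub> v" by (auto simp: a_r_coset_def')
    have "k \<in> carrier M" using k K'(1) by blast
    then have "u \<ominus>\<^bsub>M\<^esub> v = k" unfolding k(2) using uv(2) by algebra
    then show "u \<ominus>\<^bsub>M\<^esub> v \<in> K" using k by simp
  next
    assume "u \<ominus>\<^bsub>M\<^esub> v \<in> K"
    then show "u \<in> K +>\<^bsub>M\<^esub> v" using minus_add_cancel[OF uv] by (force simp: a_r_coset_def')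
  qed
  show ?thesis
  proof
    assume "K +>\<^bsub>M\<^esub> x = K +>\<^bsub>M\<^esub> y"
    moreover have "x \<in> K +>\<^bsub>M\<^esub> x" using mem[OF xy(1) xy(1)] K'(2) xy by (simp add: minus_self)
    ultimately show "x \<ominus>\<^bsub>M\<^esub> y \<in> K" using mem[OF xy] by simp
  next
    assume "x \<ominus>\<^bsub>M\<^esub> y \<in> K"
    then have "x \<in> K +>\<^bsub>M\<^esub> y" using mem[OF xy] by simp
    then show "K +>\<^bsub>M\<^esub> x = K +>\<^bsub>M\<^esub> y" using M.a_repr_independence[OF _ xy(2) submodule.axioms(1)[OF K]] by blast
  qed
qed

end

lemma carrier_quot_mod: "carrier (quot_mod M K) = (\<lambda>x. K +>\<^bsub>M\<^esub> x) ` carrier M"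
  by (auto simp: quot_mod_def A_RCOSETS_def' )

lemma zero_quot_mod: "\<zero>\<^bsub>quot_mod M K\<^esub> = K"
  by (simp add: quot_mod_def)

lemma quot_mod_zero_coset: "module R M \<Longrightarrow> submodule K R M \<Longrightarrow> K +>\<^bsub>M\<^esub> \<zero>\<^bsub>M\<^esub> = \<zero>\<^bsub>quot_mod M K\<^esub>"
proof -
  assume "module R M" and K: "submodule K R M"
  then interpret M: module R M by simp
  show ?thesis unfolding zero_quot_mod using M.submodD(1)[OF K] by (auto simp: a_r_coset_def' subset_iff)
qed

lemma add_quot_mod:
  assumes "module R M" "submodule K R M" "x \<in> carrier M" "y \<in> carrier M"
  shows "(K +>\<^bsub>M\<^esub> x) \<oplus>\<^bsub>quot_mod M K\<^esub> (K +>\<^bsub>M\<^esub> y) = K +>\<^bsub>M\<^esub> (x \<oplus>\<^bsub>M\<^esub> y)"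
proof -
  interpret M: module R M by fact
  interpret K: abelian_subgroup K M by (rule M.abelian_subgroup_submodule[OF assms(2)])
  show ?thesis using K.a_rcos_sum[OF assms(3,4)] by (simp add: quot_mod_def)
qed

lemma smult_quot_mod:
  assumes "module R M" "submodule K R M" "x \<in> carrier M" "c \<in> carrier R"
  shows "c \<odot>\<^bsub>quot_mod M K\<^esub> (K +>\<^bsub>M\<^esub> x) = K +>\<^bsub>M\<^esub> (c \<odot>\<^bsub>M\<^esub> x)"
proof -
  interpret M: module R M by fact
  note K = M.submodD[OF assms(2)]
  have "c \<odot>\<^bsub>quot_mod M K\<^esub> (K +>\<^bsub>M\<^esub> x) = {k \<oplus>\<^bsub>M\<^esub> c \<odot>\<^bsub>M\<^esub> (k' \<oplus>\<^bsub>M\<^esub> x) | k k'. k \<in> K \<and> k' \<in> K}"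
    by (auto simp: quot_mod_def set_add_def set_mult_def a_r_coset_def')
  also have "\<dots> = K +>\<^bsub>M\<^esub> (c \<odot>\<^bsub>M\<^esub> x)"
  proof (intro equalityI subsetI)
    fix u assume "u \<in> {k \<oplus>\<^bsub>M\<^esub> c \<odot>\<^bsub>M\<^esub> (k' \<oplus>\<^bsub>M\<^esub> x) | k k'. k \<in> K \<and> k' \<in> K}"
    then obtain k k' where k: "u = k \<oplus>\<^bsub>M\<^esub> c \<odot>\<^bsub>M\<^esub> (k' \<oplus>\<^bsub>M\<^esub> x)" "k \<in> K" "k' \<in> K" by blast
    have "k \<in> carrier M" "k' \<in> carrier M" using k K(1) by auto
    then have "u = (k \<oplus>\<^bsub>M\<^esub> c \<odot>\<^bsub>M\<^esub> k') \<oplus>\<^bsub>M\<^esub> c \<odot>\<^bsub>M\<^esub> x" unfolding k(1) using assms(3,4) by algebra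
    then show "u \<in> K +>\<^bsub>M\<^esub> (c \<odot>\<^bsub>M\<^esub> x)" using K(3)[OF k(2) K(4)[OF assms(4) k(3)]] by (auto simp: a_r_coset_def')
  next
    fix u assume "u \<in> K +>\<^bsub>M\<^esub> (c \<odot>\<^bsub>M\<^esub> x)"
    then obtain k where k: "k \<in> K" "u = k \<oplus>\<^bsub>M\<^esub> c \<odot>\<^bsub>M\<^esub> x" by (auto simp: a_r_coset_def')
    then have "u = k \<oplus>\<^bsub>M\<^esub> c \<odot>\<^bsub>M\<^esub> (\<zero>\<^bsub>M\<^esub> \<oplus>\<^bsub>M\<^esub> x)" using assms(3) by simp
    then show "u \<in> {k \<oplus>\<^bsub>M\<^esub> c \<odot>\<^bsub>M\<^esub> (k' \<oplus>\<^bsub>M\<^esub> x) | k k'. k \<in> K \<and> k' \<in> K}" using k(1) K(2) by blast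
  qed
  finally show ?thesis .
qed

lemma module_quot_mod:
  assumes "module R M" "submodule K R M"
  shows "module R (quot_mod M K)"
proof -
  interpret M: module R M by fact
  note simps = add_quot_mod[OF assms] smult_quot_mod[OF assms] quot_mod_zero_coset[OF assms, symmetric]
  show ?thesis
  proof (rule moduleI)
    show "cring R" by (rule M.R.is_cring)
    show "abelian_group (quot_mod M K)"
    proof (rule abelian_groupI)
      fix X assume "X \<in> carrier (quot_mod M K)"
      then obtain x where x: "X = K +>\<^bsub>M\<^esub> x" "x \<in> carrier M" by (auto simp: carrier_quot_mod)
      have "(K +>\<^bsub>M\<^esub> \<ominus>\<^bsub>M\<^esub> x) \<oplus>\<^bsub>quot_mod M K\<^esub> X = \<zero>\<^bsub>quot_mod M K\<^esub>" using x by (simp add: simps M.M.l_neg)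
      then show "\<exists>Y\<in>carrier (quot_mod M K). Y \<oplus>\<^bsub>quot_mod M K\<^esub> X = \<zero>\<^bsub>quot_mod M K\<^esub>"
        using x by (auto simp: carrier_quot_mod)
    qed (auto simp: carrier_quot_mod simps M.M.a_ac)
  qed (auto simp: carrier_quot_mod simps M.smult_l_distr M.smult_r_distr M.smult_assoc1)
qed

lemma quot_mod_hom:
  assumes "module R M" "submodule K R M"
  shows "(\<lambda>x. K +>\<^bsub>M\<^esub> x) \<in> mod_hom R M (quot_mod M K)"
  by (rule mod_homI) (auto simp: carrier_quot_mod add_quot_mod[OF assms] smult_quot_mod[OF assms])

section \<open>Normalized dualizing complexes\<close>

text \<open>Subtraction in \<open>sub_mod M H\<close> goes through an inverse sought in the carrier
  \<open>H\<close>, so unlike sums and scalar multiples it does not agree with that of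
  \<open>M\<close> by definition.\<close>

lemma sub_mod_minus:
  assumes "module R M" "submodule H R M" "x \<in> H" "y \<in> H"
  shows "x \<ominus>\<^bsub>sub_mod M H\<^esub> y = x \<ominus>\<^bsub>M\<^esub> y"
proof -
  interpret M: module R M by fact
  interpret S: module R "sub_mod M H" by (rule module_sub_mod[OF assms(1,2)])
  have H: "H \<subseteq> carrier M" by (rule M.submodD(1)[OF assms(2)])
  have m: "x \<ominus>\<^bsub>sub_mod M H\<^esub> y \<in> H" using S.M.minus_closed[of x y] assms(3,4) by simp
  have "(x \<ominus>\<^bsub>sub_mod M H\<^esub> y) \<oplus>\<^bsub>M\<^esub> y = x" using S.minus_add_cancel[of x y] assms(3,4) by simp
  moreover have "x \<in> carrier M" "y \<in> carrier M" "x \<ominus>\<^bsub>sub_mod M H\<^esub> y \<in> carrier M" using H m assms(3,4) by auto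
  ultimately show ?thesis by (metis M.M.add.right_cancel M.M.minus_closed M.minus_add_cancel)
qed

lemma cyc_inj_sub_mod:
  assumes "module R M" "submodule H R M" "V \<subseteq> H" "cyc_inj R (sub_mod M H) V B"
  shows "cyc_inj R M V B"
  unfolding cyc_inj_def
proof (intro allI impI, elim conjE)
  fix I x y
  assume *: "ideal I R" "x \<in> carrier R" "y \<in> V" "\<forall>c\<in>colon R I x. c \<odot>\<^bsub>M\<^esub> y \<in> B"
  interpret M: module R M by fact
  obtain z where z: "z \<in> V" "\<And>a. a \<in> I \<Longrightarrow> a \<odot>\<^bsub>M\<^esub> z \<in> B" "x \<odot>\<^bsub>M\<^esub> z \<ominus>\<^bsub>sub_mod M H\<^esub> y \<in> B"
    using cyc_injD[OF assms(4) *(1-3)] *(4) by (metis sub_mod_simps(4))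
  have "x \<odot>\<^bsub>M\<^esub> z \<in> H" using z(1) assms(3) M.submodD(4)[OF assms(2) *(2)] by blast
  then have "x \<odot>\<^bsub>M\<^esub> z \<ominus>\<^bsub>M\<^esub> y \<in> B" using z(3) sub_mod_minus[OF assms(1,2)] *(3) assms(3) by (metis subsetD)
  then show "\<exists>z\<in>V. (\<forall>a\<in>I. a \<odot>\<^bsub>M\<^esub> z \<in> B) \<and> x \<odot>\<^bsub>M\<^esub> z \<ominus>\<^bsub>M\<^esub> y \<in> B" using z by blast
qed

section \<open>The torsion subcomplex and the cohomology of \<open>Hom(R/m, D)\<close>\<close>

context cyc_inj_complex
begin

abbreviation T :: "int \<Rightarrow> 'd set" where "T n \<equiv> tors (obj D n)"
abbreviation torsD :: "('a, 'd) cochain" where "torsD \<equiv> torsion_cpx (max_ideal R) R D"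

lemma d_torsion: "x \<in> T n \<Longrightarrow> diff D n x \<in> T (n + 1)"
proof -
  assume x: "x \<in> T n"
  have xc: "x \<in> carrier (obj D n)" using x by (simp add: torsion_part_def)
  have "\<exists>k::nat. u [^] k \<odot>\<^bsub>obj D (n + 1)\<^esub> diff D n x = \<zero>\<^bsub>obj D (n + 1)\<^esub>" if u: "u \<in> max_ideal R" for u
  proof -
    obtain k :: nat where k: "u [^] k \<odot>\<^bsub>obj D n\<^esub> x = \<zero>\<^bsub>obj D n\<^esub>"
      using x u torsion_iff[OF is_complexD(1)[OF complex]] by blast
    have "u [^] k \<in> carrier R" using u idealD(1)[OF ideal_max_ideal] by auto
    then show ?thesis using d_hom(3)[OF _ xc, of "u [^] k"] k d_hom(4)[of n] by (intro exI[of _ k]) simp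
  qed
  then show ?thesis unfolding torsion_iff[OF is_complexD(1)[OF complex]] using d_hom(1)[OF xc] by blast
qed

lemma torsD_simps: "obj torsD n = sub_mod (obj D n) (T n)" "diff torsD n = diff D n"
  by (simp_all add: torsion_cpx_def)

lemma T_carrier: "x \<in> T n \<Longrightarrow> x \<in> carrier (obj D n)"
  by (simp add: torsion_part_def)

lemma submodule_T: "submodule (T n) R (obj D n)"
  by (rule submodule_torsion[OF is_complexD(1)[OF complex]])

lemma is_complex_torsD: "is_complex R torsD"
  unfolding is_complex_def torsD_simps sub_mod_simps
proof (intro allI conjI ballI)
  fix n
  show "module R (sub_mod (obj D n) (T n))" by (rule module_sub_mod[OF is_complexD(1)[OF complex] submodule_T])
  show "diff D n \<in> mod_hom R (sub_mod (obj D n) (T n)) (sub_mod (obj D (n + 1)) (T (n + 1)))"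
    by (rule mod_homI) (auto simp: d_torsion d_hom T_carrier)
  show "diff D (n + 1) (diff D n x) = \<zero>\<^bsub>obj D (n + 2)\<^esub>" if "x \<in> T n" for x
    using dd[of x "n + 1"] T_carrier[OF that] by (simp add: add.assoc)
qed

lemma cocycles_torsD: "cocycles torsD n = {x \<in> T n. diff D n x = \<zero>\<^bsub>obj D (n + 1)\<^esub>}"
  by (simp add: cocycles_def torsD_simps)

lemma coboundaries_torsD: "coboundaries torsD n = diff D (n - 1) ` T (n - 1)"
  by (simp add: coboundaries_def torsD_simps)

lemma submodule_ZT: "submodule (cocycles torsD n) R (obj D n)"
  unfolding cocycles_torsD
  by (rule D.submod_intro) (use D.submodD[OF submodule_T] in \<open>auto simp: d_hom T_carrier\<close>)

lemma submodule_BT: "submodule (coboundaries torsD n) R (obj D n)"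
  unfolding coboundaries_torsD
  by (rule submod_image[OF is_complexD(1)[OF complex] is_complexD(1)[OF complex] is_complexD(3)[OF complex] submodule_T])

text \<open>Induction over the degree along \<open>0 \<rightarrow> Z \<rightarrow> T \<rightarrow> B
  \<rightarrow> 0\<close> and \<open>0 \<rightarrow> B \<rightarrow> Z \<rightarrow> H \<rightarrow>
  0\<close>: the term \<open>T\<close> is cyclically injective by \<open>cyc_inj_torsion\<close>,
  and \<open>H\<close> is zero or, in degree \<open>t\<close>, cyclically injective by
  assumption.\<close>

lemma cyc_inj_ZT_BT:
  assumes ex: "\<And>n. n \<noteq> t \<Longrightarrow> cocycles torsD n \<subseteq> coboundaries torsD n"
    and t: "cyc_inj R (obj D t) (cocycles torsD t) (coboundaries torsD t)"
  shows "cyc_inj R (obj D n) (cocycles torsD n) {\<zero>\<^bsub>obj D n\<^esub>} \<and> cyc_inj R (obj D n) (coboundaries torsD n) {\<zero>\<^bsub>obj D n\<^esub>}"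
proof -
  let ?P = "\<lambda>n. cyc_inj R (obj D n) (cocycles torsD n) {\<zero>\<^bsub>obj D n\<^esub>} \<and> cyc_inj R (obj D n) (coboundaries torsD n) {\<zero>\<^bsub>obj D n\<^esub>}"
  have base: "?P n" if "n < lo" for n
  proof -
    have "V = {\<zero>\<^bsub>obj D n\<^esub>}" if "submodule V R (obj D n)" for V
      using D.submodD(1,2)[OF that] below[OF \<open>n < lo\<close>] by auto
    moreover have "cyc_inj R (obj D n) {\<zero>\<^bsub>obj D n\<^esub>} {\<zero>\<^bsub>obj D n\<^esub>}"
      using idealD(1) by (auto simp: cyc_inj_def D.minus_self subset_iff)
    ultimately show ?thesis using submodule_ZT submodule_BT by metis
  qed
  have step: "?P (n + 1)" if P: "?P n" for n
  proof -
    have "cyc_inj R (obj D n) (T n) (cocycles torsD n)"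
      by (rule cyc_inj_quotient[OF noeth is_complexD(1)[OF complex] submodule_T submodule_ZT])
        (use P cyc_inj_torsion[OF is_complexD(1)[OF complex] cyc] in \<open>auto simp: cocycles_torsD\<close>)
    then have "cyc_inj R (obj D (n + 1)) (diff D n ` T n) {\<zero>\<^bsub>obj D (n + 1)\<^esub>}"
      unfolding cocycles_torsD
      by (rule cyc_inj_image[OF is_complexD(1)[OF complex] is_complexD(1)[OF complex] is_complexD(2)[OF complex] submodule_T])
    then have B: "cyc_inj R (obj D (n + 1)) (coboundaries torsD (n + 1)) {\<zero>\<^bsub>obj D (n + 1)\<^esub>}"
      by (simp add: coboundaries_torsD)
    have BZ: "coboundaries torsD (n + 1) \<subseteq> cocycles torsD (n + 1)"
      by (rule coboundaries_subset_cocycles[OF is_complex_torsD])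
    show ?thesis
    proof (cases "n + 1 = t")
      case True
      then show ?thesis
        using cyc_inj_extension[OF noeth is_complexD(1)[OF complex] submodule_ZT submodule_BT BZ B] t B by blast
    next
      case False
      then have "cocycles torsD (n + 1) = coboundaries torsD (n + 1)" using ex BZ by blast
      then show ?thesis using B by simp
    qed
  qed
  have "?P (lo - 1 + int k)" for k
  proof (induction k)
    case (Suc k)
    then show ?case using step[of "lo - 1 + int k"] by (simp add: algebra_simps)
  qed (use base in simp)
  from this[of "nat (n - (lo - 1))"] show ?thesis using base[of n] by (cases "n \<ge> lo - 1") auto
qed

lemma ann_max_ideal_torsion: "x \<in> ann (max_ideal R) n \<Longrightarrow> x \<in> T n"
  unfolding torsion_iff[OF is_complexD(1)[OF complex]]
  using idealD(1)[OF ideal_max_ideal] by (auto simp: ann_def intro!: exI[of _ "1::nat"])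

text \<open>Elements killed by \<open>m\<close> are torsion, so \<open>ann m\<close> lives inside
  the torsion complex. Cyclic injectivity of its cocycles and coboundaries makes passage to elements
  killed by \<open>m\<close> exact. So the cohomology of \<open>ann m\<close> is the part of the
  cohomology of \<open>torsD\<close> killed by \<open>m\<close>: zero outside degree
  \<open>t\<close>, and containing the class of \<open>z\<close> in degree \<open>t\<close>.\<close>

lemma max_ideal_cohomology:
  assumes ex: "\<And>n. n \<noteq> t \<Longrightarrow> cocycles torsD n \<subseteq> coboundaries torsD n"
    and t: "cyc_inj R (obj D t) (cocycles torsD t) (coboundaries torsD t)"
    and z: "z \<in> cocycles torsD t" "z \<notin> coboundaries torsD t"
      "\<And>c. c \<in> max_ideal R \<Longrightarrow> c \<odot>\<^bsub>obj D t\<^esub> z \<in> coboundaries torsD t"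
  shows "n \<noteq> t \<Longrightarrow> exact_at (max_ideal R) n" "\<not> exact_at (max_ideal R) t"
proof -
  note cZB = cyc_inj_ZT_BT[OF ex t]
  note m = idealD(1)[OF ideal_max_ideal]
  show "exact_at (max_ideal R) n" if n: "n \<noteq> t"
    unfolding exact_at_def
  proof
    fix y assume y: "y \<in> cyc_ann (max_ideal R) n"
    then have yann: "y \<in> ann (max_ideal R) n" by (simp add: cyc_ann_def)
    have "y \<in> coboundaries torsD n"
      using y ex[OF n] ann_max_ideal_torsion by (auto simp: cyc_ann_def cocycles_torsD)
    then obtain u where u: "u \<in> T (n - 1)" "y = diff D (n - 1) u" by (auto simp: coboundaries_torsD)
    note uc = T_carrier[OF u(1)]
    have "a \<odot>\<^bsub>obj D (n - 1)\<^esub> u \<in> cocycles torsD (n - 1)" if a: "a \<in> max_ideal R" for a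
    proof -
      have ac: "a \<in> carrier R" using a m by blast
      have "diff D (n - 1) (a \<odot>\<^bsub>obj D (n - 1)\<^esub> u) = \<zero>\<^bsub>obj D n\<^esub>"
        using d_hom'(3)[OF ac uc] yann a u(2) by (simp add: ann_def)
      then show ?thesis using D.submodD(4)[OF submodule_T ac u(1)] by (simp add: cocycles_torsD)
    qed
    then obtain w where w: "w \<in> cocycles torsD (n - 1)"
      "\<forall>a\<in>max_ideal R. a \<odot>\<^bsub>obj D (n - 1)\<^esub> (u \<ominus>\<^bsub>obj D (n - 1)\<^esub> w) = \<zero>\<^bsub>obj D (n - 1)\<^esub>"
      using cyc_inj_lift[OF noeth is_complexD(1)[OF complex] submodule_ZT conjunct1[OF cZB] ideal_max_ideal uc] by blast
    have wc: "w \<in> carrier (obj D (n - 1))" "diff D (n - 1) w = \<zero>\<^bsub>obj D n\<^esub>" using w(1) T_carrier by (auto simp: cocycles_torsD)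
    have "diff D (n - 1) (u \<ominus>\<^bsub>obj D (n - 1)\<^esub> w) = y"
      using d_hom'(6)[OF uc wc(1)] wc(2) u(2) d_hom'(1)[OF uc] by (simp add: D.M.minus_eq D.a_inv_zero)
    moreover have "u \<ominus>\<^bsub>obj D (n - 1)\<^esub> w \<in> ann (max_ideal R) (n - 1)" using w(2) uc wc(1) by (simp add: ann_def)
    ultimately show "y \<in> bnd_ann (max_ideal R) n" unfolding bnd_ann_def by blast
  qed
  show "\<not> exact_at (max_ideal R) t"
  proof
    assume ext: "exact_at (max_ideal R) t"
    have zc: "z \<in> carrier (obj D t)" using z(1) T_carrier by (simp add: cocycles_torsD)
    obtain w where w: "w \<in> coboundaries torsD t"
      "\<forall>a\<in>max_ideal R. a \<odot>\<^bsub>obj D t\<^esub> (z \<ominus>\<^bsub>obj D t\<^esub> w) = \<zero>\<^bsub>obj D t\<^esub>"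
      using cyc_inj_lift[OF noeth is_complexD(1)[OF complex] submodule_BT conjunct2[OF cZB] ideal_max_ideal zc] z(3) by blast
    have "w \<in> cocycles torsD t" using w(1) coboundaries_subset_cocycles[OF is_complex_torsD] by blast
    then have "z \<ominus>\<^bsub>obj D t\<^esub> w \<in> cocycles torsD t" using D.submodD(6)[OF submodule_ZT z(1)] by blast
    then have "z \<ominus>\<^bsub>obj D t\<^esub> w \<in> cyc_ann (max_ideal R) t"
      using w(2) T_carrier by (auto simp: cocycles_torsD cyc_ann_def ann_def)
    then obtain v where v: "v \<in> ann (max_ideal R) (t - 1)" "diff D (t - 1) v = z \<ominus>\<^bsub>obj D t\<^esub> w"
      by (rule exact_at_cycE[OF ext])
    then have "z \<ominus>\<^bsub>obj D t\<^esub> w \<in> coboundaries torsD t"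
      using ann_max_ideal_torsion unfolding coboundaries_torsD by (metis imageI)
    then have "z \<in> coboundaries torsD t" by (rule D.submod_coset[OF submodule_BT _ w(1) zc])
    then show False using z(2) by blast
  qed
qed

end

text \<open>A regular sequence of length \<open>depth R\<close> cannot be prolonged inside the
  maximal ideal, so every element of that ideal is a zero divisor modulo it, and
  \<open>socle_exists\<close> applies.\<close>

lemma (in noetherian_local_ring) maximal_regular_sequence:
  assumes "depth R = enat r"
  shows "\<exists>xs y. regular_sequence R xs \<and> set xs \<subseteq> max_ideal R \<and> length xs = r \<and>
    y \<in> carrier R \<and> y \<notin> Idl (set xs) \<and> (\<forall>x\<in>max_ideal R. x \<otimes> y \<in> Idl (set xs))"
proof -
  let ?S = "{enat (length xs) | xs. regular_sequence R xs \<and> set xs \<subseteq> max_ideal R}"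
  note m = idealD[OF ideal_max_ideal]
  have "Idl {} = {\<zero>}"
    using genideal_minimal[OF zeroideal, of "{}"] idealD(2)[OF genideal_ideal[of "{}"]] by auto
  then have "regular_sequence R []" using one_not_zero by (auto simp: regular_sequence_def)
  then have "enat (length []) \<in> ?S" by fastforce
  then have ne: "?S \<noteq> {}" by blast
  have Sup: "Sup ?S = enat r" using assms by (simp add: depth_def)
  \<comment> \<open>A finite supremum in \<open>enat\<close> over a nonempty set is attained;
    nonemptiness comes from the empty sequence.\<close>
  then have "finite ?S" "Max ?S = enat r" using ne unfolding Sup_enat_def by (auto split: if_splits)
  then have "enat r \<in> ?S" using Max_in[OF _ ne] by metis
  then obtain xs where xs: "regular_sequence R xs" "set xs \<subseteq> max_ideal R" "length xs = r" by auto
  have xsc: "set xs \<subseteq> carrier R" using xs(2) m(1) by blast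
  have "\<exists>a\<in>carrier R. a \<notin> Idl (set xs) \<and> x \<otimes> a \<in> Idl (set xs)" if x: "x \<in> max_ideal R" for x
  proof (rule ccontr)
    assume contra: "\<not> ?thesis"
    have sub: "set (xs @ [x]) \<subseteq> max_ideal R" using xs(2) x by simp
    have "Idl (set (xs @ [x])) \<subseteq> max_ideal R" by (rule genideal_minimal[OF ideal_max_ideal sub])
    then have "Idl (set (xs @ [x])) \<noteq> carrier R" using one_notin_max_ideal by auto
    moreover have "a \<in> Idl (set (take k (xs @ [x])))"
      if "k < length (xs @ [x])" "a \<in> carrier R" "(xs @ [x]) ! k \<otimes> a \<in> Idl (set (take k (xs @ [x])))" for k a
    proof (cases "k < length xs")
      case True
      then show ?thesis using that(2,3) xs(1) by (simp add: regular_sequence_def nth_append)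
    next
      case False
      then have "k = length xs" using that(1) by simp
      then show ?thesis using that(2,3) contra by auto
    qed
    ultimately have "regular_sequence R (xs @ [x])" using sub m(1) unfolding regular_sequence_def by blast
    then have "enat (length (xs @ [x])) \<in> ?S" using sub by blast
    then have "enat (length (xs @ [x])) \<le> enat r" unfolding Sup[symmetric] by (rule Sup_upper)
    then show False using xs(3) by simp
  qed
  then obtain y where "y \<in> carrier R" "y \<notin> Idl (set xs)" "\<forall>x\<in>max_ideal R. x \<otimes> y \<in> Idl (set xs)"
    using socle_exists[OF genideal_ideal[OF xsc]] by blast
  then show ?thesis using xs by blast
qed

text \<open>Here the normalization is used: the residue field inside \<open>E\<close> becomes the
  class \<open>z\<close> of \<open>max_ideal_cohomology\<close>. The finitely generated cohomology
  of \<open>D\<close> feeds Nakayama's lemma, first for the annihilator complexes and at the end for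
  the submodule \<open>X\<close>.\<close>

lemma (in noetherian_local_ring) dualizing_top_degree:
  fixes D :: "('a, 'd) cochain"
  assumes dim: "krull_dim R = enat t" and depth: "depth R = enat r" and D: "normalized_dualizing_complex R D"
  defines "s \<equiv> int t - int r"
  shows "\<And>n. n > s \<Longrightarrow> cocycles D n \<subseteq> coboundaries D n"
    "\<exists>X. submodule X R (obj D s) \<and> coboundaries D s \<subseteq> X \<and>
      (\<forall>a\<in>max_ideal R. \<forall>v\<in>cocycles D s. a \<odot>\<^bsub>obj D s\<^esub> v \<in> X) \<and> \<not> cocycles D s \<subseteq> X"
proof -
  have cpx: "is_complex R D" and bdd: "bounded_cpx D" and inj: "\<And>n. injective_mod R (obj D n)"
    and fin: "\<And>n. fin_gen_mod R (cohomology D n)"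
    using D by (auto simp: normalized_dualizing_complex_def dualizing_complex_def)
  obtain E :: "('a, 'd) module" where hull: "injective_hull R (quot_mod (ring_mod R) (max_ideal R)) E"
    and iso: "derived_iso R (torsion_cpx (max_ideal R) R D) (stalk E (int t))"
    using D dim by (auto simp: normalized_dualizing_complex_def)
  obtain lo where lo: "\<And>n. n < lo \<Longrightarrow> is_zero_mod (obj D n)" using bdd unfolding bounded_cpx_def by blast
  interpret cyc_inj_complex R D lo
    by unfold_locales (use cpx injective_imp_cyc_inj[OF inj] lo in \<open>auto simp: is_zero_mod_def\<close>)
  note m = idealD[OF ideal_max_ideal]
  have E: "module R E" "cyc_inj R E (carrier E) {\<zero>\<^bsub>E\<^esub>}"
    using hull injective_imp_cyc_inj by (auto simp: injective_hull_def injective_mod_def)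
  interpret E: module R E by (rule E)
  \<comment> \<open>The image of \<open>\<one>\<close> under the embedding of \<open>R/m\<close>
    into \<open>E\<close>.\<close>
  obtain e where e: "e \<in> carrier E" "e \<noteq> \<zero>\<^bsub>E\<^esub>" "\<And>c. c \<in> max_ideal R \<Longrightarrow> c \<odot>\<^bsub>E\<^esub> e = \<zero>\<^bsub>E\<^esub>"
  proof -
    let ?M = "ring_mod R" and ?m = "max_ideal R"
    have sm: "submodule ?m R ?M" by (rule module.submod_intro[OF module_ring_mod]) (use m in auto)
    obtain \<iota> where \<iota>: "\<iota> \<in> mod_hom R (quot_mod ?M ?m) E" "inj_on \<iota> (carrier (quot_mod ?M ?m))"
      using hull unfolding injective_hull_def by blast
    note Q = module_quot_mod[OF module_ring_mod sm]
    let ?q = "\<lambda>x. ?m +>\<^bsub>?M\<^esub> x"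
    have qc: "?q x \<in> carrier (quot_mod ?M ?m)" if "x \<in> carrier R" for x using that by (simp add: carrier_quot_mod)
    have q0: "?q x = \<zero>\<^bsub>quot_mod ?M ?m\<^esub> \<longleftrightarrow> x \<in> ?m" if x: "x \<in> carrier R" for x
    proof -
      interpret M: module R "ring_mod R" by (rule module_ring_mod)
      have "x \<ominus>\<^bsub>?M\<^esub> \<zero>\<^bsub>?M\<^esub> = x" using x M.M.minus_eq[of x "\<zero>\<^bsub>?M\<^esub>"] M.a_inv_zero by simp
      then show ?thesis
        using M.coset_eq_iff[OF sm, of x "\<zero>\<^bsub>?M\<^esub>"] x quot_mod_zero_coset[OF module_ring_mod sm] by simp
    qed
    have \<iota>0: "\<iota> \<zero>\<^bsub>quot_mod ?M ?m\<^esub> = \<zero>\<^bsub>E\<^esub>" by (rule mod_hom_more(1)[OF Q E(1) \<iota>(1)])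
    show ?thesis
    proof (rule that)
      show "\<iota> (?q \<one>) \<in> carrier E" using mod_homD(1)[OF \<iota>(1)] qc by simp
      show "\<iota> (?q \<one>) \<noteq> \<zero>\<^bsub>E\<^esub>"
      proof
        assume "\<iota> (?q \<one>) = \<zero>\<^bsub>E\<^esub>"
        then have "?q \<one> = \<zero>\<^bsub>quot_mod ?M ?m\<^esub>"
          using inj_onD[OF \<iota>(2)] \<iota>0 qc[of \<one>] abelian_monoid.zero_closed[of "quot_mod ?M ?m"] module.axioms(2)[OF Q]
          by (simp add: abelian_group_def)
        then show False using q0[of \<one>] one_notin_max_ideal by simp
      qed
      fix c assume c: "c \<in> max_ideal R"
      then have cc: "c \<in> carrier R" using m(1) by blast
      have "c \<odot>\<^bsub>E\<^esub> \<iota> (?q \<one>) = \<iota> (c \<odot>\<^bsub>quot_mod ?M ?m\<^esub> ?q \<one>)" using mod_homD(3)[OF \<iota>(1) cc qc] by simp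
      also have "c \<odot>\<^bsub>quot_mod ?M ?m\<^esub> ?q \<one> = ?q c"
        using smult_quot_mod[OF module_ring_mod sm, of \<one> c] cc by simp
      also have "?q c = \<zero>\<^bsub>quot_mod ?M ?m\<^esub>" using q0 cc c by simp
      finally show "c \<odot>\<^bsub>E\<^esub> \<iota> (?q \<one>) = \<zero>\<^bsub>E\<^esub>" using \<iota>0 by simp
    qed
  qed
  note st = derived_iso_stalk[OF is_complex_torsD E(1) iso]
  obtain z where z: "z \<in> cocycles torsD (int t)" "z \<notin> coboundaries torsD (int t)"
    "\<And>c. c \<in> max_ideal R \<Longrightarrow> c \<odot>\<^bsub>obj D (int t)\<^esub> z \<in> coboundaries torsD (int t)"
    using st(3)[OF e(1,2)] e(3) m(1) by (auto simp: torsD_simps)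
  have "cyc_inj R (obj D (int t)) (cocycles torsD (int t)) (coboundaries torsD (int t))"
    by (rule cyc_inj_sub_mod[OF is_complexD(1)[OF cpx] submodule_T])
      (use st(2)[OF E(2)] in \<open>auto simp: torsD_simps cocycles_torsD\<close>)
  note mc = max_ideal_cohomology[OF st(1) this z]
  have Zeq: "cyc_ann {\<zero>} n = cocycles D n" "bnd_ann {\<zero>} n = coboundaries D n" for n
    by (auto simp: cyc_ann_def bnd_ann_def ann_zero cocycles_def coboundaries_def)
  have fg0: "fg_at {\<zero>} n" for n
  proof -
    obtain A where A: "finite A" "A \<subseteq> carrier (cohomology D n)"
      "\<And>x. x \<in> carrier (cohomology D n) \<Longrightarrow> \<exists>c\<in>A \<rightarrow> carrier R. x = (\<Oplus>\<^bsub>cohomology D n\<^esub>a\<in>A. c a \<odot>\<^bsub>cohomology D n\<^esub> a)"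
      using fin[of n] unfolding fin_gen_mod_def by blast
    let ?Z = "sub_mod (obj D n) (cocycles D n)" and ?B = "coboundaries D n"
    have modZ: "module R ?Z" by (rule module_sub_mod[OF is_complexD(1)[OF cpx] submodule_cocycles[OF cpx]])
    have smB: "submodule ?B R ?Z"
      by (rule module.submod_intro[OF modZ])
        (use D.submodD[OF submodule_coboundaries[OF cpx]] coboundaries_subset_cocycles[OF cpx] in auto)
    note modH = module_quot_mod[OF modZ smB]
    have H: "cohomology D n = quot_mod ?Z ?B" by (simp add: cohomology_def)
    let ?q = "\<lambda>x. ?B +>\<^bsub>?Z\<^esub> x"
    have "\<forall>a\<in>A. \<exists>u\<in>cocycles D n. ?q u = a" using A(2) unfolding H carrier_quot_mod by auto
    \<comment> \<open>Representatives of the generating classes; they turn sums in the quotient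
      module into spans in \<open>D^n\<close> modulo coboundaries.\<close>
    then obtain g where g: "\<And>a. a \<in> A \<Longrightarrow> g a \<in> cocycles D n \<and> ?q (g a) = a" by metis
    obtain S where S: "set S = g ` A" using finite_list[OF finite_imageI[OF A(1), of g]] by blast
    have SZ: "set S \<subseteq> cocycles D n" using S g by auto
    then have Sc: "set S \<subseteq> carrier (obj D n)" using D.submodD(1)[OF submodule_cocycles[OF cpx]] by blast
    let ?G = "gspan (obj D n) (carrier R) ?B S"
    have smG: "submodule ?G R (obj D n)" by (rule D.submod_gspan[OF oneideal submodule_coboundaries[OF cpx] Sc])
    note G = D.submodD[OF smG]
    have BG: "?B \<subseteq> ?G" by (rule D.gspan_base[OF oneideal submodule_coboundaries[OF cpx] Sc])
    have GZ: "?G \<subseteq> cocycles D n"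
      using D.gspan_minimal[OF submodule_cocycles[OF cpx] coboundaries_subset_cocycles[OF cpx] SZ] by blast
    have smG': "submodule ?G R ?Z" by (rule module.submod_intro[OF modZ]) (use G GZ in auto)
    have smqG: "submodule (?q ` ?G) R (quot_mod ?Z ?B)"
      by (rule submod_image[OF modZ modH quot_mod_hom[OF modZ smB] smG'])
    have "cocycles D n \<subseteq> ?G"
    proof
      fix x assume x: "x \<in> cocycles D n"
      then have "?q x \<in> carrier (cohomology D n)" unfolding H carrier_quot_mod by simp
      then obtain c where c: "c \<in> A \<rightarrow> carrier R" "?q x = (\<Oplus>\<^bsub>quot_mod ?Z ?B\<^esub>a\<in>A. c a \<odot>\<^bsub>quot_mod ?Z ?B\<^esub> a)"
        using A(3) unfolding H by blast
      have "?q x \<in> ?q ` ?G"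
        unfolding c(2)
      proof (rule module.finsum_in_submod[OF modH smqG A(1)])
        fix a assume a: "a \<in> A"
        have "g a \<in> ?G" using D.gspan_gens[OF submodule_coboundaries[OF cpx] Sc] S a by blast
        then have "a \<in> ?q ` ?G" using g[OF a] by (metis imageI)
        then show "c a \<odot>\<^bsub>quot_mod ?Z ?B\<^esub> a \<in> ?q ` ?G"
          using module.submodD(4)[OF modH smqG] c(1) a by blast
      qed
      then obtain y where y: "y \<in> ?G" "?q x = ?q y" by blast
      have "x \<ominus>\<^bsub>?Z\<^esub> y \<in> ?B" using module.coset_eq_iff[OF modZ smB, of x y] x y GZ by auto
      then have "x \<ominus>\<^bsub>obj D n\<^esub> y \<in> ?G"
        using sub_mod_minus[OF is_complexD(1)[OF cpx] submodule_cocycles[OF cpx] x, of y] y(1) GZ BG by (metis subsetD)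
      then show "x \<in> ?G"
        using D.submod_coset[OF smG _ y(1)] x D.submodD(1)[OF submodule_cocycles[OF cpx]] by blast
    qed
    then show ?thesis unfolding fg_at_def Zeq using SZ by blast
  qed
  note fg = fg_all[OF fg0]
  have above: "exact_at I n" if "ideal I R" "n > int t" for I n
    by (rule exact_above[OF fg _ that]) (use mc(1) in auto)
  obtain xs y where xs: "regular_sequence R xs" "set xs \<subseteq> max_ideal R" "length xs = r" and
    y: "y \<in> carrier R" "y \<notin> Idl (set xs)" "\<And>x. x \<in> max_ideal R \<Longrightarrow> x \<otimes> y \<in> Idl (set xs)"
    using maximal_regular_sequence[OF depth] by blast
  have top: "\<not> exact_at {\<zero>} s" "\<And>n. n > s \<Longrightarrow> exact_at {\<zero>} n"
    using top_degree[OF fg above mc(2) xs(1,2) y] xs(3) unfolding s_def by auto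
  show "cocycles D n \<subseteq> coboundaries D n" if "n > s" for n
    using top(2)[OF that] unfolding exact_at_def Zeq .
  obtain S where S: "set S \<subseteq> cocycles D s" "cocycles D s \<subseteq> gspan (obj D s) (carrier R) (coboundaries D s) S"
    using fg0[of s] unfolding fg_at_def Zeq by blast
  show "\<exists>X. submodule X R (obj D s) \<and> coboundaries D s \<subseteq> X \<and>
      (\<forall>a\<in>max_ideal R. \<forall>v\<in>cocycles D s. a \<odot>\<^bsub>obj D s\<^esub> v \<in> X) \<and> \<not> cocycles D s \<subseteq> X"
    by (rule nakayama_submodule[OF is_complexD(1)[OF cpx] submodule_coboundaries[OF cpx] S(1) submodule_cocycles[OF cpx] S(2)])
      (use top(1) in \<open>simp add: exact_at_def Zeq\<close>)
qed

section \<open>Free modules\<close>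

lemma free_mod_simps:
  "carrier (free_mod R S) = {\<phi>. (\<forall>s\<in>S. \<phi> s \<in> carrier R) \<and> (\<forall>s. s \<notin> S \<longrightarrow> \<phi> s = \<zero>\<^bsub>R\<^esub>) \<and> finite {s. \<phi> s \<noteq> \<zero>\<^bsub>R\<^esub>}}"
  "\<zero>\<^bsub>free_mod R S\<^esub> = (\<lambda>_. \<zero>\<^bsub>R\<^esub>)"
  "\<phi> \<oplus>\<^bsub>free_mod R S\<^esub> \<psi> = (\<lambda>s. \<phi> s \<oplus>\<^bsub>R\<^esub> \<psi> s)"
  "c \<odot>\<^bsub>free_mod R S\<^esub> \<phi> = (\<lambda>s. c \<otimes>\<^bsub>R\<^esub> \<phi> s)"
  by (simp_all add: free_mod_def)

context cring
begin

lemma free_modD: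
  assumes "\<phi> \<in> carrier (free_mod R S)"
  shows "\<phi> s \<in> carrier R" "s \<notin> S \<Longrightarrow> \<phi> s = \<zero>" "finite {s. \<phi> s \<noteq> \<zero>}" "{s. \<phi> s \<noteq> \<zero>} \<subseteq> S"
  using assms by (auto simp: free_mod_simps)

lemma free_modI:
  assumes "\<And>s. \<phi> s \<in> carrier R" "finite F" "F \<subseteq> S" "\<And>s. s \<notin> F \<Longrightarrow> \<phi> s = \<zero>"
  shows "\<phi> \<in> carrier (free_mod R S)"
proof -
  have "{s. \<phi> s \<noteq> \<zero>} \<subseteq> F" using assms(4) by auto
  then have "finite {s. \<phi> s \<noteq> \<zero>}" by (rule finite_subset[OF _ assms(2)])
  then show ?thesis using assms by (auto simp: free_mod_simps)
qed

lemma module_free_mod: "module R (free_mod R S)"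
proof (rule moduleI)
  let ?F = "free_mod R S"
  have add: "\<phi> \<oplus>\<^bsub>?F\<^esub> \<psi> \<in> carrier ?F" if "\<phi> \<in> carrier ?F" "\<psi> \<in> carrier ?F" for \<phi> \<psi>
    unfolding free_mod_simps(3)
    by (rule free_modI[of _ "{s. \<phi> s \<noteq> \<zero>} \<union> {s. \<psi> s \<noteq> \<zero>}"])
      (use free_modD[OF that(1)] free_modD[OF that(2)] in auto)
  have smult: "c \<odot>\<^bsub>?F\<^esub> \<phi> \<in> carrier ?F" if "c \<in> carrier R" "\<phi> \<in> carrier ?F" for \<phi> c
    unfolding free_mod_simps(4)
    by (rule free_modI[of _ "{s. \<phi> s \<noteq> \<zero>}"])
      (use free_modD[OF that(2)] that(1) in auto)
  show "cring R" by (rule is_cring)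
  show "abelian_group ?F"
  proof (rule abelian_groupI)
    show "\<zero>\<^bsub>?F\<^esub> \<in> carrier ?F" by (simp add: free_mod_simps)
    fix \<phi> assume \<phi>: "\<phi> \<in> carrier ?F"
    note p = free_modD[OF \<phi>]
    show "\<zero>\<^bsub>?F\<^esub> \<oplus>\<^bsub>?F\<^esub> \<phi> = \<phi>" using p by (simp add: free_mod_simps)
    have "(\<lambda>s. \<ominus> \<phi> s) \<oplus>\<^bsub>?F\<^esub> \<phi> = \<zero>\<^bsub>?F\<^esub>" using p by (simp add: free_mod_simps l_neg)
    moreover have "(\<lambda>s. \<ominus> \<phi> s) \<in> carrier ?F" by (rule free_modI[of _ "{s. \<phi> s \<noteq> \<zero>}"]) (use p in auto)
    ultimately show "\<exists>\<psi>\<in>carrier ?F. \<psi> \<oplus>\<^bsub>?F\<^esub> \<phi> = \<zero>\<^bsub>?F\<^esub>" by blast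
    fix \<psi> assume "\<psi> \<in> carrier ?F"
    note q = free_modD[OF this]
    show "\<phi> \<oplus>\<^bsub>?F\<^esub> \<psi> = \<psi> \<oplus>\<^bsub>?F\<^esub> \<phi>" using p q by (simp add: free_mod_simps a_comm)
    fix \<chi> assume "\<chi> \<in> carrier ?F"
    note r = free_modD[OF this]
    show "\<phi> \<oplus>\<^bsub>?F\<^esub> \<psi> \<oplus>\<^bsub>?F\<^esub> \<chi> = \<phi> \<oplus>\<^bsub>?F\<^esub> (\<psi> \<oplus>\<^bsub>?F\<^esub> \<chi>)"
      using p q r by (simp add: free_mod_simps a_assoc)
  qed (rule add)
  show "\<And>a x. a \<in> carrier R \<Longrightarrow> x \<in> carrier ?F \<Longrightarrow> a \<odot>\<^bsub>?F\<^esub> x \<in> carrier ?F" by (rule smult)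
  show "(a \<oplus> b) \<odot>\<^bsub>?F\<^esub> x = a \<odot>\<^bsub>?F\<^esub> x \<oplus>\<^bsub>?F\<^esub> b \<odot>\<^bsub>?F\<^esub> x" "(a \<otimes> b) \<odot>\<^bsub>?F\<^esub> x = a \<odot>\<^bsub>?F\<^esub> (b \<odot>\<^bsub>?F\<^esub> x)"
    if "a \<in> carrier R" "b \<in> carrier R" "x \<in> carrier ?F" for a b x
    using that(1,2) free_modD(1)[OF that(3)] by (simp_all add: free_mod_simps l_distr m_assoc)
  show "a \<odot>\<^bsub>?F\<^esub> (x \<oplus>\<^bsub>?F\<^esub> y) = a \<odot>\<^bsub>?F\<^esub> x \<oplus>\<^bsub>?F\<^esub> a \<odot>\<^bsub>?F\<^esub> y"
    if "a \<in> carrier R" "x \<in> carrier ?F" "y \<in> carrier ?F" for a x y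
    using that(1) free_modD(1)[OF that(2)] free_modD(1)[OF that(3)] by (simp add: free_mod_simps r_distr)
  show "\<one> \<odot>\<^bsub>?F\<^esub> x = x" if "x \<in> carrier ?F" for x
    using free_modD(1)[OF that] by (simp add: free_mod_simps)
qed

lemma free_gen_simps: "free_gen R s s = \<one>" "s' \<noteq> s \<Longrightarrow> free_gen R s s' = \<zero>"
  by (simp_all add: free_gen_def)

lemma free_gen_closed: "s \<in> S \<Longrightarrow> free_gen R s \<in> carrier (free_mod R S)"
  by (rule free_modI[of _ "{s}"]) (auto simp: free_gen_def)

lemma free_mod_generated:
  assumes X: "submodule X R (free_mod R S)" and gens: "\<And>s. s \<in> S \<Longrightarrow> free_gen R s \<in> X"
  shows "carrier (free_mod R S) \<subseteq> X"
proof
  fix \<phi> assume \<phi>: "\<phi> \<in> carrier (free_mod R S)"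
  interpret F: module R "free_mod R S" by (rule module_free_mod)
  note X' = F.submodD[OF X]
  have "\<phi> \<in> X" if "finite F" "F \<subseteq> S" "\<phi> \<in> carrier (free_mod R S)" "\<And>s. s \<notin> F \<Longrightarrow> \<phi> s = \<zero>" for F \<phi>
    using that
  proof (induction F arbitrary: \<phi>)
    case empty
    then have "\<phi> = \<zero>\<^bsub>free_mod R S\<^esub>" by (auto simp: free_mod_simps)
    then show ?case using X'(2) by simp
  next
    case (insert s F)
    note p = free_modD[OF insert.prems(2)]
    let ?\<psi> = "\<phi>(s := \<zero>)"
    have eq: "\<phi> = ?\<psi> \<oplus>\<^bsub>free_mod R S\<^esub> \<phi> s \<odot>\<^bsub>free_mod R S\<^esub> free_gen R s"
      using p by (auto simp: free_mod_simps free_gen_def fun_eq_iff)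
    have "?\<psi> \<in> carrier (free_mod R S)"
      by (rule free_modI[of _ F]) (use p insert in auto)
    then have "?\<psi> \<in> X" using insert by auto
    moreover have "\<phi> s \<odot>\<^bsub>free_mod R S\<^esub> free_gen R s \<in> X" using X'(4) p(1) gens insert.prems(1) by blast
    ultimately show ?case using X'(3) eq by metis
  qed
  from this[OF free_modD(3,4)[OF \<phi>] \<phi>] show "\<phi> \<in> X" by simp
qed

lemma mod_hom_eq_on_free:
  assumes M: "module R M" and h: "h \<in> mod_hom R (free_mod R S) M" "h' \<in> mod_hom R (free_mod R S) M"
    and eq: "\<And>s. s \<in> S \<Longrightarrow> h (free_gen R s) = h' (free_gen R s)" and \<phi>: "\<phi> \<in> carrier (free_mod R S)"
  shows "h \<phi> = h' \<phi>"
proof -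
  interpret F: module R "free_mod R S" by (rule module_free_mod)
  note h1 = mod_homD[OF h(1)] mod_hom_more[OF module_free_mod M h(1)]
    and h2 = mod_homD[OF h(2)] mod_hom_more[OF module_free_mod M h(2)]
  have "submodule {\<phi> \<in> carrier (free_mod R S). h \<phi> = h' \<phi>} R (free_mod R S)"
    by (rule F.submod_intro) (auto simp: h1 h2)
  moreover have "free_gen R s \<in> {\<phi> \<in> carrier (free_mod R S). h \<phi> = h' \<phi>}" if "s \<in> S" for s
    using eq[OF that] free_gen_closed[OF that] by simp
  ultimately have "\<phi> \<in> {\<phi> \<in> carrier (free_mod R S). h \<phi> = h' \<phi>}"
    using \<phi> by (rule subsetD[OF free_mod_generated])
  then show ?thesis by simp
qed

text \<open>The sum runs over the support of \<open>\<phi>\<close>, exactly as in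
  \<open>tensor_map\<close>, which thus applies \<open>lin\<close> to the representatives of a
  coset.\<close>

definition lin :: "('a, 'm) module \<Rightarrow> ('s \<Rightarrow> 'm) \<Rightarrow> ('s \<Rightarrow> 'a) \<Rightarrow> 'm"
  where "lin M a \<phi> = (\<Oplus>\<^bsub>M\<^esub>s\<in>{s. \<phi> s \<noteq> \<zero>}. \<phi> s \<odot>\<^bsub>M\<^esub> a s)"

lemma lin_superset:
  assumes M: "module R M" and a: "a \<in> S \<rightarrow> carrier M" and \<phi>: "\<phi> \<in> carrier (free_mod R S)"
    and F: "finite F" "F \<subseteq> S" "{s. \<phi> s \<noteq> \<zero>} \<subseteq> F"
  shows "lin M a \<phi> = (\<Oplus>\<^bsub>M\<^esub>s\<in>F. \<phi> s \<odot>\<^bsub>M\<^esub> a s)"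
  unfolding lin_def
proof -
  interpret M: module R M by fact
  show "(\<Oplus>\<^bsub>M\<^esub>s\<in>{s. \<phi> s \<noteq> \<zero>}. \<phi> s \<odot>\<^bsub>M\<^esub> a s) = (\<Oplus>\<^bsub>M\<^esub>s\<in>F. \<phi> s \<odot>\<^bsub>M\<^esub> a s)"
  proof (rule M.add.finprod_mono_neutral_cong_left[OF F(1,3)])
    show "\<phi> s \<odot>\<^bsub>M\<^esub> a s = \<zero>\<^bsub>M\<^esub>" if "s \<in> F - {s. \<phi> s \<noteq> \<zero>}" for s
      using that a F(2) by (auto simp: Pi_iff subset_iff)
    show "(\<lambda>s. \<phi> s \<odot>\<^bsub>M\<^esub> a s) \<in> F \<rightarrow> carrier M"
      using a F(2) free_modD(1)[OF \<phi>] by (auto simp: Pi_iff subset_iff)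
  qed simp
qed

lemma lin_hom:
  assumes M: "module R M" and a: "a \<in> S \<rightarrow> carrier M"
  shows "lin M a \<in> mod_hom R (free_mod R S) M"
proof (rule mod_homI)
  interpret M: module R M by fact
  interpret F: module R "free_mod R S" by (rule module_free_mod)
  fix \<phi> assume \<phi>: "\<phi> \<in> carrier (free_mod R S)"
  note p = free_modD[OF \<phi>]
  have cl: "(\<lambda>s. \<chi> s \<odot>\<^bsub>M\<^esub> a s) \<in> F \<rightarrow> carrier M" if "\<And>s. \<chi> s \<in> carrier R" "F \<subseteq> S" for \<chi> F
    using that a by auto
  show "lin M a \<phi> \<in> carrier M" unfolding lin_def by (rule M.M.finsum_closed) (use cl[of \<phi>] p in auto)
  show "lin M a (c \<odot>\<^bsub>free_mod R S\<^esub> \<phi>) = c \<odot>\<^bsub>M\<^esub> lin M a \<phi>" if c: "c \<in> carrier R" for c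
  proof -
    let ?F = "{s. \<phi> s \<noteq> \<zero>}"
    have "lin M a (c \<odot>\<^bsub>free_mod R S\<^esub> \<phi>) = (\<Oplus>\<^bsub>M\<^esub>s\<in>?F. (c \<otimes> \<phi> s) \<odot>\<^bsub>M\<^esub> a s)"
    proof -
      have "{s. c \<otimes> \<phi> s \<noteq> \<zero>} \<subseteq> ?F" using c by auto
      then show ?thesis
        using lin_superset[OF M a F.smult_closed[OF c \<phi>] p(3,4)] by (simp add: free_mod_simps)
    qed
    also have "\<dots> = (\<Oplus>\<^bsub>M\<^esub>s\<in>?F. c \<odot>\<^bsub>M\<^esub> (\<phi> s \<odot>\<^bsub>M\<^esub> a s))"
      by (rule M.M.finsum_cong') (use p(1,4) a c in \<open>auto intro!: M.smult_assoc1 M.smult_closed simp: Pi_iff\<close>)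
    also have "\<dots> = c \<odot>\<^bsub>M\<^esub> lin M a \<phi>"
      unfolding lin_def by (rule M.finsum_smult_ldistr[symmetric]) (use p(3) c cl[of \<phi>] p in auto)
    finally show ?thesis .
  qed
  fix \<psi> assume \<psi>: "\<psi> \<in> carrier (free_mod R S)"
  note q = free_modD[OF \<psi>]
  let ?F = "{s. \<phi> s \<noteq> \<zero>} \<union> {s. \<psi> s \<noteq> \<zero>}"
  have F: "finite ?F" "?F \<subseteq> S" using p q by auto
  have "lin M a (\<phi> \<oplus>\<^bsub>free_mod R S\<^esub> \<psi>) = (\<Oplus>\<^bsub>M\<^esub>s\<in>?F. (\<phi> s \<oplus> \<psi> s) \<odot>\<^bsub>M\<^esub> a s)"
  proof -
    have "{s. \<phi> s \<oplus> \<psi> s \<noteq> \<zero>} \<subseteq> ?F" by auto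
    then show ?thesis using lin_superset[OF M a F.M.a_closed[OF \<phi> \<psi>] F] by (simp add: free_mod_simps)
  qed
  also have "\<dots> = (\<Oplus>\<^bsub>M\<^esub>s\<in>?F. \<phi> s \<odot>\<^bsub>M\<^esub> a s \<oplus>\<^bsub>M\<^esub> \<psi> s \<odot>\<^bsub>M\<^esub> a s)"
    by (rule M.M.finsum_cong') (use F p(1) q(1) a in \<open>auto intro!: M.smult_l_distr simp: Pi_iff\<close>)
  also have "\<dots> = (\<Oplus>\<^bsub>M\<^esub>s\<in>?F. \<phi> s \<odot>\<^bsub>M\<^esub> a s) \<oplus>\<^bsub>M\<^esub> (\<Oplus>\<^bsub>M\<^esub>s\<in>?F. \<psi> s \<odot>\<^bsub>M\<^esub> a s)"
    by (rule M.M.finsum_addf) (use F cl[of \<phi>] cl[of \<psi>] p q in auto)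
  finally show "lin M a (\<phi> \<oplus>\<^bsub>free_mod R S\<^esub> \<psi>) = lin M a \<phi> \<oplus>\<^bsub>M\<^esub> lin M a \<psi>"
    using lin_superset[OF M a \<phi> F] lin_superset[OF M a \<psi> F] by auto
qed

lemma lin_gen:
  assumes M: "module R M" and a: "a \<in> S \<rightarrow> carrier M" and s: "s \<in> S"
  shows "lin M a (free_gen R s) = a s"
proof -
  interpret M: module R M by fact
  have as: "a s \<in> carrier M" using a s by blast
  have "lin M a (free_gen R s) = (\<Oplus>\<^bsub>M\<^esub>s'\<in>{s}. free_gen R s s' \<odot>\<^bsub>M\<^esub> a s')"
    by (rule lin_superset[OF M a free_gen_closed[OF s]]) (use s in \<open>auto simp: free_gen_def\<close>)
  also have "\<dots> = a s" using as by (simp add: M.M.finsum_insert free_gen_simps)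
  finally show ?thesis .
qed

text \<open>Coefficient and value are taken together: the coefficient may lie in an ideal such that
  only the product is known to lie in \<open>X\<close>.\<close>

lemma hom_free_in_submod:
  assumes M: "module R M" and h: "h \<in> mod_hom R (free_mod R S) M" and X: "submodule X R M"
    and gen: "\<And>s. s \<in> S \<Longrightarrow> \<phi> s \<odot>\<^bsub>M\<^esub> h (free_gen R s) \<in> X" and \<phi>: "\<phi> \<in> carrier (free_mod R S)"
  shows "h \<phi> \<in> X"
proof -
  interpret M: module R M by fact
  let ?a = "\<lambda>s. h (free_gen R s)"
  have a: "?a \<in> S \<rightarrow> carrier M" by (rule Pi_I) (rule mod_homD(1)[OF h free_gen_closed])
  have "h \<phi> = lin M ?a \<phi>"
    by (rule mod_hom_eq_on_free[OF M h lin_hom[OF M a] _ \<phi>]) (use lin_gen[OF M a] in simp)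
  also have "\<dots> \<in> X"
    unfolding lin_def by (rule M.finsum_in_submod[OF X]) (use gen free_modD[OF \<phi>] in auto)
  finally show ?thesis .
qed

text \<open>Basis vectors are lifted one by one, so the element types of \<open>A\<close> and
  \<open>C\<close> are arbitrary, whereas \<open>projective_mod\<close> tests two fixed types. The
  complex \<open>F \<otimes> D\<close> is treated with this version.\<close>

lemma free_lift:
  assumes A: "module R A" and C: "module R C" and g: "g \<in> mod_hom R A C"
    and f: "f \<in> mod_hom R (free_mod R S) C" and im: "\<And>s. s \<in> S \<Longrightarrow> f (free_gen R s) \<in> g ` carrier A"
  shows "\<exists>h\<in>mod_hom R (free_mod R S) A. \<forall>\<phi>\<in>carrier (free_mod R S). g (h \<phi>) = f \<phi>"
proof -
  define a where "a s = (SOME x. x \<in> carrier A \<and> g x = f (free_gen R s))" for s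
  have a: "a s \<in> carrier A \<and> g (a s) = f (free_gen R s)" if s: "s \<in> S" for s
  proof -
    obtain x where "f (free_gen R s) = g x" "x \<in> carrier A" using im[OF s] by (rule imageE)
    then have "\<exists>x. x \<in> carrier A \<and> g x = f (free_gen R s)" by auto
    then show ?thesis unfolding a_def by (rule someI_ex)
  qed
  then have aS: "a \<in> S \<rightarrow> carrier A" by blast
  have h: "lin A a \<in> mod_hom R (free_mod R S) A" by (rule lin_hom[OF A aS])
  have "g (lin A a \<phi>) = f \<phi>" if "\<phi> \<in> carrier (free_mod R S)" for \<phi>
    by (rule mod_hom_eq_on_free[OF C mod_hom_compose[OF h g] f _ that]) (use lin_gen[OF A aS] a in simp)
  then show ?thesis using h by blast
qed

lemma projective_free_mod: "projective_mod R (free_mod R S)"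
  unfolding projective_mod_def
proof (rule conjI, rule module_free_mod, intro allI impI, elim conjE)
  fix A :: "('a, ('s \<Rightarrow> 'a) \<Rightarrow> 'a) module" and B :: "('a, 's \<Rightarrow> 'a) module" and g f
  assume *: "module R A" "module R B" "g \<in> mod_hom R A B" "g ` carrier A = carrier B" "f \<in> mod_hom R (free_mod R S) B"
  show "\<exists>h\<in>mod_hom R (free_mod R S) A. \<forall>x\<in>carrier (free_mod R S). g (h x) = f x"
    by (rule free_lift[OF *(1-3,5)]) (use *(4) mod_homD(1)[OF *(5) free_gen_closed] in blast)
qed

end

section \<open>Projective lifting\<close>

text \<open>Moves a module along an injection into one of the element types that
  \<open>projective_mod\<close> tests. \<open>the_inv e\<close> is meaningful on the image of
  \<open>e\<close>, where the carrier lies.\<close>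

definition transport_mod :: "('m \<Rightarrow> 'n) \<Rightarrow> ('r, 'm) module \<Rightarrow> ('r, 'n) module"
  where "transport_mod e M =
    \<lparr>carrier = e ` carrier M, monoid.mult = (\<lambda>_ _. undefined), one = undefined, zero = e \<zero>\<^bsub>M\<^esub>,
     add = (\<lambda>x y. e (the_inv e x \<oplus>\<^bsub>M\<^esub> the_inv e y)), smult = (\<lambda>r x. e (r \<odot>\<^bsub>M\<^esub> the_inv e x))\<rparr>"

lemma module_transport:
  assumes "module R M" "inj e"
  shows "module R (transport_mod e M)" "e \<in> mod_hom R M (transport_mod e M)"
    "the_inv e \<in> mod_hom R (transport_mod e M) M"
proof -
  interpret M: module R M by fact
  have inv[simp]: "the_inv e (e x) = x" for x by (rule the_inv_f_f[OF assms(2)])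
  show "module R (transport_mod e M)"
  proof (rule moduleI)
    show "cring R" by (rule M.R.is_cring)
    show "abelian_group (transport_mod e M)"
    proof (rule abelian_groupI)
      fix x assume "x \<in> carrier (transport_mod e M)"
      then obtain u where "x = e u" "u \<in> carrier M" by (auto simp: transport_mod_def)
      then show "\<exists>y\<in>carrier (transport_mod e M). y \<oplus>\<^bsub>transport_mod e M\<^esub> x = \<zero>\<^bsub>transport_mod e M\<^esub>"
        by (intro bexI[of _ "e (\<ominus>\<^bsub>M\<^esub> u)"]) (auto simp: transport_mod_def M.M.l_neg)
    qed (auto simp: transport_mod_def M.M.a_ac)
  qed (auto simp: transport_mod_def M.smult_l_distr M.smult_r_distr M.smult_assoc1)
  show "e \<in> mod_hom R M (transport_mod e M)" "the_inv e \<in> mod_hom R (transport_mod e M) M"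
    by (auto simp: mod_hom_def transport_mod_def)
qed

text \<open>\<open>A\<close> and the image of \<open>g\<close> are copied by \<open>e\<close> and
  \<open>e'\<close> into the tested types. The image takes the place of \<open>C\<close> because the
  definition of projectivity asks for a surjection.\<close>

lemma projective_lift:
  fixes P :: "('r, 'p) module" and A :: "('r, 'a) module" and C :: "('r, 'c) module"
    and e :: "'a \<Rightarrow> 'p \<Rightarrow> 'r" and e' :: "'c \<Rightarrow> 'p"
  assumes P: "projective_mod R P" and A: "module R A" and C: "module R C" and e: "inj e" "inj e'"
    and g: "g \<in> mod_hom R A C" and f: "f \<in> mod_hom R P C" and im: "f ` carrier P \<subseteq> g ` carrier A"
  shows "\<exists>h\<in>mod_hom R P A. \<forall>x\<in>carrier P. g (h x) = f x"
proof -
  interpret A: module R A by fact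
  interpret C: module R C by fact
  let ?A = "transport_mod e A" and ?B = "sub_mod C (g ` carrier A)"
  have B: "module R ?B" by (rule module_sub_mod[OF C submod_image[OF A C g A.carrier_is_submodule]])
  note tA = module_transport[OF A e(1)] and tB = module_transport[OF B e(2)]
  have gB: "g \<in> mod_hom R A ?B" and fB: "f \<in> mod_hom R P ?B"
    using g f im by (auto simp: mod_hom_def)
  let ?g = "\<lambda>x. e' (g (the_inv e x))" and ?f = "\<lambda>x. e' (f x)"
  have g': "?g \<in> mod_hom R ?A (transport_mod e' ?B)"
    using mod_hom_compose[OF mod_hom_compose[OF tA(3) gB] tB(2)] .
  have f': "?f \<in> mod_hom R P (transport_mod e' ?B)" using mod_hom_compose[OF fB tB(2)] .
  have "?g ` carrier ?A = carrier (transport_mod e' ?B)"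
    by (auto simp: transport_mod_def the_inv_f_f[OF e(1)] image_iff)
  then have "\<exists>h\<in>mod_hom R P ?A. \<forall>x\<in>carrier P. ?g (h x) = ?f x"
    using conjunct2[OF P[unfolded projective_mod_def], rule_format, of ?A "transport_mod e' ?B" ?g ?f] tA(1) tB(1) g' f'
    by simp
  then obtain h where h: "h \<in> mod_hom R P ?A" "\<forall>x\<in>carrier P. ?g (h x) = ?f x" by (rule bexE)
  have hom: "(\<lambda>x. the_inv e (h x)) \<in> mod_hom R P A" by (rule mod_hom_compose[OF h(1) tA(3)])
  have eq: "g (the_inv e (h x)) = f x" if "x \<in> carrier P" for x
    by (rule injD[OF e(2) h(2)[rule_format, OF that]])
  show ?thesis by (rule bexI[OF _ hom]) (simp add: eq)
qed

lemma inj_indicator: "a \<noteq> b \<Longrightarrow> inj (\<lambda>x p. if p = x then a else b)"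
  by (rule injI) (metis)

section \<open>Resolutions\<close>

lemma mod_hom_minus:
  assumes "module R M" "module R N" "f \<in> mod_hom R M N" "g \<in> mod_hom R M N"
  shows "(\<lambda>x. f x \<ominus>\<^bsub>N\<^esub> g x) \<in> mod_hom R M N"
proof (rule mod_homI)
  interpret N: module R N by fact
  note f = mod_homD[OF assms(3)] and g = mod_homD[OF assms(4)]
  fix x assume x: "x \<in> carrier M"
  show "f x \<ominus>\<^bsub>N\<^esub> g x \<in> carrier N" using f(1)[OF x] g(1)[OF x] by simp
  show "f (r \<odot>\<^bsub>M\<^esub> x) \<ominus>\<^bsub>N\<^esub> g (r \<odot>\<^bsub>M\<^esub> x) = r \<odot>\<^bsub>N\<^esub> (f x \<ominus>\<^bsub>N\<^esub> g x)" if "r \<in> carrier R" for r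
    using f(1)[OF x] g(1)[OF x] f(3)[OF that x] g(3)[OF that x] that by (simp add: N.smult_minus_distr)
  fix y assume y: "y \<in> carrier M"
  show "f (x \<oplus>\<^bsub>M\<^esub> y) \<ominus>\<^bsub>N\<^esub> g (x \<oplus>\<^bsub>M\<^esub> y) = (f x \<ominus>\<^bsub>N\<^esub> g x) \<oplus>\<^bsub>N\<^esub> (f y \<ominus>\<^bsub>N\<^esub> g y)"
    unfolding f(2)[OF x y] g(2)[OF x y]
    using f(1)[OF x] g(1)[OF x] f(1)[OF y] g(1)[OF y] by algebra
qed

lemma quasi_isoI:
  assumes X: "is_complex R X" and Y: "is_complex R Y" and f: "chain_map R X Y f"
    and inj: "\<And>n z. z \<in> cocycles X n \<Longrightarrow> f n z \<in> coboundaries Y n \<Longrightarrow> z \<in> coboundaries X n"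
    and surj: "\<And>n y. y \<in> cocycles Y n \<Longrightarrow> \<exists>z\<in>cocycles X n. y \<ominus>\<^bsub>obj Y n\<^esub> f n z \<in> coboundaries Y n"
  shows "quasi_iso R X Y f"
  unfolding quasi_iso_def
proof (intro conjI allI f)
  fix n
  interpret X: module R "obj X n" by (rule is_complexD[OF X])
  note ZX = X.submodD[OF submodule_cocycles[OF X, of n]]
  note fm = mod_hom_more[OF is_complexD(1)[OF X] is_complexD(1)[OF Y] chain_mapD(1)[OF f, of n]]
  note map = cohomology_map_coset_of[OF X Y f]
  note fz = chain_map_cocycle[OF X Y f]
  show "bij_betw (cohomology_map Y f n) (carrier (cohomology X n)) (carrier (cohomology Y n))"
    unfolding carrier_cohomology
  proof (rule bij_betw_imageI)
    show "inj_on (cohomology_map Y f n) (coset_of X n ` cocycles X n)"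
    proof (rule inj_onI)
      fix a b assume "a \<in> coset_of X n ` cocycles X n" "b \<in> coset_of X n ` cocycles X n"
        and eq: "cohomology_map Y f n a = cohomology_map Y f n b"
      then obtain x y where *: "x \<in> cocycles X n" "y \<in> cocycles X n" "a = coset_of X n x" "b = coset_of X n y" by blast
      have "f n x \<ominus>\<^bsub>obj Y n\<^esub> f n y \<in> coboundaries Y n"
        using eq coset_of_eq_iff[OF Y fz[OF *(1)] fz[OF *(2)]] map * by simp
      then have "f n (x \<ominus>\<^bsub>obj X n\<^esub> y) \<in> coboundaries Y n" using fm(3) * ZX(1) by (metis subsetD)
      then have "x \<ominus>\<^bsub>obj X n\<^esub> y \<in> coboundaries X n" by (rule inj[OF ZX(6)[OF *(1,2)]])
      then show "a = b" using coset_of_eq_iff[OF X *(1,2)] *(3,4) by simp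
    qed
    show "cohomology_map Y f n ` coset_of X n ` cocycles X n = coset_of Y n ` cocycles Y n"
    proof (intro equalityI subsetI)
      fix c assume "c \<in> cohomology_map Y f n ` coset_of X n ` cocycles X n"
      then show "c \<in> coset_of Y n ` cocycles Y n" using map fz by auto
    next
      fix c assume "c \<in> coset_of Y n ` cocycles Y n"
      then obtain y where y: "y \<in> cocycles Y n" "c = coset_of Y n y" by blast
      obtain z where z: "z \<in> cocycles X n" "y \<ominus>\<^bsub>obj Y n\<^esub> f n z \<in> coboundaries Y n" using surj[OF y(1)] by blast
      then have "c = cohomology_map Y f n (coset_of X n z)"
        using coset_of_eq_iff[OF Y y(1) fz[OF z(1)]] map[OF z(1)] y(2) by simp
      then show "c \<in> cohomology_map Y f n ` coset_of X n ` cocycles X n" using z(1) by blast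
    qed
  qed
qed

text \<open>Indexing by naturals, with the augmentation kept separate, lets lifts and homotopies be
  built by recursion; \<open>cochain\<close> returns to the integer grading.\<close>

locale resolution = cring R for R :: "('r, 'k) ring_scheme" (structure) +
  fixes N :: "('r, 'n) module" and X :: "nat \<Rightarrow> ('r, 'p) module" and d :: "nat \<Rightarrow> 'p \<Rightarrow> 'p" and aug :: "'p \<Rightarrow> 'n"
  assumes mod_N: "module R N" and mod_X: "\<And>l. module R (X l)"
    and d_hom: "\<And>l. d l \<in> mod_hom R (X (Suc l)) (X l)" and aug_hom: "aug \<in> mod_hom R (X 0) N"
    and aug_surj: "aug ` carrier (X 0) = carrier N"
    and aug_d: "\<And>x. x \<in> carrier (X (Suc 0)) \<Longrightarrow> aug (d 0 x) = \<zero>\<^bsub>N\<^esub>"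
    and dd: "\<And>l x. x \<in> carrier (X (Suc (Suc l))) \<Longrightarrow> d l (d (Suc l) x) = \<zero>\<^bsub>X l\<^esub>"
    and exact_aug: "\<And>x. x \<in> carrier (X 0) \<Longrightarrow> aug x = \<zero>\<^bsub>N\<^esub> \<Longrightarrow> x \<in> d 0 ` carrier (X (Suc 0))"
    and exact_d: "\<And>l x. x \<in> carrier (X (Suc l)) \<Longrightarrow> d l x = \<zero>\<^bsub>X l\<^esub> \<Longrightarrow> x \<in> d (Suc l) ` carrier (X (Suc (Suc l)))"

lemma (in cring) resolution_of_proj_resolution:
  fixes N :: "('a, 'n) module" and P :: "('a, 'p) cochain"
  assumes N: "module R N" and P: "proj_resolution R N P"
  shows "\<exists>aug. resolution R N (\<lambda>l. obj P (- int l)) (\<lambda>l. diff P (- int (Suc l))) aug"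
proof -
  have cpx: "is_complex R P" and zero: "\<And>n. n > 0 \<Longrightarrow> is_zero_mod (obj P n)"
    using P by (auto simp: proj_resolution_def)
  obtain f where f: "quasi_iso R P (stalk N 0) f" using P unfolding proj_resolution_def by blast
  interpret N: module R N by fact
  note S = is_complex_stalk[OF N, of 0]
  note qi = quasi_isoD[OF cpx S f]
  have idx: "- int (Suc l) = - int l - 1" for l by simp
  have ob: "obj (stalk N 0) 0 = N" by (simp add: stalk_simps)
  note f0 = chain_mapD(1)[OF qi(1), of 0, unfolded ob]
  have zero_mod: "carrier (obj P 1) = {\<zero>\<^bsub>obj P 1\<^esub>}" using zero[of 1] by (simp add: is_zero_mod_def)
  show ?thesis
  proof (rule exI[of _ "f 0"], intro resolution.intro resolution_axioms.intro)
    show "cring R" by (rule is_cring)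
    show "module R N" by (rule N)
    show "module R (obj P (- int l))" for l by (rule is_complexD[OF cpx])
    show "diff P (- int (Suc l)) \<in> mod_hom R (obj P (- int (Suc l))) (obj P (- int l))" for l
      unfolding idx by (rule is_complexD[OF cpx])
    show "f 0 \<in> mod_hom R (obj P (- int 0)) N" using f0 by simp
    have surj: "\<exists>x\<in>carrier (obj P 0). f 0 x = y" if y: "y \<in> carrier N" for y
    proof -
      obtain z where z: "z \<in> cocycles P 0" "y \<ominus>\<^bsub>N\<^esub> f 0 z \<in> {\<zero>\<^bsub>N\<^esub>}"
        using qi(3)[of y 0] y unfolding cocycles_stalk coboundaries_stalk[OF N] ob by blast
      have zc: "z \<in> carrier (obj P 0)" using z(1) by (simp add: cocycles_def)
      have "y = f 0 z" using N.eq_of_minus_zero[OF y mod_homD(1)[OF f0 zc]] z(2) by simp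
      then show ?thesis using zc by blast
    qed
    show "f 0 ` carrier (obj P (- int 0)) = carrier N" using surj mod_homD(1)[OF f0] by auto
    show "f 0 (diff P (- int (Suc 0)) x) = \<zero>\<^bsub>N\<^esub>" if "x \<in> carrier (obj P (- int (Suc 0)))" for x
      using chain_mapD(3)[OF qi(1), of x 0] that by (simp add: stalk_simps)
    show "diff P (- int (Suc l)) (diff P (- int (Suc (Suc l))) x) = \<zero>\<^bsub>obj P (- int l)\<^esub>"
      if "x \<in> carrier (obj P (- int (Suc (Suc l))))" for l x
      using is_complexD(4)[OF cpx, of x "- int (Suc l)"] that by (simp add: algebra_simps)
    show "x \<in> diff P (- int (Suc 0)) ` carrier (obj P (- int (Suc 0)))"
      if "x \<in> carrier (obj P (- int 0))" "f 0 x = \<zero>\<^bsub>N\<^esub>" for x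
    proof -
      have "diff P 0 x \<in> carrier (obj P 1)" using mod_homD(1)[OF is_complexD(2)[OF cpx, of 0]] that(1) by simp
      then have "x \<in> cocycles P 0" using that(1) zero_mod by (simp add: cocycles_def)
      then have "x \<in> coboundaries P 0" using qi(2) that(2) coboundaries_stalk[OF N] by blast
      then show ?thesis by (simp add: coboundaries_def)
    qed
    show "x \<in> diff P (- int (Suc (Suc l))) ` carrier (obj P (- int (Suc (Suc l))))"
      if x: "x \<in> carrier (obj P (- int (Suc l)))" "diff P (- int (Suc l)) x = \<zero>\<^bsub>obj P (- int l)\<^esub>" for l x
    proof -
      have xz: "x \<in> cocycles P (- int (Suc l))" using x by (simp add: cocycles_def)
      have "f (- int (Suc l)) x \<in> carrier (obj (stalk N 0) (- int (Suc l)))"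
        by (rule mod_homD(1)[OF chain_mapD(1)[OF qi(1)] x(1)])
      then have "f (- int (Suc l)) x \<in> coboundaries (stalk N 0) (- int (Suc l))"
        by (simp add: coboundaries_stalk[OF N] stalk_simps)
      then have "x \<in> coboundaries P (- int (Suc l))" by (rule qi(2)[OF xz])
      then show ?thesis unfolding coboundaries_def idx[of "Suc l"] .
    qed
  qed
qed

context resolution
begin

lemmas aug_props = mod_homD[OF aug_hom] mod_hom_more[OF mod_X mod_N aug_hom]
lemmas d_props = mod_homD[OF d_hom] mod_hom_more[OF mod_X mod_X d_hom]

text \<open>In positive degrees the zero module is realized inside \<open>X 0\<close>, since all
  terms share one element type.\<close>

definition cochain :: "('r, 'p) cochain"
  where "cochain = \<lparr>obj = (\<lambda>n. if n \<le> 0 then X (nat (- n)) else sub_mod (X 0) {\<zero>\<^bsub>X 0\<^esub>}),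
    diff = (\<lambda>n. if n < 0 then d (nat (- n - 1)) else (\<lambda>_. \<zero>\<^bsub>X 0\<^esub>))\<rparr>"

lemma cochain_simps:
  "obj cochain (- int l) = X l" "n > 0 \<Longrightarrow> obj cochain n = sub_mod (X 0) {\<zero>\<^bsub>X 0\<^esub>}"
  "diff cochain (- int (Suc l)) = d l" "n \<ge> 0 \<Longrightarrow> diff cochain n = (\<lambda>_. \<zero>\<^bsub>X 0\<^esub>)"
  by (simp_all add: cochain_def)

lemma degree_cases:
  fixes n :: int
  obtains l where "n = - int (Suc l)" | "n = 0" | "n > 0"
proof (cases "n < 0")
  case True
  then have "n = - int (Suc (nat (- n - 1)))" by simp
  then show ?thesis using that(1) by blast
qed (use that in force)

lemma is_complex_cochain: "is_complex R cochain"
  unfolding is_complex_def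
proof (intro allI conjI ballI)
  fix n
  interpret X0: module R "X 0" by (rule mod_X)
  have Z: "module R (sub_mod (X 0) {\<zero>\<^bsub>X 0\<^esub>})" by (rule module_sub_mod[OF mod_X X0.submod_zero])
  show "module R (obj cochain n)" using mod_X Z by (simp add: cochain_def)
  show "diff cochain n \<in> mod_hom R (obj cochain n) (obj cochain (n + 1))"
  proof (cases n rule: degree_cases)
    case (1 l)
    then have "n + 1 = - int l" by simp
    then show ?thesis using d_hom 1 cochain_simps(1,3) by (metis)
  next
    case 2
    then show ?thesis by (auto simp: cochain_def mod_hom_def)
  next
    case 3
    then show ?thesis by (auto simp: cochain_def mod_hom_def)
  qed
  fix x assume x: "x \<in> carrier (obj cochain n)"
  show "diff cochain (n + 1) (diff cochain n x) = \<zero>\<^bsub>obj cochain (n + 2)\<^esub>"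
  proof (cases n rule: degree_cases)
    case (1 l)
    show ?thesis
    proof (cases l)
      case 0
      then show ?thesis using 1 by (simp add: cochain_def)
    next
      case (Suc l')
      have "n + 1 = - int (Suc l')" "n + 2 = - int l'" using 1 Suc by simp_all
      then show ?thesis using dd[of x l'] x 1 Suc cochain_simps(1,3) by (metis)
    qed
  qed (auto simp: cochain_def)
qed

lemma proj_resolution_cochain:
  assumes "\<And>l. projective_mod R (X l)" "projective_mod R (sub_mod (X 0) {\<zero>\<^bsub>X 0\<^esub>})"
  shows "proj_resolution R N cochain"
  unfolding proj_resolution_def
proof (intro conjI allI impI exI)
  let ?f = "\<lambda>n. if n = (0::int) then aug else (\<lambda>_. \<zero>\<^bsub>N\<^esub>)"
  interpret N: module R N by (rule mod_N)
  show "is_complex R cochain" by (rule is_complex_cochain)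
  show "projective_mod R (obj cochain n)" for n using assms by (simp add: cochain_def)
  show "is_zero_mod (obj cochain n)" if "0 < n" for n using that by (simp add: cochain_def is_zero_mod_def)
  have ob: "obj cochain 0 = X 0" by (simp add: cochain_def)
  have f: "chain_map R cochain (stalk N 0) ?f"
    unfolding chain_map_def
  proof (intro allI conjI ballI)
    fix n
    show "?f n \<in> mod_hom R (obj cochain n) (obj (stalk N 0) n)"
      using aug_hom by (auto simp: stalk_simps ob mod_hom_def)
    show "?f (n + 1) (diff cochain n x) = diff (stalk N 0) n (?f n x)" if x: "x \<in> carrier (obj cochain n)" for x
    proof (cases "n = -1")
      case True
      then have "x \<in> carrier (X (Suc 0))" "diff cochain n = d 0"
        using x cochain_simps(1)[of "Suc 0"] cochain_simps(3)[of 0] by simp_all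
      then show ?thesis using aug_d[of x] True by (simp add: stalk_simps)
    next
      case False
      then show ?thesis by (simp add: stalk_simps)
    qed
  qed
  show "quasi_iso R cochain (stalk N 0) ?f"
  proof (rule quasi_isoI[OF is_complex_cochain is_complex_stalk[OF mod_N] f])
    fix n z assume z: "z \<in> cocycles cochain n" "?f n z \<in> coboundaries (stalk N 0) n"
    show "z \<in> coboundaries cochain n"
    proof (cases n rule: degree_cases)
      case (1 l)
      have i: "n + 1 = - int l" "n - 1 = - int (Suc (Suc l))" using 1 by simp_all
      have "z \<in> carrier (X (Suc l))" "d l z = \<zero>\<^bsub>X l\<^esub>"
        using z(1) unfolding cocycles_def i(1) unfolding 1 cochain_simps by auto
      then have "z \<in> d (Suc l) ` carrier (X (Suc (Suc l)))" by (rule exact_d)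
      then show ?thesis unfolding coboundaries_def i(2) cochain_simps .
    next
      case 2
      have "z \<in> carrier (X 0)" "aug z = \<zero>\<^bsub>N\<^esub>" using z 2 coboundaries_stalk[OF mod_N] by (auto simp: cocycles_def ob)
      then have "z \<in> d 0 ` carrier (X (Suc 0))" by (rule exact_aug)
      moreover have "n - 1 = - int (Suc 0)" using 2 by simp
      ultimately show ?thesis unfolding coboundaries_def cochain_simps by (metis cochain_simps(1,3))
    next
      case 3
      then have "z = \<zero>\<^bsub>obj cochain n\<^esub>" using z(1) by (simp add: cocycles_def cochain_def)
      then show ?thesis
        using module.submodD(2)[OF is_complexD(1)[OF is_complex_cochain] submodule_coboundaries[OF is_complex_cochain]] by simp
    qed
  next
    fix n y assume y: "y \<in> cocycles (stalk N 0) n"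
    show "\<exists>z\<in>cocycles cochain n. y \<ominus>\<^bsub>obj (stalk N 0) n\<^esub> ?f n z \<in> coboundaries (stalk N 0) n"
    proof (cases "n = 0")
      case True
      then have "y \<in> carrier N" using y by (simp add: cocycles_stalk stalk_simps)
      then obtain z where z: "z \<in> carrier (X 0)" "aug z = y" using aug_surj by (metis imageE)
      have "z \<in> cocycles cochain 0" using z(1) by (simp add: cocycles_def cochain_def)
      then show ?thesis
        using True z(2) \<open>y \<in> carrier N\<close> by (intro bexI[of _ z]) (auto simp: coboundaries_stalk[OF mod_N] stalk_simps N.minus_self)
    next
      case False
      have S: "module R (obj (stalk N 0) n)" by (rule is_complexD[OF is_complex_stalk[OF mod_N]])
      have y0: "y \<in> carrier (obj (stalk N 0) n)" "y = \<zero>\<^bsub>N\<^esub>" using y False by (auto simp: cocycles_stalk stalk_simps)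
      have "y \<ominus>\<^bsub>obj (stalk N 0) n\<^esub> \<zero>\<^bsub>N\<^esub> = \<zero>\<^bsub>obj (stalk N 0) n\<^esub>"
        using module.minus_self[OF S y0(1)] y0(2) by simp
      then have "y \<ominus>\<^bsub>obj (stalk N 0) n\<^esub> ?f n \<zero>\<^bsub>obj cochain n\<^esub> \<in> coboundaries (stalk N 0) n"
        using False by (simp add: coboundaries_stalk[OF mod_N] stalk_simps)
      then show ?thesis
        using module.submodD(2)[OF is_complexD(1)[OF is_complex_cochain] submodule_cocycles[OF is_complex_cochain]] by blast
    qed
  qed
qed

end

section \<open>Comparison of resolutions up to homotopy\<close>

locale projective_resolution = resolution R N X d aug
  for R :: "('r, 'k) ring_scheme" (structure) and N :: "('r, 'n) module" and X :: "nat \<Rightarrow> ('r, 'p) module" and d aug +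
  assumes proj_X: "\<And>l. projective_mod R (X l)"
begin

text \<open>The comparison theorem of homological algebra; the injections \<open>e1\<close>,
  \<open>e2\<close>, \<open>e3\<close> are there for \<open>projective_lift\<close>.\<close>

lemma comparison_exists:
  fixes Y :: "nat \<Rightarrow> ('r, 'y) module" and e1 :: "'y \<Rightarrow> 'p \<Rightarrow> 'r" and e2 :: "'y \<Rightarrow> 'p" and e3 :: "'n \<Rightarrow> 'p"
  assumes Y: "resolution R N Y dY augY" and inj: "inj e1" "inj e2" "inj e3"
  shows "\<exists>\<phi>. (\<forall>l. \<phi> l \<in> mod_hom R (X l) (Y l)) \<and> (\<forall>x\<in>carrier (X 0). augY (\<phi> 0 x) = aug x) \<and>
    (\<forall>l. \<forall>x\<in>carrier (X (Suc l)). dY l (\<phi> (Suc l) x) = \<phi> l (d l x))"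
proof -
  interpret Y: resolution R N Y dY augY by fact
  \<comment> \<open>The recursion sees only the latest map, so the invariant records what the next
    lift needs of the previous square: cycles go to cycles, and these are boundaries in
    \<open>Y\<close>.\<close>
  let ?P = "\<lambda>l \<phi>. \<phi> \<in> mod_hom R (X l) (Y l) \<and> (l = 0 \<longrightarrow> (\<forall>x\<in>carrier (X 0). augY (\<phi> x) = aug x)) \<and>
    (\<forall>l'. l = Suc l' \<longrightarrow> (\<forall>x\<in>carrier (X (Suc l')). d l' x = \<zero>\<^bsub>X l'\<^esub> \<longrightarrow> dY l' (\<phi> x) = \<zero>\<^bsub>Y l'\<^esub>))"
  let ?Q = "\<lambda>l \<phi> \<phi>'. \<forall>x\<in>carrier (X (Suc l)). dY l (\<phi>' x) = \<phi> (d l x)"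
  have "\<exists>\<phi>. \<forall>l. ?P l (\<phi> l) \<and> ?Q l (\<phi> l) (\<phi> (Suc l))"
  proof (rule dependent_nat_choice)
    have "aug ` carrier (X 0) \<subseteq> augY ` carrier (Y 0)" using aug_surj Y.aug_surj by simp
    then obtain \<phi> where "\<phi> \<in> mod_hom R (X 0) (Y 0)" "\<forall>x\<in>carrier (X 0). augY (\<phi> x) = aug x"
      using projective_lift[OF proj_X Y.mod_X mod_N inj(1,3) Y.aug_hom aug_hom] by blast
    then show "\<exists>\<phi>. ?P 0 \<phi>" by blast
  next
    fix \<phi> l assume P: "?P l \<phi>"
    then have \<phi>: "\<phi> \<in> mod_hom R (X l) (Y l)" by blast
    have f: "(\<lambda>x. \<phi> (d l x)) \<in> mod_hom R (X (Suc l)) (Y l)" by (rule mod_hom_compose[OF d_hom \<phi>])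
    have "\<phi> (d l x) \<in> dY l ` carrier (Y (Suc l))" if x: "x \<in> carrier (X (Suc l))" for x
    proof (cases l)
      case 0
      have "augY (\<phi> (d l x)) = \<zero>\<^bsub>N\<^esub>" using P 0 x aug_d d_props(1) by simp
      then show ?thesis using Y.exact_aug[of "\<phi> (d l x)"] mod_homD(1)[OF f x] 0 by simp
    next
      case (Suc l')
      have "dY l' (\<phi> (d l x)) = \<zero>\<^bsub>Y l'\<^esub>" using P Suc x dd d_props(1) by simp
      then show ?thesis using Y.exact_d[of "\<phi> (d l x)" l'] mod_homD(1)[OF f x] Suc by simp
    qed
    then have "(\<lambda>x. \<phi> (d l x)) ` carrier (X (Suc l)) \<subseteq> dY l ` carrier (Y (Suc l))" by blast
    from projective_lift[OF proj_X Y.mod_X Y.mod_X inj(1,2) Y.d_hom f this]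
    obtain \<phi>' where \<phi>': "\<phi>' \<in> mod_hom R (X (Suc l)) (Y (Suc l))" "?Q l \<phi> \<phi>'" by blast
    have "?P (Suc l) \<phi>'" using \<phi>' mod_hom_more(1)[OF mod_X Y.mod_X \<phi>] by simp
    then show "\<exists>\<phi>'. ?P (Suc l) \<phi>' \<and> ?Q l \<phi> \<phi>'" using \<phi>'(2) by blast
  qed
  then obtain \<phi> where \<phi>: "\<forall>l. ?P l (\<phi> l) \<and> ?Q l (\<phi> l) (\<phi> (Suc l))" by (rule exE)
  have "?P l (\<phi> l)" "?Q l (\<phi> l) (\<phi> (Suc l))" for l
    by (rule conjunct1[OF spec[OF \<phi>]], rule conjunct2[OF spec[OF \<phi>]])
  then show ?thesis by (intro exI[of _ \<phi>]) simp
qed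

lemma homotopy_exists:
  fixes Y :: "nat \<Rightarrow> ('r, 'y) module" and e1 :: "'y \<Rightarrow> 'p \<Rightarrow> 'r" and e2 :: "'y \<Rightarrow> 'p"
  assumes Y: "resolution R N Y dY augY" and inj: "inj e1" "inj e2"
    and \<tau>: "\<And>l. \<tau> l \<in> mod_hom R (X l) (Y l)" "\<And>x. x \<in> carrier (X 0) \<Longrightarrow> augY (\<tau> 0 x) = \<zero>\<^bsub>N\<^esub>"
      "\<And>l x. x \<in> carrier (X (Suc l)) \<Longrightarrow> dY l (\<tau> (Suc l) x) = \<tau> l (d l x)"
  shows "\<exists>\<theta>. (\<forall>l. \<theta> l \<in> mod_hom R (X l) (Y (Suc l))) \<and> (\<forall>x\<in>carrier (X 0). dY 0 (\<theta> 0 x) = \<tau> 0 x) \<and>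
    (\<forall>l. \<forall>x\<in>carrier (X (Suc l)). dY (Suc l) (\<theta> (Suc l) x) = \<tau> (Suc l) x \<ominus>\<^bsub>Y (Suc l)\<^esub> \<theta> l (d l x))"
proof -
  interpret Y: resolution R N Y dY augY by fact
  let ?ker = "\<lambda>l x. \<forall>l'. l = Suc l' \<longrightarrow> d l' x = \<zero>\<^bsub>X l'\<^esub>"
  \<comment> \<open>On cycles the homotopy equation reads \<open>d \<theta> = \<tau>\<close>,
    without the term \<open>\<theta> d\<close>; this makes \<open>?f\<close>, the right-hand side
    for the next map, take values in cycles.\<close>
  let ?P = "\<lambda>l \<theta>. \<theta> \<in> mod_hom R (X l) (Y (Suc l)) \<and> (\<forall>x\<in>carrier (X l). ?ker l x \<longrightarrow> dY l (\<theta> x) = \<tau> l x)"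
  let ?Q = "\<lambda>l \<theta> \<theta>'. \<forall>x\<in>carrier (X (Suc l)). dY (Suc l) (\<theta>' x) = \<tau> (Suc l) x \<ominus>\<^bsub>Y (Suc l)\<^esub> \<theta> (d l x)"
  have "\<exists>\<theta>. \<forall>l. ?P l (\<theta> l) \<and> ?Q l (\<theta> l) (\<theta> (Suc l))"
  proof (rule dependent_nat_choice)
    have "\<tau> 0 ` carrier (X 0) \<subseteq> dY 0 ` carrier (Y (Suc 0))"
      using Y.exact_aug \<tau>(2) mod_homD(1)[OF \<tau>(1)] by blast
    from projective_lift[OF proj_X Y.mod_X Y.mod_X inj Y.d_hom \<tau>(1) this]
    show "\<exists>\<theta>. ?P 0 \<theta>" by auto
  next
    fix \<theta> l assume P: "?P l \<theta>"
    then have \<theta>: "\<theta> \<in> mod_hom R (X l) (Y (Suc l))" by blast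
    let ?f = "\<lambda>x. \<tau> (Suc l) x \<ominus>\<^bsub>Y (Suc l)\<^esub> \<theta> (d l x)"
    interpret Yl: module R "Y l" by (rule Y.mod_X)
    interpret YS: module R "Y (Suc l)" by (rule Y.mod_X)
    have f: "?f \<in> mod_hom R (X (Suc l)) (Y (Suc l))"
      by (rule mod_hom_minus[OF mod_X Y.mod_X \<tau>(1) mod_hom_compose[OF d_hom \<theta>]])
    have "?f x \<in> dY (Suc l) ` carrier (Y (Suc (Suc l)))" if x: "x \<in> carrier (X (Suc l))" for x
    proof (rule Y.exact_d[OF mod_homD(1)[OF f x]])
      have dx: "d l x \<in> carrier (X l)" using d_props(1)[OF x] .
      have k: "?ker l (d l x)" using dd x by auto
      have "dY l (?f x) = dY l (\<tau> (Suc l) x) \<ominus>\<^bsub>Y l\<^esub> dY l (\<theta> (d l x))"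
        by (rule Y.d_props(6)[OF mod_homD(1)[OF \<tau>(1) x] mod_homD(1)[OF \<theta> dx]])
      also have "\<dots> = \<tau> l (d l x) \<ominus>\<^bsub>Y l\<^esub> \<tau> l (d l x)" using \<tau>(3)[OF x] P dx k by simp
      also have "\<dots> = \<zero>\<^bsub>Y l\<^esub>" using mod_homD(1)[OF \<tau>(1) dx] by (rule Yl.minus_self)
      finally show "dY l (?f x) = \<zero>\<^bsub>Y l\<^esub>" .
    qed
    then have "?f ` carrier (X (Suc l)) \<subseteq> dY (Suc l) ` carrier (Y (Suc (Suc l)))" by blast
    from projective_lift[OF proj_X Y.mod_X Y.mod_X inj Y.d_hom f this]
    obtain \<theta>' where \<theta>': "\<theta>' \<in> mod_hom R (X (Suc l)) (Y (Suc (Suc l)))" "?Q l \<theta> \<theta>'" by blast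
    have "\<tau> (Suc l) x \<ominus>\<^bsub>Y (Suc l)\<^esub> \<zero>\<^bsub>Y (Suc l)\<^esub> = \<tau> (Suc l) x" if "x \<in> carrier (X (Suc l))" for x
      using mod_homD(1)[OF \<tau>(1) that] by algebra
    then have "?P (Suc l) \<theta>'" using \<theta>' mod_hom_more(1)[OF mod_X Y.mod_X \<theta>] by simp
    then show "\<exists>\<theta>'. ?P (Suc l) \<theta>' \<and> ?Q l \<theta> \<theta>'" using \<theta>'(2) by blast
  qed
  then obtain \<theta> where \<theta>: "\<forall>l. ?P l (\<theta> l) \<and> ?Q l (\<theta> l) (\<theta> (Suc l))" by (rule exE)
  have "?P l (\<theta> l)" "?Q l (\<theta> l) (\<theta> (Suc l))" for l
    by (rule conjunct1[OF spec[OF \<theta>]], rule conjunct2[OF spec[OF \<theta>]])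
  then show ?thesis by (intro exI[of _ \<theta>]) simp
qed

end

section \<open>Minimal free resolutions\<close>

text \<open>This is \<open>I F\<close> for the free module \<open>F\<close> on
  \<open>S\<close>.\<close>

definition coeff_sub :: "('r, 'k) ring_scheme \<Rightarrow> 'r set \<Rightarrow> 's set \<Rightarrow> ('s \<Rightarrow> 'r) set"
  where "coeff_sub R I S = {\<phi> \<in> carrier (free_mod R S). \<forall>s. \<phi> s \<in> I}"

context cring
begin

lemma submodule_coeff_sub:
  assumes "ideal I R"
  shows "submodule (coeff_sub R I S) R (free_mod R S)"
proof -
  interpret F: module R "free_mod R S" by (rule module_free_mod)
  note I = idealD[OF assms]
  show ?thesis
  proof (rule F.submod_intro)
    show "\<zero>\<^bsub>free_mod R S\<^esub> \<in> coeff_sub R I S" using I(2) F.M.zero_closed by (simp add: coeff_sub_def free_mod_simps(2))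
    show "a \<oplus>\<^bsub>free_mod R S\<^esub> b \<in> coeff_sub R I S" if "a \<in> coeff_sub R I S" "b \<in> coeff_sub R I S" for a b
      using that I(3) F.M.a_closed[of a b] by (simp add: coeff_sub_def free_mod_simps(3))
    show "c \<odot>\<^bsub>free_mod R S\<^esub> a \<in> coeff_sub R I S" if "c \<in> carrier R" "a \<in> coeff_sub R I S" for a c
      using that I(4) F.smult_closed[of c a] by (simp add: coeff_sub_def free_mod_simps(4))
  qed (auto simp: coeff_sub_def)
qed

lemma smult_coeff_sub:
  assumes "ideal I R" "c \<in> I" "\<phi> \<in> carrier (free_mod R S)"
  shows "c \<odot>\<^bsub>free_mod R S\<^esub> \<phi> \<in> coeff_sub R I S"
proof -
  have "c \<in> carrier R" using idealD(1)[OF assms(1)] assms(2) by blast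
  then have "c \<odot>\<^bsub>free_mod R S\<^esub> \<phi> \<in> carrier (free_mod R S)"
    using module.smult_closed[OF module_free_mod] assms(3) by blast
  then show ?thesis
    using idealD(5)[OF assms(1,2)] free_modD(1)[OF assms(3)] by (simp add: coeff_sub_def free_mod_simps(4))
qed

lemma hom_coeff_sub:
  assumes "ideal I R" "h \<in> mod_hom R (free_mod R S) (free_mod R S')" "\<phi> \<in> coeff_sub R I S"
  shows "h \<phi> \<in> coeff_sub R I S'"
proof (rule hom_free_in_submod[OF module_free_mod assms(2) submodule_coeff_sub[OF assms(1)]])
  show "\<phi> \<in> carrier (free_mod R S)" using assms(3) by (simp add: coeff_sub_def)
  show "\<phi> s \<odot>\<^bsub>free_mod R S'\<^esub> h (free_gen R s) \<in> coeff_sub R I S'" if "s \<in> S" for s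
    by (rule smult_coeff_sub[OF assms(1)]) (use assms(3) mod_homD(1)[OF assms(2) free_gen_closed[OF that]] in \<open>auto simp: coeff_sub_def\<close>)
qed

lemma gspan_free_mod:
  assumes "finite T"
  shows "\<exists>S. set S \<subseteq> carrier (free_mod R T) \<and> carrier (free_mod R T) \<subseteq> gspan (free_mod R T) (carrier R) {\<zero>\<^bsub>free_mod R T\<^esub>} S"
proof -
  interpret F: module R "free_mod R T" by (rule module_free_mod)
  obtain S where S: "set S = free_gen R ` T" using finite_list[OF finite_imageI[OF assms, of "free_gen R"]] by blast
  have Sc: "set S \<subseteq> carrier (free_mod R T)" unfolding S by (rule image_subsetI) (rule free_gen_closed)
  have "carrier (free_mod R T) \<subseteq> gspan (free_mod R T) (carrier R) {\<zero>\<^bsub>free_mod R T\<^esub>} S"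
    by (rule free_mod_generated[OF F.submod_gspan[OF oneideal F.submod_zero Sc]])
      (rule subsetD[OF F.gspan_gens[OF F.submod_zero Sc]], simp add: S)
  then show ?thesis using Sc by blast
qed

lemma submodule_free_mod_fg:
  assumes "noetherian_ring R" "finite T" "submodule W R (free_mod R T)"
  shows "\<exists>S. set S \<subseteq> W \<and> W \<subseteq> gspan (free_mod R T) (carrier R) {\<zero>\<^bsub>free_mod R T\<^esub>} S"
proof -
  interpret F: module R "free_mod R T" by (rule module_free_mod)
  note W = F.submodD(1)[OF assms(3)]
  obtain S0 where S0: "set S0 \<subseteq> carrier (free_mod R T)"
    "carrier (free_mod R T) \<subseteq> gspan (free_mod R T) (carrier R) {\<zero>\<^bsub>free_mod R T\<^esub>} S0"
    using gspan_free_mod[OF assms(2)] by blast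
  from submodule_noetherian[OF assms(1) module_free_mod F.submod_zero S0(1) assms(3)] W S0(2)
  obtain S where S: "set S \<subseteq> W"
    "\<And>w. w \<in> W \<Longrightarrow> \<exists>v\<in>gspan (free_mod R T) (carrier R) {\<zero>\<^bsub>free_mod R T\<^esub>} S. w \<ominus>\<^bsub>free_mod R T\<^esub> v \<in> {\<zero>\<^bsub>free_mod R T\<^esub>}"
    by (meson order_trans)
  have Sc: "set S \<subseteq> carrier (free_mod R T)" using S(1) W by blast
  have "w \<in> gspan (free_mod R T) (carrier R) {\<zero>\<^bsub>free_mod R T\<^esub>} S" if w: "w \<in> W" for w
  proof -
    obtain v where v: "v \<in> gspan (free_mod R T) (carrier R) {\<zero>\<^bsub>free_mod R T\<^esub>} S" "w \<ominus>\<^bsub>free_mod R T\<^esub> v = \<zero>\<^bsub>free_mod R T\<^esub>"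
      using S(2)[OF w] by blast
    have "v \<in> carrier (free_mod R T)"
      using v(1) F.submodD(1)[OF F.submod_gspan[OF oneideal F.submod_zero Sc]] by blast
    then have "w = v" using F.eq_of_minus_zero[OF _ _ v(2)] w W by blast
    then show ?thesis using v(1) by simp
  qed
  then show ?thesis using S(1) by blast
qed

end

lemma gspan_sub_mod: "gspan (sub_mod M W) C B S = gspan M C B S"
  by (induction S) simp_all

lemma (in cring) fin_gen_gspan:
  assumes "module R M" "fin_gen_mod R M"
  shows "\<exists>S. set S \<subseteq> carrier M \<and> carrier M \<subseteq> gspan M (carrier R) {\<zero>\<^bsub>M\<^esub>} S"
proof -
  interpret M: module R M by fact
  obtain A where A: "finite A" "A \<subseteq> carrier M" "\<And>x. x \<in> carrier M \<Longrightarrow> \<exists>c\<in>A \<rightarrow> carrier R. x = (\<Oplus>\<^bsub>M\<^esub>a\<in>A. c a \<odot>\<^bsub>M\<^esub> a)"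
    using assms(2) unfolding fin_gen_mod_def by blast
  obtain S where S: "set S = A" using finite_list[OF A(1)] by blast
  have Sc: "set S \<subseteq> carrier M" using S A by blast
  have sm: "submodule (gspan M (carrier R) {\<zero>\<^bsub>M\<^esub>} S) R M" by (rule M.submod_gspan[OF oneideal M.submod_zero Sc])
  have "x \<in> gspan M (carrier R) {\<zero>\<^bsub>M\<^esub>} S" if x: "x \<in> carrier M" for x
  proof -
    obtain c where c: "c \<in> A \<rightarrow> carrier R" "x = (\<Oplus>\<^bsub>M\<^esub>a\<in>A. c a \<odot>\<^bsub>M\<^esub> a)" using A(3)[OF x] by blast
    show ?thesis
      unfolding c(2) by (rule M.finsum_in_submod[OF sm A(1)])
        (use M.submodD(4)[OF sm] M.gspan_gens[OF M.submod_zero Sc] S c(1) in blast)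
  qed
  then show ?thesis using Sc by blast
qed

context noetherian_local_ring
begin

abbreviation mfree :: "'s set \<Rightarrow> ('s \<Rightarrow> 'a) set"
  where "mfree \<equiv> coeff_sub R (max_ideal R)"

lemma gen_notin_mfree: "s \<in> S \<Longrightarrow> free_gen R s \<notin> mfree S"
  using one_notin_max_ideal by (auto simp: coeff_sub_def free_gen_def split: if_splits)

text \<open>A generating list of minimal length has no relation with a unit coefficient.\<close>

lemma minimal_cover:
  fixes M :: "('a, 'm) module"
  assumes M: "module R M" and fg: "\<exists>S. set S \<subseteq> carrier M \<and> carrier M \<subseteq> gspan M (carrier R) {\<zero>\<^bsub>M\<^esub>} S"
  shows "\<exists>(T :: (nat \<times> 'x) set) \<pi>. finite T \<and> \<pi> \<in> mod_hom R (free_mod R T) M \<and> \<pi> ` carrier (free_mod R T) = carrier M \<and>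
    (\<forall>\<phi>\<in>carrier (free_mod R T). \<pi> \<phi> = \<zero>\<^bsub>M\<^esub> \<longrightarrow> \<phi> \<in> mfree T)"
proof -
  interpret M: module R M by fact
  let ?G = "gspan M (carrier R) {\<zero>\<^bsub>M\<^esub>}"
  let ?P = "\<lambda>S. set S \<subseteq> carrier M \<and> carrier M \<subseteq> ?G S"
  obtain S0 where "?P S0" using fg by (rule exE)
  from ex_has_least_nat[of ?P, OF this, of length]
  obtain S where SS: "?P S \<and> (\<forall>S'. ?P S' \<longrightarrow> length S \<le> length S')" by (rule exE)
  note S = conjunct1[OF SS] and min = conjunct2[OF SS, rule_format]
  \<comment> \<open>The dummy second component lets the basis live in the index type
    \<open>nat \<times> 'n \<times> 'r\<close> of \<open>res_elem\<close>, once \<open>'x\<close> is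
    instantiated.\<close>
  let ?T = "(\<lambda>i. (i, undefined :: 'x)) ` {..<length S}"
  let ?a = "\<lambda>t :: nat \<times> 'x. S ! fst t"
  have a: "?a \<in> ?T \<rightarrow> carrier M"
  proof (rule Pi_I)
    fix t assume "t \<in> ?T"
    then have "S ! fst t \<in> set S" by (intro nth_mem) auto
    then show "S ! fst t \<in> carrier M" using S by blast
  qed
  let ?\<pi> = "lin M ?a"
  have \<pi>: "?\<pi> \<in> mod_hom R (free_mod R ?T) M" by (rule lin_hom[OF M a])
  note \<pi>h = mod_homD[OF \<pi>] mod_hom_more[OF module_free_mod M \<pi>]
  interpret F: module R "free_mod R ?T" by (rule module_free_mod)
  have im: "submodule (?\<pi> ` carrier (free_mod R ?T)) R M"
    by (rule submod_image[OF module_free_mod M \<pi> F.carrier_is_submodule])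
  have "set S \<subseteq> ?\<pi> ` carrier (free_mod R ?T)"
  proof
    fix x assume "x \<in> set S"
    then obtain i where i: "i < length S" "x = S ! i" by (auto simp: in_set_conv_nth)
    then have "?\<pi> (free_gen R (i, undefined)) = x" using lin_gen[OF M a, of "(i, undefined)"] by simp
    moreover have "free_gen R (i, undefined) \<in> carrier (free_mod R ?T)" using i by (intro free_gen_closed) auto
    ultimately show "x \<in> ?\<pi> ` carrier (free_mod R ?T)" by (metis imageI)
  qed
  then have "?G S \<subseteq> ?\<pi> ` carrier (free_mod R ?T)"
    using M.gspan_minimal[OF im, of "{\<zero>\<^bsub>M\<^esub>}" S "carrier R"] M.submodD(2)[OF im] by simp
  then have surj: "?\<pi> ` carrier (free_mod R ?T) = carrier M" using S \<pi>h(1) by blast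
  have "\<phi> \<in> mfree ?T" if \<phi>: "\<phi> \<in> carrier (free_mod R ?T)" "?\<pi> \<phi> = \<zero>\<^bsub>M\<^esub>" for \<phi>
  proof (rule ccontr)
    assume "\<phi> \<notin> mfree ?T"
    then obtain t where t: "\<phi> t \<notin> max_ideal R" using \<phi>(1) by (auto simp: coeff_sub_def)
    have "t \<in> ?T" using free_modD(2)[OF \<phi>(1), of t] t idealD(2)[OF ideal_max_ideal] by metis
    then obtain i where i: "i < length S" "t = (i, undefined)" by blast
    let ?S = "take i S @ drop (Suc i) S"
    have Sc: "set ?S \<subseteq> carrier M" using S set_take_subset[of i S] set_drop_subset[of "Suc i" S] by auto
    have smX: "submodule (?G ?S) R M" by (rule M.submod_gspan[OF oneideal M.submod_zero Sc])
    note X = M.submodD[OF smX] and gens = M.gspan_gens[OF M.submod_zero Sc]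
    have other: "S ! j \<in> ?G ?S" if j: "j < length S" "j \<noteq> i" for j
    proof -
      have "S ! j \<in> set ?S"
      proof (cases "j < i")
        case True
        then have "S ! j = take i S ! j" "j < length (take i S)" using j by simp_all
        then show ?thesis by (metis UnI1 nth_mem set_append)
      next
        case False
        then have "S ! j = drop (Suc i) S ! (j - Suc i)" "j - Suc i < length (drop (Suc i) S)" using j by simp_all
        then show ?thesis by (metis UnI2 nth_mem set_append)
      qed
      then show ?thesis using gens by blast
    qed
    obtain y where y: "y \<in> carrier R" "y \<otimes> \<phi> t = \<one>"
      using unit_outside_max_ideal[OF free_modD(1)[OF \<phi>(1)] t] by blast
    let ?e = "free_gen R t"
    have e: "?e \<in> carrier (free_mod R ?T)" "?\<pi> ?e = S ! i"
      using free_gen_closed[OF \<open>t \<in> ?T\<close>] lin_gen[OF M a \<open>t \<in> ?T\<close>] i(2) by simp_all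
    have Si: "S ! i \<in> carrier M" using S i nth_mem by blast
    have pc: "\<phi> t \<in> carrier R" by (rule free_modD(1)[OF \<phi>(1)])
    \<comment> \<open>The relation without its unit term; the covering map sends it into the span of
      the other generators, which therefore contains \<open>S ! i\<close>.\<close>
    let ?\<psi> = "\<phi> \<ominus>\<^bsub>free_mod R ?T\<^esub> \<phi> t \<odot>\<^bsub>free_mod R ?T\<^esub> ?e"
    have \<psi>: "?\<psi> \<in> carrier (free_mod R ?T)" using \<phi>(1) e(1) pc by simp
    have psi: "\<phi> = ?\<psi> \<oplus>\<^bsub>free_mod R ?T\<^esub> \<phi> t \<odot>\<^bsub>free_mod R ?T\<^esub> ?e"
      using F.minus_add_cancel[OF \<phi>(1), of "\<phi> t \<odot>\<^bsub>free_mod R ?T\<^esub> ?e"] e(1) pc by simp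
    have "\<phi> t = ?\<psi> t \<oplus> \<phi> t \<otimes> \<one>"
      using arg_cong[OF psi, of "\<lambda>f. f t"] unfolding free_mod_simps(3,4) free_gen_simps .
    moreover have pt: "?\<psi> t \<in> carrier R" by (rule free_modD(1)[OF \<psi>])
    moreover have "a = (a \<oplus> b \<otimes> \<one>) \<ominus> b" if "a \<in> carrier R" "b \<in> carrier R" for a b
      using that by algebra
    moreover note this[OF pt pc]
    ultimately have \<psi>t: "?\<psi> t = \<zero>" using pc by (simp add: r_neg minus_eq)
    have "?\<pi> ?\<psi> \<in> ?G ?S"
    proof (rule hom_free_in_submod[OF M \<pi> smX _ \<psi>])
      fix s assume s: "s \<in> ?T"
      show "?\<psi> s \<odot>\<^bsub>M\<^esub> ?\<pi> (free_gen R s) \<in> ?G ?S"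
      proof (cases "s = t")
        case True
        then show ?thesis using \<psi>t X(2) e Si by simp
      next
        case False
        obtain j where j: "j < length S" "s = (j, undefined)" using s by blast
        then have "j \<noteq> i" using False i(2) by simp
        then have "S ! fst s \<in> ?G ?S" using other[OF j(1)] j(2) by simp
        then show ?thesis using X(4) free_modD(1)[OF \<psi>] lin_gen[OF M a s] by simp
      qed
    qed
    moreover have "?\<pi> ?\<psi> = \<ominus>\<^bsub>M\<^esub> (\<phi> t \<odot>\<^bsub>M\<^esub> S ! i)"
      using \<pi>h(6)[OF \<phi>(1), of "\<phi> t \<odot>\<^bsub>free_mod R ?T\<^esub> ?e"] \<pi>h(3)[OF pc e(1)] e \<phi>(2) pc Si by (simp add: M.M.minus_eq)
    ultimately have "\<phi> t \<odot>\<^bsub>M\<^esub> S ! i \<in> ?G ?S" using X(5) pc Si M.M.minus_minus by (metis M.smult_closed)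
    then have "y \<odot>\<^bsub>M\<^esub> (\<phi> t \<odot>\<^bsub>M\<^esub> S ! i) \<in> ?G ?S" using X(4) y(1) by blast
    then have "S ! i \<in> ?G ?S" using y pc Si by (simp flip: M.smult_assoc1)
    then have "set S \<subseteq> ?G ?S" using other by (metis in_set_conv_nth subsetI)
    then have "?G S \<subseteq> ?G ?S" using M.gspan_minimal[OF smX] X(2) by simp
    then have "length S \<le> length ?S" using min[of ?S] Sc S by (meson order_trans)
    then show False using i(1) by simp
  qed
  then show ?thesis using \<pi> surj by (intro exI[of _ ?T] exI[of _ ?\<pi>]) auto
qed

end

locale minimal_resolution = noetherian_local_ring R + resolution R N "\<lambda>l. free_mod R (T l)" d aug
  for R :: "('r, 'k) ring_scheme" (structure) and N :: "('r, 'n) module" and T :: "nat \<Rightarrow> (nat \<times> 'n \<times> 'r) set" and d aug +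
  assumes finite_T: "\<And>l. finite (T l)"
    and minimal: "\<And>l x. x \<in> carrier (free_mod R (T (Suc l))) \<Longrightarrow> d l x \<in> coeff_sub R (max_ideal R) (T l)"

lemma (in noetherian_local_ring) minimal_resolution_exists:
  fixes N :: "('a, 'n) module"
  assumes N: "module R N" "fin_gen_mod R N"
  shows "\<exists>T d aug. minimal_resolution R N T d aug"
proof -
  obtain T0 :: "(nat \<times> 'n \<times> 'a) set" and aug where T0: "finite T0" "aug \<in> mod_hom R (free_mod R T0) N"
    "aug ` carrier (free_mod R T0) = carrier N" "\<And>\<phi>. \<phi> \<in> carrier (free_mod R T0) \<Longrightarrow> aug \<phi> = \<zero>\<^bsub>N\<^esub> \<Longrightarrow> \<phi> \<in> mfree T0"
    using minimal_cover[OF N(1) fin_gen_gspan[OF N]] by blast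
  let ?F = "\<lambda>T. free_mod R T"
  let ?K0 = "{\<phi> \<in> carrier (?F T0). aug \<phi> = \<zero>\<^bsub>N\<^esub>}"
  \<comment> \<open>A state is the basis of the current free module together with the kernel that is
    still to be covered; the kernel lies in \<open>mF\<close> because each covering is
    minimal.\<close>
  let ?P = "\<lambda>l s. finite (fst s) \<and> submodule (snd s) R (?F (fst s)) \<and> snd s \<subseteq> mfree (fst s) \<and> (l = (0::nat) \<longrightarrow> s = (T0, ?K0))"
  let ?Q = "\<lambda>(l::nat) (s :: (nat \<times> 'n \<times> 'a) set \<times> (nat \<times> 'n \<times> 'a \<Rightarrow> 'a) set) s'. \<exists>d. d \<in> mod_hom R (?F (fst s')) (?F (fst s)) \<and>
    d ` carrier (?F (fst s')) = snd s \<and> snd s' = {\<phi> \<in> carrier (?F (fst s')). d \<phi> = \<zero>\<^bsub>?F (fst s)\<^esub>}"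
  have "\<exists>s. \<forall>l. ?P l (s l) \<and> ?Q l (s l) (s (Suc l))"
  proof (rule dependent_nat_choice)
    have "submodule ?K0 R (?F T0)" by (rule submod_kernel[OF module_free_mod N(1) T0(2)])
    then show "\<exists>s. ?P 0 s" using T0 by (intro exI[of _ "(T0, ?K0)"]) auto
  next
    fix s l assume P: "?P l s"
    then have fin: "finite (fst s)" and sm: "submodule (snd s) R (?F (fst s))" by auto
    let ?M = "sub_mod (?F (fst s)) (snd s)"
    have M: "module R ?M" by (rule module_sub_mod[OF module_free_mod sm])
    have "\<exists>S. set S \<subseteq> carrier ?M \<and> carrier ?M \<subseteq> gspan ?M (carrier R) {\<zero>\<^bsub>?M\<^esub>} S"
      using submodule_free_mod_fg[OF noeth fin sm] by (simp add: gspan_sub_mod)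
    from minimal_cover[OF M this] obtain T' :: "(nat \<times> 'n \<times> 'a) set" and \<pi> where T': "finite T'" "\<pi> \<in> mod_hom R (?F T') ?M"
      "\<pi> ` carrier (?F T') = carrier ?M" "\<And>\<phi>. \<phi> \<in> carrier (?F T') \<Longrightarrow> \<pi> \<phi> = \<zero>\<^bsub>?M\<^esub> \<Longrightarrow> \<phi> \<in> mfree T'" by blast
    have \<pi>: "\<pi> \<in> mod_hom R (?F T') (?F (fst s))"
      using T'(2) module.submodD(1)[OF module_free_mod sm] by (auto simp: mod_hom_def)
    let ?s = "(T', {\<phi> \<in> carrier (?F T'). \<pi> \<phi> = \<zero>\<^bsub>?F (fst s)\<^esub>})"
    have "?P (Suc l) ?s" using T' submod_kernel[OF module_free_mod module_free_mod \<pi>] by auto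
    moreover have "?Q l s ?s" using \<pi> T'(3) by (intro exI[of _ \<pi>]) simp
    ultimately show "\<exists>s'. ?P (Suc l) s' \<and> ?Q l s s'" by blast
  qed
  then obtain s where s: "\<forall>l. ?P l (s l) \<and> ?Q l (s l) (s (Suc l))" by (rule exE)
  have Pl: "?P l (s l)" and Ql: "?Q l (s l) (s (Suc l))" for l
    by (rule conjunct1[OF spec[OF s]], rule conjunct2[OF spec[OF s]])
  from choice[OF allI[OF Ql]] obtain d where d: "\<forall>l. d l \<in> mod_hom R (?F (fst (s (Suc l)))) (?F (fst (s l))) \<and>
    d l ` carrier (?F (fst (s (Suc l)))) = snd (s l) \<and> snd (s (Suc l)) = {\<phi> \<in> carrier (?F (fst (s (Suc l)))). d l \<phi> = \<zero>\<^bsub>?F (fst (s l))\<^esub>}"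
    by (rule exE)
  have dh: "d l \<in> mod_hom R (?F (fst (s (Suc l)))) (?F (fst (s l)))"
    and dim: "d l ` carrier (?F (fst (s (Suc l)))) = snd (s l)"
    and dker: "snd (s (Suc l)) = {\<phi> \<in> carrier (?F (fst (s (Suc l)))). d l \<phi> = \<zero>\<^bsub>?F (fst (s l))\<^esub>}" for l
    using spec[OF d, of l] by blast+
  have s0: "s 0 = (T0, ?K0)" using Pl[of 0] by simp
  have "minimal_resolution R N (\<lambda>l. fst (s l)) d aug"
  proof (intro minimal_resolution.intro minimal_resolution_axioms.intro resolution.intro resolution_axioms.intro)
    show "noetherian_local_ring R" by (rule noetherian_local_ring_axioms)
    show "cring R" by (rule is_cring)
    show "module R N" by (rule N)
    show "module R (?F (fst (s l)))" for l by (rule module_free_mod)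
    show "d l \<in> mod_hom R (?F (fst (s (Suc l)))) (?F (fst (s l)))" for l by (rule dh)
    show "aug \<in> mod_hom R (?F (fst (s 0))) N" "aug ` carrier (?F (fst (s 0))) = carrier N" using T0 s0 by simp_all
    show "aug (d 0 x) = \<zero>\<^bsub>N\<^esub>" if "x \<in> carrier (?F (fst (s (Suc 0))))" for x
      using dim[of 0] that unfolding s0 snd_conv by blast
    show "d l (d (Suc l) x) = \<zero>\<^bsub>?F (fst (s l))\<^esub>" if "x \<in> carrier (?F (fst (s (Suc (Suc l)))))" for l x
      using dim[of "Suc l"] dker[of l] that by blast
    show "x \<in> d 0 ` carrier (?F (fst (s (Suc 0))))" if "x \<in> carrier (?F (fst (s 0)))" "aug x = \<zero>\<^bsub>N\<^esub>" for x
      using that unfolding dim[of 0] s0 by simp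
    show "x \<in> d (Suc l) ` carrier (?F (fst (s (Suc (Suc l)))))"
      if "x \<in> carrier (?F (fst (s (Suc l))))" "d l x = \<zero>\<^bsub>?F (fst (s l))\<^esub>" for l x
      using that unfolding dim[of "Suc l"] dker[of l] by simp
    show "finite (fst (s l))" for l using Pl[of l] by simp
    show "d l x \<in> mfree (fst (s l))" if "x \<in> carrier (?F (fst (s (Suc l))))" for l x
      using dim[of l] Pl[of l] that by blast
  qed
  then show ?thesis by blast
qed

lemma coeff_subD: "\<phi> \<in> coeff_sub R I S \<Longrightarrow> \<phi> s \<in> I"
  unfolding coeff_sub_def by blast

lemma (in cring) projective_zero_mod:
  fixes M :: "('a, 'm) module"
  assumes "module R M"
  shows "projective_mod R (sub_mod M {\<zero>\<^bsub>M\<^esub>})"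
  unfolding projective_mod_def
proof (rule conjI)
  interpret M: module R M by fact
  show P: "module R (sub_mod M {\<zero>\<^bsub>M\<^esub>})" by (rule module_sub_mod[OF assms M.submod_zero])
  show "\<forall>(A :: ('a, 'm \<Rightarrow> 'a) module) (B :: ('a, 'm) module) g f.
       module R A \<and> module R B \<and> g \<in> mod_hom R A B \<and> g ` carrier A = carrier B \<and>
       f \<in> mod_hom R (sub_mod M {\<zero>\<^bsub>M\<^esub>}) B \<longrightarrow>
       (\<exists>h\<in>mod_hom R (sub_mod M {\<zero>\<^bsub>M\<^esub>}) A. \<forall>x\<in>carrier (sub_mod M {\<zero>\<^bsub>M\<^esub>}). g (h x) = f x)"
  proof (intro allI impI, elim conjE)
    fix A :: "('a, 'm \<Rightarrow> 'a) module" and B :: "('a, 'm) module" and g f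
    assume A: "module R A" and B: "module R B" and g: "g \<in> mod_hom R A B" and f: "f \<in> mod_hom R (sub_mod M {\<zero>\<^bsub>M\<^esub>}) B"
    interpret A: module R A by (rule A)
    have "(\<lambda>_. \<zero>\<^bsub>A\<^esub>) \<in> mod_hom R (sub_mod M {\<zero>\<^bsub>M\<^esub>}) A" by (auto simp: mod_hom_def)
    moreover have "g \<zero>\<^bsub>A\<^esub> = f x" if "x \<in> carrier (sub_mod M {\<zero>\<^bsub>M\<^esub>})" for x
      using that mod_hom_more(1)[OF A B g] mod_hom_more(1)[OF P B f] by simp
    ultimately show "\<exists>h\<in>mod_hom R (sub_mod M {\<zero>\<^bsub>M\<^esub>}) A. \<forall>x\<in>carrier (sub_mod M {\<zero>\<^bsub>M\<^esub>}). g (h x) = f x"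
      by (intro bexI[of _ "\<lambda>_. \<zero>\<^bsub>A\<^esub>"]) simp_all
  qed
qed

section \<open>Minimality, the length of \<open>F\<close> and projective dimension\<close>

context minimal_resolution
begin

abbreviation F :: "nat \<Rightarrow> ('r, nat \<times> 'n \<times> 'r \<Rightarrow> 'r) module"
  where "F l \<equiv> free_mod R (T l)"

sublocale projective_resolution R N F d aug
  by unfold_locales (rule projective_free_mod)

sublocale F: module R "F l" for l
  by (rule mod_X)

text \<open>With \<open>F_l = 0\<close>, exactness puts every basis vector of \<open>F_{l+1}\<close>
  into the image of the differential, which minimality confines to \<open>mF\<close>.\<close>

lemma T_empty_Suc:
  assumes "T l = {}"
  shows "T (Suc l) = {}"
proof (rule equals0I)
  fix s assume s: "s \<in> T (Suc l)"
  let ?e = "free_gen R s"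
  have e: "?e \<in> carrier (F (Suc l))" by (rule free_gen_closed[OF s])
  have "d l ?e \<in> carrier (F l)" by (rule d_props(1)[OF e])
  then have "d l ?e = \<zero>\<^bsub>F l\<^esub>" using assms by (auto simp: free_mod_simps)
  then have "?e \<in> d (Suc l) ` carrier (F (Suc (Suc l)))" by (rule exact_d[OF e])
  then obtain y where "?e = d (Suc l) y" "y \<in> carrier (F (Suc (Suc l)))" by (rule imageE)
  then have "?e \<in> mfree (T (Suc l))" using minimal[of y "Suc l"] by simp
  then show False by (rule notE[OF gen_notin_mfree[OF s]])
qed

lemma T_empty_mono:
  assumes "T l = {}" "l \<le> k"
  shows "T k = {}"
  using assms(2) by (induction k rule: dec_induct) (use assms(1) in \<open>simp_all add: T_empty_Suc\<close>)

text \<open>\<open>P\<close> is an arbitrary resolution, in the end the chosen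
  \<open>proj_res\<close>. The maps \<open>\<psi>\<close> and \<open>\<phi>\<close> exhibit
  \<open>F\<close> as a retract of \<open>P\<close> up to the homotopy
  \<open>\<theta>\<close>.\<close>

definition retract :: "('r, ('r, 'n) res_elem) cochain \<Rightarrow> (nat \<Rightarrow> ('r, 'n) res_elem \<Rightarrow> ('r, 'n) res_elem) \<Rightarrow>
    (nat \<Rightarrow> ('r, 'n) res_elem \<Rightarrow> ('r, 'n) res_elem) \<Rightarrow> bool"
  where "retract P \<psi> \<phi> \<longleftrightarrow>
    (\<forall>l. \<psi> l \<in> mod_hom R (F l) (obj P (- int l))) \<and> (\<forall>l. \<phi> l \<in> mod_hom R (obj P (- int l)) (F l)) \<and>
    (\<forall>l. \<forall>x\<in>carrier (F (Suc l)). diff P (- int (Suc l)) (\<psi> (Suc l) x) = \<psi> l (d l x)) \<and>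
    (\<forall>l. \<forall>x\<in>carrier (obj P (- int (Suc l))). d l (\<phi> (Suc l) x) = \<phi> l (diff P (- int (Suc l)) x)) \<and>
    (\<exists>\<theta>. (\<forall>l. \<theta> l \<in> mod_hom R (F l) (F (Suc l))) \<and>
      (\<forall>x\<in>carrier (F 0). d 0 (\<theta> 0 x) = x \<ominus>\<^bsub>F 0\<^esub> \<phi> 0 (\<psi> 0 x)) \<and>
      (\<forall>l. \<forall>x\<in>carrier (F (Suc l)). d (Suc l) (\<theta> (Suc l) x) = (x \<ominus>\<^bsub>F (Suc l)\<^esub> \<phi> (Suc l) (\<psi> (Suc l) x)) \<ominus>\<^bsub>F (Suc l)\<^esub> \<theta> l (d l x)))"

lemma retract_exists:
  fixes P :: "('r, ('r, 'n) res_elem) cochain"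
  assumes P: "proj_resolution R N P"
  shows "\<exists>\<psi> \<phi>. retract P \<psi> \<phi>"
proof -
  obtain augP where resP: "resolution R N (\<lambda>l. obj P (- int l)) (\<lambda>l. diff P (- int (Suc l))) augP"
    using resolution_of_proj_resolution[OF mod_N P] by blast
  have projP: "projective_resolution R N (\<lambda>l. obj P (- int l)) (\<lambda>l. diff P (- int (Suc l))) augP"
    by (intro projective_resolution.intro projective_resolution_axioms.intro resP)
      (use P in \<open>simp add: proj_resolution_def\<close>)
  interpret P: projective_resolution R N "\<lambda>l. obj P (- int l)" "\<lambda>l. diff P (- int (Suc l))" augP by (rule projP)
  \<comment> \<open>Indicator functions embed \<open>res_elem\<close> into the functions on itself,
    and \<open>'n\<close> into \<open>res_elem\<close>, as \<open>projective_lift\<close> requires;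
    they are injective since \<open>\<one> \<noteq> \<zero>\<close>.\<close>
  let ?e1 = "\<lambda>x p. if p = (x :: ('r, 'n) res_elem) then \<one> else \<zero>" and ?e3 = "\<lambda>x p. if fst (snd p) = (x :: 'n) then \<one> else \<zero>"
  have i1: "inj ?e1" by (rule inj_indicator[OF one_not_zero])
  have i3: "inj (?e3 :: 'n \<Rightarrow> ('r, 'n) res_elem)"
  proof (rule injI)
    fix x y assume "(?e3 x :: ('r, 'n) res_elem) = ?e3 y"
    from fun_cong[OF this, of "(0, x, \<one>)"] show "x = y" using one_not_zero by (auto split: if_splits)
  qed
  have resF: "resolution R N F d aug" by (rule resolution_axioms)
  obtain \<psi> where \<psi>: "\<And>l. \<psi> l \<in> mod_hom R (F l) (obj P (- int l))" "\<And>x. x \<in> carrier (F 0) \<Longrightarrow> augP (\<psi> 0 x) = aug x"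
    "\<And>l x. x \<in> carrier (F (Suc l)) \<Longrightarrow> diff P (- int (Suc l)) (\<psi> (Suc l) x) = \<psi> l (d l x)"
    using comparison_exists[OF resP i1 inj_on_id i3] by blast
  obtain \<phi> where \<phi>: "\<And>l. \<phi> l \<in> mod_hom R (obj P (- int l)) (F l)" "\<And>x. x \<in> carrier (obj P (- int 0)) \<Longrightarrow> aug (\<phi> 0 x) = augP x"
    "\<And>l x. x \<in> carrier (obj P (- int (Suc l))) \<Longrightarrow> d l (\<phi> (Suc l) x) = \<phi> l (diff P (- int (Suc l)) x)"
    using P.comparison_exists[OF resF i1 inj_on_id i3] by blast
  \<comment> \<open>The identity minus \<open>\<phi> \<psi>\<close>, a chain map that the
    augmentation kills, hence null-homotopic.\<close>
  let ?\<tau> = "\<lambda>l x. x \<ominus>\<^bsub>F l\<^esub> \<phi> l (\<psi> l x)"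
  have id: "(\<lambda>x. x) \<in> mod_hom R (F l) (F l)" for l by (auto simp: mod_hom_def)
  have \<phi>\<psi>: "(\<lambda>x. \<phi> l (\<psi> l x)) \<in> mod_hom R (F l) (F l)" for l by (rule mod_hom_compose[OF \<psi>(1) \<phi>(1)])
  have \<tau>: "?\<tau> l \<in> mod_hom R (F l) (F l)" for l by (rule mod_hom_minus[OF mod_X mod_X id \<phi>\<psi>])
  have "aug (?\<tau> 0 x) = \<zero>\<^bsub>N\<^esub>" if x: "x \<in> carrier (F 0)" for x
  proof -
    interpret N: module R N by (rule mod_N)
    have "aug (\<phi> 0 (\<psi> 0 x)) = aug x" using \<phi>(2) mod_homD(1)[OF \<psi>(1) x] \<psi>(2)[OF x] by simp
    then show ?thesis using aug_props(6)[OF x mod_homD(1)[OF \<phi>\<psi> x]] aug_props(1)[OF x] by (simp add: N.minus_self)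
  qed
  moreover have "d l (?\<tau> (Suc l) x) = ?\<tau> l (d l x)" if x: "x \<in> carrier (F (Suc l))" for l x
    using d_props(6)[OF x mod_homD(1)[OF \<phi>\<psi> x]] \<phi>(3)[OF mod_homD(1)[OF \<psi>(1) x]] \<psi>(3)[OF x] by simp
  ultimately obtain \<theta> where \<theta>: "\<forall>l. \<theta> l \<in> mod_hom R (F l) (F (Suc l))" "\<forall>x\<in>carrier (F 0). d 0 (\<theta> 0 x) = ?\<tau> 0 x"
    "\<forall>l. \<forall>x\<in>carrier (F (Suc l)). d (Suc l) (\<theta> (Suc l) x) = ?\<tau> (Suc l) x \<ominus>\<^bsub>F (Suc l)\<^esub> \<theta> l (d l x)"
    using homotopy_exists[OF resF i1 inj_on_id, of ?\<tau>] \<tau> by blast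
  have "retract P \<psi> \<phi>" unfolding retract_def using \<psi> \<phi> \<theta> by blast
  then show ?thesis by blast
qed

lemma retractD:
  assumes "retract P \<psi> \<phi>"
  shows "\<psi> l \<in> mod_hom R (F l) (obj P (- int l))" "\<phi> l \<in> mod_hom R (obj P (- int l)) (F l)"
    "x \<in> carrier (F (Suc l)) \<Longrightarrow> diff P (- int (Suc l)) (\<psi> (Suc l) x) = \<psi> l (d l x)"
    "y \<in> carrier (obj P (- int (Suc l))) \<Longrightarrow> d l (\<phi> (Suc l) y) = \<phi> l (diff P (- int (Suc l)) y)"
  using assms unfolding retract_def by blast+

text \<open>The map \<open>1 - \<phi> \<psi>\<close> equals \<open>d \<theta> + \<theta> d\<close>,
  and both terms have values in \<open>mF\<close> by minimality. So \<open>\<phi> \<psi>\<close> is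
  the identity modulo \<open>m\<close>, with units as diagonal entries.\<close>

lemma retract_mfree:
  assumes r: "retract P \<psi> \<phi>" and x: "x \<in> carrier (F l)"
  shows "x \<ominus>\<^bsub>F l\<^esub> \<phi> l (\<psi> l x) \<in> mfree (T l)"
proof -
  obtain \<theta> where \<theta>: "\<And>l. \<theta> l \<in> mod_hom R (F l) (F (Suc l))" "\<And>x. x \<in> carrier (F 0) \<Longrightarrow> d 0 (\<theta> 0 x) = x \<ominus>\<^bsub>F 0\<^esub> \<phi> 0 (\<psi> 0 x)"
    "\<And>l x. x \<in> carrier (F (Suc l)) \<Longrightarrow> d (Suc l) (\<theta> (Suc l) x) = (x \<ominus>\<^bsub>F (Suc l)\<^esub> \<phi> (Suc l) (\<psi> (Suc l) x)) \<ominus>\<^bsub>F (Suc l)\<^esub> \<theta> l (d l x)"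
    using r unfolding retract_def by blast
  show ?thesis
  proof (cases l)
    case 0
    then show ?thesis using \<theta>(2)[of x] x minimal[OF mod_homD(1)[OF \<theta>(1)]] by metis
  next
    case (Suc k)
    have x': "x \<in> carrier (F (Suc k))" using x Suc by simp
    let ?u = "x \<ominus>\<^bsub>F (Suc k)\<^esub> \<phi> (Suc k) (\<psi> (Suc k) x)"
    have u: "?u \<in> carrier (F (Suc k))"
      using x' mod_homD(1)[OF retractD(2)[OF r] mod_homD(1)[OF retractD(1)[OF r] x']] by simp
    have 1: "\<theta> k (d k x) \<in> mfree (T (Suc k))" by (rule hom_coeff_sub[OF ideal_max_ideal \<theta>(1) minimal[OF x']])
    have 2: "?u \<ominus>\<^bsub>F (Suc k)\<^esub> \<theta> k (d k x) \<in> mfree (T (Suc k))"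
      using minimal[OF mod_homD(1)[OF \<theta>(1) x']] \<theta>(3)[OF x'] by metis
    show ?thesis
      using F.submod_coset[OF submodule_coeff_sub[OF ideal_max_ideal] 2 1 u] Suc by simp
  qed
qed

text \<open>If \<open>P_l = 0\<close>, then \<open>\<phi> \<psi>\<close> vanishes on
  \<open>F_l\<close>, although it is the identity modulo \<open>m\<close>; so no resolution is
  shorter than \<open>F\<close>.\<close>

lemma T_empty_above:
  fixes P :: "('r, ('r, 'n) res_elem) cochain"
  assumes P: "proj_resolution R N P" and "is_zero_mod (obj P (- int l))"
  shows "T l = {}"
proof (rule equals0I)
  fix s assume s: "s \<in> T l"
  let ?e = "free_gen R s"
  have e: "?e \<in> carrier (F l)" by (rule free_gen_closed[OF s])
  obtain \<psi> \<phi> where r: "retract P \<psi> \<phi>" using retract_exists[OF P] by blast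
  have cpx: "is_complex R P" using P by (simp add: proj_resolution_def)
  have "\<psi> l ?e = \<zero>\<^bsub>obj P (- int l)\<^esub>" using mod_homD(1)[OF retractD(1)[OF r] e] assms(2) by (simp add: is_zero_mod_def)
  then have "\<phi> l (\<psi> l ?e) = \<zero>\<^bsub>F l\<^esub>" using mod_hom_more(1)[OF is_complexD(1)[OF cpx] mod_X retractD(2)[OF r]] by simp
  moreover have "?e \<ominus>\<^bsub>F l\<^esub> \<zero>\<^bsub>F l\<^esub> = ?e" using e by algebra
  ultimately show False using retract_mfree[OF r e] gen_notin_mfree[OF s] by simp
qed

lemma proj_dim_le:
  assumes "T i = {}"
  shows "proj_dim R N \<le> ereal (real_of_int (int i - 1))"
proof -
  have "proj_resolution R N cochain"
    by (rule proj_resolution_cochain) (rule projective_free_mod, rule projective_zero_mod[OF mod_X])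
  moreover have "is_zero_mod (obj cochain (- k))" if k: "k > int i - 1" for k
  proof -
    have "T (nat k) = {}" by (rule T_empty_mono[OF assms]) (use k in simp)
    then have "carrier (F (nat k)) = {\<zero>\<^bsub>F (nat k)\<^esub>}" by (auto simp: free_mod_simps)
    moreover have "obj cochain (- k) = F (nat k)" using k by (simp add: cochain_def)
    ultimately show ?thesis by (simp add: is_zero_mod_def)
  qed
  ultimately show ?thesis unfolding proj_dim_def by (intro Inf_lower) blast
qed

lemma T_finally_empty:
  assumes "proj_dim R N < \<infinity>"
  shows "\<exists>l. T l = {}"
proof -
  have "\<exists>n (P :: ('r, ('r, 'n) res_elem) cochain). proj_resolution R N P \<and> (\<forall>k>n. is_zero_mod (obj P (- k)))"
  proof (rule ccontr)
    assume "\<not> ?thesis"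
    then have "proj_dim R N = Inf {}" unfolding proj_dim_def by (intro arg_cong[where f = Inf]) blast
    then show False using assms by (simp add: top_ereal_def)
  qed
  then obtain n and P :: "('r, ('r, 'n) res_elem) cochain" where P: "proj_resolution R N P" "\<And>k. k > n \<Longrightarrow> is_zero_mod (obj P (- k))" by blast
  \<comment> \<open>\<open>n\<close> may be negative; \<open>nat (n + 1)\<close> exceeds it all the
    same.\<close>
  have "T (nat (n + 1)) = {}" by (rule T_empty_above[OF P(1) P(2)]) simp
  then show ?thesis by blast
qed

text \<open>
  The homology of \<open>F/I\<^sub>kF\<close> vanishes above degree \<open>k\<close>, where \<open>I\<^sub>k\<close> is generated by the first
  \<open>k\<close> elements of the regular sequence.
\<close>

lemma exact_mod_regular_sequence:
  assumes reg: "regular_sequence R xs"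
  shows "k \<le> length xs \<Longrightarrow> k \<le> j \<Longrightarrow> z \<in> carrier (F (Suc j)) \<Longrightarrow> d j z \<in> coeff_sub R (Idl (set (take k xs))) (T j) \<Longrightarrow>
    \<exists>w\<in>carrier (F (Suc (Suc j))). z \<ominus>\<^bsub>F (Suc j)\<^esub> d (Suc j) w \<in> coeff_sub R (Idl (set (take k xs))) (T (Suc j))"
proof (induction k arbitrary: j z)
  case 0
  have "d j z = \<zero>\<^bsub>F j\<^esub>"
    using 0(4) regular_sequence_ideals(2)[OF reg] by (auto simp: coeff_sub_def free_mod_simps)
  then obtain w where w: "w \<in> carrier (F (Suc (Suc j)))" "z = d (Suc j) w" using exact_d[OF 0(3)] by blast
  have "z \<ominus>\<^bsub>F (Suc j)\<^esub> d (Suc j) w = \<zero>\<^bsub>F (Suc j)\<^esub>" unfolding w(2) by (rule F.minus_self[OF d_props(1)[OF w(1)]])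
  then have "z \<ominus>\<^bsub>F (Suc j)\<^esub> d (Suc j) w \<in> coeff_sub R (Idl (set (take 0 xs))) (T (Suc j))"
    using F.submodD(2)[OF submodule_coeff_sub[OF regular_sequence_ideals(1)[OF reg]]] by metis
  then show ?case using w(1) by blast
next
  case (Suc k)
  let ?I = "\<lambda>k. Idl (set (take k xs))" and ?x = "xs ! k"
  have k: "k < length xs" using Suc.prems(1) by simp
  note I = regular_sequence_ideals(1)[OF reg] and x = regular_sequence_ideals(3)[OF reg k]
  note col = regular_sequence_ideals(4)[OF reg k] and adj = regular_sequence_ideals(5)[OF reg k]
  note Ik = idealD[OF I[of k]]
  note C = F.submodD[OF submodule_coeff_sub[OF I]]
  obtain j' where j: "j = Suc j'" "k \<le> j'" using Suc.prems(2) by (cases j) auto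
  let ?f = "d j z"
  have f: "?f \<in> carrier (F j)" by (rule d_props(1)[OF Suc.prems(3)])
  \<comment> \<open>Coefficientwise, \<open>d z \<in> (I_k + xR) F\<close> is split as
    \<open>?v \<oplus> x u\<close> with \<open>?v \<in> I_k F\<close>.\<close>
  define c where "c t = (SOME c. c \<in> carrier R \<and> ?f t \<ominus> c \<otimes> ?x \<in> ?I k)" for t
  have c: "c t \<in> carrier R" "?f t \<ominus> c t \<otimes> ?x \<in> ?I k" for t
  proof -
    have "?f t \<in> adjoin R (?I k) ?x" using coeff_subD[OF Suc.prems(4)] adj by simp
    then obtain i e where e: "?f t = i \<oplus> e \<otimes> ?x" "i \<in> ?I k" "e \<in> carrier R" unfolding adjoin_def by blast
    have "i \<in> carrier R" using e(2) Ik(1) by blast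
    then have "?f t \<ominus> e \<otimes> ?x = i" unfolding e(1) using e(3) x by algebra
    then have "\<exists>c. c \<in> carrier R \<and> ?f t \<ominus> c \<otimes> ?x \<in> ?I k" using e(2,3) by auto
    then have "c t \<in> carrier R \<and> ?f t \<ominus> c t \<otimes> ?x \<in> ?I k" unfolding c_def by (rule someI_ex)
    then show "c t \<in> carrier R" "?f t \<ominus> c t \<otimes> ?x \<in> ?I k" by blast+
  qed
  define u where "u t = (if t \<in> T j then c t else \<zero>)" for t
  have u: "u \<in> carrier (F j)" by (rule free_modI[of _ "T j"]) (use c finite_T in \<open>auto simp: u_def\<close>)
  let ?v = "?f \<ominus>\<^bsub>F j\<^esub> ?x \<odot>\<^bsub>F j\<^esub> u"
  have vc: "?v \<in> carrier (F j)" using f u x by simp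
  have vt: "?v t = ?f t \<ominus> ?x \<otimes> u t" for t
  proof -
    have "?v \<oplus>\<^bsub>F j\<^esub> ?x \<odot>\<^bsub>F j\<^esub> u = ?f" using f u x by (intro F.minus_add_cancel) auto
    from fun_cong[OF this, of t] have "?v t \<oplus> ?x \<otimes> u t = ?f t" by (simp add: free_mod_simps)
    moreover have "?v t \<in> carrier R" "u t \<in> carrier R" by (rule free_modD(1)[OF vc], rule free_modD(1)[OF u])
    moreover have "(?v t \<oplus> ?x \<otimes> u t) \<ominus> ?x \<otimes> u t = ?v t" using calculation(2,3) x by algebra
    ultimately show ?thesis by simp
  qed
  have v: "?v \<in> coeff_sub R (?I k) (T j)"
  proof -
    have "?v t \<in> ?I k" for t
    proof (cases "t \<in> T j")
      case True
      then show ?thesis using vt c[of t] x m_comm[of ?x "c t"] by (simp add: u_def)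
    next
      case False
      then show ?thesis using free_modD(2)[OF vc] Ik(2) by metis
    qed
    then show ?thesis using vc by (simp add: coeff_sub_def)
  qed
  have xu: "?x \<odot>\<^bsub>F j\<^esub> u = ?f \<ominus>\<^bsub>F j\<^esub> ?v"
    using f u x by algebra
  \<comment> \<open>\<open>x d u = d (d z) - d ?v\<close> lies in \<open>I_k F\<close>, and
    \<open>x\<close> is regular modulo \<open>I_k\<close>.\<close>
  have du: "d j' u \<in> coeff_sub R (?I k) (T j')"
  proof -
    have u': "u \<in> carrier (F (Suc j'))" and f': "?f \<in> carrier (F (Suc j'))" and v': "?v \<in> carrier (F (Suc j'))"
      using u f vc j(1) by simp_all
    have duc: "d j' u \<in> carrier (F j')" by (rule d_props(1)[OF u'])
    have dv: "d j' ?v \<in> coeff_sub R (?I k) (T j')"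
      using hom_coeff_sub[OF I d_hom] v j(1) by metis
    have "?x \<odot>\<^bsub>F j'\<^esub> d j' u = d j' (?x \<odot>\<^bsub>F (Suc j')\<^esub> u)" using d_props(3)[OF x u'] by simp
    also have "\<dots> = d j' ?f \<ominus>\<^bsub>F j'\<^esub> d j' ?v" using d_props(6)[OF f' v'] xu j(1) by simp
    also have "\<dots> \<in> coeff_sub R (?I k) (T j')"
    proof -
      have "d j' ?f = \<zero>\<^bsub>F j'\<^esub>" using dd Suc.prems(3) j(1) by simp
      then show ?thesis using C(2,6) dv by simp
    qed
    finally have "?x \<otimes> d j' u t \<in> ?I k" for t
      using coeff_subD[of "?x \<odot>\<^bsub>F j'\<^esub> d j' u" R "?I k" "T j'" t] by (simp add: free_mod_simps(4))
    then have "d j' u t \<in> colon R (?I k) ?x" for t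
      using free_modD(1)[OF duc, of t] x m_comm[of "d j' u t" ?x] by (simp add: colon_def)
    then show ?thesis using duc col by (simp add: coeff_sub_def)
  qed
  \<comment> \<open>First use of the induction hypothesis, one degree lower: \<open>u\<close> is a
    boundary modulo \<open>I_k\<close>. It needs \<open>k \<le> j'\<close>, which is why the bound
    on \<open>j\<close> grows with \<open>k\<close>.\<close>
  then obtain w where w: "w \<in> carrier (F (Suc (Suc j')))" "u \<ominus>\<^bsub>F (Suc j')\<^esub> d (Suc j') w \<in> coeff_sub R (?I k) (T (Suc j'))"
    using Suc.IH[of j' u] k j u by auto
  have wj: "w \<in> carrier (F (Suc j))" and uw: "u \<ominus>\<^bsub>F j\<^esub> d j w \<in> coeff_sub R (?I k) (T j)" using w j(1) by simp_all
  \<comment> \<open>Subtracting \<open>x w\<close> changes \<open>z\<close> within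
    \<open>I_{k+1} F\<close>, and \<open>d ?z = ?v \<oplus> x (u - d w)\<close> lies in
    \<open>I_k F\<close>; so the induction hypothesis applies again, now in degree
    \<open>j\<close>.\<close>
  let ?z = "z \<ominus>\<^bsub>F (Suc j)\<^esub> ?x \<odot>\<^bsub>F (Suc j)\<^esub> w"
  have z: "?z \<in> carrier (F (Suc j))" using Suc.prems(3) wj x by simp
  have "d j ?z = ?f \<ominus>\<^bsub>F j\<^esub> ?x \<odot>\<^bsub>F j\<^esub> d j w"
    using d_props(6)[OF Suc.prems(3), of "?x \<odot>\<^bsub>F (Suc j)\<^esub> w"] d_props(3)[OF x wj] wj x by simp
  also have "\<dots> = ?v \<oplus>\<^bsub>F j\<^esub> ?x \<odot>\<^bsub>F j\<^esub> (u \<ominus>\<^bsub>F j\<^esub> d j w)" using f u x d_props(1)[OF wj] by algebra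
  also have "\<dots> \<in> coeff_sub R (?I k) (T j)" using C(3)[OF v C(4)[OF x uw]] .
  finally obtain y where y: "y \<in> carrier (F (Suc (Suc j)))" "?z \<ominus>\<^bsub>F (Suc j)\<^esub> d (Suc j) y \<in> coeff_sub R (?I k) (T (Suc j))"
    using Suc.IH[of j ?z] k Suc.prems(2) z by auto
  have dy: "d (Suc j) y \<in> carrier (F (Suc j))" by (rule d_props(1)[OF y(1)])
  have sub: "?I k \<subseteq> ?I (Suc k)" "?x \<in> ?I (Suc k)" using ideal_adjoin[OF I x, of k] adj by auto
  have "z \<ominus>\<^bsub>F (Suc j)\<^esub> d (Suc j) y = (?z \<ominus>\<^bsub>F (Suc j)\<^esub> d (Suc j) y) \<oplus>\<^bsub>F (Suc j)\<^esub> ?x \<odot>\<^bsub>F (Suc j)\<^esub> w"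
    using Suc.prems(3) wj x dy by algebra
  moreover have "?z \<ominus>\<^bsub>F (Suc j)\<^esub> d (Suc j) y \<in> coeff_sub R (?I (Suc k)) (T (Suc j))"
    using y(2) sub(1) by (auto simp: coeff_sub_def)
  moreover have "?x \<odot>\<^bsub>F (Suc j)\<^esub> w \<in> coeff_sub R (?I (Suc k)) (T (Suc j))" by (rule smult_coeff_sub[OF I sub(2) wj])
  ultimately have "z \<ominus>\<^bsub>F (Suc j)\<^esub> d (Suc j) y \<in> coeff_sub R (?I (Suc k)) (T (Suc j))" using C(3) by simp
  then show ?case using y(1) by blast
qed

text \<open>
  If \<open>p > r\<close>, a socle element \<open>y\<close> modulo a maximal regular sequence gives a nonzero cycle \<open>y e\<close> of
  degree \<open>p\<close>, since the differential of the basis vector \<open>e\<close> has coefficients in the maximal ideal.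
\<close>

lemma length_le_depth:
  assumes "depth R = enat r" "T p \<noteq> {}" "T (Suc p) = {}"
  shows "p \<le> r"
proof (rule ccontr)
  assume "\<not> p \<le> r"
  then obtain j where j: "p = Suc j" "r \<le> j" by (cases p) auto
  obtain xs y where xs: "regular_sequence R xs" "length xs = r" and
    y: "y \<in> carrier R" "y \<notin> Idl (set xs)" "\<forall>x\<in>max_ideal R. x \<otimes> y \<in> Idl (set xs)"
    using maximal_regular_sequence[OF assms(1)] by blast
  have take: "take r xs = xs" using xs(2) by simp
  obtain t where t: "t \<in> T (Suc j)" using assms(2) j by blast
  let ?e = "free_gen R t"
  have e: "?e \<in> carrier (F (Suc j))" by (rule free_gen_closed[OF t])
  let ?z = "y \<odot>\<^bsub>F (Suc j)\<^esub> ?e"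
  have z: "?z \<in> carrier (F (Suc j))" using e y(1) by simp
  have de: "d j ?e \<in> mfree (T j)" by (rule minimal[OF e])
  have "d j ?z = y \<odot>\<^bsub>F j\<^esub> d j ?e" using d_props(3)[OF y(1) e] .
  moreover have "y \<otimes> d j ?e s \<in> Idl (set xs)" for s
  proof -
    have "d j ?e s \<in> max_ideal R" using de by (rule coeff_subD)
    then show ?thesis using y(1,3) m_comm[of y "d j ?e s"] idealD(1)[OF ideal_max_ideal] by auto
  qed
  ultimately have "d j ?z \<in> coeff_sub R (Idl (set (take r xs))) (T j)"
    using d_props(1)[OF z] by (simp add: coeff_sub_def take free_mod_simps(4))
  then obtain w where w: "w \<in> carrier (F (Suc (Suc j)))"
    "?z \<ominus>\<^bsub>F (Suc j)\<^esub> d (Suc j) w \<in> coeff_sub R (Idl (set (take r xs))) (T (Suc j))"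
    using exact_mod_regular_sequence[OF xs(1) _ j(2) z] xs(2) by blast
  \<comment> \<open>There is nothing above \<open>F_p\<close>, so \<open>y e\<close> itself has
    coefficients in the ideal of \<open>xs\<close>, contrary to the choice of
    \<open>y\<close>.\<close>
  have "w = \<zero>\<^bsub>F (Suc (Suc j))\<^esub>" using w(1) assms(3) j(1) by (auto simp: free_mod_simps)
  then have "d (Suc j) w = \<zero>\<^bsub>F (Suc j)\<^esub>" using d_props(4) by simp
  moreover have "?z \<ominus>\<^bsub>F (Suc j)\<^esub> \<zero>\<^bsub>F (Suc j)\<^esub> = ?z" using z by algebra
  ultimately have "?z t \<in> Idl (set xs)" using coeff_subD[OF w(2), of t] take by simp
  then show False using y(1,2) by (simp add: free_mod_simps(4) free_gen_simps)
qed

end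

section \<open>The top corner of \<open>RHom\<close>\<close>

lemma hom_cpx_simps:
  "carrier (obj (hom_cpx R X Y) n) = {f. \<forall>i. f i \<in> mod_hom R (obj X i) (obj Y (i + n)) \<inter> extensional (carrier (obj X i))}"
  "\<zero>\<^bsub>obj (hom_cpx R X Y) n\<^esub> = (\<lambda>i. \<lambda>x\<in>carrier (obj X i). \<zero>\<^bsub>obj Y (i + n)\<^esub>)"
  "f \<oplus>\<^bsub>obj (hom_cpx R X Y) n\<^esub> g = (\<lambda>i. \<lambda>x\<in>carrier (obj X i). f i x \<oplus>\<^bsub>obj Y (i + n)\<^esub> g i x)"
  "diff (hom_cpx R X Y) n f = (\<lambda>i. \<lambda>x\<in>carrier (obj X i).
       if even n then diff Y (i + n) (f i x) \<ominus>\<^bsub>obj Y (i + (n + 1))\<^esub> f (i + 1) (diff X i x)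
       else diff Y (i + n) (f i x) \<oplus>\<^bsub>obj Y (i + (n + 1))\<^esub> f (i + 1) (diff X i x))"
  by (simp_all add: hom_cpx_def)

text \<open>Turns vanishing cohomology of \<open>Hom(P, Y)\<close> into a bounding family. The
  cocycle condition is asked in the form that both parts of the differential vanish separately, as
  they do for the family built in \<open>corner\<close>.\<close>

lemma hom_cpx_exact:
  assumes P: "is_complex R P" and Y: "\<And>n. module R (obj Y n)"
    and dY: "\<And>n. diff Y n \<in> mod_hom R (obj Y n) (obj Y (n + 1))"
    and zero: "is_zero_mod (cohomology (hom_cpx R P Y) (c + 1))"
    and f: "\<And>i. f i \<in> mod_hom R (obj P i) (obj Y (i + (c + 1)))"
    and df: "\<forall>i. \<forall>x\<in>carrier (obj P i). diff Y (i + (c + 1)) (f i x) = \<zero>\<^bsub>obj Y (i + (c + 1) + 1)\<^esub>"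
    and fd: "\<forall>i. \<forall>x\<in>carrier (obj P i). f (i + 1) (diff P i x) = \<zero>\<^bsub>obj Y (i + 1 + (c + 1))\<^esub>"
  shows "\<exists>h. (\<forall>i. h i \<in> mod_hom R (obj P i) (obj Y (i + c))) \<and>
    (\<forall>i. \<forall>x\<in>carrier (obj P i). f i x = (if even c then diff Y (i + c) (h i x) \<ominus>\<^bsub>obj Y (i + (c + 1))\<^esub> h (i + 1) (diff P i x)
       else diff Y (i + c) (h i x) \<oplus>\<^bsub>obj Y (i + (c + 1))\<^esub> h (i + 1) (diff P i x)))"
proof -
  interpret Y: module R "obj Y n" for n by (rule Y)
  let ?C = "hom_cpx R P Y"
  \<comment> \<open>Restriction makes the maps extensional, as the carrier of \<open>hom_cpx\<close>
    demands.\<close>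
  let ?f = "\<lambda>i. restrict (f i) (carrier (obj P i))"
  note dP = mod_homD(1)[OF is_complexD(2)[OF P]]
  have Padd: "x \<oplus>\<^bsub>obj P i\<^esub> y \<in> carrier (obj P i)" "r \<odot>\<^bsub>obj P i\<^esub> x \<in> carrier (obj P i)"
    if "x \<in> carrier (obj P i)" "y \<in> carrier (obj P i)" "r \<in> carrier R" for x y r i
  proof -
    interpret module R "obj P i" by (rule is_complexD[OF P])
    show "x \<oplus>\<^bsub>obj P i\<^esub> y \<in> carrier (obj P i)" "r \<odot>\<^bsub>obj P i\<^esub> x \<in> carrier (obj P i)" using that by simp_all
  qed
  have restr: "restrict g (carrier (obj P i)) \<in> mod_hom R (obj P i) M" if "g \<in> mod_hom R (obj P i) M" for g i M
    using that Padd[of _ i] by (auto simp: mod_hom_def)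
  have fC: "?f \<in> carrier (obj ?C (c + 1))" unfolding hom_cpx_simps using restr[OF f] by simp
  have z: "\<zero>\<^bsub>obj Y n\<^esub> \<ominus>\<^bsub>obj Y n\<^esub> \<zero>\<^bsub>obj Y n\<^esub> = \<zero>\<^bsub>obj Y n\<^esub>" for n by (simp add: Y.minus_self)
  have idx: "i + (c + 1 + 1) = i + (c + 1) + 1" "i + 1 + (c + 1) = i + (c + 1) + 1" for i by simp_all
  have "diff ?C (c + 1) ?f = \<zero>\<^bsub>obj ?C (c + 1 + 1)\<^esub>"
  proof (unfold hom_cpx_simps, rule ext, rule restrict_ext)
    fix i x assume x: "x \<in> carrier (obj P i)"
    have 1: "?f i x = f i x" "?f (i + 1) (diff P i x) = f (i + 1) (diff P i x)" using x dP by simp_all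
    show "(if even (c + 1) then diff Y (i + (c + 1)) (?f i x) \<ominus>\<^bsub>obj Y (i + (c + 1 + 1))\<^esub> ?f (i + 1) (diff P i x)
        else diff Y (i + (c + 1)) (?f i x) \<oplus>\<^bsub>obj Y (i + (c + 1 + 1))\<^esub> ?f (i + 1) (diff P i x)) = \<zero>\<^bsub>obj Y (i + (c + 1 + 1))\<^esub>"
      unfolding 1 df[rule_format, OF x] fd[rule_format, OF x] idx using z by simp
  qed
  then have fZ: "?f \<in> cocycles ?C (c + 1)" using fC by (simp add: cocycles_def)
  let ?h0 = "\<zero>\<^bsub>obj ?C c\<^esub>"
  have h0: "?h0 \<in> carrier (obj ?C c)"
    unfolding hom_cpx_simps
  proof (intro CollectI allI IntI)
    show "(\<lambda>x\<in>carrier (obj P i). \<zero>\<^bsub>obj Y (i + c)\<^esub>) \<in> mod_hom R (obj P i) (obj Y (i + c))" for i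
      by (rule restr) (auto simp: mod_hom_def)
  qed simp
  have dh0: "diff ?C c ?h0 = \<zero>\<^bsub>obj ?C (c + 1)\<^esub>"
  proof (unfold hom_cpx_simps, rule ext, rule restrict_ext)
    fix i x assume x: "x \<in> carrier (obj P i)"
    have "(\<lambda>x\<in>carrier (obj P i). \<zero>\<^bsub>obj Y (i + c)\<^esub>) x = \<zero>\<^bsub>obj Y (i + c)\<^esub>"
      "(\<lambda>x\<in>carrier (obj P (i + 1)). \<zero>\<^bsub>obj Y (i + 1 + c)\<^esub>) (diff P i x) = \<zero>\<^bsub>obj Y (i + (c + 1))\<^esub>"
      using x dP by (simp_all add: add.assoc add.commute[of 1 c])
    moreover have "diff Y (i + c) \<zero>\<^bsub>obj Y (i + c)\<^esub> = \<zero>\<^bsub>obj Y (i + (c + 1))\<^esub>"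
      using mod_hom_more(1)[OF Y Y dY[of "i + c"]] by (simp add: add.assoc)
    ultimately show "(if even c then diff Y (i + c) ((\<lambda>x\<in>carrier (obj P i). \<zero>\<^bsub>obj Y (i + c)\<^esub>) x) \<ominus>\<^bsub>obj Y (i + (c + 1))\<^esub>
          (\<lambda>x\<in>carrier (obj P (i + 1)). \<zero>\<^bsub>obj Y (i + 1 + c)\<^esub>) (diff P i x)
        else diff Y (i + c) ((\<lambda>x\<in>carrier (obj P i). \<zero>\<^bsub>obj Y (i + c)\<^esub>) x) \<oplus>\<^bsub>obj Y (i + (c + 1))\<^esub>
          (\<lambda>x\<in>carrier (obj P (i + 1)). \<zero>\<^bsub>obj Y (i + 1 + c)\<^esub>) (diff P i x)) = \<zero>\<^bsub>obj Y (i + (c + 1))\<^esub>"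
      using z by simp
  qed
  have zB: "\<zero>\<^bsub>obj ?C (c + 1)\<^esub> \<in> coboundaries ?C (c + 1)"
    unfolding coboundaries_def using h0 dh0 by (metis add_diff_cancel_right' imageI)
  have add0: "\<zero>\<^bsub>obj ?C (c + 1)\<^esub> \<oplus>\<^bsub>obj ?C (c + 1)\<^esub> ?f = ?f"
  proof (unfold hom_cpx_simps, intro ext)
    fix i x
    show "(\<lambda>x\<in>carrier (obj P i). (\<lambda>x\<in>carrier (obj P i). \<zero>\<^bsub>obj Y (i + (c + 1))\<^esub>) x \<oplus>\<^bsub>obj Y (i + (c + 1))\<^esub> ?f i x) x = ?f i x"
      using mod_homD(1)[OF f[of i], of x] by (cases "x \<in> carrier (obj P i)") simp_all
  qed
  have "coset_of ?C (c + 1) ?f \<in> carrier (cohomology ?C (c + 1))" unfolding carrier_cohomology using fZ by (rule imageI)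
  \<comment> \<open>The only class is the zero of the quotient, which is the set of coboundaries
    itself; \<open>?f\<close> belongs to its own coset because zero is a coboundary.\<close>
  then have "coset_of ?C (c + 1) ?f = coboundaries ?C (c + 1)"
    using zero by (simp add: is_zero_mod_def cohomology_def quot_mod_def)
  moreover have "?f \<in> coset_of ?C (c + 1) ?f"
    using imageI[OF zB, of "\<lambda>b. b \<oplus>\<^bsub>obj ?C (c + 1)\<^esub> ?f"] unfolding add0 coset_of_def .
  ultimately have "?f \<in> coboundaries ?C (c + 1)" by simp
  then have "?f \<in> diff ?C c ` carrier (obj ?C c)" by (simp add: coboundaries_def)
  then obtain h where h: "h \<in> carrier (obj ?C c)" "?f = diff ?C c h" by (rule imageE)
  have eq: "f i x = (if even c then diff Y (i + c) (h i x) \<ominus>\<^bsub>obj Y (i + (c + 1))\<^esub> h (i + 1) (diff P i x)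
       else diff Y (i + c) (h i x) \<oplus>\<^bsub>obj Y (i + (c + 1))\<^esub> h (i + 1) (diff P i x))" if "x \<in> carrier (obj P i)" for i x
    using fun_cong[OF fun_cong[OF h(2), of i], of x] that unfolding hom_cpx_simps by simp
  have hom: "h i \<in> mod_hom R (obj P i) (obj Y (i + c))" for i using h(1) unfolding hom_cpx_simps by blast
  show ?thesis by (intro exI[of _ h] conjI allI ballI hom eq)
qed

lemma hom_add_smult:
  assumes "module R M" "module R N" "f \<in> mod_hom R M N" "g \<in> mod_hom R M N" "e \<in> carrier R"
  shows "(\<lambda>x. f x \<oplus>\<^bsub>N\<^esub> e \<odot>\<^bsub>N\<^esub> g x) \<in> mod_hom R M N"
proof (rule mod_homI)
  interpret N: module R N by fact
  note f = mod_homD[OF assms(3)] and g = mod_homD[OF assms(4)]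
  fix x assume x: "x \<in> carrier M"
  show "f x \<oplus>\<^bsub>N\<^esub> e \<odot>\<^bsub>N\<^esub> g x \<in> carrier N" using f(1)[OF x] g(1)[OF x] assms(5) by simp
  show "f (r \<odot>\<^bsub>M\<^esub> x) \<oplus>\<^bsub>N\<^esub> e \<odot>\<^bsub>N\<^esub> g (r \<odot>\<^bsub>M\<^esub> x) = r \<odot>\<^bsub>N\<^esub> (f x \<oplus>\<^bsub>N\<^esub> e \<odot>\<^bsub>N\<^esub> g x)" if "r \<in> carrier R" for r
    using f(1)[OF x] g(1)[OF x] f(3)[OF that x] g(3)[OF that x] that assms(5)
    by (simp add: N.smult_r_distr N.smult_comm[of e r])
  fix y assume y: "y \<in> carrier M"
  show "f (x \<oplus>\<^bsub>M\<^esub> y) \<oplus>\<^bsub>N\<^esub> e \<odot>\<^bsub>N\<^esub> g (x \<oplus>\<^bsub>M\<^esub> y) = (f x \<oplus>\<^bsub>N\<^esub> e \<odot>\<^bsub>N\<^esub> g x) \<oplus>\<^bsub>N\<^esub> (f y \<oplus>\<^bsub>N\<^esub> e \<odot>\<^bsub>N\<^esub> g y)"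
    unfolding f(2)[OF x y] g(2)[OF x y]
    using f(1)[OF x] g(1)[OF x] f(1)[OF y] g(1)[OF y] assms(5) by algebra
qed

context minimal_resolution
begin

text \<open>
  Let \<open>p\<close> be the length of \<open>F\<close> and let \<open>Y'\<close> have no cohomology above \<open>s\<close>. A family \<open>g\<close> whose boundary is
  concentrated on \<open>F\<^sub>p\<close> can be changed by a boundary so that it vanishes below \<open>p - 1\<close>; on \<open>F\<^sub>p\<close> its
  boundary then lies in \<open>mZ\<^sup>s(Y') + B\<^sup>s(Y')\<close>.
\<close>

lemma corner_elimination:
  fixes Y' :: "('r, 'z) cochain"
  assumes Y': "is_complex R Y'" and ex: "\<And>n. n > s \<Longrightarrow> cocycles Y' n \<subseteq> coboundaries Y' n"
    and e: "e \<in> carrier R" "e \<otimes> e = \<one>" and c: "c = s + int p - 1"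
    and g: "\<And>l. g l \<in> mod_hom R (F l) (obj Y' (c - int l))"
    and g0: "\<And>x. 0 < p \<Longrightarrow> x \<in> carrier (F 0) \<Longrightarrow> diff Y' c (g 0 x) = \<zero>\<^bsub>obj Y' (c + 1)\<^esub>"
    and gS: "\<And>l x. Suc l < p \<Longrightarrow> x \<in> carrier (F (Suc l)) \<Longrightarrow>
      diff Y' (c - int l - 1) (g (Suc l) x) \<oplus>\<^bsub>obj Y' (c - int l)\<^esub> e \<odot>\<^bsub>obj Y' (c - int l)\<^esub> g l (d l x) = \<zero>\<^bsub>obj Y' (c - int l)\<^esub>"
  shows "l < p \<Longrightarrow> \<exists>\<kappa>\<in>mod_hom R (F l) (obj Y' (c - int l)). (\<forall>x\<in>carrier (F l). \<kappa> x \<in> cocycles Y' (c - int l)) \<and>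
    (\<forall>x\<in>carrier (F (Suc l)). \<kappa> (d l x) = g l (d l x))"
proof (induction l)
  case 0
  have "g 0 \<in> mod_hom R (F 0) (obj Y' (c - int 0))" by (rule g)
  moreover have "g 0 x \<in> cocycles Y' (c - int 0)" if "x \<in> carrier (F 0)" for x
    using g0[OF 0 that] mod_homD(1)[OF g[of 0] that] by (simp add: cocycles_def)
  ultimately show ?case by blast
next
  case (Suc l)
  then obtain \<kappa> where \<kappa>: "\<kappa> \<in> mod_hom R (F l) (obj Y' (c - int l))" "\<And>x. x \<in> carrier (F l) \<Longrightarrow> \<kappa> x \<in> cocycles Y' (c - int l)"
    "\<And>x. x \<in> carrier (F (Suc l)) \<Longrightarrow> \<kappa> (d l x) = g l (d l x)" by auto
  let ?n = "c - int l"
  have n: "c - int (Suc l) = ?n - 1" by simp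
  have "?n > s" using c Suc.prems by simp
  interpret Y0: module R "obj Y' ?n" by (rule is_complexD[OF Y'])
  interpret Y1: module R "obj Y' (?n - 1)" by (rule is_complexD[OF Y'])
  note dY = is_complexD(3)[OF Y', of ?n]
  \<comment> \<open>The values of \<open>\<kappa>\<close> are cocycles in degree
    \<open>c - l > s\<close>, hence coboundaries, so \<open>\<kappa>\<close> lifts over the free
    module \<open>F_l\<close> to some \<open>k\<close> with \<open>d k = \<kappa>\<close>.\<close>
  have "\<kappa> (free_gen R t) \<in> diff Y' (?n - 1) ` carrier (obj Y' (?n - 1))" if "t \<in> T l" for t
    using \<kappa>(2)[OF free_gen_closed[OF that]] ex[OF \<open>?n > s\<close>] by (auto simp: coboundaries_def)
  from free_lift[OF is_complexD(1)[OF Y'] is_complexD(1)[OF Y'] dY \<kappa>(1) this]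
  obtain k where k: "k \<in> mod_hom R (F l) (obj Y' (?n - 1))" "\<And>x. x \<in> carrier (F l) \<Longrightarrow> diff Y' (?n - 1) (k x) = \<kappa> x" by blast
  have gl: "g (Suc l) \<in> mod_hom R (F (Suc l)) (obj Y' (?n - 1))" using g[of "Suc l"] unfolding n .
  \<comment> \<open>The correction contributes \<open>e \<kappa> d = e g_l d\<close> to the
    differential, so by \<open>gS\<close> the values are cocycles; composed with \<open>d\<close>
    the correction vanishes because \<open>d d = 0\<close>.\<close>
  let ?\<kappa> = "\<lambda>x. g (Suc l) x \<oplus>\<^bsub>obj Y' (?n - 1)\<^esub> e \<odot>\<^bsub>obj Y' (?n - 1)\<^esub> k (d l x)"
  have hom: "?\<kappa> \<in> mod_hom R (F (Suc l)) (obj Y' (?n - 1))"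
    by (rule hom_add_smult[OF mod_X is_complexD(1)[OF Y'] gl mod_hom_compose[OF d_hom k(1)] e(1)])
  have cyc: "?\<kappa> x \<in> cocycles Y' (?n - 1)" if x: "x \<in> carrier (F (Suc l))" for x
  proof -
    have dx: "d l x \<in> carrier (F l)" by (rule d_props(1)[OF x])
    have cl: "g (Suc l) x \<in> carrier (obj Y' (?n - 1))" "k (d l x) \<in> carrier (obj Y' (?n - 1))"
      using mod_homD(1)[OF gl x] mod_homD(1)[OF k(1) dx] .
    have "diff Y' (?n - 1) (?\<kappa> x) = diff Y' (?n - 1) (g (Suc l) x) \<oplus>\<^bsub>obj Y' ?n\<^esub> e \<odot>\<^bsub>obj Y' ?n\<^esub> g l (d l x)"
      using mod_homD(2,3)[OF dY] cl e(1) k(2)[OF dx] \<kappa>(3)[OF x] by simp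
    also have "\<dots> = \<zero>\<^bsub>obj Y' ?n\<^esub>" by (rule gS[OF Suc.prems x])
    finally show ?thesis using mod_homD(1)[OF hom x] by (simp add: cocycles_def)
  qed
  have "?\<kappa> (d (Suc l) x) = g (Suc l) (d (Suc l) x)" if x: "x \<in> carrier (F (Suc (Suc l)))" for x
  proof -
    have "k (d l (d (Suc l) x)) = \<zero>\<^bsub>obj Y' (?n - 1)\<^esub>"
      using dd[OF x] mod_hom_more(1)[OF mod_X is_complexD(1)[OF Y'] k(1)] by simp
    then show ?thesis using mod_homD(1)[OF gl d_props(1)[OF x]] e(1) by simp
  qed
  then show ?case unfolding n using hom cyc by (intro bexI[of _ ?\<kappa>]) simp_all
qed

text \<open>A cocycle \<open>y\<close> and a basis vector \<open>t\<close> of \<open>F_p\<close>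
  give the cocycle \<open>a \<mapsto> \<phi>(a)_t y\<close> of \<open>Hom(P, Y)\<close>,
  concentrated on \<open>P_p\<close>. It is a boundary; pulling this back along
  \<open>\<psi>\<close> and pushing it forward along \<open>\<beta>\<close> reaches the situation of
  \<open>corner_elimination\<close>, which puts a unit multiple of \<open>\<beta> y\<close> into
  \<open>X\<close>. The separate target \<open>Y'\<close> allows \<open>P \<otimes> D\<close> to be
  replaced by \<open>F \<otimes> D\<close>.\<close>

lemma corner:
  fixes P :: "('r, ('r, 'n) res_elem) cochain" and Y :: "('r, 'y) cochain" and Y' :: "('r, 'z) cochain"
  assumes P: "proj_resolution R N P" and r: "retract P \<psi> \<phi>"
    and p: "T p \<noteq> {}" "T (Suc p) = {}"
    and Y: "\<And>n. module R (obj Y n)" "\<And>n. diff Y n \<in> mod_hom R (obj Y n) (obj Y (n + 1))"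
    and Y': "is_complex R Y'" and ex: "\<And>n. n > s \<Longrightarrow> cocycles Y' n \<subseteq> coboundaries Y' n"
    and \<beta>: "\<And>n. \<beta> n \<in> mod_hom R (obj Y n) (obj Y' n)"
      "\<And>n x. x \<in> carrier (obj Y n) \<Longrightarrow> \<beta> (n + 1) (diff Y n x) = diff Y' n (\<beta> n x)"
    and y: "y \<in> carrier (obj Y s)" "diff Y s y = \<zero>\<^bsub>obj Y (s + 1)\<^esub>"
    and zero: "is_zero_mod (cohomology (hom_cpx R P Y) (s + int p))"
    and X: "submodule X R (obj Y' s)" "coboundaries Y' s \<subseteq> X"
      "\<And>a v. a \<in> max_ideal R \<Longrightarrow> v \<in> cocycles Y' s \<Longrightarrow> a \<odot>\<^bsub>obj Y' s\<^esub> v \<in> X"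
  shows "\<beta> s y \<in> X"
proof -
  have cpx: "is_complex R P" and P1: "is_zero_mod (obj P 1)" using P by (auto simp: proj_resolution_def)
  obtain t where t: "t \<in> T p" using p(1) by blast
  \<comment> \<open>The bounding family has degree \<open>c\<close>, one below the degree
    \<open>s + p\<close> of the cocycle, so that \<open>g l\<close> lands in degree
    \<open>c - l\<close>.\<close>
  define c where "c = s + int p - 1"
  interpret Y: module R "obj Y n" for n by (rule Y)
  interpret Y': module R "obj Y' n" for n by (rule is_complexD[OF Y'])
  note \<psi> = retractD(1)[OF r] and \<phi> = retractD(2)[OF r]
  note m = idealD[OF ideal_max_ideal]
  define f where "f i a = (if i = - int p then \<phi> p a t \<odot>\<^bsub>obj Y s\<^esub> y else \<zero>\<^bsub>obj Y (i + (c + 1))\<^esub>)" for i a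
  have ip: "- int p + (c + 1) = s" by (simp add: c_def)
  have \<phi>c: "\<phi> p a t \<in> carrier R" if "a \<in> carrier (obj P (- int p))" for a
    by (rule free_modD(1)[OF mod_homD(1)[OF \<phi> that]])
  have fh: "f i \<in> mod_hom R (obj P i) (obj Y (i + (c + 1)))" for i
  proof (cases "i = - int p")
    case True
    have "(\<lambda>a. \<phi> p a t \<odot>\<^bsub>obj Y s\<^esub> y) \<in> mod_hom R (obj P (- int p)) (obj Y s)"
      by (rule mod_homI)
        (use \<phi>c y(1) mod_homD(2,3)[OF \<phi>[of p]] in \<open>simp_all add: free_mod_simps(3,4) Y.smult_l_distr Y.smult_assoc1\<close>)
    moreover have "f i = (\<lambda>a. \<phi> p a t \<odot>\<^bsub>obj Y s\<^esub> y)" using True by (simp add: f_def fun_eq_iff)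
    ultimately show ?thesis using True ip by simp
  next
    case False
    then have "f i = (\<lambda>_. \<zero>\<^bsub>obj Y (i + (c + 1))\<^esub>)" by (simp add: f_def fun_eq_iff)
    then show ?thesis by (auto simp: mod_hom_def)
  qed
  have dY0: "diff Y n \<zero>\<^bsub>obj Y n\<^esub> = \<zero>\<^bsub>obj Y (n + 1)\<^esub>" for n by (rule mod_hom_more(1)[OF Y(1) Y(1) Y(2)])
  have df: "diff Y (i + (c + 1)) (f i x) = \<zero>\<^bsub>obj Y (i + (c + 1) + 1)\<^esub>" if x: "x \<in> carrier (obj P i)" for i x
  proof (cases "i = - int p")
    case True
    have "diff Y s (\<phi> p x t \<odot>\<^bsub>obj Y s\<^esub> y) = \<phi> p x t \<odot>\<^bsub>obj Y (s + 1)\<^esub> diff Y s y"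
      by (rule mod_homD(3)[OF Y(2) _ y(1)]) (use \<phi>c x True in simp)
    then show ?thesis using True ip y(2) \<phi>c x by (simp add: f_def)
  next
    case False
    then show ?thesis using dY0 by (simp add: f_def)
  qed
  \<comment> \<open>Composition with the differential of \<open>P\<close> leads to \<open>d\<close>
    applied to an element of \<open>F_{p+1} = 0\<close>.\<close>
  have fd: "f (i + 1) (diff P i x) = \<zero>\<^bsub>obj Y (i + 1 + (c + 1))\<^esub>" if x: "x \<in> carrier (obj P i)" for i x
  proof (cases "i + 1 = - int p")
    case True
    then have i: "i = - int (Suc p)" by simp
    have "\<phi> (Suc p) x \<in> carrier (F (Suc p))" using mod_homD(1)[OF \<phi>[of "Suc p"]] x i by simp
    then have "\<phi> (Suc p) x = \<zero>\<^bsub>F (Suc p)\<^esub>" using p(2) by (auto simp: free_mod_simps)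
    then have "\<phi> p (diff P i x) = \<zero>\<^bsub>F p\<^esub>" using retractD(4)[OF r, of x p] x i d_props(4)[of p] by simp
    then have "\<phi> p (diff P i x) t = \<zero>" by (simp add: free_mod_simps(2))
    then show ?thesis unfolding f_def True ip using y(1) by simp
  next
    case False
    then show ?thesis by (simp add: f_def)
  qed
  have "is_zero_mod (cohomology (hom_cpx R P Y) (c + 1))" using zero by (simp add: c_def)
  moreover have "\<forall>i. \<forall>x\<in>carrier (obj P i). diff Y (i + (c + 1)) (f i x) = \<zero>\<^bsub>obj Y (i + (c + 1) + 1)\<^esub>"
    "\<forall>i. \<forall>x\<in>carrier (obj P i). f (i + 1) (diff P i x) = \<zero>\<^bsub>obj Y (i + 1 + (c + 1))\<^esub>"
    using df fd by simp_all
  ultimately have "\<exists>h. (\<forall>i. h i \<in> mod_hom R (obj P i) (obj Y (i + c))) \<and>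
    (\<forall>i. \<forall>x\<in>carrier (obj P i). f i x = (if even c then diff Y (i + c) (h i x) \<ominus>\<^bsub>obj Y (i + (c + 1))\<^esub> h (i + 1) (diff P i x)
       else diff Y (i + c) (h i x) \<oplus>\<^bsub>obj Y (i + (c + 1))\<^esub> h (i + 1) (diff P i x)))"
    by (intro hom_cpx_exact[OF cpx Y _ fh])
  then
  obtain h where h: "\<And>i. h i \<in> mod_hom R (obj P i) (obj Y (i + c))"
    "\<And>i x. x \<in> carrier (obj P i) \<Longrightarrow> f i x = (if even c then diff Y (i + c) (h i x) \<ominus>\<^bsub>obj Y (i + (c + 1))\<^esub> h (i + 1) (diff P i x)
       else diff Y (i + c) (h i x) \<oplus>\<^bsub>obj Y (i + (c + 1))\<^esub> h (i + 1) (diff P i x))" by blast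
  \<comment> \<open>One scalar absorbs the parity of \<open>c\<close> in the differential of
    \<open>hom_cpx\<close>, which then reads \<open>f = d h + e h d\<close>.\<close>
  define e where "e = (if even c then \<ominus> \<one> else \<one>)"
  have e: "e \<in> carrier R" "e \<otimes> e = \<one>" by (auto simp: e_def l_minus r_minus)
  have rel: "f i x = diff Y (i + c) (h i x) \<oplus>\<^bsub>obj Y (i + c + 1)\<^esub> e \<odot>\<^bsub>obj Y (i + c + 1)\<^esub> h (i + 1) (diff P i x)"
    if x: "x \<in> carrier (obj P i)" for i x
  proof -
    have hx: "h (i + 1) (diff P i x) \<in> carrier (obj Y (i + c + 1))"
      using mod_homD(1)[OF h(1)[of "i + 1"] mod_homD(1)[OF is_complexD(2)[OF cpx] x]] by (simp add: algebra_simps)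
    have idx: "i + (c + 1) = i + c + 1" by simp
    show ?thesis using h(2)[OF x, unfolded idx] hx by (simp add: e_def Y.smult_minus_one Y.M.minus_eq)
  qed
  define g where "g l x = \<beta> (c - int l) (h (- int l) (\<psi> l x))" for l x
  have hl: "h (- int l) \<in> mod_hom R (obj P (- int l)) (obj Y (c - int l))" for l
    using h(1)[of "- int l"] by simp
  have g: "g l \<in> mod_hom R (F l) (obj Y' (c - int l))" for l
    unfolding g_def by (rule mod_hom_compose[OF mod_hom_compose[OF \<psi> hl] \<beta>(1)])
  have \<beta>0: "\<beta> n \<zero>\<^bsub>obj Y n\<^esub> = \<zero>\<^bsub>obj Y' n\<^esub>" for n by (rule mod_hom_more(1)[OF Y(1) is_complexD(1)[OF Y'] \<beta>(1)])
  have R0: "\<beta> (c + 1) (f 0 (\<psi> 0 x)) = diff Y' c (g 0 x)" if x: "x \<in> carrier (F 0)" for x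
  proof -
    have \<psi>x: "\<psi> 0 x \<in> carrier (obj P 0)" using mod_homD(1)[OF \<psi> x] by simp
    have "diff P 0 (\<psi> 0 x) \<in> carrier (obj P (0 + 1))" by (rule mod_homD(1)[OF is_complexD(2)[OF cpx] \<psi>x])
    then have "diff P 0 (\<psi> 0 x) = \<zero>\<^bsub>obj P (0 + 1)\<^esub>" using P1 by (simp add: is_zero_mod_def)
    then have "h (0 + 1) (diff P 0 (\<psi> 0 x)) = \<zero>\<^bsub>obj Y (0 + 1 + c)\<^esub>"
      using mod_hom_more(1)[OF is_complexD(1)[OF cpx] Y(1) h(1)] by simp
    moreover have hx: "h 0 (\<psi> 0 x) \<in> carrier (obj Y c)" using mod_homD(1)[OF hl[of 0]] \<psi>x by simp
    moreover have "diff Y c (h 0 (\<psi> 0 x)) \<in> carrier (obj Y (c + 1))" by (rule mod_homD(1)[OF Y(2) hx])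
    ultimately have "f 0 (\<psi> 0 x) = diff Y c (h 0 (\<psi> 0 x))" using rel[OF \<psi>x] e(1) by (simp add: add.commute)
    then show ?thesis using \<beta>(2)[OF hx] by (simp add: g_def)
  qed
  have RS: "\<beta> (c - int l) (f (- int (Suc l)) (\<psi> (Suc l) x)) =
      diff Y' (c - int l - 1) (g (Suc l) x) \<oplus>\<^bsub>obj Y' (c - int l)\<^esub> e \<odot>\<^bsub>obj Y' (c - int l)\<^esub> g l (d l x)"
    if x: "x \<in> carrier (F (Suc l))" for l x
  proof -
    let ?n = "c - int l"
    have \<psi>x: "\<psi> (Suc l) x \<in> carrier (obj P (- int (Suc l)))" by (rule mod_homD(1)[OF \<psi> x])
    have hx: "h (- int (Suc l)) (\<psi> (Suc l) x) \<in> carrier (obj Y (?n - 1))"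
      using mod_homD(1)[OF hl[of "Suc l"] \<psi>x] by (simp add: algebra_simps)
    have dhx: "diff Y (?n - 1) (h (- int (Suc l)) (\<psi> (Suc l) x)) \<in> carrier (obj Y ?n)"
      using mod_homD(1)[OF Y(2) hx] by simp
    have hdx: "h (- int l) (\<psi> l (d l x)) \<in> carrier (obj Y ?n)"
      by (rule mod_homD(1)[OF hl mod_homD(1)[OF \<psi> d_props(1)[OF x]]])
    have idx: "- int (Suc l) + c = ?n - 1" "?n - 1 + 1 = ?n" "- int (Suc l) + 1 = - int l" by simp_all
    have "f (- int (Suc l)) (\<psi> (Suc l) x) = diff Y (?n - 1) (h (- int (Suc l)) (\<psi> (Suc l) x)) \<oplus>\<^bsub>obj Y ?n\<^esub>
        e \<odot>\<^bsub>obj Y ?n\<^esub> h (- int l) (\<psi> l (d l x))"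
      using rel[OF \<psi>x] retractD(3)[OF r x] unfolding idx by simp
    then have "\<beta> ?n (f (- int (Suc l)) (\<psi> (Suc l) x)) = \<beta> ?n (diff Y (?n - 1) (h (- int (Suc l)) (\<psi> (Suc l) x))) \<oplus>\<^bsub>obj Y' ?n\<^esub>
        e \<odot>\<^bsub>obj Y' ?n\<^esub> \<beta> ?n (h (- int l) (\<psi> l (d l x)))"
      using mod_homD(2,3)[OF \<beta>(1)[of ?n]] dhx hdx e(1) by simp
    moreover have idx': "c - int (Suc l) = ?n - 1" by simp
    ultimately show ?thesis using \<beta>(2)[OF hx] unfolding g_def idx' idx(2) by simp
  qed
  have f0: "f (- int l) x = \<zero>\<^bsub>obj Y (- int l + (c + 1))\<^esub>" if "l \<noteq> p" for l x
    using that by (simp add: f_def)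
  let ?e = "free_gen R t"
  have et: "?e \<in> carrier (F p)" by (rule free_gen_closed[OF t])
  let ?w = "\<phi> p (\<psi> p ?e)"
  have wc: "?w \<in> carrier (F p)" by (rule mod_homD(1)[OF \<phi> mod_homD(1)[OF \<psi> et]])
  have \<beta>y: "\<beta> s y \<in> carrier (obj Y' s)" by (rule mod_homD(1)[OF \<beta>(1) y(1)])
  have fp: "f (- int p) (\<psi> p ?e) = ?w t \<odot>\<^bsub>obj Y s\<^esub> y" by (simp add: f_def)
  have \<beta>fp: "\<beta> s (f (- int p) (\<psi> p ?e)) = ?w t \<odot>\<^bsub>obj Y' s\<^esub> \<beta> s y"
    unfolding fp by (rule mod_homD(3)[OF \<beta>(1) free_modD(1)[OF wc] y(1)])
  have inX: "?w t \<odot>\<^bsub>obj Y' s\<^esub> \<beta> s y \<in> X"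
  proof (cases p)
    case 0
    have "c + 1 = s" "c = s - 1" using 0 by (simp_all add: c_def)
    then have "?w t \<odot>\<^bsub>obj Y' s\<^esub> \<beta> s y = diff Y' (s - 1) (g 0 ?e)" using R0[of ?e] et \<beta>fp 0 by simp
    moreover have "g 0 ?e \<in> carrier (obj Y' (s - 1))" using mod_homD(1)[OF g[of 0]] et 0 \<open>c = s - 1\<close> by simp
    ultimately show ?thesis using X(2) by (auto simp: coboundaries_def)
  next
    case (Suc q)
    have cq: "c - int q = s" using Suc by (simp add: c_def)
    have et': "?e \<in> carrier (F (Suc q))" using et Suc by simp
    have g0: "diff Y' c (g 0 x) = \<zero>\<^bsub>obj Y' (c + 1)\<^esub>" if "0 < p" "x \<in> carrier (F 0)" for x
      using R0[OF that(2)] f0[of 0 "\<psi> 0 x"] that(1) \<beta>0[of "c + 1"] by simp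
    have gS: "diff Y' (c - int l - 1) (g (Suc l) x) \<oplus>\<^bsub>obj Y' (c - int l)\<^esub> e \<odot>\<^bsub>obj Y' (c - int l)\<^esub> g l (d l x) = \<zero>\<^bsub>obj Y' (c - int l)\<^esub>"
      if "Suc l < p" "x \<in> carrier (F (Suc l))" for l x
    proof -
      have "- int (Suc l) + (c + 1) = c - int l" by simp
      then show ?thesis using RS[OF that(2)] f0[of "Suc l" "\<psi> (Suc l) x"] that(1) \<beta>0[of "c - int l"] by simp
    qed
    obtain \<kappa> where \<kappa>: "\<kappa> \<in> mod_hom R (F q) (obj Y' s)" "\<And>x. x \<in> carrier (F q) \<Longrightarrow> \<kappa> x \<in> cocycles Y' s"
      "\<And>x. x \<in> carrier (F (Suc q)) \<Longrightarrow> \<kappa> (d q x) = g q (d q x)"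
    proof -
      have "\<exists>\<kappa>\<in>mod_hom R (F q) (obj Y' (c - int q)). (\<forall>x\<in>carrier (F q). \<kappa> x \<in> cocycles Y' (c - int q)) \<and>
        (\<forall>x\<in>carrier (F (Suc q)). \<kappa> (d q x) = g q (d q x))"
      proof (rule corner_elimination[OF Y' _ e c_def g])
        show "cocycles Y' n \<subseteq> coboundaries Y' n" if "s < n" for n by (rule ex[OF that])
        show "q < p" using Suc by simp
      qed (rule g0 gS; assumption)+
      then show ?thesis using that unfolding cq by blast
    qed
    \<comment> \<open>\<open>d ?e\<close> has coefficients in \<open>m\<close> and
      \<open>\<kappa>\<close> has values in the cocycles of degree \<open>s\<close>, so each summand
      is of the form that \<open>X\<close> absorbs.\<close>
    have "\<kappa> (d q ?e) \<in> X"
    proof (rule hom_free_in_submod[OF is_complexD(1)[OF Y'] \<kappa>(1) X(1) _ d_props(1)[OF et']])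
      fix u assume u: "u \<in> T q"
      show "d q ?e u \<odot>\<^bsub>obj Y' s\<^esub> \<kappa> (free_gen R u) \<in> X"
        by (rule X(3)[OF coeff_subD[OF minimal[OF et']] \<kappa>(2)[OF free_gen_closed[OF u]]])
    qed
    then have 1: "e \<odot>\<^bsub>obj Y' s\<^esub> g q (d q ?e) \<in> X" using Y'.submodD(4)[OF X(1) e(1)] \<kappa>(3)[OF et'] by simp
    have "g (Suc q) ?e \<in> carrier (obj Y' (s - 1))"
      using mod_homD(1)[OF g[of "Suc q"] et'] cq by (simp add: algebra_simps)
    then have 2: "diff Y' (s - 1) (g (Suc q) ?e) \<in> X" using X(2) by (auto simp: coboundaries_def)
    have "?w t \<odot>\<^bsub>obj Y' s\<^esub> \<beta> s y = diff Y' (s - 1) (g (Suc q) ?e) \<oplus>\<^bsub>obj Y' s\<^esub> e \<odot>\<^bsub>obj Y' s\<^esub> g q (d q ?e)"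
      using RS[OF et'] \<beta>fp Suc unfolding cq by simp
    then show ?thesis using Y'.submodD(3)[OF X(1) 2 1] by simp
  qed
  let ?a = "?e \<ominus>\<^bsub>F p\<^esub> ?w"
  \<comment> \<open>\<open>?w t\<close> is congruent to \<open>\<one>\<close> modulo
    \<open>m\<close>, hence a unit that can be divided out.\<close>
  have a: "?a t \<in> max_ideal R" by (rule coeff_subD[OF retract_mfree[OF r et]])
  have ac: "?a t \<in> carrier R" "?w t \<in> carrier R" using a m(1) free_modD(1)[OF wc] by auto
  have "?a \<oplus>\<^bsub>F p\<^esub> ?w = ?e" by (rule F.minus_add_cancel[OF et wc])
  from fun_cong[OF this, of t] have sum: "?a t \<oplus> ?w t = \<one>" by (simp add: free_mod_simps(3) free_gen_simps)
  have cancel: "(a \<oplus> b) \<ominus> a = b" if "a \<in> carrier R" "b \<in> carrier R" for a b using that by algebra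
  have "?w t = \<one> \<ominus> ?a t" using cancel[OF ac] sum by simp
  then obtain b where b: "b \<in> carrier R" "b \<otimes> ?w t = \<one>" using unit_one_minus[OF a] by metis
  have "b \<odot>\<^bsub>obj Y' s\<^esub> (?w t \<odot>\<^bsub>obj Y' s\<^esub> \<beta> s y) \<in> X" by (rule Y'.submodD(4)[OF X(1) b(1) inX])
  then show ?thesis using b ac(2) \<beta>y by (simp flip: Y'.smult_assoc1)
qed

end

section \<open>Tensor products\<close>

definition elem_tensor :: "('r, 'k) ring_scheme \<Rightarrow> ('r, 'm) module \<Rightarrow> ('r, 'n) module \<Rightarrow> 'm \<Rightarrow> 'n \<Rightarrow> ('m \<times> 'n \<Rightarrow> 'r) set"
  where "elem_tensor R M N x y = bilinear_rels R M N +>\<^bsub>pair_mod R M N\<^esub> free_gen R (x, y)"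

text \<open>The linear extension is evaluated at a representative picked by choice. For bilinear
  \<open>b\<close> it kills the relations, so the value does not depend on the pick.\<close>

definition tensor_lift :: "('r, 'k) ring_scheme \<Rightarrow> ('r, 'w) module \<Rightarrow> ('m \<Rightarrow> 'n \<Rightarrow> 'w) \<Rightarrow> ('m \<times> 'n \<Rightarrow> 'r) set \<Rightarrow> 'w"
  where "tensor_lift R W b C = cring.lin R W (\<lambda>s. b (fst s) (snd s)) (SOME \<phi>. \<phi> \<in> C)"

definition bilinear_map :: "('r, 'k) ring_scheme \<Rightarrow> ('r, 'm) module \<Rightarrow> ('r, 'n) module \<Rightarrow> ('r, 'w) module \<Rightarrow> ('m \<Rightarrow> 'n \<Rightarrow> 'w) \<Rightarrow> bool"
  where "bilinear_map R M N W b \<longleftrightarrow>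
    (\<forall>y\<in>carrier N. (\<lambda>x. b x y) \<in> mod_hom R M W) \<and> (\<forall>x\<in>carrier M. (\<lambda>y. b x y) \<in> mod_hom R N W)"

locale tensor_pair = M: module R M + N: module R N for R (structure) and M :: "('r, 'm) module" and N :: "('r, 'n) module"
begin

abbreviation "Fr \<equiv> pair_mod R M N"
abbreviation "Rel \<equiv> bilinear_rels R M N"
abbreviation "e \<equiv> \<lambda>x y. free_gen R (x, y)"
abbreviation "tens \<equiv> elem_tensor R M N"
abbreviation "Tn \<equiv> tensor_mod R M N"

lemma Fr: "module R Fr"
  by (rule M.R.module_free_mod)

sublocale Fr: module R Fr
  by (rule Fr)

lemma e_closed: "x \<in> carrier M \<Longrightarrow> y \<in> carrier N \<Longrightarrow> e x y \<in> carrier Fr"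
  by (rule M.R.free_gen_closed) simp

lemma gens_in_submodule:
  assumes "submodule K R Fr"
    and "\<And>x x' y. x \<in> carrier M \<Longrightarrow> x' \<in> carrier M \<Longrightarrow> y \<in> carrier N \<Longrightarrow> e (x \<oplus>\<^bsub>M\<^esub> x') y \<ominus>\<^bsub>Fr\<^esub> (e x y \<oplus>\<^bsub>Fr\<^esub> e x' y) \<in> K"
    and "\<And>x y y'. x \<in> carrier M \<Longrightarrow> y \<in> carrier N \<Longrightarrow> y' \<in> carrier N \<Longrightarrow> e x (y \<oplus>\<^bsub>N\<^esub> y') \<ominus>\<^bsub>Fr\<^esub> (e x y \<oplus>\<^bsub>Fr\<^esub> e x y') \<in> K"
    and "\<And>r x y. r \<in> carrier R \<Longrightarrow> x \<in> carrier M \<Longrightarrow> y \<in> carrier N \<Longrightarrow> e (r \<odot>\<^bsub>M\<^esub> x) y \<ominus>\<^bsub>Fr\<^esub> r \<odot>\<^bsub>Fr\<^esub> e x y \<in> K"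
    and "\<And>r x y. r \<in> carrier R \<Longrightarrow> x \<in> carrier M \<Longrightarrow> y \<in> carrier N \<Longrightarrow> e x (r \<odot>\<^bsub>N\<^esub> y) \<ominus>\<^bsub>Fr\<^esub> r \<odot>\<^bsub>Fr\<^esub> e x y \<in> K"
  shows "Rel \<subseteq> K"
proof -
  have "bilinear_gens R M N \<subseteq> K"
    unfolding bilinear_gens_def Let_def by (intro Un_least subsetI; clarify; intro assms(2-5))
  then show ?thesis unfolding bilinear_rels_def by (rule hull_minimal) (rule assms(1))
qed

lemma gens_subset_Rel: "bilinear_gens R M N \<subseteq> Rel"
  unfolding bilinear_rels_def by (rule hull_subset)

lemma submodule_Rel: "submodule Rel R Fr"
proof -
  let ?K = "{K. submodule K R Fr \<and> bilinear_gens R M N \<subseteq> K}"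
  have "bilinear_gens R M N \<subseteq> carrier Fr"
    unfolding bilinear_gens_def Let_def by (auto intro!: e_closed)
  then have ne: "carrier Fr \<in> ?K" using Fr.carrier_is_submodule by simp
  have eq: "Rel = \<Inter>?K" by (simp add: bilinear_rels_def hull_def)
  show ?thesis
    unfolding eq
  proof (rule Fr.submod_intro)
    show "\<Inter>?K \<subseteq> carrier Fr" using ne by blast
    show "\<zero>\<^bsub>Fr\<^esub> \<in> \<Inter>?K" using Fr.submodD(2) by blast
    show "a \<oplus>\<^bsub>Fr\<^esub> b \<in> \<Inter>?K" if "a \<in> \<Inter>?K" "b \<in> \<Inter>?K" for a b using that Fr.submodD(3) by blast
    show "c \<odot>\<^bsub>Fr\<^esub> a \<in> \<Inter>?K" if "c \<in> carrier R" "a \<in> \<Inter>?K" for a c using that Fr.submodD(4) by blast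
  qed
qed

lemma Tn: "module R Tn"
  unfolding tensor_mod_def by (rule module_quot_mod[OF Fr submodule_Rel])

sublocale Tn: module R Tn
  by (rule Tn)

abbreviation q :: "('m \<times> 'n \<Rightarrow> 'r) \<Rightarrow> ('m \<times> 'n \<Rightarrow> 'r) set"
  where "q \<phi> \<equiv> Rel +>\<^bsub>Fr\<^esub> \<phi>"

lemma q_hom: "q \<in> mod_hom R Fr Tn"
  unfolding tensor_mod_def by (rule quot_mod_hom[OF Fr submodule_Rel])

lemma q_eq: "\<phi> \<in> carrier Fr \<Longrightarrow> \<psi> \<in> carrier Fr \<Longrightarrow> q \<phi> = q \<psi> \<longleftrightarrow> \<phi> \<ominus>\<^bsub>Fr\<^esub> \<psi> \<in> Rel"
  by (rule Fr.coset_eq_iff[OF submodule_Rel])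

lemma carrier_Tn: "carrier Tn = q ` carrier Fr"
  by (simp add: tensor_mod_def carrier_quot_mod)

lemma tens_closed: "x \<in> carrier M \<Longrightarrow> y \<in> carrier N \<Longrightarrow> tens x y \<in> carrier Tn"
  unfolding elem_tensor_def carrier_Tn by (rule imageI) (rule e_closed)

lemma tens_bilinear: "bilinear_map R M N Tn tens"
  unfolding bilinear_map_def
proof (intro conjI ballI)
  note q = mod_homD[OF q_hom]
  fix y assume y: "y \<in> carrier N"
  show "(\<lambda>x. tens x y) \<in> mod_hom R M Tn"
  proof (rule mod_homI)
    fix x assume x: "x \<in> carrier M"
    show "tens x y \<in> carrier Tn" by (rule tens_closed[OF x y])
    show "tens (r \<odot>\<^bsub>M\<^esub> x) y = r \<odot>\<^bsub>Tn\<^esub> tens x y" if r: "r \<in> carrier R" for r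
    proof -
      have "e (r \<odot>\<^bsub>M\<^esub> x) y \<ominus>\<^bsub>Fr\<^esub> r \<odot>\<^bsub>Fr\<^esub> e x y \<in> Rel"
        using gens_subset_Rel r x y unfolding bilinear_gens_def Let_def by blast
      then have "q (e (r \<odot>\<^bsub>M\<^esub> x) y) = q (r \<odot>\<^bsub>Fr\<^esub> e x y)" using q_eq e_closed r x y by simp
      then show ?thesis using q(3)[OF r e_closed[OF x y]] by (simp add: elem_tensor_def)
    qed
    fix x' assume x': "x' \<in> carrier M"
    have "e (x \<oplus>\<^bsub>M\<^esub> x') y \<ominus>\<^bsub>Fr\<^esub> (e x y \<oplus>\<^bsub>Fr\<^esub> e x' y) \<in> Rel"
      using gens_subset_Rel x x' y unfolding bilinear_gens_def Let_def by blast
    then have "q (e (x \<oplus>\<^bsub>M\<^esub> x') y) = q (e x y \<oplus>\<^bsub>Fr\<^esub> e x' y)" using q_eq e_closed x x' y by simp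
    then show "tens (x \<oplus>\<^bsub>M\<^esub> x') y = tens x y \<oplus>\<^bsub>Tn\<^esub> tens x' y"
      using q(2)[OF e_closed[OF x y] e_closed[OF x' y]] by (simp add: elem_tensor_def)
  qed
next
  note q = mod_homD[OF q_hom]
  fix x assume x: "x \<in> carrier M"
  show "(\<lambda>y. tens x y) \<in> mod_hom R N Tn"
  proof (rule mod_homI)
    fix y assume y: "y \<in> carrier N"
    show "tens x y \<in> carrier Tn" by (rule tens_closed[OF x y])
    show "tens x (r \<odot>\<^bsub>N\<^esub> y) = r \<odot>\<^bsub>Tn\<^esub> tens x y" if r: "r \<in> carrier R" for r
    proof -
      have "e x (r \<odot>\<^bsub>N\<^esub> y) \<ominus>\<^bsub>Fr\<^esub> r \<odot>\<^bsub>Fr\<^esub> e x y \<in> Rel"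
        using gens_subset_Rel r x y unfolding bilinear_gens_def Let_def by blast
      then have "q (e x (r \<odot>\<^bsub>N\<^esub> y)) = q (r \<odot>\<^bsub>Fr\<^esub> e x y)" using q_eq e_closed r x y by simp
      then show ?thesis using q(3)[OF r e_closed[OF x y]] by (simp add: elem_tensor_def)
    qed
    fix y' assume y': "y' \<in> carrier N"
    have "e x (y \<oplus>\<^bsub>N\<^esub> y') \<ominus>\<^bsub>Fr\<^esub> (e x y \<oplus>\<^bsub>Fr\<^esub> e x y') \<in> Rel"
      using gens_subset_Rel x y y' unfolding bilinear_gens_def Let_def by blast
    then have "q (e x (y \<oplus>\<^bsub>N\<^esub> y')) = q (e x y \<oplus>\<^bsub>Fr\<^esub> e x y')" using q_eq e_closed x y y' by simp
    then show "tens x (y \<oplus>\<^bsub>N\<^esub> y') = tens x y \<oplus>\<^bsub>Tn\<^esub> tens x y'"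
      using q(2)[OF e_closed[OF x y] e_closed[OF x y']] by (simp add: elem_tensor_def)
  qed
qed

lemma tens_zero: "y \<in> carrier N \<Longrightarrow> tens \<zero>\<^bsub>M\<^esub> y = \<zero>\<^bsub>Tn\<^esub>" "x \<in> carrier M \<Longrightarrow> tens x \<zero>\<^bsub>N\<^esub> = \<zero>\<^bsub>Tn\<^esub>"
  using tens_bilinear mod_hom_more(1)[OF M.module_axioms Tn] mod_hom_more(1)[OF N.module_axioms Tn]
  unfolding bilinear_map_def by blast+

lemma tensor_hom_eq:
  assumes W: "module R W" and h: "h \<in> mod_hom R Tn W" "h' \<in> mod_hom R Tn W"
    and eq: "\<And>x y. x \<in> carrier M \<Longrightarrow> y \<in> carrier N \<Longrightarrow> h (tens x y) = h' (tens x y)" and z: "z \<in> carrier Tn"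
  shows "h z = h' z"
proof -
  obtain \<phi> where \<phi>: "z = q \<phi>" "\<phi> \<in> carrier Fr" using z unfolding carrier_Tn by blast
  have "h (q \<phi>) = h' (q \<phi>)"
    by (rule M.R.mod_hom_eq_on_free[OF W mod_hom_compose[OF q_hom h(1)] mod_hom_compose[OF q_hom h(2)] _ \<phi>(2)])
      (use eq in \<open>auto simp: elem_tensor_def\<close>)
  then show ?thesis using \<phi>(1) by simp
qed

lemma tensor_lift:
  assumes W: "module R W" and b: "bilinear_map R M N W b"
  shows "tensor_lift R W b \<in> mod_hom R Tn W"
    "x \<in> carrier M \<Longrightarrow> y \<in> carrier N \<Longrightarrow> tensor_lift R W b (tens x y) = b x y"
proof -
  interpret W: module R W by fact
  let ?b = "\<lambda>s. b (fst s) (snd s)" and ?S = "carrier M \<times> carrier N"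
  have b1: "y \<in> carrier N \<Longrightarrow> (\<lambda>x. b x y) \<in> mod_hom R M W" and b2: "x \<in> carrier M \<Longrightarrow> (\<lambda>y. b x y) \<in> mod_hom R N W" for x y
    using b by (auto simp: bilinear_map_def)
  have bc: "?b \<in> ?S \<rightarrow> carrier W" by (rule Pi_I) (use mod_homD(1)[OF b1] in auto)
  let ?L = "M.R.lin W ?b"
  have L: "?L \<in> mod_hom R Fr W" by (rule M.R.lin_hom[OF W bc])
  note Lh = mod_homD[OF L] mod_hom_more[OF Fr W L]
  have Le: "?L (e x y) = b x y" if "x \<in> carrier M" "y \<in> carrier N" for x y
    using M.R.lin_gen[OF W bc, of "(x, y)"] that by simp
  have bcl: "b x y \<in> carrier W" if "x \<in> carrier M" "y \<in> carrier N" for x y by (rule mod_homD(1)[OF b1[OF that(2)] that(1)])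
  have "Rel \<subseteq> {\<phi> \<in> carrier Fr. ?L \<phi> = \<zero>\<^bsub>W\<^esub>}"
  proof (rule gens_in_submodule[OF submod_kernel[OF Fr W L]])
    fix x x' y assume *: "x \<in> carrier M" "x' \<in> carrier M" "y \<in> carrier N"
    then show "e (x \<oplus>\<^bsub>M\<^esub> x') y \<ominus>\<^bsub>Fr\<^esub> (e x y \<oplus>\<^bsub>Fr\<^esub> e x' y) \<in> {\<phi> \<in> carrier Fr. ?L \<phi> = \<zero>\<^bsub>W\<^esub>}"
      using mod_homD(2)[OF b1] by (simp add: Lh e_closed Le bcl W.minus_self)
  next
    fix x y y' assume *: "x \<in> carrier M" "y \<in> carrier N" "y' \<in> carrier N"
    then show "e x (y \<oplus>\<^bsub>N\<^esub> y') \<ominus>\<^bsub>Fr\<^esub> (e x y \<oplus>\<^bsub>Fr\<^esub> e x y') \<in> {\<phi> \<in> carrier Fr. ?L \<phi> = \<zero>\<^bsub>W\<^esub>}"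
      using mod_homD(2)[OF b2] by (simp add: Lh e_closed Le bcl W.minus_self)
  next
    fix r x y assume *: "r \<in> carrier R" "x \<in> carrier M" "y \<in> carrier N"
    then show "e (r \<odot>\<^bsub>M\<^esub> x) y \<ominus>\<^bsub>Fr\<^esub> r \<odot>\<^bsub>Fr\<^esub> e x y \<in> {\<phi> \<in> carrier Fr. ?L \<phi> = \<zero>\<^bsub>W\<^esub>}"
      using mod_homD(3)[OF b1] by (simp add: Lh e_closed Le bcl W.minus_self)
    show "e x (r \<odot>\<^bsub>N\<^esub> y) \<ominus>\<^bsub>Fr\<^esub> r \<odot>\<^bsub>Fr\<^esub> e x y \<in> {\<phi> \<in> carrier Fr. ?L \<phi> = \<zero>\<^bsub>W\<^esub>}"
      using * mod_homD(3)[OF b2] by (simp add: Lh e_closed Le bcl W.minus_self)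
  qed
  then have RelL: "?L k = \<zero>\<^bsub>W\<^esub>" if "k \<in> Rel" for k using that by blast
  have lift: "tensor_lift R W b (q \<phi>) = ?L \<phi>" if \<phi>: "\<phi> \<in> carrier Fr" for \<phi>
  proof -
    have "\<zero>\<^bsub>Fr\<^esub> \<in> Rel" by (rule Fr.submodD(2)[OF submodule_Rel])
    then have "\<zero>\<^bsub>Fr\<^esub> \<oplus>\<^bsub>Fr\<^esub> \<phi> \<in> q \<phi>" unfolding a_r_coset_def' by blast
    then have "(SOME \<psi>. \<psi> \<in> q \<phi>) \<in> q \<phi>" by (rule someI[of "\<lambda>\<psi>. \<psi> \<in> q \<phi>"])
    then obtain k where k: "k \<in> Rel" "(SOME \<psi>. \<psi> \<in> q \<phi>) = k \<oplus>\<^bsub>Fr\<^esub> \<phi>" unfolding a_r_coset_def' by blast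
    have "k \<in> carrier Fr" using k(1) Fr.submodD(1)[OF submodule_Rel] by blast
    then have "?L (k \<oplus>\<^bsub>Fr\<^esub> \<phi>) = ?L \<phi>" using Lh(1,2) \<phi> RelL[OF k(1)] by simp
    then show ?thesis unfolding tensor_lift_def k(2) .
  qed
  show "tensor_lift R W b \<in> mod_hom R Tn W"
  proof (rule mod_homI)
    note q = mod_homD[OF q_hom]
    fix z assume "z \<in> carrier Tn"
    then obtain \<phi> where \<phi>: "z = q \<phi>" "\<phi> \<in> carrier Fr" unfolding carrier_Tn by blast
    show "tensor_lift R W b z \<in> carrier W" unfolding \<phi>(1) lift[OF \<phi>(2)] by (rule Lh(1)[OF \<phi>(2)])
    show "tensor_lift R W b (r \<odot>\<^bsub>Tn\<^esub> z) = r \<odot>\<^bsub>W\<^esub> tensor_lift R W b z" if r: "r \<in> carrier R" for r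
      unfolding \<phi>(1) q(3)[OF r \<phi>(2), symmetric] lift[OF \<phi>(2)] lift[OF Fr.smult_closed[OF r \<phi>(2)]] by (rule Lh(3)[OF r \<phi>(2)])
    fix z' assume "z' \<in> carrier Tn"
    then obtain \<psi> where \<psi>: "z' = q \<psi>" "\<psi> \<in> carrier Fr" unfolding carrier_Tn by blast
    show "tensor_lift R W b (z \<oplus>\<^bsub>Tn\<^esub> z') = tensor_lift R W b z \<oplus>\<^bsub>W\<^esub> tensor_lift R W b z'"
      unfolding \<phi>(1) \<psi>(1) q(2)[OF \<phi>(2) \<psi>(2), symmetric] lift[OF \<phi>(2)] lift[OF \<psi>(2)] lift[OF Fr.M.a_closed[OF \<phi>(2) \<psi>(2)]]
      by (rule Lh(2)[OF \<phi>(2) \<psi>(2)])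
  qed
  show "tensor_lift R W b (tens x y) = b x y" if "x \<in> carrier M" "y \<in> carrier N"
    unfolding elem_tensor_def lift[OF e_closed[OF that]] by (rule Le[OF that])
qed

lemma tensor_map:
  fixes M' :: "('r, 'm2) module" and N' :: "('r, 'n2) module"
  assumes M': "module R M'" and N': "module R N'" and f: "f \<in> mod_hom R M M'" and g: "g \<in> mod_hom R N N'"
  shows "tensor_map R M' N' f g \<in> mod_hom R Tn (tensor_mod R M' N')"
    "x \<in> carrier M \<Longrightarrow> y \<in> carrier N \<Longrightarrow> tensor_map R M' N' f g (tens x y) = elem_tensor R M' N' (f x) (g y)"
proof -
  interpret P: tensor_pair R M' N' by (intro tensor_pair.intro M' N')
  let ?a = "\<lambda>s. free_gen R (f (fst s), g (snd s))" and ?S = "carrier M \<times> carrier N"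
  have a: "?a \<in> ?S \<rightarrow> carrier P.Fr" by (rule Pi_I) (use P.e_closed mod_homD(1)[OF f] mod_homD(1)[OF g] in auto)
  let ?L = "M.R.lin P.Fr ?a"
  have L: "?L \<in> mod_hom R Fr P.Fr" by (rule M.R.lin_hom[OF P.Fr a])
  note Lh = mod_homD[OF L] mod_hom_more[OF Fr P.Fr L]
  have Le: "?L (e x y) = P.e (f x) (g y)" if "x \<in> carrier M" "y \<in> carrier N" for x y
    using M.R.lin_gen[OF P.Fr a, of "(x, y)"] that by simp
  note K = P.Fr.submodD[OF P.submodule_Rel]
  have pre: "submodule {\<phi> \<in> carrier Fr. ?L \<phi> \<in> P.Rel} R Fr"
    by (rule Fr.submod_intro) (use K in \<open>auto simp: Lh\<close>)
  note gens = subsetD[OF P.gens_subset_Rel, unfolded bilinear_gens_def Let_def]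
  \<comment> \<open>The linear map \<open>?L\<close> underlying \<open>tensor_map\<close> sends
    relations to relations; hence the whole coset of \<open>\<phi>\<close> goes to the single coset
    of \<open>?L \<phi>\<close>.\<close>
  have "Rel \<subseteq> {\<phi> \<in> carrier Fr. ?L \<phi> \<in> P.Rel}"
  proof (rule gens_in_submodule[OF pre])
    fix x x' y assume *: "x \<in> carrier M" "x' \<in> carrier M" "y \<in> carrier N"
    have "P.e (f x \<oplus>\<^bsub>M'\<^esub> f x') (g y) \<ominus>\<^bsub>P.Fr\<^esub> (P.e (f x) (g y) \<oplus>\<^bsub>P.Fr\<^esub> P.e (f x') (g y)) \<in> P.Rel"
      by (rule gens) (use * mod_homD(1)[OF f] mod_homD(1)[OF g] in blast)
    then show "e (x \<oplus>\<^bsub>M\<^esub> x') y \<ominus>\<^bsub>Fr\<^esub> (e x y \<oplus>\<^bsub>Fr\<^esub> e x' y) \<in> {\<phi> \<in> carrier Fr. ?L \<phi> \<in> P.Rel}"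
      using * mod_homD(2)[OF f] by (simp add: Lh e_closed Le)
  next
    fix x y y' assume *: "x \<in> carrier M" "y \<in> carrier N" "y' \<in> carrier N"
    have "P.e (f x) (g y \<oplus>\<^bsub>N'\<^esub> g y') \<ominus>\<^bsub>P.Fr\<^esub> (P.e (f x) (g y) \<oplus>\<^bsub>P.Fr\<^esub> P.e (f x) (g y')) \<in> P.Rel"
      by (rule gens) (use * mod_homD(1)[OF f] mod_homD(1)[OF g] in blast)
    then show "e x (y \<oplus>\<^bsub>N\<^esub> y') \<ominus>\<^bsub>Fr\<^esub> (e x y \<oplus>\<^bsub>Fr\<^esub> e x y') \<in> {\<phi> \<in> carrier Fr. ?L \<phi> \<in> P.Rel}"
      using * mod_homD(2)[OF g] by (simp add: Lh e_closed Le)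
  next
    fix r x y assume *: "r \<in> carrier R" "x \<in> carrier M" "y \<in> carrier N"
    have "P.e (r \<odot>\<^bsub>M'\<^esub> f x) (g y) \<ominus>\<^bsub>P.Fr\<^esub> r \<odot>\<^bsub>P.Fr\<^esub> P.e (f x) (g y) \<in> P.Rel"
      by (rule gens) (use * mod_homD(1)[OF f] mod_homD(1)[OF g] in blast)
    then show "e (r \<odot>\<^bsub>M\<^esub> x) y \<ominus>\<^bsub>Fr\<^esub> r \<odot>\<^bsub>Fr\<^esub> e x y \<in> {\<phi> \<in> carrier Fr. ?L \<phi> \<in> P.Rel}"
      using * mod_homD(3)[OF f] by (simp add: Lh e_closed Le)
    have "P.e (f x) (r \<odot>\<^bsub>N'\<^esub> g y) \<ominus>\<^bsub>P.Fr\<^esub> r \<odot>\<^bsub>P.Fr\<^esub> P.e (f x) (g y) \<in> P.Rel"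
      by (rule gens) (use * mod_homD(1)[OF f] mod_homD(1)[OF g] in blast)
    then show "e x (r \<odot>\<^bsub>N\<^esub> y) \<ominus>\<^bsub>Fr\<^esub> r \<odot>\<^bsub>Fr\<^esub> e x y \<in> {\<phi> \<in> carrier Fr. ?L \<phi> \<in> P.Rel}"
      using * mod_homD(3)[OF g] by (simp add: Lh e_closed Le)
  qed
  then have RelL: "?L k \<in> P.Rel" "k \<in> carrier Fr" if "k \<in> Rel" for k using that by blast+
  have map: "tensor_map R M' N' f g (q \<phi>) = P.q (?L \<phi>)" if \<phi>: "\<phi> \<in> carrier Fr" for \<phi>
  proof -
    have "tensor_map R M' N' f g (q \<phi>) = {k' \<oplus>\<^bsub>P.Fr\<^esub> ?L (k \<oplus>\<^bsub>Fr\<^esub> \<phi>) | k k'. k \<in> Rel \<and> k' \<in> P.Rel}"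
      unfolding tensor_map_def Let_def M.R.lin_def[symmetric] by (auto simp: set_add_def set_mult_def a_r_coset_def')
    also have "\<dots> = P.q (?L \<phi>)"
    proof (intro equalityI subsetI)
      fix u assume "u \<in> {k' \<oplus>\<^bsub>P.Fr\<^esub> ?L (k \<oplus>\<^bsub>Fr\<^esub> \<phi>) | k k'. k \<in> Rel \<and> k' \<in> P.Rel}"
      then obtain k k' where k: "k \<in> Rel" "k' \<in> P.Rel" "u = k' \<oplus>\<^bsub>P.Fr\<^esub> ?L (k \<oplus>\<^bsub>Fr\<^esub> \<phi>)" by blast
      have k'c: "k' \<in> carrier P.Fr" using k(2) K(1) by blast
      have "u = (k' \<oplus>\<^bsub>P.Fr\<^esub> ?L k) \<oplus>\<^bsub>P.Fr\<^esub> ?L \<phi>"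
        unfolding k(3) Lh(2)[OF RelL(2)[OF k(1)] \<phi>] by (rule P.Fr.M.a_assoc[symmetric, OF k'c Lh(1)[OF RelL(2)[OF k(1)]] Lh(1)[OF \<phi>]])
      then show "u \<in> P.q (?L \<phi>)" using K(3)[OF k(2) RelL(1)[OF k(1)]] unfolding a_r_coset_def' by blast
    next
      fix u assume "u \<in> P.q (?L \<phi>)"
      then obtain k' where k': "k' \<in> P.Rel" "u = k' \<oplus>\<^bsub>P.Fr\<^esub> ?L \<phi>" unfolding a_r_coset_def' by blast
      then have "u = k' \<oplus>\<^bsub>P.Fr\<^esub> ?L (\<zero>\<^bsub>Fr\<^esub> \<oplus>\<^bsub>Fr\<^esub> \<phi>)" using \<phi> by simp
      then show "u \<in> {k' \<oplus>\<^bsub>P.Fr\<^esub> ?L (k \<oplus>\<^bsub>Fr\<^esub> \<phi>) | k k'. k \<in> Rel \<and> k' \<in> P.Rel}"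
        using k'(1) Fr.submodD(2)[OF submodule_Rel] by blast
    qed
    finally show ?thesis .
  qed
  show "tensor_map R M' N' f g \<in> mod_hom R Tn P.Tn"
  proof (rule mod_homI)
    note q = mod_homD[OF q_hom] and q' = mod_homD[OF P.q_hom]
    fix z assume "z \<in> carrier Tn"
    then obtain \<phi> where \<phi>: "z = q \<phi>" "\<phi> \<in> carrier Fr" unfolding carrier_Tn by blast
    show "tensor_map R M' N' f g z \<in> carrier P.Tn" unfolding \<phi>(1) map[OF \<phi>(2)] by (rule q'(1)[OF Lh(1)[OF \<phi>(2)]])
    show "tensor_map R M' N' f g (r \<odot>\<^bsub>Tn\<^esub> z) = r \<odot>\<^bsub>P.Tn\<^esub> tensor_map R M' N' f g z" if r: "r \<in> carrier R" for r
      unfolding \<phi>(1) q(3)[OF r \<phi>(2), symmetric] map[OF \<phi>(2)] map[OF Fr.smult_closed[OF r \<phi>(2)]] Lh(3)[OF r \<phi>(2)]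
      by (rule q'(3)[OF r Lh(1)[OF \<phi>(2)]])
    fix z' assume "z' \<in> carrier Tn"
    then obtain \<psi> where \<psi>: "z' = q \<psi>" "\<psi> \<in> carrier Fr" unfolding carrier_Tn by blast
    show "tensor_map R M' N' f g (z \<oplus>\<^bsub>Tn\<^esub> z') = tensor_map R M' N' f g z \<oplus>\<^bsub>P.Tn\<^esub> tensor_map R M' N' f g z'"
      unfolding \<phi>(1) \<psi>(1) q(2)[OF \<phi>(2) \<psi>(2), symmetric] map[OF \<phi>(2)] map[OF \<psi>(2)]
        map[OF Fr.M.a_closed[OF \<phi>(2) \<psi>(2)]] Lh(2)[OF \<phi>(2) \<psi>(2)]
      by (rule q'(2)[OF Lh(1)[OF \<phi>(2)] Lh(1)[OF \<psi>(2)]])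
  qed
  show "tensor_map R M' N' f g (tens x y) = P.tens (f x) (g y)" if "x \<in> carrier M" "y \<in> carrier N"
    unfolding elem_tensor_def map[OF e_closed[OF that]] Le[OF that] ..
qed

end

section \<open>Tensor products of complexes\<close>

lemma tensor_cpx_simps:
  "carrier (obj (tensor_cpx R X Y) n) = {z. (\<forall>i. z i \<in> carrier (tensor_mod R (obj X i) (obj Y (n - i)))) \<and>
    finite {i. z i \<noteq> \<zero>\<^bsub>tensor_mod R (obj X i) (obj Y (n - i))\<^esub>}}"
  "\<zero>\<^bsub>obj (tensor_cpx R X Y) n\<^esub> = (\<lambda>i. \<zero>\<^bsub>tensor_mod R (obj X i) (obj Y (n - i))\<^esub>)"
  "z \<oplus>\<^bsub>obj (tensor_cpx R X Y) n\<^esub> w = (\<lambda>i. z i \<oplus>\<^bsub>tensor_mod R (obj X i) (obj Y (n - i))\<^esub> w i)"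
  "r \<odot>\<^bsub>obj (tensor_cpx R X Y) n\<^esub> z = (\<lambda>i. r \<odot>\<^bsub>tensor_mod R (obj X i) (obj Y (n - i))\<^esub> z i)"
  "diff (tensor_cpx R X Y) n z i =
    (if even i then tensor_map R (obj X i) (obj Y (n + 1 - i)) (diff X (i - 1)) (\<lambda>y. y) (z (i - 1))
        \<oplus>\<^bsub>tensor_mod R (obj X i) (obj Y (n + 1 - i))\<^esub> tensor_map R (obj X i) (obj Y (n + 1 - i)) (\<lambda>x. x) (diff Y (n - i)) (z i)
      else tensor_map R (obj X i) (obj Y (n + 1 - i)) (diff X (i - 1)) (\<lambda>y. y) (z (i - 1))
        \<ominus>\<^bsub>tensor_mod R (obj X i) (obj Y (n + 1 - i))\<^esub> tensor_map R (obj X i) (obj Y (n + 1 - i)) (\<lambda>x. x) (diff Y (n - i)) (z i))"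
  by (simp_all add: tensor_cpx_def Let_def)

context cring
begin

text \<open>Signs as scalars: the two parity branches in the differential of
  \<open>tensor_cpx\<close> become one linear formula.\<close>

definition sg :: "int \<Rightarrow> 'a"
  where "sg i = (if even i then \<one> else \<ominus> \<one>)"

lemma sg_closed: "sg i \<in> carrier R"
  by (simp add: sg_def)

lemma sg_square: "sg i \<otimes> sg i = \<one>"
  by (simp add: sg_def l_minus r_minus)

end

locale tensor_complex = cring R for R :: "('r, 'k) ring_scheme" (structure) +
  fixes X :: "('r, 'm) cochain" and Y :: "('r, 'n) cochain"
  assumes X: "is_complex R X" and Y: "is_complex R Y"
begin

abbreviation Tm :: "int \<Rightarrow> int \<Rightarrow> ('r, ('m \<times> 'n \<Rightarrow> 'r) set) module"
  where "Tm i j \<equiv> tensor_mod R (obj X i) (obj Y j)"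

sublocale P: tensor_pair R "obj X i" "obj Y j" for i j
  by (intro tensor_pair.intro is_complexD(1)[OF X] is_complexD(1)[OF Y])

abbreviation C where "C \<equiv> tensor_cpx R X Y"

lemma id_hom: "(\<lambda>x. x) \<in> mod_hom R L L"
  by (auto simp: mod_hom_def)

definition dX :: "int \<Rightarrow> int \<Rightarrow> ('m \<times> 'n \<Rightarrow> 'r) set \<Rightarrow> ('m \<times> 'n \<Rightarrow> 'r) set"
  where "dX i j = tensor_map R (obj X i) (obj Y j) (diff X (i - 1)) (\<lambda>y. y)"

definition dY :: "int \<Rightarrow> int \<Rightarrow> ('m \<times> 'n \<Rightarrow> 'r) set \<Rightarrow> ('m \<times> 'n \<Rightarrow> 'r) set"
  where "dY i j = tensor_map R (obj X i) (obj Y j) (\<lambda>x. x) (diff Y (j - 1))"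

lemma dX_hom: "dX i j \<in> mod_hom R (Tm (i - 1) j) (Tm i j)"
  unfolding dX_def by (rule P.tensor_map(1)[OF is_complexD(1)[OF X] is_complexD(1)[OF Y] is_complexD(3)[OF X] id_hom])

lemma dY_hom: "dY i j \<in> mod_hom R (Tm i (j - 1)) (Tm i j)"
  unfolding dY_def by (rule P.tensor_map(1)[OF is_complexD(1)[OF X] is_complexD(1)[OF Y] id_hom is_complexD(3)[OF Y]])

lemma dX_tens: "x \<in> carrier (obj X (i - 1)) \<Longrightarrow> y \<in> carrier (obj Y j) \<Longrightarrow>
    dX i j (elem_tensor R (obj X (i - 1)) (obj Y j) x y) = elem_tensor R (obj X i) (obj Y j) (diff X (i - 1) x) y"
  unfolding dX_def by (rule P.tensor_map(2)[OF is_complexD(1)[OF X] is_complexD(1)[OF Y] is_complexD(3)[OF X] id_hom])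

lemma dY_tens: "x \<in> carrier (obj X i) \<Longrightarrow> y \<in> carrier (obj Y (j - 1)) \<Longrightarrow>
    dY i j (elem_tensor R (obj X i) (obj Y (j - 1)) x y) = elem_tensor R (obj X i) (obj Y j) x (diff Y (j - 1) y)"
  unfolding dY_def by (rule P.tensor_map(2)[OF is_complexD(1)[OF X] is_complexD(1)[OF Y] id_hom is_complexD(3)[OF Y]])

lemma diff_C:
  assumes "z \<in> carrier (obj C n)"
  shows "diff C n z i = dX i (n + 1 - i) (z (i - 1)) \<oplus>\<^bsub>Tm i (n + 1 - i)\<^esub> sg i \<odot>\<^bsub>Tm i (n + 1 - i)\<^esub> dY i (n + 1 - i) (z i)"
proof -
  have j: "n + 1 - i - 1 = n - i" by simp
  have "z i \<in> carrier (Tm i (n - i))" using assms by (simp add: tensor_cpx_simps)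
  then have cl: "dY i (n + 1 - i) (z i) \<in> carrier (Tm i (n + 1 - i))" using mod_homD(1)[OF dY_hom[of i "n + 1 - i"]] j by simp
  show ?thesis
    using cl by (simp add: tensor_cpx_simps sg_def P.Tn.smult_minus_one P.Tn.M.minus_eq) (simp add: dX_def dY_def)
qed

lemma module_C: "module R (obj C n)"
proof (rule moduleI)
  let ?T = "\<lambda>i. Tm i (n - i)"
  note simps = tensor_cpx_simps(1-4)[of R X Y n]
  have add: "z \<oplus>\<^bsub>obj C n\<^esub> w \<in> carrier (obj C n)" if "z \<in> carrier (obj C n)" "w \<in> carrier (obj C n)" for z w
  proof -
    have "{i. z i \<oplus>\<^bsub>?T i\<^esub> w i \<noteq> \<zero>\<^bsub>?T i\<^esub>} \<subseteq> {i. z i \<noteq> \<zero>\<^bsub>?T i\<^esub>} \<union> {i. w i \<noteq> \<zero>\<^bsub>?T i\<^esub>}"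
    proof (rule subsetI, rule ccontr)
      fix i assume "i \<in> {i. z i \<oplus>\<^bsub>?T i\<^esub> w i \<noteq> \<zero>\<^bsub>?T i\<^esub>}"
        and "i \<notin> {i. z i \<noteq> \<zero>\<^bsub>?T i\<^esub>} \<union> {i. w i \<noteq> \<zero>\<^bsub>?T i\<^esub>}"
      then have "z i = \<zero>\<^bsub>?T i\<^esub>" "w i = \<zero>\<^bsub>?T i\<^esub>" "z i \<oplus>\<^bsub>?T i\<^esub> w i \<noteq> \<zero>\<^bsub>?T i\<^esub>" by simp_all
      then show False using P.Tn.M.r_zero[OF P.Tn.M.zero_closed] by metis
    qed
    then have "finite {i. z i \<oplus>\<^bsub>?T i\<^esub> w i \<noteq> \<zero>\<^bsub>?T i\<^esub>}" by (rule finite_subset) (use that in \<open>simp add: simps\<close>)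
    then show ?thesis using that by (simp add: simps)
  qed
  have smult: "r \<odot>\<^bsub>obj C n\<^esub> z \<in> carrier (obj C n)" if "r \<in> carrier R" "z \<in> carrier (obj C n)" for z r
  proof -
    have "{i. r \<odot>\<^bsub>?T i\<^esub> z i \<noteq> \<zero>\<^bsub>?T i\<^esub>} \<subseteq> {i. z i \<noteq> \<zero>\<^bsub>?T i\<^esub>}"
    proof (rule Collect_mono, intro impI notI)
      fix i assume "r \<odot>\<^bsub>?T i\<^esub> z i \<noteq> \<zero>\<^bsub>?T i\<^esub>" "z i = \<zero>\<^bsub>?T i\<^esub>"
      then show False using P.Tn.smult_r_null[OF that(1)] by metis
    qed
    then have "finite {i. r \<odot>\<^bsub>?T i\<^esub> z i \<noteq> \<zero>\<^bsub>?T i\<^esub>}" by (rule finite_subset) (use that in \<open>simp add: simps\<close>)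
    then show ?thesis using that by (simp add: simps)
  qed
  show "cring R" by (rule is_cring)
  show "abelian_group (obj C n)"
  proof (rule abelian_groupI)
    show "\<zero>\<^bsub>obj C n\<^esub> \<in> carrier (obj C n)" by (simp add: simps)
    fix z assume z: "z \<in> carrier (obj C n)"
    have inv: "\<ominus>\<^bsub>?T i\<^esub> z i = (\<ominus> \<one>) \<odot>\<^bsub>?T i\<^esub> z i" for i using z by (simp add: simps P.Tn.smult_minus_one)
    have "(\<lambda>i. (\<ominus> \<one>) \<odot>\<^bsub>?T i\<^esub> z i) \<in> carrier (obj C n)" using smult[of "\<ominus> \<one>" z] z by (simp add: simps(4))
    moreover have "(\<lambda>i. (\<ominus> \<one>) \<odot>\<^bsub>?T i\<^esub> z i) \<oplus>\<^bsub>obj C n\<^esub> z = \<zero>\<^bsub>obj C n\<^esub>"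
      using z by (simp add: simps fun_eq_iff inv[symmetric] P.Tn.M.l_neg)
    ultimately show "\<exists>w\<in>carrier (obj C n). w \<oplus>\<^bsub>obj C n\<^esub> z = \<zero>\<^bsub>obj C n\<^esub>" by blast
  qed (simp_all add: add, simp_all add: simps fun_eq_iff P.Tn.M.a_ac)
  show "r \<odot>\<^bsub>obj C n\<^esub> z \<in> carrier (obj C n)" if "r \<in> carrier R" "z \<in> carrier (obj C n)" for r z
    using that by (rule smult)
qed (simp_all add: tensor_cpx_simps(1-4) fun_eq_iff P.Tn.smult_l_distr P.Tn.smult_r_distr P.Tn.smult_assoc1)

lemma C_comp: "z \<in> carrier (obj C n) \<Longrightarrow> z i \<in> carrier (Tm i (n - i))"
  by (simp add: tensor_cpx_simps)

lemma diff_C_hom: "diff C n \<in> mod_hom R (obj C n) (obj C (n + 1))"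
proof (rule mod_homI)
  interpret Cn: module R "obj C n" by (rule module_C)
  fix z assume z: "z \<in> carrier (obj C n)"
  have z1: "z (i - 1) \<in> carrier (Tm (i - 1) (n + 1 - i))" if "z \<in> carrier (obj C n)" for z i
    using C_comp[OF that, of "i - 1"] by (simp add: algebra_simps)
  have z2: "z i \<in> carrier (Tm i (n + 1 - i - 1))" if "z \<in> carrier (obj C n)" for z i
    using C_comp[OF that, of i] by simp
  let ?T = "\<lambda>i. Tm i (n + 1 - i)"
  let ?a = "\<lambda>z i. dX i (n + 1 - i) (z (i - 1))" and ?b = "\<lambda>z i. dY i (n + 1 - i) (z i)"
  have a: "?a z i \<in> carrier (?T i)" if "z \<in> carrier (obj C n)" for z i by (rule mod_homD(1)[OF dX_hom z1[OF that]])
  have b: "?b z i \<in> carrier (?T i)" if "z \<in> carrier (obj C n)" for z i by (rule mod_homD(1)[OF dY_hom z2[OF that]])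
  have nz: "z (i - 1) \<noteq> \<zero>\<^bsub>Tm (i - 1) (n - (i - 1))\<^esub> \<or> z i \<noteq> \<zero>\<^bsub>Tm i (n - i)\<^esub>" if "diff C n z i \<noteq> \<zero>\<^bsub>?T i\<^esub>" for i
  proof (rule ccontr)
    assume "\<not> ?thesis"
    then have 0: "z (i - 1) = \<zero>\<^bsub>Tm (i - 1) (n + 1 - i)\<^esub>" "z i = \<zero>\<^bsub>Tm i (n + 1 - i - 1)\<^esub>" by (simp_all add: algebra_simps)
    have "diff C n z i = \<zero>\<^bsub>?T i\<^esub>"
      unfolding diff_C[OF z] 0 mod_hom_more(1)[OF P.Tn P.Tn dX_hom] mod_hom_more(1)[OF P.Tn P.Tn dY_hom]
      using sg_closed by simp
    then show False using that by blast
  qed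
  have "{i. diff C n z i \<noteq> \<zero>\<^bsub>?T i\<^esub>} \<subseteq> (\<lambda>i. i + 1) ` {i. z i \<noteq> \<zero>\<^bsub>Tm i (n - i)\<^esub>} \<union> {i. z i \<noteq> \<zero>\<^bsub>Tm i (n - i)\<^esub>}"
  proof
    fix i assume "i \<in> {i. diff C n z i \<noteq> \<zero>\<^bsub>?T i\<^esub>}"
    then have "z (i - 1) \<noteq> \<zero>\<^bsub>Tm (i - 1) (n - (i - 1))\<^esub> \<or> z i \<noteq> \<zero>\<^bsub>Tm i (n - i)\<^esub>" using nz[of i] by simp
    then show "i \<in> (\<lambda>i. i + 1) ` {i. z i \<noteq> \<zero>\<^bsub>Tm i (n - i)\<^esub>} \<union> {i. z i \<noteq> \<zero>\<^bsub>Tm i (n - i)\<^esub>}"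
      by (auto intro!: image_eqI[of _ _ "i - 1"])
  qed
  then have "finite {i. diff C n z i \<noteq> \<zero>\<^bsub>?T i\<^esub>}"
    by (rule finite_subset) (use z in \<open>simp add: tensor_cpx_simps\<close>)
  moreover have "diff C n z i \<in> carrier (?T i)" for i
    unfolding diff_C[OF z] using a[OF z] b[OF z] sg_closed by simp
  ultimately show "diff C n z \<in> carrier (obj C (n + 1))" unfolding tensor_cpx_simps(1) by blast
  show "diff C n (r \<odot>\<^bsub>obj C n\<^esub> z) = r \<odot>\<^bsub>obj C (n + 1)\<^esub> diff C n z" if r: "r \<in> carrier R" for r
  proof
    fix i
    have comp: "(r \<odot>\<^bsub>obj C n\<^esub> z) (i - 1) = r \<odot>\<^bsub>Tm (i - 1) (n + 1 - i)\<^esub> z (i - 1)" "(r \<odot>\<^bsub>obj C n\<^esub> z) i = r \<odot>\<^bsub>Tm i (n + 1 - i - 1)\<^esub> z i"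
      by (simp_all add: tensor_cpx_simps algebra_simps)
    have "diff C n (r \<odot>\<^bsub>obj C n\<^esub> z) i = r \<odot>\<^bsub>?T i\<^esub> diff C n z i"
      unfolding diff_C[OF Cn.smult_closed[OF r z]] comp diff_C[OF z]
        mod_homD(3)[OF dX_hom r z1[OF z]] mod_homD(3)[OF dY_hom r z2[OF z]]
      using a[OF z] b[OF z] sg_closed r by (simp add: P.Tn.smult_r_distr P.Tn.smult_comm[OF sg_closed r])
    then show "diff C n (r \<odot>\<^bsub>obj C n\<^esub> z) i = (r \<odot>\<^bsub>obj C (n + 1)\<^esub> diff C n z) i"
      unfolding tensor_cpx_simps(4)[where n = "n + 1"] .
  qed
  fix w assume w: "w \<in> carrier (obj C n)"
  show "diff C n (z \<oplus>\<^bsub>obj C n\<^esub> w) = diff C n z \<oplus>\<^bsub>obj C (n + 1)\<^esub> diff C n w"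
  proof
    fix i
    have comp: "(z \<oplus>\<^bsub>obj C n\<^esub> w) (i - 1) = z (i - 1) \<oplus>\<^bsub>Tm (i - 1) (n + 1 - i)\<^esub> w (i - 1)" "(z \<oplus>\<^bsub>obj C n\<^esub> w) i = z i \<oplus>\<^bsub>Tm i (n + 1 - i - 1)\<^esub> w i"
      by (simp_all add: tensor_cpx_simps algebra_simps)
    have "diff C n (z \<oplus>\<^bsub>obj C n\<^esub> w) i = diff C n z i \<oplus>\<^bsub>?T i\<^esub> diff C n w i"
      unfolding diff_C[OF Cn.M.a_closed[OF z w]] diff_C[OF z] diff_C[OF w] comp
        mod_homD(2)[OF dX_hom z1[OF z] z1[OF w]] mod_homD(2)[OF dY_hom z2[OF z] z2[OF w]]
      using a[OF z] b[OF z] a[OF w] b[OF w] sg_closed by (simp add: P.Tn.smult_r_distr P.Tn.M.a_ac)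
    then show "diff C n (z \<oplus>\<^bsub>obj C n\<^esub> w) i = (diff C n z \<oplus>\<^bsub>obj C (n + 1)\<^esub> diff C n w) i"
      unfolding tensor_cpx_simps(3)[where n = "n + 1"] .
  qed
qed

definition single :: "int \<Rightarrow> 'm \<Rightarrow> 'n \<Rightarrow> int \<Rightarrow> ('m \<times> 'n \<Rightarrow> 'r) set"
  where "single n x y = (\<lambda>i. if i = 0 then elem_tensor R (obj X 0) (obj Y n) x y else \<zero>\<^bsub>Tm i (n - i)\<^esub>)"

lemma single_closed:
  assumes "x \<in> carrier (obj X 0)" "y \<in> carrier (obj Y n)"
  shows "single n x y \<in> carrier (obj C n)"
proof -
  have "{i. single n x y i \<noteq> \<zero>\<^bsub>Tm i (n - i)\<^esub>} \<subseteq> {0}" by (auto simp: single_def)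
  then have "finite {i. single n x y i \<noteq> \<zero>\<^bsub>Tm i (n - i)\<^esub>}" by (rule finite_subset) simp
  moreover have "single n x y i \<in> carrier (Tm i (n - i))" for i
    using P.tens_closed[OF assms] by (simp add: single_def)
  ultimately show ?thesis unfolding tensor_cpx_simps(1) by blast
qed

text \<open>As \<open>x\<close> and \<open>y\<close> are cocycles, both partial differentials of
  \<open>x \<otimes> y\<close> vanish separately.\<close>

lemma diff_single:
  assumes x: "x \<in> carrier (obj X 0)" "diff X 0 x = \<zero>\<^bsub>obj X 1\<^esub>" and y: "y \<in> carrier (obj Y n)" "diff Y n y = \<zero>\<^bsub>obj Y (n + 1)\<^esub>"
  shows "diff C n (single n x y) = \<zero>\<^bsub>obj C (n + 1)\<^esub>"
proof
  fix i
  have "dX i (n + 1 - i) (single n x y (i - 1)) = \<zero>\<^bsub>Tm i (n + 1 - i)\<^esub>"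
  proof (cases "i = 1")
    case True
    have "dX 1 n (elem_tensor R (obj X (1 - 1)) (obj Y n) x y) = elem_tensor R (obj X 1) (obj Y n) (diff X (1 - 1) x) y"
      by (rule dX_tens) (use x y in simp_all)
    then show ?thesis using True x(2) P.tens_zero(1)[OF y(1)] by (simp add: single_def)
  next
    case False
    then have "single n x y (i - 1) = \<zero>\<^bsub>Tm (i - 1) (n + 1 - i)\<^esub>" by (simp add: single_def algebra_simps)
    then show ?thesis using mod_hom_more(1)[OF P.Tn P.Tn dX_hom] by simp
  qed
  moreover have "dY i (n + 1 - i) (single n x y i) = \<zero>\<^bsub>Tm i (n + 1 - i)\<^esub>"
  proof (cases "i = 0")
    case True
    have "dY 0 (n + 1) (elem_tensor R (obj X 0) (obj Y (n + 1 - 1)) x y) = elem_tensor R (obj X 0) (obj Y (n + 1)) x (diff Y (n + 1 - 1) y)"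
      by (rule dY_tens) (use x y in simp_all)
    then show ?thesis using True y(2) P.tens_zero(2)[OF x(1)] by (simp add: single_def)
  next
    case False
    then have "single n x y i = \<zero>\<^bsub>Tm i (n + 1 - i - 1)\<^esub>" by (simp add: single_def)
    then show ?thesis by (simp only:) (rule mod_hom_more(1)[OF P.Tn P.Tn dY_hom])
  qed
  ultimately show "diff C n (single n x y) i = \<zero>\<^bsub>obj C (n + 1)\<^esub> i"
    unfolding diff_C[OF single_closed[OF x(1) y(1)]] tensor_cpx_simps(2) using sg_closed by simp
qed

end

section \<open>The complex \<open>F \<otimes> D\<close>\<close>

lemma mod_hom_finsum:
  assumes M: "module R M" and M': "module R M'" and h: "h \<in> mod_hom R M M'" and f: "f \<in> A \<rightarrow> carrier M"
  shows "h (\<Oplus>\<^bsub>M\<^esub>a\<in>A. f a) = (\<Oplus>\<^bsub>M'\<^esub>a\<in>A. h (f a))"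
proof -
  interpret M: module R M by fact
  interpret M': module R M' by fact
  show ?thesis
  proof (cases "finite A")
    case True
    then show ?thesis using f
    proof (induction A)
      case empty
      then show ?case using mod_hom_more(1)[OF M M' h] by simp
    next
      case (insert a A)
      have fa: "f a \<in> carrier M" and fA: "f \<in> A \<rightarrow> carrier M" using insert.prems by auto
      have hA: "(\<lambda>a. h (f a)) \<in> A \<rightarrow> carrier M'" using fA mod_homD(1)[OF h] by blast
      have "h (\<Oplus>\<^bsub>M\<^esub>a\<in>insert a A. f a) = h (f a \<oplus>\<^bsub>M\<^esub> (\<Oplus>\<^bsub>M\<^esub>a\<in>A. f a))"
        by (simp only: M.M.finsum_insert[OF insert.hyps fA fa])
      also have "\<dots> = h (f a) \<oplus>\<^bsub>M'\<^esub> (\<Oplus>\<^bsub>M'\<^esub>a\<in>A. h (f a))"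
        unfolding mod_homD(2)[OF h fa M.M.finsum_closed[OF fA]] insert.IH[OF fA] ..
      also have "\<dots> = (\<Oplus>\<^bsub>M'\<^esub>a\<in>insert a A. h (f a))"
        by (rule M'.M.finsum_insert[OF insert.hyps hA mod_homD(1)[OF h fa], symmetric])
      finally show ?case .
    qed
  next
    case False
    then show ?thesis using mod_hom_more(1)[OF M M' h] by (simp add: M.M.finsum_infinite M'.M.finsum_infinite)
  qed
qed

section \<open>Tensoring \<open>F\<close> with a module, in coordinates\<close>

context minimal_resolution
begin

text \<open>The map \<open>F\<^sub>l\<^sub>+\<^sub>1 \<otimes> M \<rightarrow> F\<^sub>l \<otimes> M\<close> in coordinates, an element of \<open>F\<^sub>l \<otimes> M\<close> being a family over \<open>T l\<close>.\<close>

definition mat :: "('r, 'm) module \<Rightarrow> nat \<Rightarrow> (nat \<times> 'n \<times> 'r \<Rightarrow> 'm) \<Rightarrow> nat \<times> 'n \<times> 'r \<Rightarrow> 'm"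
  where "mat M l x t = (\<Oplus>\<^bsub>M\<^esub>u\<in>T (Suc l). d l (free_gen R u) t \<odot>\<^bsub>M\<^esub> x u)"

lemma entry_closed: "u \<in> T (Suc l) \<Longrightarrow> d l (free_gen R u) t \<in> carrier R"
  by (rule free_modD(1)[OF d_props(1)[OF free_gen_closed]])

lemma entry_max_ideal: "u \<in> T (Suc l) \<Longrightarrow> d l (free_gen R u) t \<in> max_ideal R"
  by (rule coeff_subD[OF minimal[OF free_gen_closed]])

context
  fixes M :: "('r, 'm) module"
  assumes M: "module R M"
begin

interpretation M: module R M by (rule M)

lemma mat_terms: "(\<And>u. x u \<in> carrier M) \<Longrightarrow> (\<lambda>u. d l (free_gen R u) t \<odot>\<^bsub>M\<^esub> x u) \<in> T (Suc l) \<rightarrow> carrier M"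
  using entry_closed by (intro Pi_I M.smult_closed)

lemma mat_closed: "(\<And>u. x u \<in> carrier M) \<Longrightarrow> mat M l x t \<in> carrier M"
  unfolding mat_def by (rule M.M.finsum_closed[OF mat_terms])

lemma mat_add:
  assumes "\<And>u. x u \<in> carrier M" "\<And>u. y u \<in> carrier M"
  shows "mat M l (\<lambda>u. x u \<oplus>\<^bsub>M\<^esub> y u) t = mat M l x t \<oplus>\<^bsub>M\<^esub> mat M l y t"
proof -
  have "mat M l (\<lambda>u. x u \<oplus>\<^bsub>M\<^esub> y u) t =
      (\<Oplus>\<^bsub>M\<^esub>u\<in>T (Suc l). d l (free_gen R u) t \<odot>\<^bsub>M\<^esub> x u \<oplus>\<^bsub>M\<^esub> d l (free_gen R u) t \<odot>\<^bsub>M\<^esub> y u)"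
    unfolding mat_def by (rule M.M.finsum_cong'[OF refl])
      (use assms entry_closed in \<open>blast intro: M.smult_closed M.M.a_closed M.smult_r_distr\<close>)+
  then show ?thesis unfolding mat_def using M.M.finsum_addf[OF mat_terms[of x] mat_terms[of y]] assms by simp
qed

lemma mat_hom:
  assumes M': "module R M'" and h: "h \<in> mod_hom R M M'" and x: "\<And>u. x u \<in> carrier M"
  shows "h (mat M l x t) = mat M' l (\<lambda>u. h (x u)) t"
proof -
  interpret M': module R M' by fact
  have "h (mat M l x t) = (\<Oplus>\<^bsub>M'\<^esub>u\<in>T (Suc l). h (d l (free_gen R u) t \<odot>\<^bsub>M\<^esub> x u))"
    unfolding mat_def by (rule mod_hom_finsum[OF M M' h mat_terms[OF x]])
  also have "\<dots> = mat M' l (\<lambda>u. h (x u)) t"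
    unfolding mat_def
    by (rule M'.M.finsum_cong') (use x entry_closed mod_homD(1,3)[OF h] in \<open>auto intro!: M'.smult_closed\<close>)
  finally show ?thesis .
qed

lemma mat_smult:
  assumes x: "\<And>u. x u \<in> carrier M" and r: "r \<in> carrier R"
  shows "mat M l (\<lambda>u. r \<odot>\<^bsub>M\<^esub> x u) t = r \<odot>\<^bsub>M\<^esub> mat M l x t"
proof -
  have "(\<lambda>v. r \<odot>\<^bsub>M\<^esub> v) \<in> mod_hom R M M"
    by (rule mod_homI) (use r in \<open>simp_all add: M.smult_r_distr M.smult_comm[OF r]\<close>)
  from mat_hom[OF M this x] show ?thesis by simp
qed

lemma mat_outside: "t \<notin> T l \<Longrightarrow> (\<And>u. x u \<in> carrier M) \<Longrightarrow> mat M l x t = \<zero>\<^bsub>M\<^esub>"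
  unfolding mat_def
proof -
  assume t: "t \<notin> T l" and x: "\<And>u. x u \<in> carrier M"
  have "(\<Oplus>\<^bsub>M\<^esub>u\<in>T (Suc l). d l (free_gen R u) t \<odot>\<^bsub>M\<^esub> x u) = (\<Oplus>\<^bsub>M\<^esub>u\<in>T (Suc l). \<zero>\<^bsub>M\<^esub>)"
  proof (rule M.M.finsum_cong')
    fix u assume "u \<in> T (Suc l)"
    then have "d l (free_gen R u) t = \<zero>" by (rule free_modD(2)[OF d_props(1)[OF free_gen_closed] t])
    then show "d l (free_gen R u) t \<odot>\<^bsub>M\<^esub> x u = \<zero>\<^bsub>M\<^esub>" using x by simp
  qed auto
  then show "(\<Oplus>\<^bsub>M\<^esub>u\<in>T (Suc l). d l (free_gen R u) t \<odot>\<^bsub>M\<^esub> x u) = \<zero>\<^bsub>M\<^esub>" by simp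
qed

lemma mat_in_submodule:
  assumes X: "submodule X R M" and x: "\<And>a u. a \<in> max_ideal R \<Longrightarrow> a \<odot>\<^bsub>M\<^esub> x u \<in> X"
  shows "mat M l x t \<in> X"
  unfolding mat_def by (rule M.finsum_in_submod[OF X finite_T]) (rule x[OF entry_max_ideal])

text \<open>The family \<open>\<phi> u v\<close> is the coordinate vector of
  \<open>\<phi> \<otimes> v\<close>, so \<open>mat\<close> is indeed \<open>d \<otimes> M\<close>.
  Both sides are linear in \<open>\<phi>\<close> and agree on basis vectors.\<close>

lemma mat_elem:
  assumes \<phi>: "\<phi> \<in> carrier (F (Suc l))" and v: "v \<in> carrier M"
  shows "mat M l (\<lambda>u. \<phi> u \<odot>\<^bsub>M\<^esub> v) t = d l \<phi> t \<odot>\<^bsub>M\<^esub> v"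
proof -
  let ?a = "\<lambda>u. d l (free_gen R u) t \<odot>\<^bsub>M\<^esub> v"
  have a: "?a \<in> T (Suc l) \<rightarrow> carrier M" by (rule mat_terms) (rule v)
  have p: "\<phi> u \<in> carrier R" "u \<notin> T (Suc l) \<Longrightarrow> \<phi> u = \<zero>" for u using free_modD(1,2)[OF \<phi>] .
  have "(\<lambda>\<phi>. d l \<phi> t \<odot>\<^bsub>M\<^esub> v) \<in> mod_hom R (F (Suc l)) M"
  proof (rule mod_homI, goal_cases)
    case (1 x)
    note dx = free_modD(1)[OF d_props(1)[OF 1]]
    show ?case using dx v by simp
  next
    case (2 x y)
    show ?case
      unfolding d_props(2)[OF 2]
      by (subst free_mod_simps(3)) (rule M.smult_l_distr[OF free_modD(1)[OF d_props(1)[OF 2(1)]] free_modD(1)[OF d_props(1)[OF 2(2)]] v])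
  next
    case (3 r x)
    show ?case
      unfolding d_props(3)[OF 3] by (subst free_mod_simps(4)) (rule M.smult_assoc1[OF 3(1) free_modD(1)[OF d_props(1)[OF 3(2)]] v])
  qed
  then have "d l \<phi> t \<odot>\<^bsub>M\<^esub> v = lin M ?a \<phi>"
    by (rule mod_hom_eq_on_free[OF M _ lin_hom[OF M a] _ \<phi>]) (rule lin_gen[OF M a, symmetric])
  also have "\<dots> = (\<Oplus>\<^bsub>M\<^esub>u\<in>T (Suc l). \<phi> u \<odot>\<^bsub>M\<^esub> ?a u)"
    by (rule lin_superset[OF M a \<phi> finite_T order_refl free_modD(4)[OF \<phi>]])
  also have "\<dots> = mat M l (\<lambda>u. \<phi> u \<odot>\<^bsub>M\<^esub> v) t"
    unfolding mat_def
    by (rule M.M.finsum_cong'[OF refl]) (use p(1) v entry_closed in \<open>blast intro: M.smult_comm M.smult_closed\<close>)+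
  finally show ?thesis by simp
qed

lemma mat_zero: "mat M l (\<lambda>u. \<zero>\<^bsub>M\<^esub>) t = \<zero>\<^bsub>M\<^esub>"
  using mat_smult[of "\<lambda>_. \<zero>\<^bsub>M\<^esub>" \<zero>] mat_closed[of "\<lambda>_. \<zero>\<^bsub>M\<^esub>"] by simp

text \<open>By additivity over the basis of \<open>F_{l+2}\<close>, the inner family reduces to a
  basis vector \<open>v\<close> times \<open>x v\<close>, where \<open>mat_elem\<close> and
  \<open>d d = 0\<close> apply.\<close>

lemma mat_mat:
  assumes x: "\<And>u. x u \<in> carrier M"
  shows "mat M l (mat M (Suc l) x) t = \<zero>\<^bsub>M\<^esub>"
proof -
  let ?s = "\<lambda>V u. \<Oplus>\<^bsub>M\<^esub>v\<in>V. d (Suc l) (free_gen R v) u \<odot>\<^bsub>M\<^esub> x v"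
  have "mat M l (?s V) t = \<zero>\<^bsub>M\<^esub>" if "finite V" "V \<subseteq> T (Suc (Suc l))" for V
    using that
  proof (induction V)
    case empty
    then show ?case by (simp add: mat_zero)
  next
    case (insert v V)
    have cl: "(\<lambda>v. d (Suc l) (free_gen R v) u \<odot>\<^bsub>M\<^esub> x v) \<in> T (Suc (Suc l)) \<rightarrow> carrier M" for u by (rule mat_terms[OF x])
    have 1: "(\<lambda>v. d (Suc l) (free_gen R v) u \<odot>\<^bsub>M\<^esub> x v) \<in> V \<rightarrow> carrier M"
      "d (Suc l) (free_gen R v) u \<odot>\<^bsub>M\<^esub> x v \<in> carrier M" for u using cl[of u] insert.prems by auto
    have vT: "v \<in> T (Suc (Suc l))" using insert.prems by blast
    have dv: "d (Suc l) (free_gen R v) \<in> carrier (F (Suc l))" by (rule d_props(1)[OF free_gen_closed[OF vT]])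
    have "mat M l (?s (insert v V)) t = mat M l (\<lambda>u. d (Suc l) (free_gen R v) u \<odot>\<^bsub>M\<^esub> x v \<oplus>\<^bsub>M\<^esub> ?s V u) t"
      by (simp only: M.M.finsum_insert[OF insert.hyps 1])
    also have "\<dots> = mat M l (\<lambda>u. d (Suc l) (free_gen R v) u \<odot>\<^bsub>M\<^esub> x v) t \<oplus>\<^bsub>M\<^esub> mat M l (?s V) t"
      by (rule mat_add[OF 1(2) M.M.finsum_closed[OF 1(1)]])
    also have "mat M l (\<lambda>u. d (Suc l) (free_gen R v) u \<odot>\<^bsub>M\<^esub> x v) t = d l (d (Suc l) (free_gen R v)) t \<odot>\<^bsub>M\<^esub> x v"
      by (rule mat_elem[OF dv x])
    also have "\<dots> = \<zero>\<^bsub>M\<^esub>" unfolding dd[OF free_gen_closed[OF vT]] free_mod_simps(2) by (rule M.smult_l_null[OF x])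
    finally show ?case using insert by simp
  qed
  from this[OF finite_T order_refl] show ?thesis unfolding mat_def[of M "Suc l", abs_def] .
qed

end

end

locale minimal_resolution_complex = minimal_resolution R N T d aug
  for R :: "('r, 'k) ring_scheme" (structure) and N :: "('r, 'n) module" and T :: "nat \<Rightarrow> (nat \<times> 'n \<times> 'r) set" and d aug +
  fixes D :: "('r, 'd) cochain"
  assumes D: "is_complex R D"
begin

text \<open>\<open>n\<close> is the total degree. Since \<open>F_l\<close> sits in degree
  \<open>-l\<close>, its partner in \<open>D\<close> has degree \<open>n + l\<close>.\<close>

definition Ob :: "int \<Rightarrow> nat \<Rightarrow> ('r, 'd) module"
  where "Ob n l = obj D (n + int l)"

definition dD :: "int \<Rightarrow> nat \<Rightarrow> 'd \<Rightarrow> 'd"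
  where "dD n l = diff D (n + int l)"

lemma shift: "Ob (n + 1) l = Ob n (Suc l)" "dD (n + 1) l = dD n (Suc l)"
  by (simp_all add: Ob_def dD_def algebra_simps)

lemma Ob: "module R (Ob n l)"
  unfolding Ob_def by (rule is_complexD(1)[OF D])

sublocale Ob: module R "Ob n l" for n l
  by (rule Ob)

lemma dD_hom: "dD n l \<in> mod_hom R (Ob n l) (Ob n (Suc l))"
  using is_complexD(2)[OF D, of "n + int l"] by (simp add: Ob_def dD_def algebra_simps)

lemmas dD = mod_homD[OF dD_hom] mod_hom_more[OF Ob Ob dD_hom]

lemma dD_dD:
  assumes "x \<in> carrier (Ob n l)"
  shows "dD n (Suc l) (dD n l x) = \<zero>\<^bsub>Ob n (Suc (Suc l))\<^esub>"
  using is_complexD(4)[OF D, of x "n + int l + 1"] assms by (simp add: Ob_def dD_def algebra_simps)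

text \<open>A model of \<open>F \<otimes> D\<close>: the component at \<open>l\<close> is
  \<open>F_l \<otimes> D^{n+l}\<close>, a family over the finite basis \<open>T l\<close>, set to
  zero elsewhere so that equality of elements is equality of functions. The product over
  \<open>l\<close> is the direct sum as soon as \<open>F\<close> is bounded.\<close>

definition FD :: "('r, nat \<Rightarrow> nat \<times> 'n \<times> 'r \<Rightarrow> 'd) cochain"
  where "FD = \<lparr>obj = (\<lambda>n.
      \<lparr>carrier = {w. \<forall>l t. w l t \<in> carrier (Ob n l) \<and> (t \<notin> T l \<longrightarrow> w l t = \<zero>\<^bsub>Ob n l\<^esub>)},
       monoid.mult = (\<lambda>_ _. undefined), one = undefined, zero = (\<lambda>l t. \<zero>\<^bsub>Ob n l\<^esub>),
       add = (\<lambda>w v l t. w l t \<oplus>\<^bsub>Ob n l\<^esub> v l t), smult = (\<lambda>r w l t. r \<odot>\<^bsub>Ob n l\<^esub> w l t)\<rparr>),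
    diff = (\<lambda>n w l t. mat (Ob n (Suc l)) l (w (Suc l)) t \<oplus>\<^bsub>Ob n (Suc l)\<^esub> sg (int l) \<odot>\<^bsub>Ob n (Suc l)\<^esub> dD n l (w l t))\<rparr>"

lemma FD_simps:
  "carrier (obj FD n) = {w. \<forall>l t. w l t \<in> carrier (Ob n l) \<and> (t \<notin> T l \<longrightarrow> w l t = \<zero>\<^bsub>Ob n l\<^esub>)}"
  "\<zero>\<^bsub>obj FD n\<^esub> = (\<lambda>l t. \<zero>\<^bsub>Ob n l\<^esub>)"
  "w \<oplus>\<^bsub>obj FD n\<^esub> v = (\<lambda>l t. w l t \<oplus>\<^bsub>Ob n l\<^esub> v l t)"
  "r \<odot>\<^bsub>obj FD n\<^esub> w = (\<lambda>l t. r \<odot>\<^bsub>Ob n l\<^esub> w l t)"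
  by (simp_all add: FD_def)

lemma diff_FD: "diff FD n w l t = mat (Ob n (Suc l)) l (w (Suc l)) t \<oplus>\<^bsub>Ob n (Suc l)\<^esub> sg (int l) \<odot>\<^bsub>Ob n (Suc l)\<^esub> dD n l (w l t)"
  by (simp add: FD_def)

lemma FD_D:
  assumes "w \<in> carrier (obj FD n)"
  shows "w l t \<in> carrier (Ob n l)" "t \<notin> T l \<Longrightarrow> w l t = \<zero>\<^bsub>Ob n l\<^esub>"
  using assms unfolding FD_simps by blast+

lemma module_FD: "module R (obj FD n)"
proof (rule moduleI)
  show "cring R" by (rule is_cring)
  show "abelian_group (obj FD n)"
  proof (rule abelian_groupI)
    fix w assume w: "w \<in> carrier (obj FD n)"
    have "(\<lambda>l t. \<ominus>\<^bsub>Ob n l\<^esub> w l t) \<in> carrier (obj FD n)" using FD_D[OF w] by (simp add: FD_simps)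
    moreover have "(\<lambda>l t. \<ominus>\<^bsub>Ob n l\<^esub> w l t) \<oplus>\<^bsub>obj FD n\<^esub> w = \<zero>\<^bsub>obj FD n\<^esub>"
      using FD_D(1)[OF w] by (simp add: FD_simps Ob.M.l_neg)
    ultimately show "\<exists>v\<in>carrier (obj FD n). v \<oplus>\<^bsub>obj FD n\<^esub> w = \<zero>\<^bsub>obj FD n\<^esub>" by blast
  qed (simp_all add: FD_simps Ob.M.a_ac fun_eq_iff)
qed (simp_all add: FD_simps fun_eq_iff Ob.smult_l_distr Ob.smult_r_distr Ob.smult_assoc1)

sublocale FD: module R "obj FD n" for n
  by (rule module_FD)

lemma diff_terms:
  assumes "w \<in> carrier (obj FD n)"
  shows "mat (Ob n (Suc l)) l (w (Suc l)) t \<in> carrier (Ob n (Suc l))" "dD n l (w l t) \<in> carrier (Ob n (Suc l))"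
  by (rule mat_closed[OF Ob FD_D(1)[OF assms]]) (rule dD(1)[OF FD_D(1)[OF assms]])

lemma diff_FD_hom: "diff FD n \<in> mod_hom R (obj FD n) (obj FD (n + 1))"
proof (rule mod_homI)
  fix w assume w: "w \<in> carrier (obj FD n)"
  note wt = diff_terms[OF w]
  have "diff FD n w l t = \<zero>\<^bsub>Ob n (Suc l)\<^esub>" if t: "t \<notin> T l" for l t
    unfolding diff_FD mat_outside[OF Ob t FD_D(1)[OF w]] FD_D(2)[OF w t] dD(4) using sg_closed by simp
  moreover have "diff FD n w l t \<in> carrier (Ob n (Suc l))" for l t
    unfolding diff_FD using wt sg_closed by simp
  ultimately show "diff FD n w \<in> carrier (obj FD (n + 1))" by (simp add: FD_simps shift)
  show "diff FD n (r \<odot>\<^bsub>obj FD n\<^esub> w) = r \<odot>\<^bsub>obj FD (n + 1)\<^esub> diff FD n w" if r: "r \<in> carrier R" for r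
  proof (intro ext)
    fix l t
    have "diff FD n (r \<odot>\<^bsub>obj FD n\<^esub> w) l t = r \<odot>\<^bsub>Ob n (Suc l)\<^esub> diff FD n w l t"
      unfolding diff_FD FD_simps(4) mat_smult[OF Ob FD_D(1)[OF w] r] dD(3)[OF r FD_D(1)[OF w]]
      using wt r sg_closed by (simp add: Ob.smult_r_distr Ob.smult_comm[OF r sg_closed])
    then show "diff FD n (r \<odot>\<^bsub>obj FD n\<^esub> w) l t = (r \<odot>\<^bsub>obj FD (n + 1)\<^esub> diff FD n w) l t"
      unfolding FD_simps(4)[where n = "n + 1"] shift .
  qed
  fix v assume v: "v \<in> carrier (obj FD n)"
  note vt = diff_terms[OF v]
  show "diff FD n (w \<oplus>\<^bsub>obj FD n\<^esub> v) = diff FD n w \<oplus>\<^bsub>obj FD (n + 1)\<^esub> diff FD n v"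
  proof (intro ext)
    fix l t
    have "diff FD n (w \<oplus>\<^bsub>obj FD n\<^esub> v) l t = diff FD n w l t \<oplus>\<^bsub>Ob n (Suc l)\<^esub> diff FD n v l t"
      unfolding diff_FD FD_simps(3) mat_add[OF Ob FD_D(1)[OF w] FD_D(1)[OF v]] dD(2)[OF FD_D(1)[OF w] FD_D(1)[OF v]]
      using wt[of l t] vt[of l t] sg_closed by (simp add: Ob.smult_r_distr Ob.M.a_ac)
    then show "diff FD n (w \<oplus>\<^bsub>obj FD n\<^esub> v) l t = (diff FD n w \<oplus>\<^bsub>obj FD (n + 1)\<^esub> diff FD n v) l t"
      unfolding FD_simps(3)[where n = "n + 1"] shift .
  qed
qed

lemma sg_Suc: "sg (int (Suc l)) = \<ominus> sg (int l)"
  by (simp add: sg_def)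

lemma diff_diff_FD:
  assumes w: "w \<in> carrier (obj FD n)"
  shows "diff FD (n + 1) (diff FD n w) l t = \<zero>\<^bsub>Ob n (Suc (Suc l))\<^esub>"
proof -
  let ?M = "Ob n (Suc (Suc l))" and ?M1 = "Ob n (Suc l)"
  let ?c = "\<lambda>u. dD n (Suc l) (w (Suc l) u)" and ?b = "\<lambda>u. mat ?M (Suc l) (w (Suc (Suc l))) u"
  note wc = FD_D(1)[OF w]
  have b: "?b u \<in> carrier ?M" and c: "?c u \<in> carrier ?M" for u
    using diff_terms[OF w] .
  have sc: "sg (int (Suc l)) \<odot>\<^bsub>?M\<^esub> ?c u \<in> carrier ?M" for u using c sg_closed by simp
  have mc: "mat ?M l ?c t \<in> carrier ?M" by (rule mat_closed[OF Ob c])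
  have m: "mat ?M l (diff FD n w (Suc l)) t = sg (int (Suc l)) \<odot>\<^bsub>?M\<^esub> mat ?M l ?c t"
    unfolding diff_FD[abs_def] mat_add[OF Ob b sc] mat_mat[OF Ob wc] mat_smult[OF Ob c sg_closed]
    using mc sg_closed by simp
  have "dD n (Suc l) (diff FD n w l t) = mat ?M l ?c t \<oplus>\<^bsub>?M\<^esub> sg (int l) \<odot>\<^bsub>?M\<^esub> dD n (Suc l) (dD n l (w l t))"
    unfolding diff_FD using diff_terms[OF w] sg_closed dD(2,3) mat_hom[OF Ob Ob dD_hom wc] by simp
  then have 2: "dD n (Suc l) (diff FD n w l t) = mat ?M l ?c t"
    unfolding dD_dD[OF wc] using mc sg_closed by simp
  show ?thesis
    unfolding diff_FD[of "n + 1"] shift m 2 sg_Suc using mc sg_closed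
    by (simp add: Ob.smult_l_minus Ob.M.l_neg)
qed

lemma is_complex_FD: "is_complex R FD"
  unfolding is_complex_def
proof (intro allI conjI ballI)
  fix n w assume "w \<in> carrier (obj FD n)"
  moreover have "n + 2 = n + 1 + 1" by simp
  ultimately show "diff FD (n + 1) (diff FD n w) = \<zero>\<^bsub>obj FD (n + 2)\<^esub>"
    by (simp only: fun_eq_iff diff_diff_FD FD_simps(2) shift simp_thms)
qed (rule module_FD, rule diff_FD_hom)

text \<open>The two boundaries have the same contribution from component \<open>k + 1\<close>, which
  cancels; the sign is removed by multiplying with it once more.\<close>

lemma dD_minus_component:
  assumes w: "w \<in> carrier (obj FD n)" "w' \<in> carrier (obj FD n)" and eq: "\<And>u. w (Suc k) u = w' (Suc k) u"
    and 0: "diff FD n w k t = \<zero>\<^bsub>Ob n (Suc k)\<^esub>" "diff FD n w' k t = \<zero>\<^bsub>Ob n (Suc k)\<^esub>"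
  shows "dD n k (w k t \<ominus>\<^bsub>Ob n k\<^esub> w' k t) = \<zero>\<^bsub>Ob n (Suc k)\<^esub>"
proof -
  let ?M = "Ob n (Suc k)" and ?m = "mat (Ob n (Suc k)) k (w' (Suc k)) t"
  have "w (Suc k) = w' (Suc k)" using eq by (rule ext)
  then have *: "?m \<oplus>\<^bsub>?M\<^esub> sg (int k) \<odot>\<^bsub>?M\<^esub> dD n k (w k t) = ?m \<oplus>\<^bsub>?M\<^esub> sg (int k) \<odot>\<^bsub>?M\<^esub> dD n k (w' k t)"
    using 0 unfolding diff_FD by simp
  note cl = diff_terms[OF w(1), of k t] diff_terms[OF w(2), of k t]
  have "sg (int k) \<odot>\<^bsub>?M\<^esub> dD n k (w k t) = sg (int k) \<odot>\<^bsub>?M\<^esub> dD n k (w' k t)"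
    using cl sg_closed by (intro Ob.M.add.l_cancel[OF *]) simp_all
  then have "sg (int k) \<odot>\<^bsub>?M\<^esub> (sg (int k) \<odot>\<^bsub>?M\<^esub> dD n k (w k t)) = sg (int k) \<odot>\<^bsub>?M\<^esub> (sg (int k) \<odot>\<^bsub>?M\<^esub> dD n k (w' k t))" by simp
  then have "dD n k (w k t) = dD n k (w' k t)"
    using cl by (simp add: Ob.smult_assoc1[OF sg_closed sg_closed, symmetric] sg_square)
  then show ?thesis using dD(6)[OF FD_D(1)[OF w(1)] FD_D(1)[OF w(2)]] cl by (simp add: Ob.minus_self)
qed

lemma diff_diff_FD':
  assumes "w \<in> carrier (obj FD (n - 1))"
  shows "diff FD n (diff FD (n - 1) w) l t = \<zero>\<^bsub>Ob n (Suc l)\<^esub>"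
  using diff_diff_FD[OF assms, of l t] shift(1)[of "n - 1" "Suc l"] by simp

lemma shift': "Ob (n - 1) (Suc l) = Ob n l" "dD (n - 1) (Suc l) = dD n l"
  using shift[of "n - 1" l] by simp_all

lemma diff_FD_closed': "w \<in> carrier (obj FD (n - 1)) \<Longrightarrow> diff FD (n - 1) w \<in> carrier (obj FD n)"
  using mod_homD(1)[OF diff_FD_hom[of "n - 1"]] by simp

context
  fixes s :: int and p :: nat
  assumes exact: "\<And>n. n > s \<Longrightarrow> cocycles D n \<subseteq> coboundaries D n" and top: "T (Suc p) = {}"
begin

lemma exact_Ob:
  assumes "n + int l > s" "x \<in> carrier (Ob n l)" "dD n l x = \<zero>\<^bsub>Ob n (Suc l)\<^esub>"
  shows "\<exists>y\<in>carrier (Ob (n - 1) l). dD (n - 1) l y = x"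
proof -
  have "x \<in> cocycles D (n + int l)" using assms(2,3) by (simp add: cocycles_def Ob_def dD_def algebra_simps)
  then have "x \<in> diff D (n + int l - 1) ` carrier (obj D (n + int l - 1))" using exact[OF assms(1)] by (auto simp: coboundaries_def)
  then show ?thesis unfolding Ob_def dD_def by (auto simp: algebra_simps)
qed

text \<open>Descending induction on the resolution degree, starting beyond the length of \<open>F\<close>.\<close>

lemma FD_elimination:
  assumes w: "w \<in> carrier (obj FD n)" and l0: "n + int l0 > s"
    and dw: "\<And>l t. l \<ge> l0 \<Longrightarrow> diff FD n w l t = \<zero>\<^bsub>Ob n (Suc l)\<^esub>"
  shows "\<exists>v\<in>carrier (obj FD (n - 1)). \<forall>l\<ge>l0. \<forall>t. w l t = diff FD (n - 1) v l t"
proof -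
  have "l0 \<le> max l0 (Suc p)" by simp
  then show ?thesis
  proof (induction rule: inc_induct)
    case base
    have "w l t = diff FD (n - 1) \<zero>\<^bsub>obj FD (n - 1)\<^esub> l t" if l: "l \<ge> max l0 (Suc p)" for l t
    proof -
      have "T l = {}" using T_empty_mono[OF top] l by simp
      then have "w l t = \<zero>\<^bsub>Ob n l\<^esub>" using FD_D(2)[OF w, of t l] by simp
      moreover have "diff FD (n - 1) \<zero>\<^bsub>obj FD (n - 1)\<^esub> = \<zero>\<^bsub>obj FD (n - 1 + 1)\<^esub>"
        by (rule mod_hom_more(1)[OF module_FD module_FD diff_FD_hom])
      ultimately show ?thesis by (simp add: FD_simps(2))
    qed
    then show ?case using FD.M.zero_closed[of "n - 1"] by blast
  next
    case (step k)
    then obtain v where v: "v \<in> carrier (obj FD (n - 1))" "\<And>l t. l \<ge> Suc k \<Longrightarrow> w l t = diff FD (n - 1) v l t" by blast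
    let ?v = "diff FD (n - 1) v" and ?M = "Ob n k"
    note vc = diff_FD_closed'[OF v(1)]
    have "\<exists>y\<in>carrier (Ob (n - 1) k). dD (n - 1) k y = w k t \<ominus>\<^bsub>?M\<^esub> ?v k t \<and> (t \<notin> T k \<longrightarrow> y = \<zero>\<^bsub>Ob (n - 1) k\<^esub>)" for t
    proof (cases "t \<in> T k")
      case True
      have "dD n k (w k t \<ominus>\<^bsub>?M\<^esub> ?v k t) = \<zero>\<^bsub>Ob n (Suc k)\<^esub>"
        by (rule dD_minus_component[OF w vc v(2)[OF order_refl] dw[OF step(1)] diff_diff_FD'[OF v(1)]])
      moreover have "n + int k > s" using l0 step(1) by simp
      ultimately show ?thesis using exact_Ob[of n k "w k t \<ominus>\<^bsub>?M\<^esub> ?v k t"] FD_D(1)[OF w] FD_D(1)[OF vc] True by simp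
    next
      case False
      have "w k t = \<zero>\<^bsub>?M\<^esub>" "?v k t = \<zero>\<^bsub>?M\<^esub>" using FD_D(2)[OF w False] FD_D(2)[OF vc False] .
      then show ?thesis using dD(4)[of "n - 1" k] shift'(1)[of n k]
        by (intro bexI[of _ "\<zero>\<^bsub>Ob (n - 1) k\<^esub>"]) (simp_all add: Ob.minus_self)
    qed
    then obtain y where y: "\<And>t. y t \<in> carrier (Ob (n - 1) k)" "\<And>t. dD (n - 1) k (y t) = w k t \<ominus>\<^bsub>?M\<^esub> ?v k t"
      "\<And>t. t \<notin> T k \<Longrightarrow> y t = \<zero>\<^bsub>Ob (n - 1) k\<^esub>" by metis
    \<comment> \<open>A change of \<open>v\<close> in component \<open>k\<close> does not affect its
      boundary in components above \<open>k\<close>. The factor \<open>sg\<close> cancels the sign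
      in \<open>diff_FD\<close>.\<close>
    let ?v' = "v(k := \<lambda>t. v k t \<oplus>\<^bsub>Ob (n - 1) k\<^esub> sg (int k) \<odot>\<^bsub>Ob (n - 1) k\<^esub> y t)"
    have "?v' l t \<in> carrier (Ob (n - 1) l) \<and> (t \<notin> T l \<longrightarrow> ?v' l t = \<zero>\<^bsub>Ob (n - 1) l\<^esub>)" for l t
      using FD_D[OF v(1)] y(1,3) sg_closed by simp
    then have v': "?v' \<in> carrier (obj FD (n - 1))" unfolding FD_simps by blast
    have "w l t = diff FD (n - 1) ?v' l t" if l: "l \<ge> k" for l t
    proof (cases "l = k")
      case True
      have m: "mat ?M k (v (Suc k)) t \<in> carrier ?M" "dD (n - 1) k (v k t) \<in> carrier ?M"
        using diff_terms[OF v(1), of k t] unfolding shift' .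
      have wv: "w k t \<in> carrier ?M" "?v k t \<in> carrier ?M" using FD_D(1)[OF w] FD_D(1)[OF vc] .
      note dk = mod_homD[OF dD_hom[of "n - 1" k], unfolded shift']
      have "diff FD (n - 1) ?v' k t = mat ?M k (v (Suc k)) t \<oplus>\<^bsub>?M\<^esub> sg (int k) \<odot>\<^bsub>?M\<^esub>
          (dD (n - 1) k (v k t) \<oplus>\<^bsub>?M\<^esub> sg (int k) \<odot>\<^bsub>?M\<^esub> (w k t \<ominus>\<^bsub>?M\<^esub> ?v k t))"
        unfolding diff_FD[of "n - 1" ?v'] shift'
        using dk FD_D(1)[OF v(1)] y(1,2) sg_closed by simp
      also have "\<dots> = ?v k t \<oplus>\<^bsub>?M\<^esub> (w k t \<ominus>\<^bsub>?M\<^esub> ?v k t)"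
        unfolding diff_FD[of "n - 1" v] shift'
        using m wv(1) sg_closed by (simp add: Ob.smult_r_distr Ob.smult_assoc1[OF sg_closed sg_closed, symmetric] sg_square Ob.M.a_assoc)
      also have "\<dots> = w k t" using wv by algebra
      finally show ?thesis using True by simp
    next
      case False
      then have "l \<ge> Suc k" using l by simp
      have "diff FD (n - 1) ?v' l t = ?v l t" using \<open>l \<ge> Suc k\<close> by (simp add: diff_FD)
      then show ?thesis using v(2)[OF \<open>l \<ge> Suc k\<close>] by simp
    qed
    then show ?case using v' by blast
  qed
qed

lemma exact_FD:
  assumes "n > s"
  shows "cocycles FD n \<subseteq> coboundaries FD n"
proof
  fix w assume "w \<in> cocycles FD n"
  then have w: "w \<in> carrier (obj FD n)" "diff FD n w = \<zero>\<^bsub>obj FD (n + 1)\<^esub>" by (simp_all add: cocycles_def)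
  have "diff FD n w l t = \<zero>\<^bsub>Ob n (Suc l)\<^esub>" for l t unfolding w(2) FD_simps(2) shift ..
  from FD_elimination[OF w(1) _ this, of 0] obtain v where "v \<in> carrier (obj FD (n - 1))" "\<forall>l t. w l t = diff FD (n - 1) v l t"
    using assms by auto
  then show "w \<in> coboundaries FD n" unfolding coboundaries_def by (intro image_eqI[of _ _ v] ext) blast+
qed

end

end

section \<open>A submodule that detects the top cohomology of \<open>F \<otimes> D\<close>\<close>

context minimal_resolution_complex
begin

text \<open>
  If \<open>X\<close> contains \<open>mZ\<^sup>s(D) + B\<^sup>s(D)\<close> but not \<open>Z\<^sup>s(D)\<close>, then this submodule has the same property for
  \<open>F \<otimes> D\<close>, because \<open>H\<^sup>s(F \<otimes> D) \<otimes> R/m = F\<^sub>0 \<otimes> H\<^sup>s(D) \<otimes> R/m\<close>.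
\<close>

definition FD_sub :: "int \<Rightarrow> 'd set \<Rightarrow> (nat \<Rightarrow> nat \<times> 'n \<times> 'r \<Rightarrow> 'd) set"
  where "FD_sub s X = {w \<in> carrier (obj FD s). \<exists>v\<in>carrier (obj FD (s - 1)).
    (\<forall>t. w 0 t \<ominus>\<^bsub>Ob s 0\<^esub> diff FD (s - 1) v 0 t \<in> X) \<and> (\<forall>l t. l \<ge> 1 \<longrightarrow> w l t = diff FD (s - 1) v l t)}"

context
  fixes s :: int and p :: nat and X :: "'d set"
  assumes exact: "\<And>n. n > s \<Longrightarrow> cocycles D n \<subseteq> coboundaries D n" and top: "T (Suc p) = {}"
    and X: "submodule X R (Ob s 0)" and bound: "coboundaries D s \<subseteq> X"
    and max: "\<And>a v. a \<in> max_ideal R \<Longrightarrow> v \<in> cocycles D s \<Longrightarrow> a \<odot>\<^bsub>Ob s 0\<^esub> v \<in> X"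
begin

lemma elimination:
  assumes "w \<in> carrier (obj FD n)" "n + int l0 > s" "\<And>l t. l \<ge> l0 \<Longrightarrow> diff FD n w l t = \<zero>\<^bsub>Ob n (Suc l)\<^esub>"
  shows "\<exists>v\<in>carrier (obj FD (n - 1)). \<forall>l\<ge>l0. \<forall>t. w l t = diff FD (n - 1) v l t"
proof (rule FD_elimination)
  show "cocycles D n \<subseteq> coboundaries D n" if "n > s" for n by (rule exact[OF that])
qed (rule top assms | assumption)+

lemma dD_in_sub: "y \<in> carrier (Ob (s - 1) 0) \<Longrightarrow> dD (s - 1) 0 y \<in> X"
  using bound by (auto simp: coboundaries_def Ob_def dD_def)

lemma cocycleI: "v \<in> carrier (Ob s 0) \<Longrightarrow> dD s 0 v = \<zero>\<^bsub>Ob s (Suc 0)\<^esub> \<Longrightarrow> v \<in> cocycles D s"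
  by (simp add: cocycles_def Ob_def dD_def)

lemma submodule_FD_sub: "submodule (FD_sub s X) R (obj FD s)"
proof (rule FD.submod_intro)
  note h = mod_homD[OF diff_FD_hom[of "s - 1"], simplified] mod_hom_more[OF module_FD module_FD diff_FD_hom[of "s - 1"], simplified]
  note XD = Ob.submodD[OF X]
  note cl = FD_D(1)[OF diff_FD_closed']
  show "FD_sub s X \<subseteq> carrier (obj FD s)" by (auto simp: FD_sub_def)
  have "diff FD (s - 1) \<zero>\<^bsub>obj FD (s - 1)\<^esub> l t = \<zero>\<^bsub>Ob s l\<^esub>" for l t by (subst h(4)) (simp only: FD_simps)
  then show "\<zero>\<^bsub>obj FD s\<^esub> \<in> FD_sub s X"
    unfolding FD_sub_def using XD(2)
    by (intro CollectI conjI FD.M.zero_closed bexI[of _ "\<zero>\<^bsub>obj FD (s - 1)\<^esub>"]) (simp_all add: FD_simps(2) Ob.minus_self)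
  fix w assume "w \<in> FD_sub s X"
  then obtain v where w: "w \<in> carrier (obj FD s)" and v: "v \<in> carrier (obj FD (s - 1))"
    "\<And>t. w 0 t \<ominus>\<^bsub>Ob s 0\<^esub> diff FD (s - 1) v 0 t \<in> X" "\<And>l t. l \<ge> 1 \<Longrightarrow> w l t = diff FD (s - 1) v l t"
    unfolding FD_sub_def by blast
  show "r \<odot>\<^bsub>obj FD s\<^esub> w \<in> FD_sub s X" if r: "r \<in> carrier R" for r
    unfolding FD_sub_def
  proof (intro CollectI conjI bexI allI impI)
    show "r \<odot>\<^bsub>obj FD s\<^esub> w \<in> carrier (obj FD s)" using r w by simp
    show "r \<odot>\<^bsub>obj FD (s - 1)\<^esub> v \<in> carrier (obj FD (s - 1))" using r v by simp
    have *: "diff FD (s - 1) (r \<odot>\<^bsub>obj FD (s - 1)\<^esub> v) l t = r \<odot>\<^bsub>Ob s l\<^esub> diff FD (s - 1) v l t" for l t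
      unfolding h(3)[OF r v(1)] by (simp add: FD_simps(4))
    have "(r \<odot>\<^bsub>obj FD s\<^esub> w) 0 t \<ominus>\<^bsub>Ob s 0\<^esub> r \<odot>\<^bsub>Ob s 0\<^esub> diff FD (s - 1) v 0 t = r \<odot>\<^bsub>Ob s 0\<^esub> (w 0 t \<ominus>\<^bsub>Ob s 0\<^esub> diff FD (s - 1) v 0 t)" for t
      using r FD_D(1)[OF w, of 0 t] cl[OF v(1), of 0 t] unfolding FD_simps(4) by algebra
    then show "(r \<odot>\<^bsub>obj FD s\<^esub> w) 0 t \<ominus>\<^bsub>Ob s 0\<^esub> diff FD (s - 1) (r \<odot>\<^bsub>obj FD (s - 1)\<^esub> v) 0 t \<in> X" for t
      unfolding * using XD(4)[OF r v(2)[of t]] by simp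
    show "(r \<odot>\<^bsub>obj FD s\<^esub> w) l t = diff FD (s - 1) (r \<odot>\<^bsub>obj FD (s - 1)\<^esub> v) l t" if "l \<ge> 1" for l t
      unfolding * FD_simps(4)[where n = s] v(3)[OF that] ..
  qed
  fix w' assume "w' \<in> FD_sub s X"
  then obtain v' where w': "w' \<in> carrier (obj FD s)" and v': "v' \<in> carrier (obj FD (s - 1))"
    "\<And>t. w' 0 t \<ominus>\<^bsub>Ob s 0\<^esub> diff FD (s - 1) v' 0 t \<in> X" "\<And>l t. l \<ge> 1 \<Longrightarrow> w' l t = diff FD (s - 1) v' l t"
    unfolding FD_sub_def by blast
  show "w \<oplus>\<^bsub>obj FD s\<^esub> w' \<in> FD_sub s X"
    unfolding FD_sub_def
  proof (intro CollectI conjI bexI allI impI)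
    show "w \<oplus>\<^bsub>obj FD s\<^esub> w' \<in> carrier (obj FD s)" using w w' by simp
    show "v \<oplus>\<^bsub>obj FD (s - 1)\<^esub> v' \<in> carrier (obj FD (s - 1))" using v v' by simp
    have *: "diff FD (s - 1) (v \<oplus>\<^bsub>obj FD (s - 1)\<^esub> v') l t = diff FD (s - 1) v l t \<oplus>\<^bsub>Ob s l\<^esub> diff FD (s - 1) v' l t" for l t
      unfolding h(2)[OF v(1) v'(1)] by (simp add: FD_simps(3))
    have "(w \<oplus>\<^bsub>obj FD s\<^esub> w') 0 t \<ominus>\<^bsub>Ob s 0\<^esub> (diff FD (s - 1) v 0 t \<oplus>\<^bsub>Ob s 0\<^esub> diff FD (s - 1) v' 0 t)
      = (w 0 t \<ominus>\<^bsub>Ob s 0\<^esub> diff FD (s - 1) v 0 t) \<oplus>\<^bsub>Ob s 0\<^esub> (w' 0 t \<ominus>\<^bsub>Ob s 0\<^esub> diff FD (s - 1) v' 0 t)" for t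
      using FD_D(1)[OF w, of 0 t] cl[OF v(1), of 0 t] FD_D(1)[OF w', of 0 t] cl[OF v'(1), of 0 t]
      unfolding FD_simps(3) by algebra
    then show "(w \<oplus>\<^bsub>obj FD s\<^esub> w') 0 t \<ominus>\<^bsub>Ob s 0\<^esub> diff FD (s - 1) (v \<oplus>\<^bsub>obj FD (s - 1)\<^esub> v') 0 t \<in> X" for t
      unfolding * using XD(3)[OF v(2)[of t] v'(2)[of t]] by simp
    show "(w \<oplus>\<^bsub>obj FD s\<^esub> w') l t = diff FD (s - 1) (v \<oplus>\<^bsub>obj FD (s - 1)\<^esub> v') l t" if "l \<ge> 1" for l t
      unfolding * FD_simps(3)[where n = s] v(3)[OF that] v'(3)[OF that] ..
  qed
qed

lemma coboundaries_FD_sub: "coboundaries FD s \<subseteq> FD_sub s X"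
proof
  fix w assume "w \<in> coboundaries FD s"
  then obtain v where v: "w = diff FD (s - 1) v" "v \<in> carrier (obj FD (s - 1))" unfolding coboundaries_def by blast
  note cl = FD_D(1)[OF diff_FD_closed'[OF v(2)]]
  show "w \<in> FD_sub s X"
    unfolding FD_sub_def v(1) using v(2) diff_FD_closed'[OF v(2)] Ob.submodD(2)[OF X]
    by (intro CollectI conjI bexI[of _ v]) (simp_all add: Ob.minus_self cl)
qed

text \<open>By \<open>elimination\<close> the cocycle agrees with some boundary in all components
  \<open>l \<ge> 1\<close>. The difference in component \<open>0\<close> is then a cocycle of
  \<open>D\<close>, and \<open>a\<close> times it lies in \<open>X\<close>.\<close>

lemma max_ideal_FD_sub:
  assumes a: "a \<in> max_ideal R" and w: "w \<in> cocycles FD s"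
  shows "a \<odot>\<^bsub>obj FD s\<^esub> w \<in> FD_sub s X"
proof -
  have aR: "a \<in> carrier R" using a idealD(1)[OF ideal_max_ideal] by blast
  have wc: "w \<in> carrier (obj FD s)" and "diff FD s w = \<zero>\<^bsub>obj FD (s + 1)\<^esub>" using w by (simp_all add: cocycles_def)
  then have dw: "diff FD s w l t = \<zero>\<^bsub>Ob s (Suc l)\<^esub>" for l t by (simp add: FD_simps(2) shift)
  have "\<exists>v\<in>carrier (obj FD (s - 1)). \<forall>l\<ge>1. \<forall>t. w l t = diff FD (s - 1) v l t"
    by (rule elimination[OF wc _ dw]) simp_all
  then obtain v where v: "v \<in> carrier (obj FD (s - 1))" "\<forall>l\<ge>1. \<forall>t. w l t = diff FD (s - 1) v l t" by blast
  let ?v = "diff FD (s - 1) v"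
  note vc = diff_FD_closed'[OF v(1)]
  have v0: "w (Suc 0) t = ?v (Suc 0) t" for t by (rule v(2)[rule_format]) simp
  show ?thesis
    unfolding FD_sub_def
  proof (intro CollectI conjI bexI allI impI)
    show "a \<odot>\<^bsub>obj FD s\<^esub> w \<in> carrier (obj FD s)" using aR wc by simp
    show "a \<odot>\<^bsub>obj FD (s - 1)\<^esub> v \<in> carrier (obj FD (s - 1))" using aR v by simp
    have *: "diff FD (s - 1) (a \<odot>\<^bsub>obj FD (s - 1)\<^esub> v) l t = a \<odot>\<^bsub>Ob s l\<^esub> ?v l t" for l t
      unfolding mod_homD(3)[OF diff_FD_hom aR v(1)] by (simp add: FD_simps(4))
    show "(a \<odot>\<^bsub>obj FD s\<^esub> w) l t = diff FD (s - 1) (a \<odot>\<^bsub>obj FD (s - 1)\<^esub> v) l t" if "l \<ge> 1" for l t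
      unfolding * FD_simps(4)[where n = s] v(2)[rule_format, OF that] ..
    fix t
    have "w 0 t \<ominus>\<^bsub>Ob s 0\<^esub> ?v 0 t \<in> cocycles D s"
      by (rule cocycleI[OF Ob.M.minus_closed[OF FD_D(1)[OF wc] FD_D(1)[OF vc]]])
        (rule dD_minus_component[OF wc vc v0 dw diff_diff_FD'[OF v(1)]])
    moreover have "(a \<odot>\<^bsub>obj FD s\<^esub> w) 0 t \<ominus>\<^bsub>Ob s 0\<^esub> a \<odot>\<^bsub>Ob s 0\<^esub> ?v 0 t = a \<odot>\<^bsub>Ob s 0\<^esub> (w 0 t \<ominus>\<^bsub>Ob s 0\<^esub> ?v 0 t)"
      using aR FD_D(1)[OF wc, of 0 t] FD_D(1)[OF vc, of 0 t] unfolding FD_simps(4) by algebra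
    ultimately show "(a \<odot>\<^bsub>obj FD s\<^esub> w) 0 t \<ominus>\<^bsub>Ob s 0\<^esub> diff FD (s - 1) (a \<odot>\<^bsub>obj FD (s - 1)\<^esub> v) 0 t \<in> X"
      unfolding * using max[OF a] by simp
  qed
qed

text \<open>The entries of \<open>d\<close> lie in \<open>m\<close>, so the part of the boundary coming from \<open>F\<^sub>1 \<otimes> D\<close> is harmless.\<close>

lemma FD_sub_component:
  assumes w: "w \<in> FD_sub s X" and zero: "\<And>l t. l \<ge> 1 \<Longrightarrow> w l t = \<zero>\<^bsub>Ob s l\<^esub>"
  shows "w 0 t \<in> X"
proof -
  note XD = Ob.submodD[OF X]
  obtain v where wc: "w \<in> carrier (obj FD s)" and v: "v \<in> carrier (obj FD (s - 1))"
    "\<And>t. w 0 t \<ominus>\<^bsub>Ob s 0\<^esub> diff FD (s - 1) v 0 t \<in> X" "\<And>l t. l \<ge> 1 \<Longrightarrow> w l t = diff FD (s - 1) v l t"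
    using w unfolding FD_sub_def by blast
  have dv: "diff FD (s - 1) v l t = \<zero>\<^bsub>Ob (s - 1) (Suc l)\<^esub>" if "l \<ge> 1" for l t
    using v(3)[OF that, of t] zero[OF that, of t] by (simp add: shift')
  \<comment> \<open>In total degree \<open>s - 1\<close> the components \<open>l \<ge> 2\<close>
    involve \<open>D\<close> in degrees above \<open>s\<close>, and the boundary of \<open>v\<close>
    vanishes there; so \<open>v\<close> agrees with a boundary in these components.\<close>
  have "\<exists>y\<in>carrier (obj FD (s - 1 - 1)). \<forall>l\<ge>2. \<forall>t. v l t = diff FD (s - 1 - 1) y l t"
    by (rule elimination[OF v(1)]) (use dv in auto)
  then obtain y where y: "y \<in> carrier (obj FD (s - 1 - 1))" "\<And>l t. l \<ge> 2 \<Longrightarrow> v l t = diff FD (s - 1 - 1) y l t" by blast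
  let ?y = "diff FD (s - 1 - 1) y" and ?M = "Ob s 0"
  note yc = diff_FD_closed'[OF y(1)] and ddy = diff_diff_FD'[OF y(1)]
  note vcl = FD_D(1)[OF v(1)] and ycl = FD_D(1)[OF yc]
  have v1: "v 1 u \<in> carrier ?M" and y1: "?y 1 u \<in> carrier ?M" for u
    using vcl[of 1 u] ycl[of 1 u] shift'(1)[of s 0] by simp_all
  let ?x = "\<lambda>u. v 1 u \<ominus>\<^bsub>?M\<^esub> ?y 1 u"
  have x: "?x u \<in> carrier ?M" for u using v1 y1 by simp
  have "?x u \<in> cocycles D s" for u
  proof (rule cocycleI[OF x])
    have "dD (s - 1) 1 (v 1 u \<ominus>\<^bsub>Ob (s - 1) 1\<^esub> ?y 1 u) = \<zero>\<^bsub>Ob (s - 1) (Suc 1)\<^esub>"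
      by (rule dD_minus_component[OF v(1) yc _ dv ddy]) (use y(2) in auto)
    then show "dD s 0 (?x u) = \<zero>\<^bsub>Ob s (Suc 0)\<^esub>" using shift'[of s 0] shift'[of s "Suc 0"] by simp
  qed
  then have mx: "mat ?M 0 ?x t \<in> X" by (intro mat_in_submodule[OF Ob X] max)
  have y0: "?y 0 t \<in> carrier (Ob (s - 1) 0)" "v 0 t \<in> carrier (Ob (s - 1) 0)" by (rule ycl vcl)+
  have v1x: "v 1 = (\<lambda>u. ?x u \<oplus>\<^bsub>?M\<^esub> ?y 1 u)"
  proof
    show "v 1 u = ?x u \<oplus>\<^bsub>?M\<^esub> ?y 1 u" for u using v1[of u] y1[of u] by algebra
  qed
  have m: "mat ?M 0 (v 1) t = mat ?M 0 ?x t \<oplus>\<^bsub>?M\<^esub> mat ?M 0 (?y 1) t"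
    by (rule trans[OF arg_cong[OF v1x, of "\<lambda>x. mat ?M 0 x t"] mat_add[OF Ob x y1]])
  have mc: "mat ?M 0 ?x t \<in> carrier ?M" "mat ?M 0 (?y 1) t \<in> carrier ?M" by (rule mat_closed[OF Ob x] mat_closed[OF Ob y1])+
  have sg0: "sg (int 0) = \<one>" by (simp add: sg_def)
  have dy: "dD (s - 1) 0 (?y 0 t) \<in> X" and dv0: "dD (s - 1) 0 (v 0 t) \<in> X" by (rule dD_in_sub[OF y0(1)] dD_in_sub[OF y0(2)])+
  have dyc: "dD (s - 1) 0 (?y 0 t) \<in> carrier ?M" "dD (s - 1) 0 (v 0 t) \<in> carrier ?M" using dy dv0 XD(1) by blast+
  have s1: "Ob (s - 1) (Suc 0) = ?M" using shift'(1)[of s 0] .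
  \<comment> \<open>This is component \<open>0\<close> of \<open>d (d y) = 0\<close>: the part of
    the boundary of \<open>v\<close> that comes from \<open>?y 1\<close> is minus a coboundary of
    \<open>D\<close>, hence in \<open>X\<close>.\<close>
  have "mat ?M 0 (?y 1) t \<oplus>\<^bsub>?M\<^esub> dD (s - 1) 0 (?y 0 t) = \<zero>\<^bsub>?M\<^esub>"
    using ddy[of 0 t] dyc unfolding diff_FD[of "s - 1" ?y] sg0 s1 by simp
  then have "mat ?M 0 (?y 1) t = \<ominus>\<^bsub>?M\<^esub> dD (s - 1) 0 (?y 0 t)" by (rule Ob.M.minus_equality[OF _ dyc(1) mc(2), symmetric])
  then have "mat ?M 0 (?y 1) t \<in> X" using XD(5)[OF dy] by simp
  then have "mat ?M 0 (v 1) t \<oplus>\<^bsub>?M\<^esub> dD (s - 1) 0 (v 0 t) \<in> X" unfolding m using XD(3) mx dv0 by blast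
  then have "diff FD (s - 1) v 0 t \<in> X"
    unfolding diff_FD sg0 s1 using dyc by simp
  then show ?thesis using Ob.submod_coset[OF X v(2)[of t]] FD_D(1)[OF wc] by blast
qed

end

section \<open>The chain map from \<open>P \<otimes> D\<close> to
  \<open>F \<otimes> D\<close>\<close>

context
  fixes P :: "('r, ('r, 'n) res_elem) cochain" and \<psi> \<phi>
  assumes cpx: "is_complex R P" and r: "retract P \<psi> \<phi>"
begin

interpretation P: tensor_complex R P D
  by (intro tensor_complex.intro is_cring tensor_complex_axioms.intro cpx D)

text \<open>The coordinate at \<open>t\<close> of \<open>\<phi> \<otimes> D\<close> on
  \<open>P_l \<otimes> D^{n+l}\<close>.\<close>

definition bl :: "int \<Rightarrow> nat \<Rightarrow> nat \<times> 'n \<times> 'r \<Rightarrow> (('r, 'n) res_elem \<times> 'd \<Rightarrow> 'r) set \<Rightarrow> 'd"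
  where "bl n l t = tensor_lift R (Ob n l) (\<lambda>a x. \<phi> l a t \<odot>\<^bsub>Ob n l\<^esub> x)"

lemma phi_closed: "a \<in> carrier (obj P (- int l)) \<Longrightarrow> \<phi> l a t \<in> carrier R"
  by (rule free_modD(1)[OF mod_homD(1)[OF retractD(2)[OF r]]])

lemma Ob_eq: "obj D (n + int l) = Ob n l"
  by (simp add: Ob_def)

lemma bl_bilinear: "bilinear_map R (obj P (- int l)) (obj D (n + int l)) (Ob n l) (\<lambda>a x. \<phi> l a t \<odot>\<^bsub>Ob n l\<^esub> x)"
  unfolding bilinear_map_def Ob_eq
proof (intro conjI ballI)
  note ph = mod_homD[OF retractD(2)[OF r]]
  fix x assume x: "x \<in> carrier (Ob n l)"
  show "(\<lambda>a. \<phi> l a t \<odot>\<^bsub>Ob n l\<^esub> x) \<in> mod_hom R (obj P (- int l)) (Ob n l)"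
  proof (rule mod_homI, goal_cases)
    case (1 a)
    then show ?case using phi_closed x by simp
  next
    case (2 a b)
    show ?case unfolding ph(2)[OF 2] by (subst free_mod_simps(3)) (rule Ob.smult_l_distr[OF phi_closed[OF 2(1)] phi_closed[OF 2(2)] x])
  next
    case (3 c a)
    show ?case unfolding ph(3)[OF 3] by (subst free_mod_simps(4)) (rule Ob.smult_assoc1[OF 3(1) phi_closed[OF 3(2)] x])
  qed
next
  fix a assume a: "a \<in> carrier (obj P (- int l))"
  show "(\<lambda>x. \<phi> l a t \<odot>\<^bsub>Ob n l\<^esub> x) \<in> mod_hom R (Ob n l) (Ob n l)"
    by (rule mod_homI) (use phi_closed[OF a] in \<open>simp_all add: Ob.smult_r_distr Ob.smult_comm[of "\<phi> l a t"]\<close>)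
qed

lemma bl_hom: "bl n l t \<in> mod_hom R (P.Tm (- int l) (n + int l)) (Ob n l)"
  unfolding bl_def by (rule P.P.tensor_lift(1)[OF Ob bl_bilinear])

lemma bl_tens: "a \<in> carrier (obj P (- int l)) \<Longrightarrow> x \<in> carrier (Ob n l) \<Longrightarrow>
    bl n l t (elem_tensor R (obj P (- int l)) (obj D (n + int l)) a x) = \<phi> l a t \<odot>\<^bsub>Ob n l\<^esub> x"
  unfolding bl_def by (rule P.P.tensor_lift(2)[OF Ob bl_bilinear]) (simp_all add: Ob_eq)

lemma zero_hom: "module R M \<Longrightarrow> module R M' \<Longrightarrow> (\<lambda>_. \<zero>\<^bsub>M'\<^esub>) \<in> mod_hom R M M'"
proof (rule mod_homI)
  assume "module R M'"
  then interpret M': module R M' .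
  show "\<zero>\<^bsub>M'\<^esub> \<in> carrier M'" "\<zero>\<^bsub>M'\<^esub> = \<zero>\<^bsub>M'\<^esub> \<oplus>\<^bsub>M'\<^esub> \<zero>\<^bsub>M'\<^esub>" by simp_all
  show "\<zero>\<^bsub>M'\<^esub> = c \<odot>\<^bsub>M'\<^esub> \<zero>\<^bsub>M'\<^esub>" if "c \<in> carrier R" for c using that by simp
qed

lemma bl_outside:
  assumes t: "t \<notin> T l" and z: "z \<in> carrier (P.Tm (- int l) (n + int l))"
  shows "bl n l t z = \<zero>\<^bsub>Ob n l\<^esub>"
proof (rule P.P.tensor_hom_eq[OF Ob bl_hom zero_hom[OF P.P.Tn Ob] _ z])
  fix a x assume a: "a \<in> carrier (obj P (- int l))" and x: "x \<in> carrier (obj D (n + int l))"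
  have "\<phi> l a t = \<zero>" by (rule free_modD(2)[OF mod_homD(1)[OF retractD(2)[OF r] a] t])
  then show "bl n l t (elem_tensor R (obj P (- int l)) (obj D (n + int l)) a x) = \<zero>\<^bsub>Ob n l\<^esub>"
    using bl_tens[OF a] x by (simp add: Ob_eq)
qed

text \<open>On elementary tensors this is \<open>d \<phi> = \<phi> d\<close>, read in coordinates by
  \<open>mat_elem\<close>.\<close>

lemma bl_dX:
  assumes z: "z \<in> carrier (P.Tm (- int (Suc l)) (n + int (Suc l)))"
  shows "bl (n + 1) l t (P.dX (- int l) (n + 1 + int l) z) = mat (Ob n (Suc l)) l (\<lambda>u. bl n (Suc l) u z) t"
proof -
  let ?N = "Ob n (Suc l)"
  have ix: "- int (Suc l) = - int l - 1" "n + int (Suc l) = n + 1 + int l" by simp_all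
  show ?thesis
  proof (rule P.P.tensor_hom_eq[OF Ob _ _ _ z])
    show "(\<lambda>z. bl (n + 1) l t (P.dX (- int l) (n + 1 + int l) z)) \<in> mod_hom R (P.Tm (- int (Suc l)) (n + int (Suc l))) ?N"
      using mod_hom_compose[OF P.dX_hom[of "- int l" "n + 1 + int l"] bl_hom[of "n + 1" l t]] unfolding ix shift by simp
    show "(\<lambda>z. mat ?N l (\<lambda>u. bl n (Suc l) u z) t) \<in> mod_hom R (P.Tm (- int (Suc l)) (n + int (Suc l))) ?N"
    proof (rule mod_homI, goal_cases)
      case (1 z)
      show ?case by (rule mat_closed[OF Ob mod_homD(1)[OF bl_hom 1]])
    next
      case (2 z z')
      show ?case unfolding mod_homD(2)[OF bl_hom 2] by (rule mat_add[OF Ob mod_homD(1)[OF bl_hom 2(1)] mod_homD(1)[OF bl_hom 2(2)]])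
    next
      case (3 c z)
      show ?case unfolding mod_homD(3)[OF bl_hom 3] by (rule mat_smult[OF Ob mod_homD(1)[OF bl_hom 3(2)] 3(1)])
    qed
    fix a x assume a: "a \<in> carrier (obj P (- int (Suc l)))" and x: "x \<in> carrier (obj D (n + int (Suc l)))"
    let ?e = "elem_tensor R (obj P (- int (Suc l))) (obj D (n + int (Suc l))) a x"
    have da: "diff P (- int (Suc l)) a \<in> carrier (obj P (- int l))"
      using mod_homD(1)[OF is_complexD(2)[OF cpx] a] by simp
    have xO: "x \<in> carrier ?N" using x by (simp only: Ob_eq)
    have "bl (n + 1) l t (P.dX (- int l) (n + 1 + int l) ?e)
        = bl (n + 1) l t (elem_tensor R (obj P (- int l)) (obj D (n + 1 + int l)) (diff P (- int (Suc l)) a) x)"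
      using P.dX_tens[of a "- int l" x "n + 1 + int l"] a x unfolding ix by simp
    also have "\<dots> = \<phi> l (diff P (- int (Suc l)) a) t \<odot>\<^bsub>?N\<^esub> x"
      using bl_tens[OF da, of x "n + 1" t] xO unfolding shift by simp
    also have "\<dots> = mat ?N l (\<lambda>u. \<phi> (Suc l) a u \<odot>\<^bsub>?N\<^esub> x) t"
      unfolding mat_elem[OF Ob mod_homD(1)[OF retractD(2)[OF r] a] xO] retractD(4)[OF r a] ..
    also have "\<dots> = mat ?N l (\<lambda>u. bl n (Suc l) u ?e) t" by (simp only: bl_tens[OF a xO])
    finally show "bl (n + 1) l t (P.dX (- int l) (n + 1 + int l) ?e) = mat ?N l (\<lambda>u. bl n (Suc l) u ?e) t" .
  qed
qed

lemma bl_dY: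
  assumes z: "z \<in> carrier (P.Tm (- int l) (n + int l))"
  shows "bl (n + 1) l t (P.dY (- int l) (n + 1 + int l) z) = dD n l (bl n l t z)"
proof -
  let ?N = "Ob n (Suc l)"
  have ix: "n + int l = n + 1 + int l - 1" by simp
  show ?thesis
  proof (rule P.P.tensor_hom_eq[OF Ob _ _ _ z])
    show "(\<lambda>z. bl (n + 1) l t (P.dY (- int l) (n + 1 + int l) z)) \<in> mod_hom R (P.Tm (- int l) (n + int l)) ?N"
      using mod_hom_compose[OF P.dY_hom[of "- int l" "n + 1 + int l"] bl_hom[of "n + 1" l t]] unfolding ix shift by simp
    show "(\<lambda>z. dD n l (bl n l t z)) \<in> mod_hom R (P.Tm (- int l) (n + int l)) ?N"
      by (rule mod_hom_compose[OF bl_hom dD_hom])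
    fix a x assume a: "a \<in> carrier (obj P (- int l))" and x: "x \<in> carrier (obj D (n + int l))"
    let ?e = "elem_tensor R (obj P (- int l)) (obj D (n + int l)) a x"
    have xO: "x \<in> carrier (Ob n l)" using x by (simp only: Ob_eq)
    have dx: "dD n l x \<in> carrier (Ob (n + 1) l)" unfolding shift by (rule dD(1)[OF xO])
    have "P.dY (- int l) (n + 1 + int l) ?e = elem_tensor R (obj P (- int l)) (obj D (n + 1 + int l)) a (dD n l x)"
      using P.dY_tens[OF a, of x "n + 1 + int l"] x unfolding dD_def by simp
    then have "bl (n + 1) l t (P.dY (- int l) (n + 1 + int l) ?e) = \<phi> l a t \<odot>\<^bsub>?N\<^esub> dD n l x"
      using bl_tens[OF a dx, of t] unfolding shift by simp
    also have "\<dots> = dD n l (bl n l t ?e)" unfolding bl_tens[OF a xO] by (rule dD(3)[OF phi_closed[OF a] xO, symmetric])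
    finally show "bl (n + 1) l t (P.dY (- int l) (n + 1 + int l) ?e) = dD n l (bl n l t ?e)" .
  qed
qed

text \<open>\<open>tmap\<close> is \<open>\<phi> \<otimes> D\<close>.\<close>

definition tmap :: "int \<Rightarrow> (int \<Rightarrow> (('r, 'n) res_elem \<times> 'd \<Rightarrow> 'r) set) \<Rightarrow> nat \<Rightarrow> nat \<times> 'n \<times> 'r \<Rightarrow> 'd"
  where "tmap n z l t = bl n l t (z (- int l))"

lemma C_comp': "z \<in> carrier (obj P.C n) \<Longrightarrow> z (- int l) \<in> carrier (P.Tm (- int l) (n + int l))"
  using P.C_comp[of z n "- int l"] by simp

lemma tmap_hom: "tmap n \<in> mod_hom R (obj P.C n) (obj FD n)"
proof (rule mod_homI)
  fix z assume z: "z \<in> carrier (obj P.C n)"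
  have "tmap n z l t \<in> carrier (Ob n l) \<and> (t \<notin> T l \<longrightarrow> tmap n z l t = \<zero>\<^bsub>Ob n l\<^esub>)" for l t
    unfolding tmap_def using mod_homD(1)[OF bl_hom C_comp'[OF z]] bl_outside[OF _ C_comp'[OF z]] by blast
  then show "tmap n z \<in> carrier (obj FD n)" unfolding FD_simps by blast
  have "(c \<odot>\<^bsub>obj P.C n\<^esub> z) (- int l) = c \<odot>\<^bsub>P.Tm (- int l) (n + int l)\<^esub> z (- int l)" for c l
    by (simp add: tensor_cpx_simps)
  then show "tmap n (c \<odot>\<^bsub>obj P.C n\<^esub> z) = c \<odot>\<^bsub>obj FD n\<^esub> tmap n z" if c: "c \<in> carrier R" for c
    by (simp only: fun_eq_iff FD_simps tmap_def mod_homD(3)[OF bl_hom c C_comp'[OF z]] simp_thms)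
  fix w assume w: "w \<in> carrier (obj P.C n)"
  have "(z \<oplus>\<^bsub>obj P.C n\<^esub> w) (- int l) = z (- int l) \<oplus>\<^bsub>P.Tm (- int l) (n + int l)\<^esub> w (- int l)" for l
    by (simp add: tensor_cpx_simps)
  then show "tmap n (z \<oplus>\<^bsub>obj P.C n\<^esub> w) = tmap n z \<oplus>\<^bsub>obj FD n\<^esub> tmap n w"
    by (simp only: fun_eq_iff FD_simps tmap_def mod_homD(2)[OF bl_hom C_comp'[OF z] C_comp'[OF w]] simp_thms)
qed

lemma tmap_diff:
  assumes z: "z \<in> carrier (obj P.C n)"
  shows "tmap (n + 1) (diff P.C n z) = diff FD n (tmap n z)"
proof (intro ext)
  fix l t
  let ?T = "P.Tm (- int l) (n + 1 + int l)"
  have ix: "n + 1 - - int l = n + 1 + int l" "- int l - 1 = - int (Suc l)" by simp_all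
  have ix': "- int (Suc l) = - int l - 1" "n + int (Suc l) = n + 1 + int l" by simp_all
  have sg: "sg (- int l) = sg (int l)" by (simp add: sg_def)
  have z1: "z (- int (Suc l)) \<in> carrier (P.Tm (- int l - 1) (n + 1 + int l))"
    using C_comp'[OF z, of "Suc l"] unfolding ix' .
  have z0: "z (- int l) \<in> carrier (P.Tm (- int l) (n + 1 + int l - 1))" using C_comp'[OF z, of l] by simp
  note X = mod_homD(1)[OF P.dX_hom z1] and Y = mod_homD(1)[OF P.dY_hom z0]
  have "tmap (n + 1) (diff P.C n z) l t = bl (n + 1) l t (P.dX (- int l) (n + 1 + int l) (z (- int (Suc l)))
      \<oplus>\<^bsub>?T\<^esub> sg (int l) \<odot>\<^bsub>?T\<^esub> P.dY (- int l) (n + 1 + int l) (z (- int l)))"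
    unfolding tmap_def P.diff_C[OF z] ix sg ..
  also have "\<dots> = bl (n + 1) l t (P.dX (- int l) (n + 1 + int l) (z (- int (Suc l))))
      \<oplus>\<^bsub>Ob (n + 1) l\<^esub> sg (int l) \<odot>\<^bsub>Ob (n + 1) l\<^esub> bl (n + 1) l t (P.dY (- int l) (n + 1 + int l) (z (- int l)))"
    using mod_homD(2,3)[OF bl_hom[of "n + 1" l t]] X Y sg_closed by simp
  also have "\<dots> = diff FD n (tmap n z) l t"
    unfolding diff_FD tmap_def shift bl_dX[OF C_comp'[OF z]] bl_dY[OF C_comp'[OF z]] ..
  finally show "tmap (n + 1) (diff P.C n z) l t = diff FD n (tmap n z) l t" .
qed

lemma tmap_single:
  assumes a: "a \<in> carrier (obj P 0)" and y: "y \<in> carrier (obj D n)"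
  shows "tmap n (P.single n a y) 0 t = \<phi> 0 a t \<odot>\<^bsub>Ob n 0\<^esub> y" "l \<ge> 1 \<Longrightarrow> tmap n (P.single n a y) l t = \<zero>\<^bsub>Ob n l\<^esub>"
proof -
  show "tmap n (P.single n a y) 0 t = \<phi> 0 a t \<odot>\<^bsub>Ob n 0\<^esub> y"
    using bl_tens[of a 0 y n t] a y by (simp add: tmap_def P.single_def Ob_def)
  assume "l \<ge> 1"
  then have "P.single n a y (- int l) = \<zero>\<^bsub>P.Tm (- int l) (n + int l)\<^esub>" by (simp add: P.single_def)
  then show "tmap n (P.single n a y) l t = \<zero>\<^bsub>Ob n l\<^esub>"
    unfolding tmap_def by (simp only: mod_hom_more(1)[OF P.P.Tn Ob bl_hom])
qed

end

end

section \<open>The corner of \<open>RHom(N, F \<otimes> D)\<close> and the conclusion\<close>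

context minimal_resolution_complex
begin

text \<open>\<open>corner\<close> is applied with \<open>\<beta> = \<phi> \<otimes> D\<close> to the
  cocycle \<open>\<psi>(e) \<otimes> y\<close>, where \<open>e\<close> is a basis vector of
  \<open>F_0\<close>. The image in \<open>F \<otimes> D\<close> is concentrated in component
  \<open>0\<close>, and its coordinate at that basis vector is a unit times
  \<open>y\<close>.\<close>

lemma tensor_corner:
  fixes P :: "('r, ('r, 'n) res_elem) cochain"
  assumes P: "proj_resolution R N P" and p: "T p \<noteq> {}" "T (Suc p) = {}"
    and exact: "\<And>n. n > s \<Longrightarrow> cocycles D n \<subseteq> coboundaries D n"
    and zero: "is_zero_mod (cohomology (hom_cpx R P (tensor_cpx R P D)) (s + int p))"
    and X: "submodule X R (obj D s)" "coboundaries D s \<subseteq> X"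
      "\<And>a v. a \<in> max_ideal R \<Longrightarrow> v \<in> cocycles D s \<Longrightarrow> a \<odot>\<^bsub>obj D s\<^esub> v \<in> X"
  shows "cocycles D s \<subseteq> X"
proof
  fix y assume "y \<in> cocycles D s"
  then have y: "y \<in> carrier (obj D s)" "diff D s y = \<zero>\<^bsub>obj D (s + 1)\<^esub>" by (simp_all add: cocycles_def)
  have cpx: "is_complex R P" and P1: "is_zero_mod (obj P 1)" using P by (auto simp: proj_resolution_def)
  obtain \<psi> \<phi> where r: "retract P \<psi> \<phi>" using retract_exists[OF P] by (elim exE)
  interpret P: tensor_complex R P D by (intro tensor_complex.intro is_cring tensor_complex_axioms.intro cpx D)
  have X0: "submodule X R (Ob s 0)" "\<And>a v. a \<in> max_ideal R \<Longrightarrow> v \<in> cocycles D s \<Longrightarrow> a \<odot>\<^bsub>Ob s 0\<^esub> v \<in> X"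
    using X(1,3) by (simp_all add: Ob_def)
  \<comment> \<open>\<open>F_0\<close> is nonzero because \<open>F_p\<close> is.\<close>
  obtain u where u: "u \<in> T 0" using p(1) T_empty_mono[of 0 p] by fastforce
  let ?e = "free_gen R u"
  have e: "?e \<in> carrier (F 0)" by (rule free_gen_closed[OF u])
  let ?x = "\<psi> 0 ?e"
  have x: "?x \<in> carrier (obj P 0)" using mod_homD(1)[OF retractD(1)[OF r, of 0] e] by simp
  have "diff P 0 ?x \<in> carrier (obj P 1)" using mod_homD(1)[OF is_complexD(2)[OF cpx] x] by simp
  then have dx: "diff P 0 ?x = \<zero>\<^bsub>obj P 1\<^esub>" using P1 by (simp add: is_zero_mod_def)
  let ?w = "tmap \<phi> s (P.single s ?x y)"
  have wX: "?w \<in> FD_sub s X"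
  proof (rule corner[OF P r p P.module_C P.diff_C_hom is_complex_FD])
    show "cocycles FD n \<subseteq> coboundaries FD n" if "n > s" for n by (rule exact_FD[OF exact p(2) that])
    show "tmap \<phi> n \<in> mod_hom R (obj P.C n) (obj FD n)" for n by (rule tmap_hom[OF cpx r])
    show "tmap \<phi> (n + 1) (diff P.C n z) = diff FD n (tmap \<phi> n z)" if "z \<in> carrier (obj P.C n)" for n z
      by (rule tmap_diff[OF cpx r that])
    show "P.single s ?x y \<in> carrier (obj P.C s)" by (rule P.single_closed[OF x y(1)])
    show "diff P.C s (P.single s ?x y) = \<zero>\<^bsub>obj P.C (s + 1)\<^esub>" by (rule P.diff_single[OF x dx y])
    show "submodule (FD_sub s X) R (obj FD s)" by (rule submodule_FD_sub[OF exact p(2) X0(1) X(2) X0(2)])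
    show "coboundaries FD s \<subseteq> FD_sub s X" by (rule coboundaries_FD_sub[OF exact p(2) X0(1) X(2) X0(2)])
    show "a \<odot>\<^bsub>obj FD s\<^esub> v \<in> FD_sub s X" if "a \<in> max_ideal R" "v \<in> cocycles FD s" for a v
      by (rule max_ideal_FD_sub[OF exact p(2) X0(1) X(2) X0(2) that])
  qed (rule zero)
  have "?w 0 u \<in> X"
    by (rule FD_sub_component[OF exact p(2) X0(1) X(2) X0(2) wX]) (assumption | rule tmap_single(2)[OF cpx r x y(1)])+
  then have cy: "\<phi> 0 ?x u \<odot>\<^bsub>Ob s 0\<^esub> y \<in> X" by (simp only: tmap_single(1)[OF cpx r x y(1)])
  let ?c = "\<phi> 0 ?x u"
  have xF: "\<phi> 0 ?x \<in> carrier (F 0)" using mod_homD(1)[OF retractD(2)[OF r, of 0]] x by simp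
  have c: "?c \<in> carrier R" by (rule free_modD(1)[OF xF])
  \<comment> \<open>As in \<open>corner\<close>, the coordinate \<open>?c\<close> is congruent to
    \<open>\<one>\<close> modulo \<open>m\<close>, so it is a unit.\<close>
  have "(?e \<ominus>\<^bsub>F 0\<^esub> \<phi> 0 ?x) u \<in> max_ideal R" by (rule coeff_subD[OF retract_mfree[OF r e]])
  moreover have "(?e \<ominus>\<^bsub>F 0\<^esub> \<phi> 0 ?x) u = \<one> \<ominus> ?c"
  proof -
    have "?e \<ominus>\<^bsub>F 0\<^esub> \<phi> 0 ?x = ?e \<oplus>\<^bsub>F 0\<^esub> (\<ominus> \<one>) \<odot>\<^bsub>F 0\<^esub> \<phi> 0 ?x"
      using xF by (simp add: F.M.minus_eq F.smult_minus_one)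
    then show ?thesis using c by (simp add: free_mod_simps(3,4) free_gen_simps a_minus_def l_minus)
  qed
  ultimately obtain b where b: "b \<in> carrier R" "b \<otimes> (\<one> \<ominus> (\<one> \<ominus> ?c)) = \<one>" using unit_one_minus by auto
  have "\<one> \<ominus> (\<one> \<ominus> ?c) = ?c" using c by algebra
  then have bc: "b \<otimes> ?c = \<one>" using b(2) by simp
  have yO: "y \<in> carrier (Ob s 0)" using y(1) by (simp add: Ob_def)
  have "b \<odot>\<^bsub>Ob s 0\<^esub> (?c \<odot>\<^bsub>Ob s 0\<^esub> y) = y"
    unfolding Ob.smult_assoc1[OF b(1) c yO, symmetric] bc by (rule Ob.smult_one[OF yO])
  then show "y \<in> X" using Ob.submodD(4)[OF X0(1) b(1) cy] by simp
qed

end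

theorem corollary5p2:
  fixes R :: "('r, 'k) ring_scheme"
    and D :: "('r, 'd) cochain"
    and N :: "('r, 'n) module"
    and t r i :: nat
  assumes "noetherian_local_ring R"
    and "krull_dim R = enat t"
    and "depth R = enat r"
    and "r \<ge> 1"
    and "normalized_dualizing_complex R D"
    and "module R N"
    and "fin_gen_mod R N"
    and "proj_dim R N < \<infinity>"
    and "0 < i"
    and "i \<le> r"
    and "(\<forall>j\<in>{int t - int r + int i..int t}. is_zero_mod (Ext R j N D)) \<or>
         (\<forall>j\<in>{int t - int r + int i..int t}. is_zero_mod (Ext R j N (Ltensor R N D)))"
  shows "proj_dim R N < ereal (real i)"
proof -
  interpret noetherian_local_ring R by fact
  obtain T d aug where "minimal_resolution R N T d aug" using minimal_resolution_exists[OF assms(6,7)] by (elim exE)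
  then interpret minimal_resolution R N T d aug .
  have D: "is_complex R D" using assms(5) by (simp add: normalized_dualizing_complex_def dualizing_complex_def)
  interpret minimal_resolution_complex R N T d aug D by (intro minimal_resolution_complex.intro minimal_resolution_axioms minimal_resolution_complex_axioms.intro D)
  show ?thesis
  \<comment> \<open>If \<open>F_i = 0\<close>, truncation has already happened and the projective
    dimension is at most \<open>i - 1\<close>.\<close>
  proof (cases "T i = {}")
    case True
    from proj_dim_le[OF this] show ?thesis by (rule le_less_trans) simp
  next
    case False
    obtain l where "T l = {}" using T_finally_empty[OF assms(8)] by blast
    then have L: "T (LEAST l. T l = {}) = {}" by (rule LeastI)
    \<comment> \<open>The least empty index exceeds \<open>i\<close>, since \<open>F_i\<close> is
      nonzero and emptiness persists upwards; so the subtraction is a true one and \<open>p\<close>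
      is the last degree with \<open>F_p\<close> nonzero.\<close>
    define p where "p = (LEAST l. T l = {}) - 1"
    have "\<not> (LEAST l. T l = {}) \<le> i" using T_empty_mono[OF L] False by blast
    then have lp: "(LEAST l. T l = {}) = Suc p" "i \<le> p" by (simp_all add: p_def)
    then have p: "T (Suc p) = {}" "T p \<noteq> {}" using L not_less_Least[of p "\<lambda>l. T l = {}"] by simp_all
    have "p \<le> r" by (rule length_le_depth[OF assms(3) p(2,1)])
    define s where "s = int t - int r"
    \<comment> \<open>\<open>i \<le> p \<le> r\<close> places \<open>s + p\<close> between
      \<open>t - r + i\<close> and \<open>t\<close>.\<close>
    have j: "s + int p \<in> {int t - int r + int i..int t}" using lp(2) \<open>p \<le> r\<close> by (simp add: s_def)
    have "proj_resolution R N cochain"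
      by (rule proj_resolution_cochain) (rule projective_free_mod, rule projective_zero_mod[OF mod_X])
    \<comment> \<open>The minimal resolution lives in the element type of \<open>proj_res\<close>,
      so the choice there succeeds.\<close>
    then have P: "proj_resolution R N (proj_res R N)" unfolding proj_res_def by (rule someI)
    note top = dualizing_top_degree[OF assms(2,3,5), folded s_def]
    obtain X where X: "submodule X R (obj D s)" "coboundaries D s \<subseteq> X"
      "\<forall>a\<in>max_ideal R. \<forall>v\<in>cocycles D s. a \<odot>\<^bsub>obj D s\<^esub> v \<in> X" "\<not> cocycles D s \<subseteq> X" using top(2) by blast
    have mX: "a \<odot>\<^bsub>obj D s\<^esub> v \<in> X" if "a \<in> max_ideal R" "v \<in> cocycles D s" for a v using X(3) that by blast
    have "cocycles D s \<subseteq> X"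
      using assms(11)
    proof
      assume "\<forall>j\<in>{int t - int r + int i..int t}. is_zero_mod (Ext R j N D)"
      then have zero: "is_zero_mod (cohomology (hom_cpx R (proj_res R N) D) (s + int p))"
        using j unfolding Ext_def RHom_def by blast
      obtain \<psi> \<phi> where r: "retract (proj_res R N) \<psi> \<phi>" using retract_exists[OF P] by (elim exE)
      show ?thesis
      proof
        fix y assume "y \<in> cocycles D s"
        then have y: "y \<in> carrier (obj D s)" "diff D s y = \<zero>\<^bsub>obj D (s + 1)\<^esub>" by (simp_all add: cocycles_def)
        show "y \<in> X"
        \<comment> \<open>For condition (a), \<open>Y\<close> and \<open>Y'\<close> are both
          \<open>D\<close>, and \<open>\<beta>\<close> is the identity.\<close>
        proof (rule corner[OF P r p(2,1) is_complexD(1,2)[OF D] D, of s "\<lambda>_ y. y"])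
          show "cocycles D n \<subseteq> coboundaries D n" if "n > s" for n by (rule top(1)[OF that])
          show "(\<lambda>y. y) \<in> mod_hom R (obj D n) (obj D n)" for n by (rule mod_homI) simp_all
        qed (rule y zero X(1,2) mX refl | assumption)+
      qed
    next
      assume "\<forall>j\<in>{int t - int r + int i..int t}. is_zero_mod (Ext R j N (Ltensor R N D))"
      then have zero: "is_zero_mod (cohomology (hom_cpx R (proj_res R N) (tensor_cpx R (proj_res R N) D)) (s + int p))"
        using j unfolding Ext_def RHom_def Ltensor_def by blast
      show ?thesis by (rule tensor_corner[OF P p(2,1) top(1) zero X(1,2) mX])
    qed
    then show ?thesis using X(4) by blast
  qed
qed

end
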